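(* Consider the functors \[ (-)^\downarrow \colon \mathrm{HAffUn} \to [\mathrm{HAff} \mid \mathrm{Un}], \qquad (-)\text{-}\mathrm{Mod}\colon \mathrm{HAffUn} \to (\mathrm{ccVar})^{\mathrm{op}}, \qquad (-)\text{-}\mathrm{Mod}\colon [\mathrm{HAff}\mid\mathrm{Un}] \to (\mathrm{ccVar})^{\mathrm{op}} \] given by $\mathbb{T} \mapsto \mathbb{T}^\downarrow$, $\mathbb{T}\mapsto \mathbb{T}\text{-}\mathrm{Mod}$ and $[\mathbb{H}\mid M]\mapsto [\mathbb{H}\mid M]\text{-}\mathrm{Mod}$. All three are equivalences of categories, and the composite of $(-)^\downarrow$ with $(-)\text{-}\mathrm{Mod}\colon [\mathrm{HAff}\mid\mathrm{Un}] \to (\mathrm{ccVar})^{\mathrm{op}}$ is naturally isomorphic to $(-)\text{-}\mathrm{Mod}\colon \mathrm{HAffUn}\to(\mathrm{ccVar})^{\mathrm{op}}$. Moreover, this triangle restricts to a triangle of equivalences, commuting to within natural isomorphism, between the full subcategories $\mathrm{HAffUn}^\omega$, $[\mathrm{HAff}^\omega\mid\mathrm{Un}]$ and $(\mathrm{ccVar}^\omega)^{\mathrm{op}}$.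
   Context: Notation: for sets $I,J$, $J^I$ is the set of functions $I \to J$; $u_i$ is the value of $u\in J^I$ at $i$; $\lambda i.\, t_i$ is the function $i \mapsto t_i$; $n$ is identified with $\{1,\dots,n\}$. Algebraic theories. An algebraic theory $\mathbb{T}$ comprises: for each set $I$, a set $T(I)$; for each $i\in I$, an element $\pi_i \in T(I)$; and for all sets $I,J$, a substitution function $T(I)\times T(J)^I \to T(J)$, $(t,u)\mapsto t(u)$; subject to $t(\lambda i.\,\pi_i)=t$, $\pi_i(u)=u_i$ and $(t(u))(v) = t(\lambda i.\, u_i(v))$. A homomorphism $\varphi\colon\mathbb{S}\to\mathbb{T}$ consists of functions $\varphi_I\colon S(I)\to T(I)$ preserving projections and substitution. $\mathbb{T}$ is non-degenerate if $\pi_1\ne\pi_2\in T(2)$, and finitary if each $t\in T(I)$ can be written as $t(x)=u(x_{i_1},\dots,x_{i_n})$ for some $n \in \mathbb{N}$, $i_1,\dots,i_n\in I$ and $u\in T(n)$. Equations in variables $x,y,x_i,x_{ij}$ are universally quantified over all sets $K$ and all elements of $T(K)$. Models and varieties. A $\mathbb{T}$-model is a (possibly empty) set $X$ with functions $T(I)\times X^I\to X$, $(t,x)\mapsto [\![t]\!](x)$, such that $[\![\pi_i]\!](x)=x_i$ and $[\![t(u)]\!](x)=[\![t]\!](\lambda i.\,[\![u_i]\!](x))$; homomorphisms preserve the functions $[\![t]\!]$. $\mathbb{T}\text{-}\mathrm{Mod}$ is the category of $\mathbb{T}$-models, seen as concrete (via the underlying-set functor). A homomorphism $\varphi\colon\mathbb{S}\to\mathbb{T}$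 induces the functor $\varphi^*\colon\mathbb{T}\text{-}\mathrm{Mod}\to\mathbb{S}\text{-}\mathrm{Mod}$ over $\mathrm{Set}$ with $[\![t]\!]_{\varphi^*X}=[\![\varphi(t)]\!]_X$. A variety is the concrete category of (possibly empty) models of a possibly infinitary single-sorted equational theory, possibly with a proper class of function symbols, for which free models on all sets exist; it is finitary if presentable by operations of finite arity, and non-degenerate if some model has at least two elements. $\mathrm{Var}$ is the category of varieties and concrete functors (functors commuting strictly with the underlying-set functors). $\mathrm{ccVar}$ (resp. $\mathrm{ccVar}^\omega$) is the full subcategory of $\mathrm{Var}$ on the non-degenerate cartesian closed (resp. cartesian closed finitary) varieties. Hyperaffine--unary theories. $t \in T(I)$ is affine if $t(\lambda i.\, x) = x$, and hyperaffine if also $t(\lambda i.\, t(\lambda j.\, x_{ij})) = t(\lambda i.\, x_{ii})$. $\mathbb{T}$ is hyperaffine if every operation is so. $\mathbb{T}$ is hyperaffine--unary if each $t\in T(I)$ has a unique decomposition $t = h(\lambda i.\, m(x_i))$ with $h\in T(I)$ hyperaffine and $m\in T(1)$. $\mathrm{HAffUn}$ (resp. $\mathrm{HAffUn}^\omega$) is the category of non-degenerate (resp. non-degenerate finitary) hyperaffine--unary theories and all theory homomorphisms. Matched pairs of theories. A matched pair of theories $[\mathbb{H}\mid M]$ is a hyperaffine theory $\mathbb{H}$ and a monoid $M$ with operations, for each set $I$, $M\times H(I)\to H(I)$, $(m,h)\mapsto m^*h$ and $H(I)\times M^I\to M$, $(h,n)\mapsto h\rhd n$, satisfying: $m^*\pi_i=\pi_i$;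 $m^*(h(k))=(m^*h)(\lambda i.\,m^*k_i)$; $1^*h=h$; $m^*(n^*h)=(mn)^*h$; $\pi_i\rhd m=m_i$; $h(k)\rhd m=h\rhd(\lambda i.\,k_i\rhd m)$; $(h\rhd m)n=h\rhd(\lambda i.\,m_in)$; $n(h\rhd m)=(n^*h)\rhd(\lambda i.\,nm_i)$; $(k\rhd m)^*h=k(\lambda j.\,m_j^*h)$. It is finitary or non-degenerate when $\mathbb{H}$ is so. A homomorphism $[\varphi\mid f]\colon[\mathbb{H}\mid M]\to[\mathbb{H}'\mid M']$ is a theory homomorphism $\varphi\colon\mathbb{H}\to\mathbb{H}'$ and a monoid homomorphism $f\colon M\to M'$ with $\varphi(m^*h)=f(m)^*(\varphi(h))$ and $f(h\rhd n)=\varphi(h)\rhd(\lambda i.\,f(n_i))$. $[\mathrm{HAff}\mid\mathrm{Un}]$ (resp. $[\mathrm{HAff}^\omega\mid\mathrm{Un}]$) is the category of non-degenerate (resp. non-degenerate finitary) matched pairs of theories. The functor $(-)^\downarrow$. For $\mathbb{T}$ hyperaffine--unary, $\mathbb{T}^\downarrow=[\mathbb{H}\mid M]$, where $\mathbb{H}$ is the subtheory of hyperaffine operations, $M=T(1)$ is the monoid under substitution $mn=m(n)$, $m^*h\in H(I)$ is the unique hyperaffine operation with $m(h(\lambda i.\,x_i))=(m^*h)(\lambda i.\,m(x_i))$, and $h\rhd n\in M$ is the unary operation $h(\lambda i.\,n_i(x))$. On morphisms, $\varphi\mapsto[\varphi|_{\mathbb{H}}\mid\varphi|_M]$. Models of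 matched pairs. An $[\mathbb{H}\mid M]$-model is a set $X$ with an $\mathbb{H}$-model structure $[\![-]\!]$ and a left $M$-action $\cdot$ such that $(h\rhd m)\cdot x=[\![h]\!](\lambda i.\,m_i\cdot x)$ for $x \in X$, $m \in M^I$, and $n\cdot[\![h]\!](x)=[\![n^*h]\!](\lambda i.\,n\cdot x_i)$ for $x\in X^I$, $n\in M$. Homomorphisms preserve both structures. $[\mathbb{H}\mid M]\text{-}\mathrm{Mod}$ is the resulting variety; a homomorphism $[\varphi\mid f]$ induces a concrete functor $[\mathbb{H}'\mid M']\text{-}\mathrm{Mod}\to[\mathbb{H}\mid M]\text{-}\mathrm{Mod}$ acting by $\varphi^*$ and $f^*$ on the two structures. *)

theory Defs
  imports "HOL-Algebra.Group"
begin

unbundle cardinal_syntax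

section \<open>The universe of sets\<close>

text \<open>
  HOL has no type of all sets. We work relative to a type whose cardinality is uncountable and
  strongly inaccessible, i.e. relative to a Grothendieck universe: \<^emph>\<open>sets\<close> are the small subsets of
  the type, \<^emph>\<open>classes\<close> are its arbitrary subsets. The set of functions \<^term>\<open>I \<rightarrow>\<^sub>E J\<close> from
  HOL-Library.FuncSet plays the role of \<open>J\<^sup>I\<close>.
\<close>

class universe =
  assumes uncountable_universe: "|UNIV :: nat set| <o |UNIV :: 'a set|"
    and regular_universe: "regularCard |UNIV :: 'a set|"
    and strong_limit_universe: "\<And>A :: 'a set. |A| <o |UNIV :: 'a set| \<Longrightarrow> |Pow A| <o |UNIV :: 'a set|"

definition small :: "'u set \<Rightarrow> bool" where
  "small A \<longleftrightarrow> |A| <o |UNIV :: 'u set|"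

text \<open>Some fixed elements serve as the natural numbers; \<open>fin n\<close> is the set \<open>{1,\<dots>,n}\<close>.\<close>

definition num :: "nat \<Rightarrow> 'u" where
  "num = (SOME e. inj e)"

definition fin :: "nat \<Rightarrow> 'u set" where
  "fin n = num ` {1..n}"


section \<open>Categories\<close>

text \<open>\<open>cmp C X Y Z g f\<close> is the composite of \<open>f : X \<rightarrow> Y\<close> and \<open>g : Y \<rightarrow> Z\<close>.
  Hom-sets need not be disjoint, as every operation is told the objects concerned.\<close>

record ('o, 'a) cat =
  Ob :: "'o set"
  Hom :: "'o \<Rightarrow> 'o \<Rightarrow> 'a set"
  ident :: "'o \<Rightarrow> 'a"
  cmp :: "'o \<Rightarrow> 'o \<Rightarrow> 'o \<Rightarrow> 'a \<Rightarrow> 'a \<Rightarrow> 'a"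

definition category :: "('o, 'a) cat \<Rightarrow> bool" where
  "category C \<longleftrightarrow>
     (\<forall>X\<in>Ob C. ident C X \<in> Hom C X X) \<and>
     (\<forall>X\<in>Ob C. \<forall>Y\<in>Ob C. \<forall>Z\<in>Ob C. \<forall>f\<in>Hom C X Y. \<forall>g\<in>Hom C Y Z. cmp C X Y Z g f \<in> Hom C X Z) \<and>
     (\<forall>X\<in>Ob C. \<forall>Y\<in>Ob C. \<forall>f\<in>Hom C X Y.
        cmp C X X Y f (ident C X) = f \<and> cmp C X Y Y (ident C Y) f = f) \<and>
     (\<forall>W\<in>Ob C. \<forall>X\<in>Ob C. \<forall>Y\<in>Ob C. \<forall>Z\<in>Ob C. \<forall>f\<in>Hom C W X. \<forall>g\<in>Hom C X Y. \<forall>h\<in>Hom C Y Z.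
        cmp C W Y Z h (cmp C W X Y g f) = cmp C W X Z (cmp C X Y Z h g) f)"

definition op_cat :: "('o, 'a) cat \<Rightarrow> ('o, 'a) cat" where
  "op_cat C = \<lparr>Ob = Ob C, Hom = (\<lambda>X Y. Hom C Y X), ident = ident C,
               cmp = (\<lambda>X Y Z g f. cmp C Z Y X f g)\<rparr>"

definition full_subcat :: "('o, 'a) cat \<Rightarrow> ('o \<Rightarrow> bool) \<Rightarrow> ('o, 'a) cat" where
  "full_subcat C P = C\<lparr>Ob := {X \<in> Ob C. P X}\<rparr>"

definition inverse_arrows :: "('o, 'a) cat \<Rightarrow> 'o \<Rightarrow> 'o \<Rightarrow> 'a \<Rightarrow> 'a \<Rightarrow> bool" where
  "inverse_arrows C X Y f g \<longleftrightarrow> f \<in> Hom C X Y \<and> g \<in> Hom C Y X \<and>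
     cmp C X Y X g f = ident C X \<and> cmp C Y X Y f g = ident C Y"

definition is_iso :: "('o, 'a) cat \<Rightarrow> 'o \<Rightarrow> 'o \<Rightarrow> 'a \<Rightarrow> bool" where
  "is_iso C X Y f \<longleftrightarrow> (\<exists>g. inverse_arrows C X Y f g)"

definition isomorphic :: "('o, 'a) cat \<Rightarrow> 'o \<Rightarrow> 'o \<Rightarrow> bool" where
  "isomorphic C X Y \<longleftrightarrow> (\<exists>f. is_iso C X Y f)"

record ('o, 'a, 'p, 'b) fctr =
  fob :: "'o \<Rightarrow> 'p"
  far :: "'o \<Rightarrow> 'o \<Rightarrow> 'a \<Rightarrow> 'b"

definition is_functor :: "('o, 'a) cat \<Rightarrow> ('p, 'b) cat \<Rightarrow> ('o, 'a, 'p, 'b) fctr \<Rightarrow> bool" where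
  "is_functor C D F \<longleftrightarrow> category C \<and> category D \<and>
     (\<forall>X\<in>Ob C. fob F X \<in> Ob D) \<and>
     (\<forall>X\<in>Ob C. \<forall>Y\<in>Ob C. \<forall>f\<in>Hom C X Y. far F X Y f \<in> Hom D (fob F X) (fob F Y)) \<and>
     (\<forall>X\<in>Ob C. far F X X (ident C X) = ident D (fob F X)) \<and>
     (\<forall>X\<in>Ob C. \<forall>Y\<in>Ob C. \<forall>Z\<in>Ob C. \<forall>f\<in>Hom C X Y. \<forall>g\<in>Hom C Y Z.
        far F X Z (cmp C X Y Z g f)
          = cmp D (fob F X) (fob F Y) (fob F Z) (far F Y Z g) (far F X Y f))"

definition id_fctr :: "('o, 'a, 'o, 'a) fctr" where
  "id_fctr = \<lparr>fob = (\<lambda>X. X), far = (\<lambda>X Y f. f)\<rparr>"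

definition comp_fctr ::
  "('p, 'b, 'q, 'c) fctr \<Rightarrow> ('o, 'a, 'p, 'b) fctr \<Rightarrow> ('o, 'a, 'q, 'c) fctr" where
  "comp_fctr G F = \<lparr>fob = (\<lambda>X. fob G (fob F X)),
                    far = (\<lambda>X Y f. far G (fob F X) (fob F Y) (far F X Y f))\<rparr>"

definition naturally_isomorphic ::
  "('o, 'a) cat \<Rightarrow> ('p, 'b) cat \<Rightarrow> ('o, 'a, 'p, 'b) fctr \<Rightarrow> ('o, 'a, 'p, 'b) fctr \<Rightarrow> bool" where
  "naturally_isomorphic C D F G \<longleftrightarrow> is_functor C D F \<and> is_functor C D G \<and>
     (\<exists>\<alpha>. (\<forall>X\<in>Ob C. is_iso D (fob F X) (fob G X) (\<alpha> X)) \<and>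
          (\<forall>X\<in>Ob C. \<forall>Y\<in>Ob C. \<forall>f\<in>Hom C X Y.
             cmp D (fob F X) (fob F Y) (fob G Y) (\<alpha> Y) (far F X Y f)
               = cmp D (fob F X) (fob G X) (fob G Y) (far G X Y f) (\<alpha> X)))"

definition equivalence_of_cats :: "('o, 'a) cat \<Rightarrow> ('p, 'b) cat \<Rightarrow> ('o, 'a, 'p, 'b) fctr \<Rightarrow> bool" where
  "equivalence_of_cats C D F \<longleftrightarrow> is_functor C D F \<and>
     (\<exists>G. is_functor D C G \<and>
          naturally_isomorphic C C (comp_fctr G F) id_fctr \<and>
          naturally_isomorphic D D (comp_fctr F G) id_fctr)"

definition is_terminal :: "('o, 'a) cat \<Rightarrow> 'o \<Rightarrow> bool" where
  "is_terminal C T \<longleftrightarrow> T \<in> Ob C \<and> (\<forall>X\<in>Ob C. \<exists>!f. f \<in> Hom C X T)"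

definition is_product :: "('o, 'a) cat \<Rightarrow> 'o \<Rightarrow> 'o \<Rightarrow> 'o \<Rightarrow> 'a \<Rightarrow> 'a \<Rightarrow> bool" where
  "is_product C X Y P p q \<longleftrightarrow> P \<in> Ob C \<and> p \<in> Hom C P X \<and> q \<in> Hom C P Y \<and>
     (\<forall>Z\<in>Ob C. \<forall>f\<in>Hom C Z X. \<forall>g\<in>Hom C Z Y.
        \<exists>!h. h \<in> Hom C Z P \<and> cmp C Z P X p h = f \<and> cmp C Z P Y q h = g)"

text \<open>\<open>E\<close>, with evaluation \<open>e : E \<times> Y \<rightarrow> Z\<close>, is an exponential of \<open>Z\<close> by \<open>Y\<close>; here \<open>(P, p, q)\<close> is a
  product \<open>E \<times> Y\<close>, and below \<open>h\<close> is \<open>g \<times> Y : X \<times> Y \<rightarrow> E \<times> Y\<close>.\<close>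

definition is_exponential ::
  "('o, 'a) cat \<Rightarrow> 'o \<Rightarrow> 'o \<Rightarrow> 'o \<Rightarrow> 'o \<Rightarrow> 'a \<Rightarrow> 'a \<Rightarrow> 'a \<Rightarrow> bool" where
  "is_exponential C Y Z E P p q e \<longleftrightarrow> E \<in> Ob C \<and> is_product C E Y P p q \<and> e \<in> Hom C P Z \<and>
     (\<forall>X\<in>Ob C. \<forall>Q a b. is_product C X Y Q a b \<longrightarrow>
        (\<forall>f\<in>Hom C Q Z. \<exists>!g. g \<in> Hom C X E \<and>
           (\<exists>h\<in>Hom C Q P. cmp C Q P E p h = cmp C Q X E g a \<and> cmp C Q P Y q h = b \<and>
                          cmp C Q P Z e h = f)))"

definition cartesian_closed :: "('o, 'a) cat \<Rightarrow> bool" where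
  "cartesian_closed C \<longleftrightarrow> category C \<and>
     (\<exists>T. is_terminal C T) \<and>
     (\<forall>X\<in>Ob C. \<forall>Y\<in>Ob C. \<exists>P p q. is_product C X Y P p q) \<and>
     (\<forall>Y\<in>Ob C. \<forall>Z\<in>Ob C. \<exists>E P p q e. is_exponential C Y Z E P p q e)"


section \<open>Algebraic theories\<close>

text \<open>\<open>subst T I J t u\<close> is \<open>t(u)\<close> for \<open>t \<in> T(I)\<close> and \<open>u \<in> T(J)\<^sup>I\<close>. The values of the three
  components outside the stated domains are irrelevant: a change there gives an isomorphic theory.\<close>

record 'u alg_theory =
  opn :: "'u set \<Rightarrow> 'u set"
  pro :: "'u set \<Rightarrow> 'u \<Rightarrow> 'u"
  subst :: "'u set \<Rightarrow> 'u set \<Rightarrow> 'u \<Rightarrow> ('u \<Rightarrow> 'u) \<Rightarrow> 'u"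

definition algebraic_theory :: "'u alg_theory \<Rightarrow> bool" where
  "algebraic_theory T \<longleftrightarrow>
     (\<forall>I. small I \<longrightarrow> small (opn T I)) \<and>
     (\<forall>I. small I \<longrightarrow> (\<forall>i\<in>I. pro T I i \<in> opn T I)) \<and>
     (\<forall>I J. small I \<longrightarrow> small J \<longrightarrow>
        (\<forall>t\<in>opn T I. \<forall>u \<in> I \<rightarrow>\<^sub>E opn T J. subst T I J t u \<in> opn T J)) \<and>
     (\<forall>I. small I \<longrightarrow> (\<forall>t\<in>opn T I. subst T I I t (\<lambda>i\<in>I. pro T I i) = t)) \<and>
     (\<forall>I J. small I \<longrightarrow> small J \<longrightarrow>
        (\<forall>i\<in>I. \<forall>u \<in> I \<rightarrow>\<^sub>E opn T J. subst T I J (pro T I i) u = u i)) \<and>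
     (\<forall>I J K. small I \<longrightarrow> small J \<longrightarrow> small K \<longrightarrow>
        (\<forall>t\<in>opn T I. \<forall>u \<in> I \<rightarrow>\<^sub>E opn T J. \<forall>v \<in> J \<rightarrow>\<^sub>E opn T K.
           subst T J K (subst T I J t u) v = subst T I K t (\<lambda>i\<in>I. subst T J K (u i) v)))"

type_synonym 'u theory_map = "'u set \<Rightarrow> 'u \<Rightarrow> 'u"

definition restrict_map :: "('u set \<Rightarrow> 'u set) \<Rightarrow> 'u theory_map \<Rightarrow> 'u theory_map" where
  "restrict_map A \<phi> = (\<lambda>I t. if small I \<and> t \<in> A I then \<phi> I t else undefined)"

definition theory_hom :: "'u alg_theory \<Rightarrow> 'u alg_theory \<Rightarrow> 'u theory_map \<Rightarrow> bool" where
  "theory_hom S T \<phi> \<longleftrightarrow> restrict_map (opn S) \<phi> = \<phi> \<and>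
     (\<forall>I. small I \<longrightarrow> (\<forall>t\<in>opn S I. \<phi> I t \<in> opn T I)) \<and>
     (\<forall>I. small I \<longrightarrow> (\<forall>i\<in>I. \<phi> I (pro S I i) = pro T I i)) \<and>
     (\<forall>I J. small I \<longrightarrow> small J \<longrightarrow> (\<forall>t\<in>opn S I. \<forall>u \<in> I \<rightarrow>\<^sub>E opn S J.
        \<phi> J (subst S I J t u) = subst T I J (\<phi> I t) (\<lambda>i\<in>I. \<phi> J (u i))))"

definition theory_id :: "'u alg_theory \<Rightarrow> 'u theory_map" where
  "theory_id T = restrict_map (opn T) (\<lambda>I t. t)"

definition theory_comp :: "'u alg_theory \<Rightarrow> 'u theory_map \<Rightarrow> 'u theory_map \<Rightarrow> 'u theory_map" where
  "theory_comp R \<psi> \<phi> = restrict_map (opn R) (\<lambda>I t. \<psi> I (\<phi> I t))"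

definition nondegenerate :: "'u alg_theory \<Rightarrow> bool" where
  "nondegenerate T \<longleftrightarrow> pro T (fin 2) (num 1) \<noteq> pro T (fin 2) (num 2)"

definition finitary :: "'u alg_theory \<Rightarrow> bool" where
  "finitary T \<longleftrightarrow> (\<forall>I. small I \<longrightarrow> (\<forall>t\<in>opn T I.
     \<exists>n. \<exists>s \<in> fin n \<rightarrow> I. \<exists>u \<in> opn T (fin n).
       \<forall>K. small K \<longrightarrow> (\<forall>x \<in> I \<rightarrow>\<^sub>E opn T K.
         subst T I K t x = subst T (fin n) K u (\<lambda>k\<in>fin n. x (s k)))))"

text \<open>\<open>m(a)\<close> for unary \<open>m \<in> T(1)\<close> and \<open>a \<in> T(K)\<close>.\<close>

definition app1 :: "'u alg_theory \<Rightarrow> 'u set \<Rightarrow> 'u \<Rightarrow> 'u \<Rightarrow> 'u" where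
  "app1 T K m a = subst T (fin 1) K m (\<lambda>_\<in>fin 1. a)"

definition affine :: "'u alg_theory \<Rightarrow> 'u set \<Rightarrow> 'u \<Rightarrow> bool" where
  "affine T I t \<longleftrightarrow> (\<forall>K. small K \<longrightarrow> (\<forall>x\<in>opn T K. subst T I K t (\<lambda>i\<in>I. x) = x))"

definition hyperaffine :: "'u alg_theory \<Rightarrow> 'u set \<Rightarrow> 'u \<Rightarrow> bool" where
  "hyperaffine T I t \<longleftrightarrow> affine T I t \<and>
     (\<forall>K. small K \<longrightarrow> (\<forall>x. (\<forall>i\<in>I. \<forall>j\<in>I. x i j \<in> opn T K) \<longrightarrow>
        subst T I K t (\<lambda>i\<in>I. subst T I K t (\<lambda>j\<in>I. x i j)) = subst T I K t (\<lambda>i\<in>I. x i i)))"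

definition hyperaffine_theory :: "'u alg_theory \<Rightarrow> bool" where
  "hyperaffine_theory T \<longleftrightarrow> algebraic_theory T \<and>
     (\<forall>I. small I \<longrightarrow> (\<forall>t\<in>opn T I. hyperaffine T I t))"

definition hyperaffine_unary :: "'u alg_theory \<Rightarrow> bool" where
  "hyperaffine_unary T \<longleftrightarrow> algebraic_theory T \<and>
     (\<forall>I. small I \<longrightarrow> (\<forall>t\<in>opn T I.
        \<exists>!(h, m). h \<in> opn T I \<and> hyperaffine T I h \<and> m \<in> opn T (fin 1) \<and>
          (\<forall>K. small K \<longrightarrow> (\<forall>x \<in> I \<rightarrow>\<^sub>E opn T K.
             subst T I K t x = subst T I K h (\<lambda>i\<in>I. app1 T K m (x i))))))"

definition HAffUn :: "('u alg_theory, 'u theory_map) cat" where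
  "HAffUn = \<lparr>Ob = {T. hyperaffine_unary T \<and> nondegenerate T},
             Hom = (\<lambda>S T. {\<phi>. theory_hom S T \<phi>}),
             ident = theory_id,
             cmp = (\<lambda>R S T \<psi> \<phi>. theory_comp R \<psi> \<phi>)\<rparr>"

definition HAffUn_fin :: "('u alg_theory, 'u theory_map) cat" where
  "HAffUn_fin = full_subcat HAffUn finitary"


section \<open>Matched pairs of theories\<close>

text \<open>\<open>pull I m h\<close> is \<open>m\<^sup>*h\<close>, and \<open>push I h n\<close> is \<open>h \<rhd> n\<close>, for \<open>h \<in> H(I)\<close>.\<close>

record 'u matched =
  hth :: "'u alg_theory"
  mon :: "'u monoid"
  pull :: "'u set \<Rightarrow> 'u \<Rightarrow> 'u \<Rightarrow> 'u"
  push :: "'u set \<Rightarrow> 'u \<Rightarrow> ('u \<Rightarrow> 'u) \<Rightarrow> 'u"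

definition matched_pair :: "'u matched \<Rightarrow> bool" where
  "matched_pair P \<longleftrightarrow>
    (let H = hth P; M = mon P; S = carrier M in
     hyperaffine_theory H \<and> monoid M \<and> small S \<and>
     (\<forall>I. small I \<longrightarrow> (\<forall>m\<in>S. \<forall>h\<in>opn H I. pull P I m h \<in> opn H I)) \<and>
     (\<forall>I. small I \<longrightarrow> (\<forall>h\<in>opn H I. \<forall>n \<in> I \<rightarrow>\<^sub>E S. push P I h n \<in> S)) \<and>
     (\<forall>I. small I \<longrightarrow> (\<forall>m\<in>S. \<forall>i\<in>I. pull P I m (pro H I i) = pro H I i)) \<and>
     (\<forall>I J. small I \<longrightarrow> small J \<longrightarrow> (\<forall>m\<in>S. \<forall>h\<in>opn H I. \<forall>k \<in> I \<rightarrow>\<^sub>E opn H J.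
        pull P J m (subst H I J h k) = subst H I J (pull P I m h) (\<lambda>i\<in>I. pull P J m (k i)))) \<and>
     (\<forall>I. small I \<longrightarrow> (\<forall>h\<in>opn H I. pull P I \<one>\<^bsub>M\<^esub> h = h)) \<and>
     (\<forall>I. small I \<longrightarrow> (\<forall>m\<in>S. \<forall>n\<in>S. \<forall>h\<in>opn H I.
        pull P I m (pull P I n h) = pull P I (m \<otimes>\<^bsub>M\<^esub> n) h)) \<and>
     (\<forall>I. small I \<longrightarrow> (\<forall>i\<in>I. \<forall>m \<in> I \<rightarrow>\<^sub>E S. push P I (pro H I i) m = m i)) \<and>
     (\<forall>I J. small I \<longrightarrow> small J \<longrightarrow> (\<forall>h\<in>opn H I. \<forall>k \<in> I \<rightarrow>\<^sub>E opn H J. \<forall>m \<in> J \<rightarrow>\<^sub>E S.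
        push P J (subst H I J h k) m = push P I h (\<lambda>i\<in>I. push P J (k i) m))) \<and>
     (\<forall>I. small I \<longrightarrow> (\<forall>h\<in>opn H I. \<forall>m \<in> I \<rightarrow>\<^sub>E S. \<forall>n\<in>S.
        push P I h m \<otimes>\<^bsub>M\<^esub> n = push P I h (\<lambda>i\<in>I. m i \<otimes>\<^bsub>M\<^esub> n))) \<and>
     (\<forall>I. small I \<longrightarrow> (\<forall>h\<in>opn H I. \<forall>m \<in> I \<rightarrow>\<^sub>E S. \<forall>n\<in>S.
        n \<otimes>\<^bsub>M\<^esub> push P I h m = push P I (pull P I n h) (\<lambda>i\<in>I. n \<otimes>\<^bsub>M\<^esub> m i))) \<and>
     (\<forall>I J. small I \<longrightarrow> small J \<longrightarrow> (\<forall>h\<in>opn H I. \<forall>k\<in>opn H J. \<forall>m \<in> J \<rightarrow>\<^sub>E S.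
        pull P I (push P J k m) h = subst H J I k (\<lambda>j\<in>J. pull P I (m j) h))))"

type_synonym 'u matched_map = "'u theory_map \<times> ('u \<Rightarrow> 'u)"

definition matched_hom :: "'u matched \<Rightarrow> 'u matched \<Rightarrow> 'u matched_map \<Rightarrow> bool" where
  "matched_hom P Q = (\<lambda>(\<phi>, f).
     theory_hom (hth P) (hth Q) \<phi> \<and>
     f \<in> hom (mon P) (mon Q) \<and> f \<in> extensional (carrier (mon P)) \<and>
     f \<one>\<^bsub>mon P\<^esub> = \<one>\<^bsub>mon Q\<^esub> \<and>
     (\<forall>I. small I \<longrightarrow> (\<forall>m \<in> carrier (mon P). \<forall>h \<in> opn (hth P) I.
        \<phi> I (pull P I m h) = pull Q I (f m) (\<phi> I h))) \<and>
     (\<forall>I. small I \<longrightarrow> (\<forall>h \<in> opn (hth P) I. \<forall>n \<in> I \<rightarrow>\<^sub>E carrier (mon P).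
        f (push P I h n) = push Q I (\<phi> I h) (\<lambda>i\<in>I. f (n i)))))"

definition HAff_Un :: "('u matched, 'u matched_map) cat" where
  "HAff_Un = \<lparr>Ob = {P. matched_pair P \<and> nondegenerate (hth P)},
              Hom = (\<lambda>P Q. {F. matched_hom P Q F}),
              ident = (\<lambda>P. (theory_id (hth P), \<lambda>m\<in>carrier (mon P). m)),
              cmp = (\<lambda>P Q R (\<psi>, g) (\<phi>, f).
                       (theory_comp (hth P) \<psi> \<phi>, \<lambda>m\<in>carrier (mon P). g (f m)))\<rparr>"

definition HAff_Un_fin :: "('u matched, 'u matched_map) cat" where
  "HAff_Un_fin = full_subcat HAff_Un (\<lambda>P. finitary (hth P))"

definition hyperaffine_part :: "'u alg_theory \<Rightarrow> 'u alg_theory" where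
  "hyperaffine_part T = T\<lparr>opn := (\<lambda>I. {t \<in> opn T I. hyperaffine T I t})\<rparr>"

definition unary_monoid :: "'u alg_theory \<Rightarrow> 'u monoid" where
  "unary_monoid T = \<lparr>carrier = opn T (fin 1), mult = (\<lambda>m n. app1 T (fin 1) m n),
                     one = pro T (fin 1) (num 1)\<rparr>"

definition down :: "'u alg_theory \<Rightarrow> 'u matched" where
  "down T = \<lparr>hth = hyperaffine_part T, mon = unary_monoid T,
     pull = (\<lambda>I m h. THE k. k \<in> opn T I \<and> hyperaffine T I k \<and>
        (\<forall>K. small K \<longrightarrow> (\<forall>x \<in> I \<rightarrow>\<^sub>E opn T K.
           app1 T K m (subst T I K h x) = subst T I K k (\<lambda>i\<in>I. app1 T K m (x i))))),
     push = (\<lambda>I h n. subst T I (fin 1) h (\<lambda>i\<in>I. n i))\<rparr>"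

definition down_functor :: "('u alg_theory, 'u theory_map, 'u matched, 'u matched_map) fctr" where
  "down_functor = \<lparr>fob = down,
     far = (\<lambda>S T \<phi>. (restrict_map (opn (hyperaffine_part S)) \<phi>, restrict (\<phi> (fin 1)) (opn S (fin 1))))\<rparr>"


section \<open>Varieties\<close>

text \<open>Function symbols: any class can serve as a class of function symbols. The two constructors
  name the symbols of theories and matched pairs, but arities are assigned by each signature.\<close>

datatype 'u fsym = OpSym "'u set" 'u | ActSym 'u

record 'u alg =
  car :: "'u set"
  itp :: "'u fsym \<Rightarrow> ('u \<Rightarrow> 'u) \<Rightarrow> 'u"

text \<open>Interpretations are extensional, so that distinct algebras differ as mathematical structures;
  this matters because concrete functors are compared strictly.\<close>

definition is_alg :: "'u fsym set \<Rightarrow> ('u fsym \<Rightarrow> 'u set) \<Rightarrow> 'u alg \<Rightarrow> bool" where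
  "is_alg \<Sigma> ar X \<longleftrightarrow> small (car X) \<and>
     itp X \<in> (\<Pi>\<^sub>E s\<in>\<Sigma>. (ar s \<rightarrow>\<^sub>E car X) \<rightarrow>\<^sub>E car X)"

definition alg_hom ::
  "'u fsym set \<Rightarrow> ('u fsym \<Rightarrow> 'u set) \<Rightarrow> 'u alg \<Rightarrow> 'u alg \<Rightarrow> ('u \<Rightarrow> 'u) \<Rightarrow> bool" where
  "alg_hom \<Sigma> ar X Y f \<longleftrightarrow> f \<in> car X \<rightarrow>\<^sub>E car Y \<and>
     (\<forall>s\<in>\<Sigma>. \<forall>x \<in> ar s \<rightarrow>\<^sub>E car X. f (itp X s x) = itp Y s (\<lambda>i\<in>ar s. f (x i)))"

datatype 'u trm = Var 'u | App "'u fsym" "'u \<Rightarrow> 'u trm"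

inductive is_trm :: "'u fsym set \<Rightarrow> ('u fsym \<Rightarrow> 'u set) \<Rightarrow> 'u set \<Rightarrow> 'u trm \<Rightarrow> bool"
  for \<Sigma> ar K where
  "k \<in> K \<Longrightarrow> is_trm \<Sigma> ar K (Var k)"
| "\<lbrakk>s \<in> \<Sigma>; \<And>i. i \<in> ar s \<Longrightarrow> is_trm \<Sigma> ar K (ts i)\<rbrakk> \<Longrightarrow> is_trm \<Sigma> ar K (App s ts)"

primrec ev :: "('u fsym \<Rightarrow> 'u set) \<Rightarrow> 'u alg \<Rightarrow> ('u \<Rightarrow> 'u) \<Rightarrow> 'u trm \<Rightarrow> 'u" where
  "ev ar X \<rho> (Var k) = \<rho> k"
| "ev ar X \<rho> (App s ts) = itp X s (restrict (\<lambda>i. ev ar X \<rho> (ts i)) (ar s))"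

text \<open>An equation \<open>(K, a, b)\<close> consists of two terms in variables from \<open>K\<close>.\<close>

record 'u eqn_theory =
  syms :: "'u fsym set"
  arity :: "'u fsym \<Rightarrow> 'u set"
  eqns :: "('u set \<times> 'u trm \<times> 'u trm) set"

definition equational_theory :: "'u eqn_theory \<Rightarrow> bool" where
  "equational_theory E \<longleftrightarrow> |syms E| \<le>o |UNIV :: 'u set| \<and>
     (\<forall>s\<in>syms E. small (arity E s)) \<and>
     (\<forall>(K, a, b)\<in>eqns E. small K \<and>
        is_trm (syms E) (arity E) K a \<and> is_trm (syms E) (arity E) K b)"

definition eqn_model :: "'u eqn_theory \<Rightarrow> 'u alg \<Rightarrow> bool" where
  "eqn_model E X \<longleftrightarrow> is_alg (syms E) (arity E) X \<and>
     (\<forall>(K, a, b)\<in>eqns E. \<forall>\<rho> \<in> K \<rightarrow>\<^sub>E car X. ev (arity E) X \<rho> a = ev (arity E) X \<rho> b)"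

text \<open>Concrete categories: an arrow is identified with its underlying function, the underlying-set
  functor being faithful.\<close>

record ('o, 'u) conc =
  cob :: "'o set"
  und :: "'o \<Rightarrow> 'u set"
  chom :: "'o \<Rightarrow> 'o \<Rightarrow> ('u \<Rightarrow> 'u) set"

definition cat_of :: "('o, 'u) conc \<Rightarrow> ('o, 'u \<Rightarrow> 'u) cat" where
  "cat_of C = \<lparr>Ob = cob C, Hom = chom C, ident = (\<lambda>X. \<lambda>x\<in>und C X. x),
               cmp = (\<lambda>X Y Z g f. \<lambda>x\<in>und C X. g (f x))\<rparr>"

definition concrete_category :: "('o, 'u) conc \<Rightarrow> bool" where
  "concrete_category C \<longleftrightarrow> category (cat_of C) \<and> (\<forall>X\<in>cob C. small (und C X)) \<and>
     (\<forall>X\<in>cob C. \<forall>Y\<in>cob C. chom C X Y \<subseteq> und C X \<rightarrow>\<^sub>E und C Y)"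

definition restrict_fctr :: "('o, 'a) cat \<Rightarrow> ('o, 'a, 'p, 'b) fctr \<Rightarrow> ('o, 'a, 'p, 'b) fctr" where
  "restrict_fctr C F =
     \<lparr>fob = (\<lambda>X. if X \<in> Ob C then fob F X else undefined),
      far = (\<lambda>X Y f. if X \<in> Ob C \<and> Y \<in> Ob C \<and> f \<in> Hom C X Y then far F X Y f else undefined)\<rparr>"

type_synonym ('o, 'u) conc_fctr = "('o, 'u \<Rightarrow> 'u, 'o, 'u \<Rightarrow> 'u) fctr"

definition concrete_functor ::
  "('o, 'u) conc \<Rightarrow> ('o, 'u) conc \<Rightarrow> ('o, 'u) conc_fctr \<Rightarrow> bool" where
  "concrete_functor C D F \<longleftrightarrow> is_functor (cat_of C) (cat_of D) F \<and>
     restrict_fctr (cat_of C) F = F \<and>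
     (\<forall>X\<in>cob C. und D (fob F X) = und C X) \<and>
     (\<forall>X\<in>cob C. \<forall>Y\<in>cob C. \<forall>f\<in>chom C X Y. far F X Y f = f)"

definition Conc :: "(('o, 'u) conc, ('o, 'u) conc_fctr) cat" where
  "Conc = \<lparr>Ob = {C. concrete_category C}, Hom = (\<lambda>C D. {F. concrete_functor C D F}),
           ident = (\<lambda>C. restrict_fctr (cat_of C) id_fctr),
           cmp = (\<lambda>B C D G F. restrict_fctr (cat_of B) (comp_fctr G F))\<rparr>"

definition eqn_Mod :: "'u eqn_theory \<Rightarrow> ('u alg, 'u) conc" where
  "eqn_Mod E = \<lparr>cob = {X. eqn_model E X}, und = car,
                chom = (\<lambda>X Y. {f. alg_hom (syms E) (arity E) X Y f})\<rparr>"

definition has_free_objects :: "('o, 'u) conc \<Rightarrow> bool" where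
  "has_free_objects C \<longleftrightarrow> (\<forall>K :: 'u set. small K \<longrightarrow>
     (\<exists>F\<in>cob C. \<exists>\<eta> \<in> K \<rightarrow>\<^sub>E und C F. \<forall>X\<in>cob C. \<forall>f \<in> K \<rightarrow>\<^sub>E und C X.
        \<exists>!g. g \<in> chom C F X \<and> (\<forall>k\<in>K. g (\<eta> k) = f k)))"

definition variety :: "('u alg, 'u) conc \<Rightarrow> bool" where
  "variety C \<longleftrightarrow> (\<exists>E. equational_theory E \<and> C = eqn_Mod E) \<and> has_free_objects C"

definition finitary_variety :: "('u alg, 'u) conc \<Rightarrow> bool" where
  "finitary_variety C \<longleftrightarrow> variety C \<and>
     (\<exists>E. equational_theory E \<and> (\<forall>s\<in>syms E. finite (arity E s)) \<and> isomorphic Conc C (eqn_Mod E))"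

definition nondegenerate_variety :: "('u alg, 'u) conc \<Rightarrow> bool" where
  "nondegenerate_variety C \<longleftrightarrow> (\<exists>X\<in>cob C. \<exists>x\<in>und C X. \<exists>y\<in>und C X. x \<noteq> y)"

type_synonym 'u var_cat = "(('u alg, 'u) conc, ('u alg, 'u) conc_fctr) cat"

definition Variety :: "'u var_cat" where
  "Variety = full_subcat Conc variety"

definition ccVar :: "'u var_cat" where
  "ccVar = full_subcat Variety (\<lambda>C. nondegenerate_variety C \<and> cartesian_closed (cat_of C))"

definition ccVar_fin :: "'u var_cat" where
  "ccVar_fin = full_subcat ccVar finitary_variety"


section \<open>Models of theories and of matched pairs\<close>

primrec sym_arity :: "'u fsym \<Rightarrow> 'u set" where
  "sym_arity (OpSym I t) = I"
| "sym_arity (ActSym m) = fin 1"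

definition theory_syms :: "'u alg_theory \<Rightarrow> 'u fsym set" where
  "theory_syms T = {OpSym I t | I t. small I \<and> t \<in> opn T I}"

definition matched_syms :: "'u matched \<Rightarrow> 'u fsym set" where
  "matched_syms P = theory_syms (hth P) \<union> ActSym ` carrier (mon P)"

definition act :: "'u alg \<Rightarrow> 'u \<Rightarrow> 'u \<Rightarrow> 'u" where
  "act X m x = itp X (ActSym m) (\<lambda>_\<in>fin 1. x)"

definition model_laws :: "'u alg_theory \<Rightarrow> 'u alg \<Rightarrow> bool" where
  "model_laws T X \<longleftrightarrow>
     (\<forall>I. small I \<longrightarrow> (\<forall>i\<in>I. \<forall>x \<in> I \<rightarrow>\<^sub>E car X. itp X (OpSym I (pro T I i)) x = x i)) \<and>
     (\<forall>I J. small I \<longrightarrow> small J \<longrightarrow>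
        (\<forall>t\<in>opn T I. \<forall>u \<in> I \<rightarrow>\<^sub>E opn T J. \<forall>x \<in> J \<rightarrow>\<^sub>E car X.
           itp X (OpSym J (subst T I J t u)) x
             = itp X (OpSym I t) (\<lambda>i\<in>I. itp X (OpSym J (u i)) x)))"

definition theory_model :: "'u alg_theory \<Rightarrow> 'u alg \<Rightarrow> bool" where
  "theory_model T X \<longleftrightarrow> is_alg (theory_syms T) sym_arity X \<and> model_laws T X"

definition matched_model :: "'u matched \<Rightarrow> 'u alg \<Rightarrow> bool" where
  "matched_model P X \<longleftrightarrow>
    (let H = hth P; M = mon P in
     is_alg (matched_syms P) sym_arity X \<and> model_laws H X \<and>
     (\<forall>x \<in> car X. act X \<one>\<^bsub>M\<^esub> x = x) \<and>
     (\<forall>m \<in> carrier M. \<forall>n \<in> carrier M. \<forall>x \<in> car X. act X (m \<otimes>\<^bsub>M\<^esub> n) x = act X m (act X n x)) \<and>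
     (\<forall>I. small I \<longrightarrow> (\<forall>h\<in>opn H I. \<forall>m \<in> I \<rightarrow>\<^sub>E carrier M. \<forall>x \<in> car X.
        act X (push P I h m) x = itp X (OpSym I h) (\<lambda>i\<in>I. act X (m i) x))) \<and>
     (\<forall>I. small I \<longrightarrow> (\<forall>h\<in>opn H I. \<forall>n \<in> carrier M. \<forall>x \<in> I \<rightarrow>\<^sub>E car X.
        act X n (itp X (OpSym I h) x) = itp X (OpSym I (pull P I n h)) (\<lambda>i\<in>I. act X n (x i)))))"

definition theory_Mod :: "'u alg_theory \<Rightarrow> ('u alg, 'u) conc" where
  "theory_Mod T = \<lparr>cob = {X. theory_model T X}, und = car,
                   chom = (\<lambda>X Y. {f. alg_hom (theory_syms T) sym_arity X Y f})\<rparr>"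

definition matched_Mod :: "'u matched \<Rightarrow> ('u alg, 'u) conc" where
  "matched_Mod P = \<lparr>cob = {X. matched_model P X}, und = car,
                    chom = (\<lambda>X Y. {f. alg_hom (matched_syms P) sym_arity X Y f})\<rparr>"

text \<open>The algebra for the symbols \<open>\<Sigma>\<close> in which \<open>s\<close> is interpreted as \<open>\<sigma> s\<close> is in \<open>X\<close>, and the
  concrete functor from \<open>C\<close> acting so on objects.\<close>

definition reduct :: "'u fsym set \<Rightarrow> ('u fsym \<Rightarrow> 'u fsym) \<Rightarrow> 'u alg \<Rightarrow> 'u alg" where
  "reduct \<Sigma> \<sigma> X = \<lparr>car = car X, itp = (\<lambda>s\<in>\<Sigma>. itp X (\<sigma> s))\<rparr>"

definition reduct_fctr ::
  "('u alg, 'u) conc \<Rightarrow> 'u fsym set \<Rightarrow> ('u fsym \<Rightarrow> 'u fsym) \<Rightarrow> ('u alg, 'u) conc_fctr" where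
  "reduct_fctr C \<Sigma> \<sigma> = restrict_fctr (cat_of C) \<lparr>fob = reduct \<Sigma> \<sigma>, far = (\<lambda>X Y f. f)\<rparr>"

text \<open>\<open>theory_Mod_functor\<close> sends \<open>\<phi> : S \<rightarrow> T\<close> to \<open>\<phi>\<^sup>*\<close>, from \<open>T\<close>-models to \<open>S\<close>-models; thus it is
  a functor to the opposite of the category of varieties, as is \<open>matched_Mod_functor\<close>. Theory
  symbols are \<open>OpSym\<close> only, so the value of the first renaming on \<open>ActSym\<close> is immaterial.\<close>

definition theory_Mod_functor ::
  "('u alg_theory, 'u theory_map, ('u alg, 'u) conc, ('u alg, 'u) conc_fctr) fctr" where
  "theory_Mod_functor = \<lparr>fob = theory_Mod,
     far = (\<lambda>S T \<phi>. reduct_fctr (theory_Mod T) (theory_syms S)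
                      (case_fsym (\<lambda>I t. OpSym I (\<phi> I t)) ActSym))\<rparr>"

definition matched_Mod_functor ::
  "('u matched, 'u matched_map, ('u alg, 'u) conc, ('u alg, 'u) conc_fctr) fctr" where
  "matched_Mod_functor = \<lparr>fob = matched_Mod,
     far = (\<lambda>P Q (\<phi>, f). reduct_fctr (matched_Mod Q) (matched_syms P)
                           (case_fsym (\<lambda>I t. OpSym I (\<phi> I t)) (\<lambda>m. ActSym (f m))))\<rparr>"

end

theory Submission
  imports Defs
begin

text \<open>
  A theory is recovered from its variety by taking \<open>T(I)\<close> to be the free model on \<open>I\<close>, so that \<open>T \<mapsto> T-Mod\<close> is
  a contravariant equivalence between theories and varieties, under which finitary theories correspond to finitary
  varieties. If \<open>T\<close> is hyperaffine--unary, then the homomorphisms \<open>F 1 \<times> Y \<rightarrow> Z\<close> carry the structure of an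
  exponential \<open>Z\<^sup>Y\<close>. Conversely, if \<open>T-Mod\<close> is cartesian closed then products distribute over the coproduct
  \<open>F I = \<Sum>\<^sub>i F 1\<close>; thus \<open>F I\<close> acts on \<open>Z\<^sup>I\<close> by selecting a coordinate on each summand, and the operation
  \<open>Z\<^sup>I \<rightarrow> Z\<close> obtained from \<open>t \<in> F I\<close> is the hyperaffine part of \<open>t\<close>.

  A matched pair \<open>[H | M]\<close> comes from the hyperaffine--unary theory of all pairs \<open>(h, m) \<in> H(I) \<times> M\<close>, which
  makes \<open>T \<mapsto> down T\<close> an equivalence. A model of \<open>T\<close> is determined by its hyperaffine and
  its unary operations, which make it a model of \<open>down T\<close>; so the triangle commutes and its third side is an equivalence, too. The finitary
  statement follows since being finitary is invariant under all three functors.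
\<close>

section \<open>Small sets\<close>

text \<open>Of a decomposition \<open>t = h(m(x_i))\<close> only \<open>h\<close> is elusive:
  affineness forces \<open>m(x) = t(x, x, ...)\<close>. The calculus of \<open>h\<close> rests on
  one consequence of unique decompositions: an operation whose unary part is the identity is its own
  hyperaffine part, so affine operations are hyperaffine. Hence composites of hyperaffine operations
  are hyperaffine, and the diagonal law for such a composite shows that they commute. Therefore a
  hyperaffine operation that reappears inside a unary part can be absorbed, and the substitution
  laws for exponentials, for pairs \<open>(h, m)\<close> and for models rebuilt from matched pairs
  all come down to this. Conversely, affineness and the diagonal law of an \<open>h\<close> found by
  cartesian closure are equalities of homomorphisms out of some \<open>F I \<times> X\<close>,
  decided on the summands \<open>F 1 \<times> X\<close>. Everything lives in one type, so pairs,
  powers and exponentials are carried by codes. And concrete functors commute with underlying sets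
  on the nose: isomorphisms of concrete categories keep carriers and functions, and a model that is
  rebuilt has to equal the given one.\<close>

declare One_nat_def [simp del]

lemma infinite_universe: "infinite (UNIV :: 'u::universe set)"
  using uncountable_universe[where 'a='u] infinite_iff_card_of_nat ordLess_imp_ordLeq by blast

lemma small_subset: "small B \<Longrightarrow> A \<subseteq> B \<Longrightarrow> small A"
  unfolding small_def using card_of_mono1 ordLeq_ordLess_trans by blast

lemma small_finite: "finite A \<Longrightarrow> small (A :: 'u::universe set)"
  unfolding small_def using infinite_universe
  by (meson card_of_Well_order card_of_ordLeq_finite not_ordLess_iff_ordLeq)

text \<open>If \<open>A <+> B\<close> is infinite, the product embeds into the square of this sum,
  which has the cardinality of the sum again; the sum stays below the universe because the universe
  is infinite.\<close>

lemma ordLess_universe_Times: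
  assumes "|A| <o |UNIV :: 'u::universe set|" "|B| <o |UNIV :: 'u set|"
  shows "|A \<times> B| <o |UNIV :: 'u set|"
proof -
  let ?C = "A <+> B"
  have C: "|?C| <o |UNIV :: 'u set|"
    using assms card_of_Plus_ordLess_infinite infinite_universe by blast
  show ?thesis
  proof (cases "finite ?C")
    case True
    then have "finite (A \<times> B)" by (auto simp: finite_Plus_iff)
    then show ?thesis using infinite_universe
      by (meson card_of_Well_order card_of_ordLeq_finite not_ordLess_iff_ordLeq)
  next
    case False
    have "|A \<times> B| \<le>o |?C \<times> ?C|"
      using card_of_Times_mono1[OF card_of_Plus1] card_of_Times_mono2[OF card_of_Plus2]
      by (rule ordLeq_transitive)
    also have "|?C \<times> ?C| =o |?C|" using False by (rule card_of_Times_same_infinite)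
    finally show ?thesis using C ordLeq_ordLess_trans by blast
  qed
qed

text \<open>Carriers and sets of operations are subsets of \<open>'u\<close>, so a pair of elements
  has to be an element again. Any injection of \<open>'u \<times> 'u\<close> into \<open>'u\<close>
  serves; one exists because \<open>'u\<close> is infinite.\<close>

definition pr :: "'u::universe \<Rightarrow> 'u \<Rightarrow> 'u" where
  "pr a b = (SOME e :: 'u \<times> 'u \<Rightarrow> 'u. inj e) (a, b)"

lemma inj_pr: "inj (\<lambda>(a, b). pr a (b :: 'u::universe))"
proof -
  have "|UNIV :: ('u \<times> 'u) set| \<le>o |UNIV :: 'u set|"
    using card_of_Times_same_infinite[OF infinite_universe[where 'u='u]]
    by (simp add: ordIso_iff_ordLeq)
  then have "\<exists>e :: 'u \<times> 'u \<Rightarrow> 'u. inj e" by (simp add: card_of_ordLeq[symmetric])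
  from someI_ex[OF this] show ?thesis by (simp add: pr_def case_prod_beta)
qed

lemma pr_eq_iff [simp]: "pr a b = pr c d \<longleftrightarrow> a = c \<and> b = (d :: 'u::universe)"
  using inj_pr[THEN injD, of "(a, b)" "(c, d)"] by auto

definition fs :: "'u::universe \<Rightarrow> 'u" where "fs z = (THE a. \<exists>b. z = pr a b)"
definition sn :: "'u::universe \<Rightarrow> 'u" where "sn z = (THE b. \<exists>a. z = pr a b)"

lemma fs_pr [simp]: "fs (pr a b) = a" and sn_pr [simp]: "sn (pr a b) = (b :: 'u::universe)"
  by (auto simp: fs_def sn_def)

definition prod_set :: "'u::universe set \<Rightarrow> 'u set \<Rightarrow> 'u set" where
  "prod_set A B = (\<lambda>(a, b). pr a b) ` (A \<times> B)"

lemma pr_in_prod_set [simp]: "pr a b \<in> prod_set A B \<longleftrightarrow> a \<in> A \<and> b \<in> B"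
  by (auto simp: prod_set_def)

lemma prod_setE: assumes "z \<in> prod_set A B"
  obtains a b where "z = pr a b" "a \<in> A" "b \<in> B"
  using assms by (auto simp: prod_set_def)

lemma in_prod_set_iff: "z \<in> prod_set A B \<longleftrightarrow> z = pr (fs z) (sn z) \<and> fs z \<in> A \<and> sn z \<in> B"
  by (auto elim: prod_setE) (metis pr_in_prod_set)

lemma small_prod_set: "small A \<Longrightarrow> small B \<Longrightarrow> small (prod_set A B)"
  unfolding small_def prod_set_def
  using ordLess_universe_Times card_of_image ordLeq_ordLess_trans by blast

text \<open>Powers and exponentials consist of functions, but a carrier consists of elements of
  \<open>'u\<close>. A function is replaced by its graph, a subset of the small set
  \<open>prod_set A B\<close>; by the strong limit property the power set of that set is small, so
  that it embeds into \<open>'u\<close> with small image.\<close>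

lemma small_funspace_code:
  fixes A B :: "'u::universe set"
  assumes "small A" "small B"
  obtains e :: "('u \<Rightarrow> 'u) \<Rightarrow> 'u" where "inj_on e (A \<rightarrow>\<^sub>E B)" "small (e ` (A \<rightarrow>\<^sub>E B))"
proof -
  let ?C = "prod_set A B"
  define gr where "gr f = {pr a (f a) | a. a \<in> A}" for f :: "'u \<Rightarrow> 'u"
  have C: "|Pow ?C| <o |UNIV :: 'u set|"
    using small_prod_set[OF assms] strong_limit_universe by (auto simp: small_def)
  then obtain g where g: "inj_on g (Pow ?C)" "g ` Pow ?C \<subseteq> (UNIV :: 'u set)"
    using card_of_ordLeq[of "Pow ?C" "UNIV :: 'u set"] ordLess_imp_ordLeq by blast
  have gr: "gr ` (A \<rightarrow>\<^sub>E B) \<subseteq> Pow ?C" by (auto simp: gr_def)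
  have "inj_on gr (A \<rightarrow>\<^sub>E B)"
  proof (rule inj_onI)
    fix f f' assume f: "f \<in> A \<rightarrow>\<^sub>E B" "f' \<in> A \<rightarrow>\<^sub>E B" and eq: "gr f = gr f'"
    have "f a = f' a" if "a \<in> A" for a
    proof -
      have "pr a (f a) \<in> gr f" using that by (auto simp: gr_def)
      then have "pr a (f a) \<in> gr f'" by (simp only: eq)
      then show ?thesis by (auto simp: gr_def)
    qed
    then show "f = f'" using f by (auto intro: PiE_ext)
  qed
  then have "inj_on (g \<circ> gr) (A \<rightarrow>\<^sub>E B)"
    using g(1) gr by (meson comp_inj_on inj_on_subset)
  moreover have "small ((g \<circ> gr) ` (A \<rightarrow>\<^sub>E B))"
  proof -
    have "(g \<circ> gr) ` (A \<rightarrow>\<^sub>E B) \<subseteq> g ` Pow ?C" using gr by auto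
    moreover have "small (g ` Pow ?C)"
      unfolding small_def using C card_of_image ordLeq_ordLess_trans by blast
    ultimately show ?thesis using small_subset by blast
  qed
  ultimately show ?thesis using that by blast
qed

text \<open>By regularity a small set is not cofinal in the well-order of \<open>'u\<close>, hence
  is contained in an initial segment. Each initial segment is small and so is its power set, and
  there are only \<open>|UNIV|\<close> segments.\<close>

lemma card_small_sets: "|{I :: 'u::universe set. small I}| \<le>o |UNIV :: 'u set|"
proof -
  let ?r = "|UNIV :: 'u set|"
  have fld: "Field ?r = UNIV" by (rule Field_card_of)
  have "{I :: 'u set. small I} \<subseteq> (\<Union>a\<in>UNIV. Pow (under ?r a))"
  proof safe
    fix I :: "'u set" assume I: "small I"
    have "\<exists>i\<in>Field ?r. I \<subseteq> under ?r i"
    proof (rule regularCard_UNION)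
      show "Card_order ?r" by (rule card_of_Card_order)
      show "regularCard ?r" by (rule regular_universe)
      show "relChain ?r (under ?r)"
        unfolding relChain_def under_def
        using card_of_Well_order[of "UNIV :: 'u set"]
        by (auto simp: order_on_defs dest: transD)
      show "I \<subseteq> (\<Union>i\<in>Field ?r. under ?r i)"
        using card_of_Well_order[of "UNIV :: 'u set"]
        by (auto simp: order_on_defs under_def refl_on_def fld)
      show "|I| <o ?r" using I by (simp add: small_def)
    qed
    then show "I \<in> (\<Union>a. Pow (under ?r a))" by auto
  qed
  moreover have "|\<Union>a\<in>UNIV. Pow (under ?r a)| \<le>o ?r"
  proof (rule card_of_UNION_ordLeq_infinite)
    show "infinite (UNIV :: 'u set)" by (rule infinite_universe)
    show "|UNIV :: 'u set| \<le>o ?r" by (rule card_of_mono1) simp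
    show "\<forall>a\<in>UNIV. |Pow (under ?r a)| \<le>o ?r"
    proof
      fix a :: 'u
      have "|underS ?r a| <o ?r"
        by (rule card_of_underS[OF card_of_Card_order]) (simp add: fld)
      then have "small (underS ?r a)" by (simp add: small_def)
      moreover have "small {a}" by (simp add: small_finite)
      ultimately have "small (underS ?r a \<union> {a})"
        unfolding small_def using card_of_Un_ordLess_infinite infinite_universe by blast
      moreover have "under ?r a \<subseteq> underS ?r a \<union> {a}" by (auto simp: under_def underS_def)
      ultimately have "small (under ?r a)" using small_subset by blast
      then show "|Pow (under ?r a)| \<le>o ?r"
        using strong_limit_universe ordLess_imp_ordLeq by (auto simp: small_def)
    qed
  qed
  ultimately show ?thesis using card_of_mono1 ordLeq_transitive by blast
qed

text \<open>This bound makes the operations of a theory an admissible class of symbols for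
  \<open>equational_theory\<close>: there are at most \<open>|UNIV|\<close> small arities and at
  most \<open>|UNIV|\<close> operations of each.\<close>

lemma card_OpSyms:
  fixes A :: "'u::universe set \<Rightarrow> 'u set"
  shows "|{OpSym I t | I t. small I \<and> t \<in> A I}| \<le>o |UNIV :: 'u set|"
proof -
  let ?P = "{I :: 'u set. small I} \<times> (UNIV :: 'u set)"
  have "{OpSym I t | I t. small I \<and> t \<in> A I} \<subseteq> (\<lambda>(I, t). OpSym I t) ` ?P" by auto
  then have "|{OpSym I t | I t. small I \<and> t \<in> A I}| \<le>o |?P|"
    by (rule ordLeq_transitive[OF card_of_mono1 card_of_image])
  also have "|?P| \<le>o |UNIV :: 'u set|"
    using infinite_universe card_small_sets card_of_mono1[OF subset_UNIV]
    by (rule card_of_Sigma_ordLeq_infinite[OF _ _ ballI])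
  finally show ?thesis .
qed

section \<open>The standard finite sets \<open>fin n\<close>\<close>

lemma inj_num: "inj (num :: nat \<Rightarrow> 'u::universe)"
proof -
  have "\<exists>e :: nat \<Rightarrow> 'u. inj e" using infinite_countable_subset[OF infinite_universe] by blast
  then show ?thesis unfolding num_def by (rule someI_ex)
qed

lemma num_eq_iff [simp]: "num a = (num b :: 'u::universe) \<longleftrightarrow> a = b"
  using inj_num by (auto dest: injD)

lemma finite_fin [simp]: "finite (fin n)"
  by (simp add: fin_def)

lemma card_fin [simp]: "card (fin n :: 'u::universe set) = n"
  unfolding fin_def by (subst card_image) (auto intro: inj_onI)

lemma small_fin [simp]: "small (fin n :: 'u::universe set)"
  by (simp add: small_finite)

lemma fin_1: "fin 1 = {num 1}"
  by (simp add: fin_def)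

lemma num_in_fin1 [simp]: "num 1 \<in> fin 1"
  by (simp add: fin_def)

lemma finite_bij_fin:
  assumes "finite J" obtains e where "bij_betw e (fin (card J) :: 'u::universe set) J"
  using finite_same_card_bij[OF finite_fin assms] by (metis card_fin)

section \<open>Functors and equivalences\<close>

lemma
  assumes "category C"
  shows ident_in_Hom: "X \<in> Ob C \<Longrightarrow> ident C X \<in> Hom C X X"
    and cmp_in_Hom: "\<lbrakk>X \<in> Ob C; Y \<in> Ob C; Z \<in> Ob C; f \<in> Hom C X Y; g \<in> Hom C Y Z\<rbrakk>
      \<Longrightarrow> cmp C X Y Z g f \<in> Hom C X Z"
    and cmp_ident_right: "\<lbrakk>X \<in> Ob C; Y \<in> Ob C; f \<in> Hom C X Y\<rbrakk> \<Longrightarrow> cmp C X X Y f (ident C X) = f"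
    and cmp_ident_left: "\<lbrakk>X \<in> Ob C; Y \<in> Ob C; f \<in> Hom C X Y\<rbrakk> \<Longrightarrow> cmp C X Y Y (ident C Y) f = f"
    and cmp_assoc: "\<lbrakk>W \<in> Ob C; X \<in> Ob C; Y \<in> Ob C; Z \<in> Ob C;
        f \<in> Hom C W X; g \<in> Hom C X Y; h \<in> Hom C Y Z\<rbrakk>
      \<Longrightarrow> cmp C W X Z (cmp C X Y Z h g) f = cmp C W Y Z h (cmp C W X Y g f)"
  using assms unfolding category_def by simp_all

lemmas category_simps = ident_in_Hom cmp_in_Hom cmp_ident_right cmp_ident_left cmp_assoc

lemma inverse_arrows_sym: "inverse_arrows C X Y f g \<Longrightarrow> inverse_arrows C Y X g f"
  by (auto simp: inverse_arrows_def)

lemma inverse_arrows_cancel: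
  assumes "category C" "inverse_arrows C X Y a b" "X \<in> Ob C" "Y \<in> Ob C" "W \<in> Ob C" "f \<in> Hom C W X"
  shows "cmp C W Y X b (cmp C W X Y a f) = f"
  using assms cmp_assoc[of C W X Y X f a b] by (simp add: inverse_arrows_def category_simps)

lemma isomorphic_sym: "isomorphic C X Y \<Longrightarrow> isomorphic C Y X"
  by (auto simp: isomorphic_def is_iso_def dest: inverse_arrows_sym)

lemma inverse_arrows_cmp:
  assumes C: "category C" and ob: "X \<in> Ob C" "Y \<in> Ob C" "Z \<in> Ob C"
    and ab: "inverse_arrows C X Y a b" and cd: "inverse_arrows C Y Z c d"
  shows "inverse_arrows C X Z (cmp C X Y Z c a) (cmp C Z Y X b d)"
proof -
  have h: "a \<in> Hom C X Y" "b \<in> Hom C Y X" "c \<in> Hom C Y Z" "d \<in> Hom C Z Y"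
    "cmp C X Y X b a = ident C X" "cmp C Z Y Z c d = ident C Z"
    using ab cd by (auto simp: inverse_arrows_def)
  show ?thesis
    using inverse_arrows_cancel[OF C cd, of X a]
      inverse_arrows_cancel[OF C inverse_arrows_sym[OF ab], of Z d] h ob
    by (simp add: inverse_arrows_def category_simps[OF C])
qed

lemma isomorphic_trans:
  assumes "category C" "X \<in> Ob C" "Y \<in> Ob C" "Z \<in> Ob C" "isomorphic C X Y" "isomorphic C Y Z"
  shows "isomorphic C X Z"
  using assms inverse_arrows_cmp unfolding isomorphic_def is_iso_def by metis

lemma bij_betw_conjugate:
  assumes C: "category C" and ob: "X \<in> Ob C" "Y \<in> Ob C" "X' \<in> Ob C" "Y' \<in> Ob C"
    and ab: "inverse_arrows C X Y a b" and ab': "inverse_arrows C X' Y' a' b'"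
  shows "bij_betw (\<lambda>f. cmp C Y X' Y' a' (cmp C Y X X' f b)) (Hom C X X') (Hom C Y Y')"
proof (rule bij_betw_byWitness[where f' = "\<lambda>g. cmp C X Y' X' b' (cmp C X Y Y' g a)"])
  have h: "a \<in> Hom C X Y" "b \<in> Hom C Y X" "a' \<in> Hom C X' Y'" "b' \<in> Hom C Y' X'"
    "cmp C X Y X b a = ident C X" "cmp C Y X Y a b = ident C Y"
    using ab ab' by (auto simp: inverse_arrows_def)
  note s = category_simps[OF C]
  show "\<forall>f\<in>Hom C X X'. cmp C X Y' X' b' (cmp C X Y Y' (cmp C Y X' Y' a' (cmp C Y X X' f b)) a) = f"
    using inverse_arrows_cancel[OF C ab'] ob h by (simp add: s)
  show "\<forall>g\<in>Hom C Y Y'. cmp C Y X' Y' a' (cmp C Y X X' (cmp C X Y' X' b' (cmp C X Y Y' g a)) b) = g"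
    using inverse_arrows_cancel[OF C inverse_arrows_sym[OF ab']] ob h by (simp add: s)
qed (use ob ab ab' C in \<open>auto simp: inverse_arrows_def intro!: cmp_in_Hom\<close>)

lemma
  assumes "is_functor C D F"
  shows functor_cats: "category C" "category D"
    and functor_ob: "X \<in> Ob C \<Longrightarrow> fob F X \<in> Ob D"
    and functor_hom: "\<lbrakk>X \<in> Ob C; Y \<in> Ob C; f \<in> Hom C X Y\<rbrakk>
      \<Longrightarrow> far F X Y f \<in> Hom D (fob F X) (fob F Y)"
    and functor_ident: "X \<in> Ob C \<Longrightarrow> far F X X (ident C X) = ident D (fob F X)"
    and functor_cmp: "\<lbrakk>X \<in> Ob C; Y \<in> Ob C; Z \<in> Ob C; f \<in> Hom C X Y; g \<in> Hom C Y Z\<rbrakk>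
      \<Longrightarrow> far F X Z (cmp C X Y Z g f)
        = cmp D (fob F X) (fob F Y) (fob F Z) (far F Y Z g) (far F X Y f)"
  using assms unfolding is_functor_def by simp_all

lemma functor_inverse_arrows:
  assumes F: "is_functor C D F" and ob: "X \<in> Ob C" "Y \<in> Ob C" and ab: "inverse_arrows C X Y a b"
  shows "inverse_arrows D (fob F X) (fob F Y) (far F X Y a) (far F Y X b)"
  using ab ob functor_cmp[OF F ob(1) ob(2) ob(1), of a b]
    functor_cmp[OF F ob(2) ob(1) ob(2), of b a]
  by (simp add: inverse_arrows_def functor_hom[OF F] functor_ident[OF F])

lemma functor_isomorphic:
  assumes "is_functor C D F" "X \<in> Ob C" "Y \<in> Ob C" "isomorphic C X Y"
  shows "isomorphic D (fob F X) (fob F Y)"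
  using assms functor_inverse_arrows unfolding isomorphic_def is_iso_def by metis

lemma is_functor_comp:
  assumes "is_functor C D F" "is_functor D E G"
  shows "is_functor C E (comp_fctr G F)"
  using assms unfolding is_functor_def comp_fctr_def by simp

lemma is_functor_id: "category C \<Longrightarrow> is_functor C C id_fctr"
  unfolding is_functor_def id_fctr_def by (simp add: category_simps)

section \<open>Equivalences as fully faithful, essentially surjective functors\<close>

definition fully_faithful :: "('o, 'a) cat \<Rightarrow> ('p, 'b) cat \<Rightarrow> ('o, 'a, 'p, 'b) fctr \<Rightarrow> bool" where
  "fully_faithful C D F \<longleftrightarrow>
     (\<forall>X\<in>Ob C. \<forall>Y\<in>Ob C. bij_betw (far F X Y) (Hom C X Y) (Hom D (fob F X) (fob F Y)))"

definition ess_surjective :: "('o, 'a) cat \<Rightarrow> ('p, 'b) cat \<Rightarrow> ('o, 'a, 'p, 'b) fctr \<Rightarrow> bool" where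
  "ess_surjective C D F \<longleftrightarrow> (\<forall>Z\<in>Ob D. \<exists>X\<in>Ob C. isomorphic D (fob F X) Z)"

text \<open>The inverse picks for each \<open>Z\<close> an object \<open>G Z\<close> and an
  isomorphism \<open>e Z\<close> from \<open>F (G Z)\<close> to \<open>Z\<close>; an arrow
  \<open>k\<close> goes to the unique arrow that \<open>F\<close> sends to the conjugate of
  \<open>k\<close> by \<open>e\<close>. Equations between arrows of \<open>C\<close> are checked
  after applying \<open>F\<close>, which is faithful.\<close>

theorem equivalence_if_fully_faithful_ess_surjective:
  assumes F: "is_functor C D F" and ff: "fully_faithful C D F" and es: "ess_surjective C D F"
  shows "equivalence_of_cats C D F"
proof -
  note CD = functor_cats[OF F]
  note C = CD(1) note D = CD(2)
  note sC = category_simps[OF C] note sD = category_simps[OF D]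
  note Fo = functor_ob[OF F] note Fh = functor_hom[OF F]
  have "\<forall>Z\<in>Ob D. \<exists>X a b. X \<in> Ob C \<and> inverse_arrows D (fob F X) Z a b"
    using es unfolding ess_surjective_def isomorphic_def is_iso_def by blast
  then obtain G e d where G: "\<And>Z. Z \<in> Ob D \<Longrightarrow> G Z \<in> Ob C"
    and ed: "\<And>Z. Z \<in> Ob D \<Longrightarrow> inverse_arrows D (fob F (G Z)) Z (e Z) (d Z)"
    by metis
  have eh: "e Z \<in> Hom D (fob F (G Z)) Z" "d Z \<in> Hom D Z (fob F (G Z))"
    "cmp D Z (fob F (G Z)) Z (e Z) (d Z) = ident D Z"
    "cmp D (fob F (G Z)) Z (fob F (G Z)) (d Z) (e Z) = ident D (fob F (G Z))" if "Z \<in> Ob D" for Z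
    using ed[OF that] by (auto simp: inverse_arrows_def)
  \<comment> \<open>\<open>B X Y\<close> inverts the bijection of \<open>F\<close> on the hom-set,
    so \<open>far F\<close> cancels it.\<close>
  define B where "B X Y = inv_into (Hom C X Y) (far F X Y)" for X Y
  have B: "B X Y k \<in> Hom C X Y" "far F X Y (B X Y k) = k"
    if "X \<in> Ob C" "Y \<in> Ob C" "k \<in> Hom D (fob F X) (fob F Y)" for X Y k
    using that ff unfolding fully_faithful_def B_def
    by (metis bij_betw_def inv_into_into, metis bij_betw_inv_into_right)
  have inj: "f = g" if "X \<in> Ob C" "Y \<in> Ob C" "f \<in> Hom C X Y" "g \<in> Hom C X Y"
    "far F X Y f = far F X Y g" for X Y f g
    using that ff unfolding fully_faithful_def by (metis bij_betw_def inj_on_def)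
  define GG where "GG = \<lparr>fob = G, far = (\<lambda>Z Z' k. B (G Z) (G Z')
    (cmp D (fob F (G Z)) Z' (fob F (G Z')) (d Z') (cmp D (fob F (G Z)) Z Z' k (e Z))))\<rparr>"
  have fobG: "fob GG = G" by (simp add: GG_def)
  have farG: "far GG Z Z' k \<in> Hom C (G Z) (G Z')"
      "far F (G Z) (G Z') (far GG Z Z' k) =
       cmp D (fob F (G Z)) Z' (fob F (G Z')) (d Z') (cmp D (fob F (G Z)) Z Z' k (e Z))"
    if "Z \<in> Ob D" "Z' \<in> Ob D" "k \<in> Hom D Z Z'" for Z Z' k
    unfolding GG_def using that by (simp_all add: B G Fo eh sD)
  have GGf: "is_functor D C GG"
    unfolding is_functor_def fobG
  proof (intro conjI ballI)
    fix X assume X: "X \<in> Ob D"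
    show "far GG X X (ident D X) = ident C (G X)"
      by (rule inj[of "G X" "G X"])
        (use X in \<open>simp_all add: G sC sD farG functor_ident[OF F] eh Fo\<close>)
  next
    fix X Y Z f g assume h: "X \<in> Ob D" "Y \<in> Ob D" "Z \<in> Ob D" "f \<in> Hom D X Y" "g \<in> Hom D Y Z"
    show "far GG X Z (cmp D X Y Z g f) = cmp C (G X) (G Y) (G Z) (far GG Y Z g) (far GG X Y f)"
      by (rule inj[of "G X" "G Z"])
        (use h in \<open>simp_all add: G sC sD farG functor_cmp[OF F] eh Fo
          inverse_arrows_cancel[OF D inverse_arrows_sym[OF ed]]\<close>)
  qed (simp_all add: C D G farG)
  \<comment> \<open>The component at \<open>X\<close> is the arrow that \<open>F\<close> sends to
    \<open>e (fob F X)\<close>.\<close>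
  have n1: "naturally_isomorphic C C (comp_fctr GG F) id_fctr"
    unfolding naturally_isomorphic_def
  proof (intro conjI exI[of _ "\<lambda>X. B (G (fob F X)) X (e (fob F X))"] ballI)
    fix X assume X: "X \<in> Ob C"
    note h = Fo[OF X] G[OF Fo[OF X]]
    show "is_iso C (fob (comp_fctr GG F) X) (fob id_fctr X) (B (G (fob F X)) X (e (fob F X)))"
      unfolding is_iso_def inverse_arrows_def
    proof (intro exI[of _ "B X (G (fob F X)) (d (fob F X))"] conjI)
      show "cmp C (fob (comp_fctr GG F) X) (fob id_fctr X) (fob (comp_fctr GG F) X)
         (B X (G (fob F X)) (d (fob F X))) (B (G (fob F X)) X (e (fob F X)))
        = ident C (fob (comp_fctr GG F) X)"
        unfolding comp_fctr_def id_fctr_def fobG fctr.simps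
        by (rule inj[OF h(2) h(2)])
          (use h X in \<open>simp_all add: sC B eh functor_cmp[OF F] functor_ident[OF F]\<close>)
      show "cmp C (fob id_fctr X) (fob (comp_fctr GG F) X) (fob id_fctr X)
         (B (G (fob F X)) X (e (fob F X))) (B X (G (fob F X)) (d (fob F X)))
        = ident C (fob id_fctr X)"
        unfolding comp_fctr_def id_fctr_def fobG fctr.simps
        by (rule inj[OF X X])
          (use h X in \<open>simp_all add: sC B eh functor_cmp[OF F] functor_ident[OF F]\<close>)
    qed (use h X in \<open>simp_all add: comp_fctr_def id_fctr_def fobG B eh\<close>)
  next
    fix X Y f assume X: "X \<in> Ob C" and Y: "Y \<in> Ob C" and f: "f \<in> Hom C X Y"
    note h = Fo[OF X] G[OF Fo[OF X]] Fo[OF Y] G[OF Fo[OF Y]] Fh[OF X Y f]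
    show "cmp C (fob (comp_fctr GG F) X) (fob (comp_fctr GG F) Y) (fob id_fctr Y)
        (B (G (fob F Y)) Y (e (fob F Y))) (far (comp_fctr GG F) X Y f)
      = cmp C (fob (comp_fctr GG F) X) (fob id_fctr X) (fob id_fctr Y)
        (far id_fctr X Y f) (B (G (fob F X)) X (e (fob F X)))"
      unfolding comp_fctr_def id_fctr_def fobG fctr.simps
      by (rule inj[OF h(2) Y])
        (use h X Y f in \<open>simp_all add: sC sD B eh Fo functor_cmp[OF F] farG
          inverse_arrows_cancel[OF D inverse_arrows_sym[OF ed]]\<close>)
  qed (use F GGf C in \<open>auto intro: is_functor_comp is_functor_id\<close>)
  \<comment> \<open>Here \<open>e\<close> itself is the natural isomorphism, since
    \<open>far GG\<close> was defined by conjugation with it.\<close>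
  have n2: "naturally_isomorphic D D (comp_fctr F GG) id_fctr"
    unfolding naturally_isomorphic_def
  proof (intro conjI exI[of _ e] ballI)
    fix X assume X: "X \<in> Ob D"
    show "is_iso D (fob (comp_fctr F GG) X) (fob id_fctr X) (e X)"
      using ed[OF X] by (auto simp: is_iso_def comp_fctr_def id_fctr_def fobG)
  next
    fix X Y f assume X: "X \<in> Ob D" and Y: "Y \<in> Ob D" and f: "f \<in> Hom D X Y"
    show "cmp D (fob (comp_fctr F GG) X) (fob (comp_fctr F GG) Y) (fob id_fctr Y)
          (e Y) (far (comp_fctr F GG) X Y f)
      = cmp D (fob (comp_fctr F GG) X) (fob id_fctr X) (fob id_fctr Y) (far id_fctr X Y f) (e X)"
      unfolding comp_fctr_def id_fctr_def fobG fctr.simps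
      using X Y f by (simp add: farG sD eh G Fo inverse_arrows_cancel[OF D inverse_arrows_sym[OF ed]])
  qed (use F GGf D in \<open>auto intro: is_functor_comp is_functor_id\<close>)
  show ?thesis unfolding equivalence_of_cats_def using F GGf n1 n2 by blast
qed

section \<open>Opposite categories and full subcategories\<close>

lemma
  shows Ob_op_cat [simp]: "Ob (op_cat C) = Ob C"
    and Hom_op_cat [simp]: "Hom (op_cat C) X Y = Hom C Y X"
    and ident_op_cat [simp]: "ident (op_cat C) = ident C"
    and cmp_op_cat [simp]: "cmp (op_cat C) X Y Z g f = cmp C Z Y X f g"
  by (simp_all add: op_cat_def)

lemma category_op_cat: "category C \<Longrightarrow> category (op_cat C)"
  unfolding category_def by simp

lemma inverse_arrows_op_cat [simp]:
  "inverse_arrows (op_cat C) X Y f g \<longleftrightarrow> inverse_arrows C X Y g f"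
  by (auto simp: inverse_arrows_def)

lemma isomorphic_op_cat [simp]: "isomorphic (op_cat C) X Y \<longleftrightarrow> isomorphic C X Y"
  by (auto simp: isomorphic_def is_iso_def)

lemma
  shows Ob_full_subcat [simp]: "Ob (full_subcat C P) = {X \<in> Ob C. P X}"
    and Hom_full_subcat [simp]: "Hom (full_subcat C P) = Hom C"
    and ident_full_subcat [simp]: "ident (full_subcat C P) = ident C"
    and cmp_full_subcat [simp]: "cmp (full_subcat C P) = cmp C"
  by (simp_all add: full_subcat_def)

lemma category_full_subcat: "category C \<Longrightarrow> category (full_subcat C P)"
  unfolding category_def by simp

lemma op_cat_full_subcat: "op_cat (full_subcat C P) = full_subcat (op_cat C) P"
  by (simp add: op_cat_def full_subcat_def)

lemma is_iso_full_subcat [simp]: "is_iso (full_subcat C P) = is_iso C"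
  by (simp add: is_iso_def inverse_arrows_def fun_eq_iff)

lemma isomorphic_full_subcat [simp]: "isomorphic (full_subcat C P) = isomorphic C"
  by (simp add: isomorphic_def fun_eq_iff)

lemma is_functor_full_subcat:
  assumes "is_functor C D F" "\<And>X. X \<in> Ob C \<Longrightarrow> P X \<Longrightarrow> Q (fob F X)"
  shows "is_functor (full_subcat C P) (full_subcat D Q) F"
  using assms unfolding is_functor_def by (simp add: category_full_subcat[of C] category_full_subcat[of D])

text \<open>An object with property \<open>Q\<close> is isomorphic to some \<open>fob F X\<close>;
  invariance of \<open>Q\<close> moves the property to \<open>fob F X\<close>, and then
  \<open>P X\<close> holds, so that \<open>X\<close> lies in the subcategory.\<close>

lemma equivalence_full_subcat:
  assumes F: "is_functor C D F" "fully_faithful C D F" "ess_surjective C D F"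
    and PQ: "\<And>X. X \<in> Ob C \<Longrightarrow> P X \<longleftrightarrow> Q (fob F X)"
    and Q: "\<And>Z Z'. \<lbrakk>Z \<in> Ob D; Z' \<in> Ob D; isomorphic D Z Z'; Q Z'\<rbrakk> \<Longrightarrow> Q Z"
  shows "equivalence_of_cats (full_subcat C P) (full_subcat D Q) F"
proof (rule equivalence_if_fully_faithful_ess_surjective)
  show "is_functor (full_subcat C P) (full_subcat D Q) F"
    using is_functor_full_subcat[OF F(1)] PQ by blast
  show "fully_faithful (full_subcat C P) (full_subcat D Q) F"
    using F(2) by (simp add: fully_faithful_def)
  show "ess_surjective (full_subcat C P) (full_subcat D Q) F"
    using F(3) PQ Q functor_ob[OF F(1)] unfolding ess_surjective_def by simp metis
qed

lemma naturally_isomorphic_full_subcat: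
  assumes "naturally_isomorphic C D F G" "\<And>X. X \<in> Ob C \<Longrightarrow> P X \<Longrightarrow> Q (fob F X)"
    "\<And>X. X \<in> Ob C \<Longrightarrow> P X \<Longrightarrow> Q (fob G X)"
  shows "naturally_isomorphic (full_subcat C P) (full_subcat D Q) F G"
  using assms is_functor_full_subcat[of C D F P Q] is_functor_full_subcat[of C D G P Q]
  unfolding naturally_isomorphic_def by simp blast

text \<open>Both \<open>H\<close> and \<open>G \<circ> F\<close> being fully faithful, \<open>G\<close> is bijective on the hom-sets between objects
  in the image of \<open>F\<close>; all other hom-sets are conjugate to these.\<close>

lemma two_out_of_three:
  assumes F: "is_functor A B F" "fully_faithful A B F" "ess_surjective A B F"
    and G: "is_functor B C G"
    and H: "fully_faithful A C H" "ess_surjective A C H"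
    and iso: "naturally_isomorphic A C (comp_fctr G F) H"
  shows "fully_faithful B C G" "ess_surjective B C G"
proof -
  have HF: "is_functor A C H" using iso by (simp add: naturally_isomorphic_def)
  note A = functor_cats(1)[OF F(1)] note B = functor_cats(1)[OF G] note C = functor_cats(2)[OF G]
  obtain \<alpha> where "\<forall>X\<in>Ob A. \<exists>b. inverse_arrows C (fob G (fob F X)) (fob H X) (\<alpha> X) b"
    and nat: "\<And>X Y f. \<lbrakk>X \<in> Ob A; Y \<in> Ob A; f \<in> Hom A X Y\<rbrakk> \<Longrightarrow>
      cmp C (fob G (fob F X)) (fob G (fob F Y)) (fob H Y) (\<alpha> Y)
        (far G (fob F X) (fob F Y) (far F X Y f))
      = cmp C (fob G (fob F X)) (fob H X) (fob H Y) (far H X Y f) (\<alpha> X)"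
    using iso unfolding naturally_isomorphic_def comp_fctr_def is_iso_def fctr.simps by blast
  then obtain \<beta> where ab: "\<And>X. X \<in> Ob A \<Longrightarrow> inverse_arrows C (fob G (fob F X)) (fob H X) (\<alpha> X) (\<beta> X)"
    by metis
  note o = functor_ob[OF F(1)] functor_ob[OF G] functor_ob[OF HF]
  show "ess_surjective B C G"
    unfolding ess_surjective_def
  proof
    fix Z assume Z: "Z \<in> Ob C"
    then obtain X where X: "X \<in> Ob A" "isomorphic C (fob H X) Z"
      using H(2) by (auto simp: ess_surjective_def)
    have "isomorphic C (fob G (fob F X)) (fob H X)"
      using ab[OF X(1)] by (auto simp: isomorphic_def is_iso_def)
    then have "isomorphic C (fob G (fob F X)) Z"
      using isomorphic_trans[OF C _ _ Z _ X(2)] o X(1) by blast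
    then show "\<exists>Y\<in>Ob B. isomorphic C (fob G Y) Z" using o X(1) by blast
  qed
  \<comment> \<open>By naturality \<open>G\<close> after \<open>F\<close> is \<open>H\<close>
    conjugated by \<alpha>; cancelling the bijection given by \<open>F\<close> leaves
    \<open>G\<close>.\<close>
  have img: "bij_betw (far G (fob F X) (fob F Y)) (Hom B (fob F X) (fob F Y))
      (Hom C (fob G (fob F X)) (fob G (fob F Y)))" if X: "X \<in> Ob A" and Y: "Y \<in> Ob A" for X Y
  proof -
    let ?k = "\<lambda>f. cmp C (fob G (fob F X)) (fob H Y) (fob G (fob F Y)) (\<beta> Y)
      (cmp C (fob G (fob F X)) (fob H X) (fob H Y) f (\<alpha> X))"
    have k: "bij_betw ?k (Hom C (fob H X) (fob H Y)) (Hom C (fob G (fob F X)) (fob G (fob F Y)))"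
      using bij_betw_conjugate[OF C, of "fob H X" "fob G (fob F X)" "fob H Y" "fob G (fob F Y)"
          "\<beta> X" "\<alpha> X" "\<beta> Y" "\<alpha> Y"] X Y o ab inverse_arrows_sym by metis
    have h: "bij_betw (far H X Y) (Hom A X Y) (Hom C (fob H X) (fob H Y))"
      using H(1) X Y by (simp add: fully_faithful_def)
    have f: "bij_betw (far F X Y) (Hom A X Y) (Hom B (fob F X) (fob F Y))"
      using F(2) X Y by (simp add: fully_faithful_def)
    have kh: "bij_betw (\<lambda>f. ?k (far H X Y f)) (Hom A X Y)
        (Hom C (fob G (fob F X)) (fob G (fob F Y)))"
      using bij_betw_trans[OF h k] by (simp add: comp_def)
    have "?k (far H X Y f) = far G (fob F X) (fob F Y) (far F X Y f)" if "f \<in> Hom A X Y" for f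
    proof -
      have "?k (far H X Y f) = cmp C (fob G (fob F X)) (fob H Y) (fob G (fob F Y)) (\<beta> Y)
         (cmp C (fob G (fob F X)) (fob G (fob F Y)) (fob H Y) (\<alpha> Y)
            (far G (fob F X) (fob F Y) (far F X Y f)))"
        using nat[OF X Y that] by simp
      then show ?thesis
        using inverse_arrows_cancel[OF C ab[OF Y], of "fob G (fob F X)"] X Y that o
        by (simp add: functor_hom[OF F(1)] functor_hom[OF G])
    qed
    then have "bij_betw (\<lambda>f. far G (fob F X) (fob F Y) (far F X Y f)) (Hom A X Y)
        (Hom C (fob G (fob F X)) (fob G (fob F Y)))"
      using kh bij_betw_cong by (metis (no_types, lifting))
    then show ?thesis unfolding bij_betw_comp_iff[OF f] comp_def .
  qed
  show "fully_faithful B C G"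
    unfolding fully_faithful_def
  proof (intro ballI)
    fix Y Y' assume Y: "Y \<in> Ob B" and Y': "Y' \<in> Ob B"
    obtain X a b where X: "X \<in> Ob A" "inverse_arrows B (fob F X) Y a b"
      using F(3) Y by (auto simp: ess_surjective_def isomorphic_def is_iso_def)
    obtain X' a' b' where X': "X' \<in> Ob A" "inverse_arrows B (fob F X') Y' a' b'"
      using F(3) Y' by (auto simp: ess_surjective_def isomorphic_def is_iso_def)
    let ?FX = "fob F X" and ?FX' = "fob F X'"
    note ab = functor_inverse_arrows[OF G _ Y X(2)] functor_inverse_arrows[OF G _ Y' X'(2)]
    \<comment> \<open>\<open>?u\<close> replaces \<open>Y\<close> and \<open>Y'\<close> by
      isomorphic objects in the image of \<open>F\<close>, and \<open>?v\<close> undoes this after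
      \<open>G\<close> has been applied; so the composite of \<open>?u\<close>, \<open>G\<close> on
      the image and \<open>?v\<close> is \<open>G\<close> on \<open>Hom B Y Y'\<close>.\<close>
    let ?u = "\<lambda>g. cmp B ?FX Y' ?FX' b' (cmp B ?FX Y Y' g a)"
    let ?v = "\<lambda>f. cmp C (fob G Y) (fob G ?FX') (fob G Y') (far G ?FX' Y' a')
      (cmp C (fob G Y) (fob G ?FX) (fob G ?FX') f (far G Y ?FX b))"
    have u: "bij_betw ?u (Hom B Y Y') (Hom B ?FX ?FX')"
      using bij_betw_conjugate[OF B Y _ Y' _ inverse_arrows_sym[OF X(2)] inverse_arrows_sym[OF X'(2)]]
        o X(1) X'(1) by simp
    have v: "bij_betw ?v (Hom C (fob G ?FX) (fob G ?FX')) (Hom C (fob G Y) (fob G Y'))"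
      using bij_betw_conjugate[OF C _ _ _ _ ab] o X(1) X'(1) Y Y' by simp
    have vgu: "bij_betw (\<lambda>g. ?v (far G ?FX ?FX' (?u g))) (Hom B Y Y') (Hom C (fob G Y) (fob G Y'))"
      using bij_betw_trans[OF bij_betw_trans[OF u img[OF X(1) X'(1)]] v] by (simp add: comp_def)
    have "?v (far G ?FX ?FX' (?u g)) = far G Y Y' g" if g: "g \<in> Hom B Y Y'" for g
    proof -
      have h: "a \<in> Hom B ?FX Y" "b \<in> Hom B Y ?FX" "a' \<in> Hom B ?FX' Y'" "b' \<in> Hom B Y' ?FX'"
        "cmp B Y ?FX Y a b = ident B Y"
        using X(2) X'(2) by (auto simp: inverse_arrows_def)
      note ob = o(1)[OF X(1)] o(1)[OF X'(1)] Y Y'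
      have u: "?u g \<in> Hom B ?FX ?FX'" using ob h g by (intro cmp_in_Hom[OF B])
      have "?v (far G ?FX ?FX' (?u g)) = far G Y Y'
          (cmp B Y ?FX' Y' a' (cmp B Y ?FX ?FX' (?u g) b))"
        using functor_cmp[OF G ob(3) ob(1) ob(2) h(2) u]
          functor_cmp[OF G ob(3) ob(2) ob(4) cmp_in_Hom[OF B ob(3) ob(1) ob(2) h(2) u] h(3)]
        by simp
      also have "cmp B Y ?FX ?FX' (?u g) b = cmp B Y Y' ?FX' b' g"
        using ob h g by (simp add: category_simps[OF B])
      also have "cmp B Y ?FX' Y' a' (cmp B Y Y' ?FX' b' g) = g"
        using inverse_arrows_cancel[OF B inverse_arrows_sym[OF X'(2)]] ob g by simp
      finally show ?thesis .
    qed
    then have "bij_betw (\<lambda>g. ?v (far G ?FX ?FX' (?u g))) (Hom B Y Y') (Hom C (fob G Y) (fob G Y'))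
      = bij_betw (far G Y Y') (Hom B Y Y') (Hom C (fob G Y) (fob G Y'))"
      by (rule bij_betw_cong)
    then show "bij_betw (far G Y Y') (Hom B Y Y') (Hom C (fob G Y) (fob G Y'))"
      using vgu by (rule iffD1)
  qed
qed

section \<open>Concrete functors\<close>

lemma
  shows Ob_cat_of [simp]: "Ob (cat_of C) = cob C"
    and Hom_cat_of [simp]: "Hom (cat_of C) = chom C"
    and ident_cat_of [simp]: "ident (cat_of C) X = (\<lambda>x\<in>und C X. x)"
    and cmp_cat_of [simp]: "cmp (cat_of C) X Y Z g f = (\<lambda>x\<in>und C X. g (f x))"
  by (simp_all add: cat_of_def)

text \<open>A concrete functor is determined by its action on objects.\<close>

definition conc_functor :: "('o, 'u) conc \<Rightarrow> ('o \<Rightarrow> 'o) \<Rightarrow> ('o, 'u) conc_fctr" where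
  "conc_functor C fo = restrict_fctr (cat_of C) \<lparr>fob = fo, far = (\<lambda>X Y f. f)\<rparr>"

text \<open>Arrows are functions, and a concrete functor keeps them; functoriality therefore reduces
  to an inclusion between hom-sets.\<close>

definition conc_map :: "('o, 'u) conc \<Rightarrow> ('o, 'u) conc \<Rightarrow> ('o \<Rightarrow> 'o) \<Rightarrow> bool" where
  "conc_map C D fo \<longleftrightarrow> (\<forall>X\<in>cob C. fo X \<in> cob D \<and> und D (fo X) = und C X) \<and>
     (\<forall>X\<in>cob C. \<forall>Y\<in>cob C. chom C X Y \<subseteq> chom D (fo X) (fo Y))"

lemma conc_mapD:
  assumes "conc_map C D fo"
  shows "X \<in> cob C \<Longrightarrow> fo X \<in> cob D" "X \<in> cob C \<Longrightarrow> und D (fo X) = und C X"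
    "\<lbrakk>X \<in> cob C; Y \<in> cob C; f \<in> chom C X Y\<rbrakk> \<Longrightarrow> f \<in> chom D (fo X) (fo Y)"
  using assms unfolding conc_map_def by blast+

lemma conc_functor_eq: "conc_functor C fo =
    \<lparr>fob = (\<lambda>X. if X \<in> cob C then fo X else undefined),
     far = (\<lambda>X Y f. if X \<in> cob C \<and> Y \<in> cob C \<and> f \<in> chom C X Y then f else undefined)\<rparr>"
  by (simp add: conc_functor_def restrict_fctr_def cong: if_cong)

lemma fob_conc_functor [simp]: "X \<in> cob C \<Longrightarrow> fob (conc_functor C fo) X = fo X"
  by (simp add: conc_functor_def restrict_fctr_def)

lemma far_conc_functor [simp]:
  "\<lbrakk>X \<in> cob C; Y \<in> cob C; f \<in> chom C X Y\<rbrakk> \<Longrightarrow> far (conc_functor C fo) X Y f = f"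
  by (simp add: conc_functor_def restrict_fctr_def)

lemma conc_functor_cong: "(\<And>X. X \<in> cob C \<Longrightarrow> fo X = go X) \<Longrightarrow> conc_functor C fo = conc_functor C go"
  by (auto simp: conc_functor_eq)

lemma conc_functor_eq_iff:
  "conc_functor C fo = conc_functor C go \<longleftrightarrow> (\<forall>X\<in>cob C. fo X = go X)"
  by (metis conc_functor_cong fob_conc_functor)

lemma concrete_functor_conc_functor:
  assumes C: "concrete_category C" and D: "concrete_category D" and fo: "conc_map C D fo"
  shows "concrete_functor C D (conc_functor C fo)"
proof -
  have c: "category (cat_of C)" "category (cat_of D)"
    using C D by (auto simp: concrete_category_def)
  have i: "(\<lambda>x\<in>und C X. x) \<in> chom C X X" if "X \<in> cob C" for X
    using ident_in_Hom[OF c(1)] that by simp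
  have k: "(\<lambda>x\<in>und C X. g (f x)) \<in> chom C X Z"
    if "X \<in> cob C" "Y \<in> cob C" "Z \<in> cob C" "f \<in> chom C X Y" "g \<in> chom C Y Z" for X Y Z f g
    using cmp_in_Hom[OF c(1)] that by simp
  show ?thesis
    using conc_mapD[OF fo] c unfolding concrete_functor_def is_functor_def
    by (auto simp: i k) (auto simp: conc_functor_eq restrict_fctr_def cong: if_cong)
qed

text \<open>\<open>restrict_fctr\<close> fixes the values outside the category, so a concrete
  functor equals the one built from its object map, and equality of concrete functors becomes
  equality of object maps.\<close>

lemma concrete_functorD:
  assumes "concrete_functor C D F"
  shows "conc_map C D (fob F)" "F = conc_functor C (fob F)"
proof -
  show "conc_map C D (fob F)"
    using assms unfolding concrete_functor_def is_functor_def conc_map_def by force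
  have r: "restrict_fctr (cat_of C) F = F" using assms by (simp add: concrete_functor_def)
  have "far F X Y f = far (conc_functor C (fob F)) X Y f" for X Y f
  proof (cases "X \<in> cob C \<and> Y \<in> cob C \<and> f \<in> chom C X Y")
    case True then show ?thesis using assms by (simp add: concrete_functor_def)
  next
    case False then show ?thesis
      by (subst r[symmetric]) (auto simp: conc_functor_def restrict_fctr_def)
  qed
  moreover have "fob F X = fob (conc_functor C (fob F)) X" for X
    by (subst (1) r[symmetric]) (auto simp: conc_functor_def restrict_fctr_def)
  ultimately show "F = conc_functor C (fob F)"
    by (intro fctr.equality) (auto simp: fun_eq_iff)
qed

lemma
  shows Ob_Conc [simp]: "Ob Conc = {C. concrete_category C}"
    and Hom_Conc [simp]: "Hom Conc C D = {F. concrete_functor C D F}"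
    and ident_Conc: "ident Conc C = conc_functor C (\<lambda>X. X)"
  by (simp_all add: Conc_def conc_functor_def id_fctr_def)

lemma cmp_Conc:
  assumes "conc_map B C fo"
  shows "cmp Conc B C D (conc_functor C go) (conc_functor B fo) = conc_functor B (\<lambda>X. go (fo X))"
proof -
  have "far (conc_functor C go) (fo X) (fo Y) f = f"
    if "X \<in> cob B" "Y \<in> cob B" "f \<in> chom B X Y" for X Y f
    using that conc_mapD[OF assms] by (intro far_conc_functor)
  moreover have "fob (conc_functor C go) (fo X) = go (fo X)" if "X \<in> cob B" for X
    using that conc_mapD[OF assms] by simp
  ultimately show ?thesis
    by (auto simp: Conc_def conc_functor_eq[of B] comp_fctr_def restrict_fctr_def fun_eq_iff
        cong: if_cong)
qed

lemma conc_map_id: "conc_map C C (\<lambda>X. X)"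
  by (simp add: conc_map_def)

lemma conc_map_comp: "conc_map B C fo \<Longrightarrow> conc_map C D go \<Longrightarrow> conc_map B D (\<lambda>X. go (fo X))"
  unfolding conc_map_def by blast

lemma category_Conc: "category Conc"
proof -
  have nf: "\<exists>fo. F = conc_functor C fo \<and> conc_map C D fo" if "concrete_functor C D F"
    for C D :: "('o, 'u) conc" and F
    using concrete_functorD[OF that] by metis
  show ?thesis
    unfolding category_def
  proof (intro conjI ballI)
    fix X Y Z :: "('o, 'u) conc" and f g
    assume h: "X \<in> Ob Conc" "Y \<in> Ob Conc" "Z \<in> Ob Conc" "f \<in> Hom Conc X Y" "g \<in> Hom Conc Y Z"
    obtain fo go where e: "f = conc_functor X fo" "g = conc_functor Y go"
      and m: "conc_map X Y fo" "conc_map Y Z go"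
      using nf[of X Y f] nf[of Y Z g] h by auto
    show "cmp Conc X Y Z g f \<in> Hom Conc X Z"
      using h concrete_functor_conc_functor[OF _ _ conc_map_comp[OF m]]
      by (simp add: e cmp_Conc[OF m(1)])
  next
    fix W X Y Z :: "('o, 'u) conc" and f g h
    assume h: "W \<in> Ob Conc" "X \<in> Ob Conc" "Y \<in> Ob Conc" "Z \<in> Ob Conc"
      "f \<in> Hom Conc W X" "g \<in> Hom Conc X Y" "h \<in> Hom Conc Y Z"
    obtain fo go ho where e: "f = conc_functor W fo" "g = conc_functor X go" "h = conc_functor Y ho"
      and m: "conc_map W X fo" "conc_map X Y go" "conc_map Y Z ho"
      using nf[of W X f] nf[of X Y g] nf[of Y Z h] h by auto
    show "cmp Conc W Y Z h (cmp Conc W X Y g f) = cmp Conc W X Z (cmp Conc X Y Z h g) f"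
      unfolding e using m
      by (simp add: cmp_Conc conc_map_comp[of W X fo Y go])
  next
    fix X :: "('o, 'u) conc" assume "X \<in> Ob Conc"
    then show "ident Conc X \<in> Hom Conc X X"
      by (simp add: ident_Conc concrete_functor_conc_functor conc_map_id)
  next
    fix X Y :: "('o, 'u) conc" and f assume "f \<in> Hom Conc X Y"
    then obtain fo where "f = conc_functor X fo" "conc_map X Y fo" using nf[of X Y f] by auto
    then show "cmp Conc X X Y f (ident Conc X) = f" "cmp Conc X Y Y (ident Conc Y) f = f"
      by (simp_all add: ident_Conc cmp_Conc conc_map_id)
  qed
qed

section \<open>Isomorphisms of concrete categories\<close>

definition conc_iso :: "('o, 'u) conc \<Rightarrow> ('o, 'u) conc \<Rightarrow> ('o \<Rightarrow> 'o) \<Rightarrow> ('o \<Rightarrow> 'o) \<Rightarrow> bool" where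
  "conc_iso C D fo go \<longleftrightarrow> conc_map C D fo \<and> conc_map D C go \<and>
     (\<forall>X\<in>cob C. go (fo X) = X) \<and> (\<forall>Y\<in>cob D. fo (go Y) = Y)"

lemma conc_iso_sym: "conc_iso C D fo go \<Longrightarrow> conc_iso D C go fo"
  by (auto simp: conc_iso_def)

text \<open>Each object map includes hom-sets into hom-sets, and the two maps invert each other; so
  the hom-sets are equal and not just in bijection. With \<open>conc_iso_cob\<close> this lets
  notions phrased by objects, arrows and underlying sets be transported by rewriting.\<close>

lemma conc_iso_chom:
  assumes "conc_iso C D fo go" "X \<in> cob C" "Y \<in> cob C"
  shows "chom D (fo X) (fo Y) = chom C X Y"
proof -
  have "chom C (go (fo X)) (go (fo Y)) = chom C X Y" using assms by (simp add: conc_iso_def)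
  then show ?thesis using assms unfolding conc_iso_def conc_map_def by blast
qed

lemma conc_iso_cob:
  assumes "conc_iso C D fo go" shows "cob D = fo ` cob C"
proof
  show "cob D \<subseteq> fo ` cob C"
  proof
    fix Y assume "Y \<in> cob D"
    then have "Y = fo (go Y)" "go Y \<in> cob C" using assms by (auto simp: conc_iso_def conc_map_def)
    then show "Y \<in> fo ` cob C" by (rule image_eqI)
  qed
  show "fo ` cob C \<subseteq> cob D" using assms by (auto simp: conc_iso_def conc_map_def)
qed

lemma inverse_arrows_conc_functor:
  assumes "concrete_category C" "concrete_category D" "conc_iso C D fo go"
  shows "inverse_arrows Conc C D (conc_functor C fo) (conc_functor D go)"
  using assms unfolding inverse_arrows_def conc_iso_def
  by (auto simp: concrete_functor_conc_functor cmp_Conc ident_Conc intro: conc_functor_cong)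

lemma isomorphic_ConcI:
  "\<lbrakk>concrete_category C; concrete_category D; conc_iso C D fo go\<rbrakk> \<Longrightarrow> isomorphic Conc C D"
  using inverse_arrows_conc_functor unfolding isomorphic_def is_iso_def by blast

lemma isomorphic_ConcE:
  assumes "isomorphic Conc C D"
  obtains fo go where "conc_iso C D fo go"
proof -
  obtain F G where FG: "inverse_arrows Conc C D F G"
    using assms by (auto simp: isomorphic_def is_iso_def)
  then have f: "concrete_functor C D F" and g: "concrete_functor D C G"
    by (auto simp: inverse_arrows_def)
  note F = concrete_functorD[OF f] and G = concrete_functorD[OF g]
  have "cmp Conc C D C G F = ident Conc C" "cmp Conc D C D F G = ident Conc D"
    using FG by (auto simp: inverse_arrows_def)
  moreover have "cmp Conc C D C G F = conc_functor C (\<lambda>X. fob G (fob F X))"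
    using cmp_Conc[OF F(1), of C "fob G"] unfolding F(2)[symmetric] G(2)[symmetric] .
  moreover have "cmp Conc D C D F G = conc_functor D (\<lambda>X. fob F (fob G X))"
    using cmp_Conc[OF G(1), of D "fob F"] unfolding F(2)[symmetric] G(2)[symmetric] .
  ultimately have "conc_iso C D (fob F) (fob G)"
    using F(1) G(1) by (simp add: conc_iso_def conc_functor_eq_iff ident_Conc)
  then show ?thesis using that by blast
qed

lemma conc_iso_is_product:
  assumes i: "conc_iso C D fo go" and ob: "X \<in> cob C" "Y \<in> cob C"
    and P: "is_product (cat_of C) X Y P p q"
  shows "is_product (cat_of D) (fo X) (fo Y) (fo P) p q"
proof -
  have u: "\<And>X. X \<in> cob C \<Longrightarrow> und D (fo X) = und C X" using i by (simp add: conc_iso_def conc_map_def)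
  show ?thesis
    using P ob unfolding is_product_def Ob_cat_of Hom_cat_of cmp_cat_of conc_iso_cob[OF i]
    by (simp add: conc_iso_chom[OF i] u)
qed

lemma conc_iso_is_exponential:
  assumes i: "conc_iso C D fo go" and ob: "Y \<in> cob C" "Z \<in> cob C"
    and E: "is_exponential (cat_of C) Y Z E P p q e"
  shows "is_exponential (cat_of D) (fo Y) (fo Z) (fo E) (fo P) p q e"
  unfolding is_exponential_def
proof (intro conjI ballI allI impI)
  have u: "\<And>X. X \<in> cob C \<Longrightarrow> und D (fo X) = und C X" using i by (simp add: conc_iso_def conc_map_def)
  have E': "E \<in> cob C" "is_product (cat_of C) E Y P p q" "e \<in> chom C P Z"
    using E by (simp_all add: is_exponential_def)
  then have P: "P \<in> cob C" by (simp add: is_product_def)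
  show "fo E \<in> Ob (cat_of D)" using E' conc_iso_cob[OF i] by simp
  show "is_product (cat_of D) (fo E) (fo Y) (fo P) p q"
    using conc_iso_is_product[OF i _ _ E'(2)] E' ob by blast
  show "e \<in> Hom (cat_of D) (fo P) (fo Z)" using E' P ob by (simp add: conc_iso_chom[OF i])
  fix X' Q' a b f
  assume X': "X' \<in> Ob (cat_of D)" and Q': "is_product (cat_of D) X' (fo Y) Q' a b"
    and f: "f \<in> Hom (cat_of D) Q' (fo Z)"
  obtain X Q where X: "X \<in> cob C" "X' = fo X" and Q: "Q \<in> cob C" "Q' = fo Q"
    using X' Q' conc_iso_cob[OF i] by (auto simp: is_product_def)
  have "is_product (cat_of C) X Y Q a b"
    using conc_iso_is_product[OF conc_iso_sym[OF i] _ _ Q'] X' X Q ob i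
    by (auto simp: conc_iso_def conc_map_def)
  moreover have "f \<in> chom C Q Z" using f Q ob by (simp add: conc_iso_chom[OF i])
  ultimately have "\<exists>!g. g \<in> chom C X E \<and> (\<exists>h\<in>chom C Q P.
      cmp (cat_of C) Q P E p h = cmp (cat_of C) Q X E g a \<and> cmp (cat_of C) Q P Y q h = b \<and>
      cmp (cat_of C) Q P Z e h = f)"
    using E X by (simp add: is_exponential_def)
  then show "\<exists>!g. g \<in> Hom (cat_of D) X' (fo E) \<and> (\<exists>h\<in>Hom (cat_of D) Q' (fo P).
      cmp (cat_of D) Q' (fo P) (fo E) p h = cmp (cat_of D) Q' X' (fo E) g a \<and>
      cmp (cat_of D) Q' (fo P) (fo Y) q h = b \<and> cmp (cat_of D) Q' (fo P) (fo Z) e h = f)"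
    using X Q P E' by (simp add: conc_iso_chom[OF i] u)
qed

lemma conc_iso_cartesian_closed:
  assumes i: "conc_iso C D fo go" and D: "concrete_category D"
    and C: "cartesian_closed (cat_of C)"
  shows "cartesian_closed (cat_of D)"
  unfolding cartesian_closed_def
proof (intro conjI ballI)
  note cb = conc_iso_cob[OF i]
  show "category (cat_of D)" using D by (simp add: concrete_category_def)
  obtain T where "is_terminal (cat_of C) T" using C by (auto simp: cartesian_closed_def)
  then have "is_terminal (cat_of D) (fo T)"
    unfolding is_terminal_def Ob_cat_of Hom_cat_of cb by (simp add: conc_iso_chom[OF i])
  then show "\<exists>T. is_terminal (cat_of D) T" ..
  fix X' Y' assume "X' \<in> Ob (cat_of D)" "Y' \<in> Ob (cat_of D)"
  then obtain X Y where XY: "X \<in> cob C" "Y \<in> cob C" "X' = fo X" "Y' = fo Y" by (auto simp: cb)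
  show "\<exists>P p q. is_product (cat_of D) X' Y' P p q"
    using C XY conc_iso_is_product[OF i] unfolding cartesian_closed_def Ob_cat_of by metis
  show "\<exists>E P p q e. is_exponential (cat_of D) X' Y' E P p q e"
    using C XY conc_iso_is_exponential[OF i] unfolding cartesian_closed_def Ob_cat_of by metis
qed

lemma conc_iso_has_free_objects:
  assumes i: "conc_iso C D fo go" and C: "has_free_objects C"
  shows "has_free_objects D"
proof -
  have u: "\<And>X. X \<in> cob C \<Longrightarrow> und D (fo X) = und C X" using i by (simp add: conc_iso_def conc_map_def)
  show ?thesis
    using C unfolding has_free_objects_def conc_iso_cob[OF i]
    by (simp add: u conc_iso_chom[OF i])
qed

lemma conc_iso_nondegenerate:
  "conc_iso C D fo go \<Longrightarrow> nondegenerate_variety C \<Longrightarrow> nondegenerate_variety D"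
  unfolding nondegenerate_variety_def conc_iso_def conc_map_def by metis

section \<open>Models as algebras with operations on arbitrary families\<close>

text \<open>Only the values of \<open>f\<close> on \<open>I\<close> matter, so no extensionality bookkeeping is needed.\<close>

definition op :: "'u alg \<Rightarrow> 'u set \<Rightarrow> 'u \<Rightarrow> ('u \<Rightarrow> 'u) \<Rightarrow> 'u" where
  "op X I t f = itp X (OpSym I t) (restrict f I)"

lemma op_cong: "(\<And>i. i \<in> I \<Longrightarrow> f i = g i) \<Longrightarrow> op X I t f = op X I t g"
  unfolding op_def by (metis restrict_ext)

lemma op_full_cong:
  "\<lbrakk>X = X'; I = I'; t = t'; \<And>i. i \<in> I' \<Longrightarrow> f i = g i\<rbrakk> \<Longrightarrow> op X I t f = op X' I' t' g"
  using op_cong by metis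

abbreviation thom :: "'u alg_theory \<Rightarrow> 'u alg \<Rightarrow> 'u alg \<Rightarrow> ('u \<Rightarrow> 'u) \<Rightarrow> bool" where
  "thom T \<equiv> alg_hom (theory_syms T) sym_arity"

text \<open>Values are restricted to the symbols of \<open>T\<close> and to families in
  \<open>A\<close>, as the extensional format of \<open>is_alg\<close> requires; the case
  \<open>ActSym\<close> does not arise among the symbols of a theory.\<close>

definition mk_alg ::
  "'u alg_theory \<Rightarrow> 'u set \<Rightarrow> ('u set \<Rightarrow> 'u \<Rightarrow> ('u \<Rightarrow> 'u) \<Rightarrow> 'u) \<Rightarrow> 'u alg" where
  "mk_alg T A g = \<lparr>car = A, itp = (\<lambda>s\<in>theory_syms T.
     \<lambda>x\<in>sym_arity s \<rightarrow>\<^sub>E A. case s of OpSym I t \<Rightarrow> g I t x | ActSym m \<Rightarrow> undefined)\<rparr>"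

lemma car_mk_alg [simp]: "car (mk_alg T A g) = A"
  by (simp add: mk_alg_def)

lemma OpSym_in_theory_syms [simp]: "OpSym I t \<in> theory_syms T \<longleftrightarrow> small I \<and> t \<in> opn T I"
  by (auto simp: theory_syms_def)

lemma ActSym_notin_theory_syms [simp]: "ActSym m \<notin> theory_syms T"
  by (auto simp: theory_syms_def)

lemma theory_symsE:
  assumes "s \<in> theory_syms T" obtains I t where "s = OpSym I t" "small I" "t \<in> opn T I"
  using assms by (auto simp: theory_syms_def)

lemma op_mk_alg:
  "\<lbrakk>small I; t \<in> opn T I; \<And>i. i \<in> I \<Longrightarrow> f i \<in> A\<rbrakk> \<Longrightarrow> op (mk_alg T A g) I t f = g I t (restrict f I)"
  by (simp add: op_def mk_alg_def)

definition free_model :: "'u alg_theory \<Rightarrow> 'u set \<Rightarrow> 'u alg" where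
  "free_model T K = mk_alg T (opn T K) (\<lambda>I t u. subst T I K t u)"

definition prod_model :: "'u::universe alg_theory \<Rightarrow> 'u alg \<Rightarrow> 'u alg \<Rightarrow> 'u alg" where
  "prod_model T X Y = mk_alg T (prod_set (car X) (car Y))
     (\<lambda>I t x. pr (op X I t (\<lambda>i. fs (x i))) (op Y I t (\<lambda>i. sn (x i))))"

text \<open>A homomorphism from the product of \<open>X\<close> and \<open>Y\<close> to
  \<open>Z\<close> in curried form: operations act on both arguments at once, not on each
  separately. Currying keeps codes of pairs out of the calculations.\<close>

definition bihom :: "'u alg_theory \<Rightarrow> 'u alg \<Rightarrow> 'u alg \<Rightarrow> 'u alg \<Rightarrow> ('u \<Rightarrow> 'u \<Rightarrow> 'u) \<Rightarrow> bool" where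
  "bihom T X Y Z f \<longleftrightarrow> (\<forall>x\<in>car X. \<forall>y\<in>car Y. f x y \<in> car Z) \<and>
     (\<forall>I t x y. small I \<longrightarrow> t \<in> opn T I \<longrightarrow> (\<forall>i\<in>I. x i \<in> car X) \<longrightarrow> (\<forall>i\<in>I. y i \<in> car Y) \<longrightarrow>
        f (op X I t x) (op Y I t y) = op Z I t (\<lambda>i. f (x i) (y i)))"

text \<open>The universal property of an exponential with \<open>bihom\<close> in place of maps out
  of a product. Existence of these for all \<open>Y\<close> and \<open>Z\<close> is shown below to
  be equivalent to cartesian closedness.\<close>

definition exponential_model ::
  "'u alg_theory \<Rightarrow> 'u alg \<Rightarrow> 'u alg \<Rightarrow> 'u alg \<Rightarrow> ('u \<Rightarrow> 'u \<Rightarrow> 'u) \<Rightarrow> bool" where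
  "exponential_model T Y Z E \<epsilon> \<longleftrightarrow> theory_model T E \<and> bihom T E Y Z \<epsilon> \<and>
     (\<forall>X f. theory_model T X \<longrightarrow> bihom T X Y Z f \<longrightarrow>
        (\<exists>!g. thom T X E g \<and> (\<forall>x\<in>car X. \<forall>y\<in>car Y. f x y = \<epsilon> (g x) y)))"

lemma PiE_iff_restrict: "x \<in> A \<rightarrow>\<^sub>E B \<longleftrightarrow> x = restrict x A \<and> (\<forall>i\<in>A. x i \<in> B)"
  by (auto simp: PiE_def extensional_def restrict_def fun_eq_iff)

lemma ball_PiE: "(\<forall>x \<in> A \<rightarrow>\<^sub>E B. P x) \<longleftrightarrow> (\<forall>x. (\<forall>i\<in>A. x i \<in> B) \<longrightarrow> P (restrict x A))"
proof safe
  fix x assume "\<forall>x. (\<forall>i\<in>A. x i \<in> B) \<longrightarrow> P (restrict x A)" "x \<in> A \<rightarrow>\<^sub>E B"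
  then have "P (restrict x A)" by auto
  then show "P x" using \<open>x \<in> A \<rightarrow>\<^sub>E B\<close> by (simp add: PiE_restrict)
qed auto

lemma ball_theory_syms:
  "(\<forall>s\<in>theory_syms T. P s) \<longleftrightarrow> (\<forall>I t. small I \<longrightarrow> t \<in> opn T I \<longrightarrow> P (OpSym I t))"
  by (auto simp: theory_syms_def)

lemma thom_iff: "thom T X Y f \<longleftrightarrow> f \<in> car X \<rightarrow>\<^sub>E car Y \<and>
   (\<forall>I t x. small I \<longrightarrow> t \<in> opn T I \<longrightarrow> (\<forall>i\<in>I. x i \<in> car X) \<longrightarrow>
     f (op X I t x) = op Y I t (\<lambda>i. f (x i)))"
proof -
  have r: "(\<lambda>i\<in>I. f (restrict x I i)) = (\<lambda>i\<in>I. f (x i))" for I x by auto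
  show ?thesis
    unfolding alg_hom_def ball_PiE op_def ball_theory_syms sym_arity.simps r by blast
qed

lemma thom_in: "thom T X Y f \<Longrightarrow> x \<in> car X \<Longrightarrow> f x \<in> car Y"
  by (auto simp: thom_iff)

lemma thom_op: "\<lbrakk>thom T X Y f; small I; t \<in> opn T I; \<And>i. i \<in> I \<Longrightarrow> x i \<in> car X\<rbrakk>
    \<Longrightarrow> f (op X I t x) = op Y I t (\<lambda>i. f (x i))"
  by (auto simp: thom_iff)

lemma thomI: "\<lbrakk>\<And>x. x \<in> car X \<Longrightarrow> f x \<in> car Y; f \<in> extensional (car X);
    \<And>I t x. \<lbrakk>small I; t \<in> opn T I; \<And>i. i \<in> I \<Longrightarrow> x i \<in> car X\<rbrakk> \<Longrightarrow> f (op X I t x) = op Y I t (\<lambda>i. f (x i))\<rbrakk>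
    \<Longrightarrow> thom T X Y f"
  unfolding thom_iff PiE_def by auto

lemma thom_eqI:
  "\<lbrakk>thom T X Y f; thom T X Y' g; \<And>x. x \<in> car X \<Longrightarrow> f x = g x\<rbrakk> \<Longrightarrow> f = g"
  unfolding thom_iff PiE_def by (meson IntE extensionalityI)

lemma bihom_in: "\<lbrakk>bihom T X Y Z f; x \<in> car X; y \<in> car Y\<rbrakk> \<Longrightarrow> f x y \<in> car Z"
  by (simp add: bihom_def)

lemma bihom_op: "\<lbrakk>bihom T X Y Z f; small I; t \<in> opn T I; \<And>i. i \<in> I \<Longrightarrow> x i \<in> car X; \<And>i. i \<in> I \<Longrightarrow> y i \<in> car Y\<rbrakk>
   \<Longrightarrow> f (op X I t x) (op Y I t y) = op Z I t (\<lambda>i. f (x i) (y i))"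
  by (simp add: bihom_def)

lemma is_alg_itp:
  assumes "is_alg \<Sigma> ar X" "s \<in> \<Sigma>" "x \<in> ar s \<rightarrow>\<^sub>E car X"
  shows "itp X s x \<in> car X"
proof -
  have "itp X s \<in> (ar s \<rightarrow>\<^sub>E car X) \<rightarrow>\<^sub>E car X"
    using assms(1,2) unfolding is_alg_def by (meson PiE_mem)
  then show ?thesis using assms(3) by (rule PiE_mem)
qed

lemma
  shows ball_Collect2: "(\<forall>z\<in>{f x y |x y. P x y}. R z) \<longleftrightarrow> (\<forall>x y. P x y \<longrightarrow> R (f x y))"
    and ball_Collect3: "(\<forall>z\<in>{g x y w |x y w. Q x y w}. R z) \<longleftrightarrow> (\<forall>x y w. Q x y w \<longrightarrow> R (g x y w))"
    and ball_Collect4: "(\<forall>z\<in>{h x y w v |x y w v. S x y w v}. R z) \<longleftrightarrow>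
      (\<forall>x y w v. S x y w v \<longrightarrow> R (h x y w v))"
  by blast+

lemma restrict_PiE_self: "x \<in> A \<rightarrow>\<^sub>E B \<Longrightarrow> (\<lambda>i\<in>A. x i) = x"
  by (metis PiE_iff_restrict)

locale alg_th =
  fixes T :: "'u::universe alg_theory"
  assumes T: "algebraic_theory T"
begin

lemma small_opn: "small I \<Longrightarrow> small (opn T I)"
  and pro_opn: "\<lbrakk>small I; i \<in> I\<rbrakk> \<Longrightarrow> pro T I i \<in> opn T I"
  and subst_opn: "\<lbrakk>small I; small J; t \<in> opn T I; u \<in> I \<rightarrow>\<^sub>E opn T J\<rbrakk> \<Longrightarrow> subst T I J t u \<in> opn T J"
  and subst_pro: "\<lbrakk>small I; t \<in> opn T I\<rbrakk> \<Longrightarrow> subst T I I t (restrict (pro T I) I) = t"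
  and pro_subst: "\<lbrakk>small I; small J; i \<in> I; u \<in> I \<rightarrow>\<^sub>E opn T J\<rbrakk> \<Longrightarrow> subst T I J (pro T I i) u = u i"
  and subst_subst: "\<lbrakk>small I; small J; small K; t \<in> opn T I; u \<in> I \<rightarrow>\<^sub>E opn T J; v \<in> J \<rightarrow>\<^sub>E opn T K\<rbrakk>
     \<Longrightarrow> subst T J K (subst T I J t u) v = subst T I K t (\<lambda>i\<in>I. subst T J K (u i) v)"
  using T unfolding algebraic_theory_def by simp_all

abbreviation Md :: "'u alg \<Rightarrow> bool" where "Md \<equiv> theory_model T"
abbreviation F :: "'u set \<Rightarrow> 'u alg" where "F \<equiv> free_model T"

lemma small_car: "Md X \<Longrightarrow> small (car X)"
  by (simp add: theory_model_def is_alg_def)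

lemma op_in: "\<lbrakk>Md X; small I; t \<in> opn T I; \<And>i. i \<in> I \<Longrightarrow> f i \<in> car X\<rbrakk> \<Longrightarrow> op X I t f \<in> car X"
proof -
  assume a: "Md X" "small I" "t \<in> opn T I" "\<And>i. i \<in> I \<Longrightarrow> f i \<in> car X"
  then have "itp X (OpSym I t) (restrict f I) \<in> car X"
    unfolding theory_model_def by (intro is_alg_itp[of "theory_syms T" sym_arity]) simp_all
  then show ?thesis by (simp add: op_def)
qed

lemma op_pro: "\<lbrakk>Md X; small I; i \<in> I; \<And>i. i \<in> I \<Longrightarrow> f i \<in> car X\<rbrakk> \<Longrightarrow> op X I (pro T I i) f = f i"
  unfolding theory_model_def model_laws_def op_def by simp

lemma op_subst:
  assumes "Md X" "small I" "small J" "t \<in> opn T I" "\<And>i. i \<in> I \<Longrightarrow> u i \<in> opn T J"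
    "\<And>j. j \<in> J \<Longrightarrow> f j \<in> car X"
  shows "op X J (subst T I J t (restrict u I)) f = op X I t (\<lambda>i. op X J (u i) f)"
proof -
  have "op X J (subst T I J t (restrict u I)) f
      = itp X (OpSym I t) (\<lambda>i\<in>I. itp X (OpSym J (restrict u I i)) (restrict f J))"
    using assms unfolding theory_model_def model_laws_def op_def by simp
  also have "\<dots> = op X I t (\<lambda>i. op X J (u i) f)"
    unfolding op_def by (rule arg_cong[where f = "itp X (OpSym I t)"]) auto
  finally show ?thesis .
qed

lemma theory_model_mk_alg:
  assumes A: "small A"
    and g: "\<And>I t x. \<lbrakk>small I; t \<in> opn T I; x \<in> I \<rightarrow>\<^sub>E A\<rbrakk> \<Longrightarrow> g I t x \<in> A"
    and p: "\<And>I i x. \<lbrakk>small I; i \<in> I; x \<in> I \<rightarrow>\<^sub>E A\<rbrakk> \<Longrightarrow> g I (pro T I i) x = x i"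
    and s: "\<And>I J t u x. \<lbrakk>small I; small J; t \<in> opn T I; u \<in> I \<rightarrow>\<^sub>E opn T J; x \<in> J \<rightarrow>\<^sub>E A\<rbrakk>
      \<Longrightarrow> g J (subst T I J t u) x = g I t (\<lambda>i\<in>I. g J (u i) x)"
  shows "Md (mk_alg T A g)"
  unfolding theory_model_def
proof
  show "is_alg (theory_syms T) sym_arity (mk_alg T A g)"
    using A g by (simp add: is_alg_def mk_alg_def restrict_PiE_iff ball_theory_syms Pi_iff)
  have i: "itp (mk_alg T A g) (OpSym I t) x = g I t x" if "small I" "t \<in> opn T I" "x \<in> I \<rightarrow>\<^sub>E A" for I t x
    using that by (simp add: mk_alg_def)
  show "model_laws T (mk_alg T A g)"
    unfolding model_laws_def car_mk_alg
  proof (intro conjI allI impI ballI)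
    fix I :: "'u set" and i x assume "small I" "i \<in> I" "x \<in> I \<rightarrow>\<^sub>E A"
    then show "itp (mk_alg T A g) (OpSym I (pro T I i)) x = x i" by (simp add: i pro_opn p)
  next
    fix I J t u x
    assume h: "small I" "small J" "t \<in> opn T I" "u \<in> I \<rightarrow>\<^sub>E opn T J" "x \<in> J \<rightarrow>\<^sub>E A"
    have "(\<lambda>j\<in>I. itp (mk_alg T A g) (OpSym J (u j)) x) = (\<lambda>j\<in>I. g J (u j) x)"
      using h by (auto intro!: restrict_ext i)
    moreover have "(\<lambda>j\<in>I. g J (u j) x) \<in> I \<rightarrow>\<^sub>E A" using h by (auto intro: g)
    ultimately show "itp (mk_alg T A g) (OpSym J (subst T I J t u)) x =
       itp (mk_alg T A g) (OpSym I t) (\<lambda>i\<in>I. itp (mk_alg T A g) (OpSym J (u i)) x)"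
      using h by (simp add: i subst_opn s)
  qed
qed

lemma F_model: "small K \<Longrightarrow> Md (F K)"
  unfolding free_model_def
  by (rule theory_model_mk_alg) (auto simp: small_opn subst_opn pro_subst subst_subst)

lemma car_F [simp]: "car (F K) = opn T K"
  by (simp add: free_model_def)

lemma op_F: "\<lbrakk>small I; t \<in> opn T I; \<And>i. i \<in> I \<Longrightarrow> f i \<in> opn T K\<rbrakk>
    \<Longrightarrow> op (F K) I t f = subst T I K t (restrict f I)"
  by (simp add: free_model_def op_mk_alg)

lemma op_F_in: "\<lbrakk>small I; small K; t \<in> opn T I; \<And>i. i \<in> I \<Longrightarrow> f i \<in> opn T K\<rbrakk>
    \<Longrightarrow> op (F K) I t f \<in> opn T K"
  using op_in[OF F_model] by simp

lemma op_F_pro: "\<lbrakk>small I; small K; i \<in> I; \<And>i. i \<in> I \<Longrightarrow> f i \<in> opn T K\<rbrakk>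
    \<Longrightarrow> op (F K) I (pro T I i) f = f i"
  using op_pro[OF F_model] by simp

lemma op_F_pros: "\<lbrakk>small I; t \<in> opn T I\<rbrakk> \<Longrightarrow> op (F I) I t (pro T I) = t"
  by (simp add: op_F pro_opn subst_pro)

text \<open>Substitution is the action of \<open>t\<close> in the free model \<open>F J\<close>. In
  this form associativity needs no extensionality of \<open>u\<close>, which is how substitution is
  mostly written from here on.\<close>

lemma op_op:
  assumes "Md X" "small I" "small J" "t \<in> opn T I" "\<And>i. i \<in> I \<Longrightarrow> u i \<in> opn T J"
    "\<And>j. j \<in> J \<Longrightarrow> f j \<in> car X"
  shows "op X J (op (F J) I t u) f = op X I t (\<lambda>i. op X J (u i) f)"
  using op_subst[OF assms] assms by (simp add: op_F)

lemma op_hom: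
  assumes X: "Md X" and I: "small I" and a: "\<And>i. i \<in> I \<Longrightarrow> a i \<in> car X"
  shows "thom T (F I) X (\<lambda>t\<in>opn T I. op X I t a)"
proof (rule thomI)
  fix J t x assume h: "small J" "t \<in> opn T J" "\<And>i. i \<in> J \<Longrightarrow> x i \<in> car (F I)"
  then show "(\<lambda>t\<in>opn T I. op X I t a) (op (F I) J t x) = op X J t (\<lambda>i. (\<lambda>t\<in>opn T I. op X I t a) (x i))"
    using assms by (auto simp: op_F_in op_op intro: op_cong)
qed (use assms in \<open>auto simp: op_in\<close>)

text \<open>In \<open>F I\<close> every \<open>t\<close> is the operation \<open>t\<close> applied
  to the projections, so a homomorphism out of \<open>F I\<close> is determined by its values
  there.\<close>

lemma hom_F:
  assumes g: "thom T (F I) X g" and I: "small I" and t: "t \<in> opn T I"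
  shows "g t = op X I t (\<lambda>i. g (pro T I i))"
  using thom_op[OF g I t, of "pro T I"] I t by (simp add: op_F_pros pro_opn)

lemma has_free_objects_theory_Mod: "has_free_objects (theory_Mod T)"
  unfolding has_free_objects_def
proof (intro allI impI)
  fix K :: "'u set" assume K: "small K"
  show "\<exists>Fr\<in>cob (theory_Mod T). \<exists>\<eta>\<in>K \<rightarrow>\<^sub>E und (theory_Mod T) Fr. \<forall>X\<in>cob (theory_Mod T).
     \<forall>f\<in>K \<rightarrow>\<^sub>E und (theory_Mod T) X. \<exists>!g. g \<in> chom (theory_Mod T) Fr X \<and> (\<forall>k\<in>K. g (\<eta> k) = f k)"
  proof (intro bexI[of _ "F K"] bexI[of _ "restrict (pro T K) K"] ballI)
    fix X f assume "X \<in> cob (theory_Mod T)" and f: "f \<in> K \<rightarrow>\<^sub>E und (theory_Mod T) X"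
    then have X: "Md X" and fK: "\<And>k. k \<in> K \<Longrightarrow> f k \<in> car X" by (auto simp: theory_Mod_def)
    show "\<exists>!g. g \<in> chom (theory_Mod T) (F K) X \<and> (\<forall>k\<in>K. g (restrict (pro T K) K k) = f k)"
    proof (intro ex1I[of _ "\<lambda>t\<in>opn T K. op X K t f"] conjI ballI)
      show "(\<lambda>t\<in>opn T K. op X K t f) \<in> chom (theory_Mod T) (F K) X"
        using op_hom[OF X K fK] by (simp add: theory_Mod_def)
      fix k assume "k \<in> K"
      then show "(\<lambda>t\<in>opn T K. op X K t f) (restrict (pro T K) K k) = f k"
        using X K fK by (simp add: pro_opn op_pro)
    next
      fix g assume g: "g \<in> chom (theory_Mod T) (F K) X \<and> (\<forall>k\<in>K. g (restrict (pro T K) K k) = f k)"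
      then have g': "thom T (F K) X g" by (simp add: theory_Mod_def)
      show "g = (\<lambda>t\<in>opn T K. op X K t f)"
        by (rule thom_eqI[OF g' op_hom[OF X K fK]])
          (use g in \<open>auto simp: hom_F[OF g' K] intro: op_cong\<close>)
    qed
  qed (use K in \<open>auto simp: theory_Mod_def F_model pro_opn\<close>)
qed

section \<open>The models of a theory form a variety\<close>

definition model_eqns :: "'u eqn_theory" where
  "model_eqns = \<lparr>syms = theory_syms T, arity = sym_arity,
     eqns = {(I, App (OpSym I (pro T I i)) Var, Var i) | I i. small I \<and> i \<in> I} \<union>
       {(J, App (OpSym J (subst T I J t u)) Var, App (OpSym I t) (\<lambda>i. App (OpSym J (u i)) Var)) | I J t u.
          small I \<and> small J \<and> t \<in> opn T I \<and> u \<in> I \<rightarrow>\<^sub>E opn T J}\<rparr>"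

lemma equational_model_eqns: "equational_theory model_eqns"
  unfolding equational_theory_def
proof (intro conjI)
  show "|syms model_eqns| \<le>o |UNIV :: 'u set|"
    using card_OpSyms by (simp add: model_eqns_def theory_syms_def)
  show "\<forall>s\<in>syms model_eqns. small (arity model_eqns s)"
    by (auto simp: model_eqns_def elim: theory_symsE)
  show "\<forall>(K, a, b)\<in>eqns model_eqns. small K \<and>
     is_trm (syms model_eqns) (arity model_eqns) K a \<and> is_trm (syms model_eqns) (arity model_eqns) K b"
    by (auto simp: model_eqns_def pro_opn subst_opn intro!: is_trm.intros)
qed

lemma eqn_model_model_eqns: "eqn_model model_eqns X \<longleftrightarrow> Md X"
  unfolding eqn_model_def theory_model_def model_laws_def model_eqns_def eqn_theory.simps
    ball_Un ball_Collect2 ball_Collect4 prod.case ev.simps sym_arity.simps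
  by (auto simp: restrict_PiE_self)

lemma theory_Mod_eq_eqn_Mod: "theory_Mod T = eqn_Mod model_eqns"
  unfolding theory_Mod_def eqn_Mod_def eqn_model_model_eqns by (simp add: model_eqns_def)

lemma variety_theory_Mod: "variety (theory_Mod T)"
  unfolding variety_def
  using has_free_objects_theory_Mod equational_model_eqns theory_Mod_eq_eqn_Mod by metis

lemma
  shows cob_theory_Mod [simp]: "X \<in> cob (theory_Mod T) \<longleftrightarrow> Md X"
    and und_theory_Mod [simp]: "und (theory_Mod T) = car"
    and chom_theory_Mod [simp]: "f \<in> chom (theory_Mod T) X Y \<longleftrightarrow> thom T X Y f"
  by (simp_all add: theory_Mod_def)

end

lemma category_cat_of_algs:
  assumes "\<And>s X. s \<in> \<Sigma> \<Longrightarrow> X \<in> A \<Longrightarrow> itp X s \<in> (ar s \<rightarrow>\<^sub>E car X) \<rightarrow>\<^sub>E car X"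
  shows "category (cat_of \<lparr>cob = A, und = car, chom = (\<lambda>X Y. {f. alg_hom \<Sigma> ar X Y f})\<rparr>)"
proof -
  have c: "itp X s x \<in> car X" if "s \<in> \<Sigma>" "X \<in> A" "x \<in> ar s \<rightarrow>\<^sub>E car X" for s X x
    using assms[OF that(1,2)] that(3) by auto
  have r: "(\<lambda>i\<in>I. f (restrict x I i)) = (\<lambda>i\<in>I. f (x i))" for I and f x :: "'a \<Rightarrow> 'a" by auto
  have id: "alg_hom \<Sigma> ar X X (\<lambda>x\<in>car X. x)" if "X \<in> A" for X
  proof -
    have "(\<lambda>i\<in>ar s. (\<lambda>x\<in>car X. x) (x i)) = x" if "x \<in> ar s \<rightarrow>\<^sub>E car X" for x s
      using that by (auto simp: fun_eq_iff PiE_def extensional_def)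
    then show ?thesis using that c unfolding alg_hom_def by auto
  qed
  have cmp: "alg_hom \<Sigma> ar X Z (\<lambda>x\<in>car X. g (f x))"
    if "X \<in> A" "alg_hom \<Sigma> ar X Y f" "alg_hom \<Sigma> ar Y Z g" for X Y Z f g
  proof -
    have "(\<lambda>i\<in>ar s. (\<lambda>x\<in>car X. g (f x)) (x i)) = (\<lambda>i\<in>ar s. g ((\<lambda>i\<in>ar s. f (x i)) i))"
      if "x \<in> ar s \<rightarrow>\<^sub>E car X" for x s
      by (rule restrict_ext) (use PiE_mem[OF that] in auto)
    moreover have "(\<lambda>i\<in>ar s. f (x i)) \<in> ar s \<rightarrow>\<^sub>E car Y" if "x \<in> ar s \<rightarrow>\<^sub>E car X" for x s
      using that \<open>alg_hom \<Sigma> ar X Y f\<close> by (auto simp: alg_hom_def)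
    ultimately show ?thesis using that c unfolding alg_hom_def
      by (auto simp del: restrict_apply) auto
  qed
  show ?thesis
    unfolding category_def by (auto simp: id cmp) (auto simp: alg_hom_def PiE_def extensional_def fun_eq_iff)
qed

lemma concrete_category_eqn_Mod: "concrete_category (eqn_Mod E)"
  unfolding concrete_category_def
proof (intro conjI ballI)
  show "category (cat_of (eqn_Mod E))"
    unfolding eqn_Mod_def
    by (rule category_cat_of_algs) (auto simp: eqn_model_def is_alg_def)
qed (auto simp: eqn_Mod_def eqn_model_def is_alg_def alg_hom_def)

lemma (in alg_th) concrete_category_theory_Mod: "concrete_category (theory_Mod T)"
  using concrete_category_eqn_Mod theory_Mod_eq_eqn_Mod by metis

text \<open>From here on the simplifier rewrites a family under \<open>op\<close> with the index
  assumed to lie in the arity, the only place where its values matter.\<close>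

declare op_full_cong [cong]

section \<open>Products and exponentials of models\<close>

context alg_th
begin

lemma thom_comp: "\<lbrakk>Md X; thom T X Y f; thom T Y Z g\<rbrakk> \<Longrightarrow> thom T X Z (\<lambda>x\<in>car X. g (f x))"
  by (rule thomI) (auto simp: thom_in op_in thom_op)

lemma prod_model_model:
  assumes X: "Md X" and Y: "Md Y" shows "Md (prod_model T X Y)"
  unfolding prod_model_def
proof (rule theory_model_mk_alg)
  have c: "fs (x i) \<in> car X" "sn (x i) \<in> car Y" if "x \<in> I \<rightarrow>\<^sub>E prod_set (car X) (car Y)" "i \<in> I" for x i I
    using PiE_mem[OF that] by (auto elim!: prod_setE)
  show "small (prod_set (car X) (car Y))" using X Y by (simp add: small_prod_set small_car)
  fix I t x assume "small I" "t \<in> opn T I" "x \<in> I \<rightarrow>\<^sub>E prod_set (car X) (car Y)"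
  then show "pr (op X I t (\<lambda>i. fs (x i))) (op Y I t (\<lambda>i. sn (x i))) \<in> prod_set (car X) (car Y)"
    using X Y c[of x I] by (simp add: op_in)
next
  have c: "fs (x i) \<in> car X" "sn (x i) \<in> car Y" if "x \<in> I \<rightarrow>\<^sub>E prod_set (car X) (car Y)" "i \<in> I" for x i I
    using PiE_mem[OF that] by (auto elim!: prod_setE)
  fix I :: "'u set" and i x assume h: "small I" "i \<in> I" "x \<in> I \<rightarrow>\<^sub>E prod_set (car X) (car Y)"
  then have "x i \<in> prod_set (car X) (car Y)" by auto
  then show "pr (op X I (pro T I i) (\<lambda>i. fs (x i))) (op Y I (pro T I i) (\<lambda>i. sn (x i))) = x i"
    using X Y c[OF h(3)] h by (simp add: op_pro) (metis in_prod_set_iff)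
next
  have c: "fs (x i) \<in> car X" "sn (x i) \<in> car Y" if "x \<in> I \<rightarrow>\<^sub>E prod_set (car X) (car Y)" "i \<in> I" for x i I
    using PiE_mem[OF that] by (auto elim!: prod_setE)
  fix I J t u x
  assume h: "small I" "small J" "t \<in> opn T I" "u \<in> I \<rightarrow>\<^sub>E opn T J" "x \<in> J \<rightarrow>\<^sub>E prod_set (car X) (car Y)"
  note s = op_subst[OF X h(1-3), of u] op_subst[OF Y h(1-3), of u]
  show "pr (op X J (subst T I J t u) (\<lambda>i. fs (x i))) (op Y J (subst T I J t u) (\<lambda>i. sn (x i))) =
     pr (op X I t (\<lambda>i. fs ((\<lambda>i\<in>I. pr (op X J (u i) (\<lambda>i. fs (x i))) (op Y J (u i) (\<lambda>i. sn (x i)))) i)))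
       (op Y I t (\<lambda>i. sn ((\<lambda>i\<in>I. pr (op X J (u i) (\<lambda>i. fs (x i))) (op Y J (u i) (\<lambda>i. sn (x i)))) i)))"
    using s h c[OF h(5)] PiE_mem[OF h(4)] by (simp add: PiE_restrict)
qed

lemma car_prod_model [simp]: "car (prod_model T X Y) = prod_set (car X) (car Y)"
  by (simp add: prod_model_def)

lemma op_prod_model:
  "\<lbrakk>small I; t \<in> opn T I; \<And>i. i \<in> I \<Longrightarrow> f i \<in> prod_set (car X) (car Y)\<rbrakk>
    \<Longrightarrow> op (prod_model T X Y) I t f = pr (op X I t (\<lambda>i. fs (f i))) (op Y I t (\<lambda>i. sn (f i)))"
  unfolding prod_model_def by (auto simp: op_mk_alg intro!: op_cong)

lemma fs_prod_set: "z \<in> prod_set A B \<Longrightarrow> fs z \<in> A"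
  and sn_prod_set: "z \<in> prod_set A B \<Longrightarrow> sn z \<in> B"
  and pr_fs_sn: "z \<in> prod_set A B \<Longrightarrow> pr (fs z) (sn z) = z"
  by (auto elim: prod_setE)

lemma thom_fs: "thom T (prod_model T X Y) X (\<lambda>z\<in>prod_set (car X) (car Y). fs z)"
  and thom_sn: "thom T (prod_model T X Y) Y (\<lambda>z\<in>prod_set (car X) (car Y). sn z)"
  if "Md X" "Md Y" for X Y
  using that op_in[OF prod_model_model[OF that]]
  by (auto intro!: thomI simp: fs_prod_set sn_prod_set op_prod_model)

lemma thom_pair:
  assumes "Md X" "Md Y" "Md Q" "thom T Q X a" "thom T Q Y b"
  shows "thom T Q (prod_model T X Y) (\<lambda>z\<in>car Q. pr (a z) (b z))"
  by (rule thomI) (use assms in \<open>auto simp: thom_in op_in thom_op op_prod_model\<close>)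

lemma is_product_prod_model:
  assumes X: "Md X" and Y: "Md Y"
  shows "is_product (cat_of (theory_Mod T)) X Y (prod_model T X Y)
    (\<lambda>z\<in>prod_set (car X) (car Y). fs z) (\<lambda>z\<in>prod_set (car X) (car Y). sn z)"
  unfolding is_product_def
proof (intro conjI ballI)
  fix Z f g assume "Z \<in> Ob (cat_of (theory_Mod T))"
    and "f \<in> Hom (cat_of (theory_Mod T)) Z X" and "g \<in> Hom (cat_of (theory_Mod T)) Z Y"
  then have Z: "Md Z" and f: "thom T Z X f" and g: "thom T Z Y g" by auto
  have ex: "f \<in> extensional (car Z)" "g \<in> extensional (car Z)"
    using f g by (auto simp: thom_iff PiE_def)
  show "\<exists>!h. h \<in> Hom (cat_of (theory_Mod T)) Z (prod_model T X Y) \<and>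
      cmp (cat_of (theory_Mod T)) Z (prod_model T X Y) X (\<lambda>z\<in>prod_set (car X) (car Y). fs z) h = f \<and>
      cmp (cat_of (theory_Mod T)) Z (prod_model T X Y) Y (\<lambda>z\<in>prod_set (car X) (car Y). sn z) h = g"
  proof (intro ex1I[of _ "\<lambda>z\<in>car Z. pr (f z) (g z)"] conjI)
    fix h assume h: "h \<in> Hom (cat_of (theory_Mod T)) Z (prod_model T X Y) \<and>
      cmp (cat_of (theory_Mod T)) Z (prod_model T X Y) X (\<lambda>z\<in>prod_set (car X) (car Y). fs z) h = f \<and>
      cmp (cat_of (theory_Mod T)) Z (prod_model T X Y) Y (\<lambda>z\<in>prod_set (car X) (car Y). sn z) h = g"
    then have h': "thom T Z (prod_model T X Y) h" by simp
    show "h = (\<lambda>z\<in>car Z. pr (f z) (g z))"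
    proof (rule thom_eqI[OF h' thom_pair[OF X Y Z f g]])
      fix z assume z: "z \<in> car Z"
      then have "h z \<in> prod_set (car X) (car Y)" using thom_in[OF h'] by simp
      then show "h z = (\<lambda>z\<in>car Z. pr (f z) (g z)) z" using h z pr_fs_sn[of "h z"] by auto
    qed
  qed (use X Y Z f g ex in \<open>auto simp: thom_pair thom_in fun_eq_iff extensional_def\<close>)
qed (use assms in \<open>simp_all add: prod_model_model thom_fs thom_sn\<close>)

lemma bihom_thom:
  assumes X: "Md X" and Y: "Md Y" and f: "bihom T X Y Z f"
  shows "thom T (prod_model T X Y) Z (\<lambda>z\<in>prod_set (car X) (car Y). f (fs z) (sn z))"
proof (rule thomI)
  fix I t x assume h: "small I" "t \<in> opn T I" "\<And>i. i \<in> I \<Longrightarrow> x i \<in> car (prod_model T X Y)"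
  then have i: "fs (x i) \<in> car X" "sn (x i) \<in> car Y" if "i \<in> I" for i
    using h(3)[OF that] by (auto elim: prod_setE)
  have "f (op X I t (\<lambda>i. fs (x i))) (op Y I t (\<lambda>i. sn (x i))) = op Z I t (\<lambda>i. f (fs (x i)) (sn (x i)))"
    using f h(1,2) i by (rule bihom_op)
  then show "(\<lambda>z\<in>prod_set (car X) (car Y). f (fs z) (sn z)) (op (prod_model T X Y) I t x)
     = op Z I t (\<lambda>i. (\<lambda>z\<in>prod_set (car X) (car Y). f (fs z) (sn z)) (x i))"
    using h i X Y by (simp add: op_prod_model op_in)
qed (use f in \<open>auto simp: fs_prod_set sn_prod_set bihom_in\<close>)

lemma thom_bihom:
  assumes "Md X" "Md Y" "thom T (prod_model T X Y) Z f"
  shows "bihom T X Y Z (\<lambda>x y. f (pr x y))"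
  unfolding bihom_def
proof (intro conjI ballI allI impI)
  fix I t x y assume h: "small I" "t \<in> opn T I" "\<forall>i\<in>I. x i \<in> car X" "\<forall>i\<in>I. y i \<in> car Y"
  then have "f (op (prod_model T X Y) I t (\<lambda>i. pr (x i) (y i))) = op Z I t (\<lambda>i. f (pr (x i) (y i)))"
    by (intro thom_op[OF assms(3)]) auto
  then show "f (pr (op X I t x) (op Y I t y)) = op Z I t (\<lambda>i. f (pr (x i) (y i)))"
    using h by (simp add: op_prod_model)
qed (use assms in \<open>auto simp: thom_in\<close>)

lemma ex1_terminal_model: "\<exists>X. is_terminal (cat_of (theory_Mod T)) X"
proof -
  let ?X = "mk_alg T {undefined} (\<lambda>I t x. undefined)"
  have X: "Md ?X"
  proof (rule theory_model_mk_alg)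
    fix I :: "'u set" and i x assume "small I" "i \<in> I" "x \<in> I \<rightarrow>\<^sub>E {undefined :: 'u}"
    then have "x i \<in> {undefined}" by (auto dest: PiE_mem)
    then show "undefined = x i" by simp
  qed (simp_all add: small_finite)
  have "\<exists>!f. thom T Y ?X f" if Y: "Md Y" for Y
  proof (intro ex1I[of _ "\<lambda>y\<in>car Y. undefined"])
    show "thom T Y ?X (\<lambda>y\<in>car Y. undefined)"
      by (rule thomI) (use Y in \<open>auto simp: op_in op_mk_alg\<close>)
    fix f assume f: "thom T Y ?X f"
    then show "f = (\<lambda>y\<in>car Y. undefined)"
      using thom_in[OF f] by (auto simp: thom_iff PiE_def extensional_def fun_eq_iff)
  qed
  then show ?thesis using X unfolding is_terminal_def Ball_def by auto
qed

lemma thom_ext: "thom T X Y f \<Longrightarrow> f \<in> extensional (car X)"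
  by (simp add: thom_iff PiE_def)

lemma is_product_lift:
  assumes "is_product (cat_of (theory_Mod T)) X Y P p q" "Md Z" "thom T Z X f" "thom T Z Y g"
  shows "\<exists>!h. thom T Z P h \<and> (\<lambda>z\<in>car Z. p (h z)) = f \<and> (\<lambda>z\<in>car Z. q (h z)) = g"
  using assms unfolding is_product_def Ball_def Ob_cat_of Hom_cat_of cmp_cat_of und_theory_Mod
    cob_theory_Mod chom_theory_Mod by blast

lemma is_exponential_lift:
  assumes E: "is_exponential (cat_of (theory_Mod T)) Y Z E P p q e" and X: "Md X"
    and Q: "is_product (cat_of (theory_Mod T)) X Y Q a b" and f: "thom T Q Z f"
  shows "\<exists>!g. thom T X E g \<and> (\<exists>h. thom T Q P h \<and> (\<lambda>z\<in>car Q. p (h z)) = (\<lambda>z\<in>car Q. g (a z)) \<and>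
    (\<lambda>z\<in>car Q. q (h z)) = b \<and> (\<lambda>z\<in>car Q. e (h z)) = f)"
proof -
  let ?C = "cat_of (theory_Mod T)"
  have X': "X \<in> Ob ?C" and f': "f \<in> Hom ?C Q Z" using X f by auto
  have "\<forall>X\<in>Ob ?C. \<forall>Q a b. is_product ?C X Y Q a b \<longrightarrow>
        (\<forall>f\<in>Hom ?C Q Z. \<exists>!g. g \<in> Hom ?C X E \<and>
           (\<exists>h\<in>Hom ?C Q P. cmp ?C Q P E p h = cmp ?C Q X E g a \<and> cmp ?C Q P Y q h = b \<and>
                          cmp ?C Q P Z e h = f))"
    using E unfolding is_exponential_def by (elim conjE)
  from this[rule_format, OF X' Q f'] show ?thesis
    unfolding Hom_cat_of cmp_cat_of und_theory_Mod chom_theory_Mod Bex_def .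
qed

lemma is_product_cancel:
  assumes P: "is_product (cat_of (theory_Mod T)) X Y P p q"
    and "Md Z" "thom T Z P h" "thom T Z P h'"
    and "\<And>z. z \<in> car Z \<Longrightarrow> p (h z) = p (h' z)" "\<And>z. z \<in> car Z \<Longrightarrow> q (h z) = q (h' z)"
  shows "h = h'"
proof -
  let ?f = "\<lambda>z\<in>car Z. p (h z)" and ?g = "\<lambda>z\<in>car Z. q (h z)"
  have "thom T Z X ?f" "thom T Z Y ?g"
    using P assms thom_comp by (simp_all add: is_product_def)
  then have "\<exists>!h. thom T Z P h \<and> (\<lambda>z\<in>car Z. p (h z)) = ?f \<and> (\<lambda>z\<in>car Z. q (h z)) = ?g"
    using is_product_lift[OF P assms(2)] by blast
  moreover have "(\<lambda>z\<in>car Z. p (h' z)) = ?f" "(\<lambda>z\<in>car Z. q (h' z)) = ?g"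
    using assms by (auto simp: fun_eq_iff)
  ultimately show ?thesis using assms by blast
qed

text \<open>\<open>is_exponential\<close> comes with some product \<open>P\<close> of
  \<open>E\<close> and \<open>Y\<close>; its evaluation is pulled back along the comparison
  \<open>h\<close> from \<open>prod_model T E Y\<close>. The universal property is then used for the
  concrete product of \<open>X\<close> and \<open>Y\<close>.\<close>

lemma cartesian_closed_exponential_model:
  assumes cc: "cartesian_closed (cat_of (theory_Mod T))" and Y: "Md Y" and Z: "Md Z"
  shows "\<exists>E \<epsilon>. exponential_model T Y Z E \<epsilon>"
proof -
  let ?C = "cat_of (theory_Mod T)"
  obtain E P p q e where exp: "is_exponential ?C Y Z E P p q e"
    using cc Y Z unfolding cartesian_closed_def Ob_cat_of by (metis cob_theory_Mod)
  then have E: "Md E" and P: "is_product ?C E Y P p q" and e: "thom T P Z e"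
    by (auto simp: is_exponential_def)
  have PM: "Md P" and p: "thom T P E p" and q: "thom T P Y q"
    using P by (auto simp: is_product_def)
  let ?Q = "prod_model T E Y"
  have Q: "Md ?Q" using E Y by (rule prod_model_model)
  have "\<exists>!h. thom T ?Q P h \<and> (\<lambda>z\<in>car ?Q. p (h z)) = (\<lambda>z\<in>car ?Q. fs z) \<and>
    (\<lambda>z\<in>car ?Q. q (h z)) = (\<lambda>z\<in>car ?Q. sn z)"
    using is_product_lift[OF P Q thom_fs[OF E Y] thom_sn[OF E Y]] by simp
  then obtain h where h: "thom T ?Q P h" and "(\<lambda>z\<in>car ?Q. p (h z)) = (\<lambda>z\<in>car ?Q. fs z)"
    and "(\<lambda>z\<in>car ?Q. q (h z)) = (\<lambda>z\<in>car ?Q. sn z)" by blast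
  then have ph: "p (h z) = fs z" "q (h z) = sn z" if "z \<in> prod_set (car E) (car Y)" for z
    using that by (metis car_prod_model restrict_apply')+
  let ?\<epsilon> = "\<lambda>c y. e (h (pr c y))"
  have "thom T ?Q Z (\<lambda>z\<in>car ?Q. e (h z))" using Q h e by (rule thom_comp)
  from thom_bihom[OF E Y this] have \<epsilon>: "bihom T E Y Z ?\<epsilon>"
    by (auto simp: bihom_def op_in[OF E] op_in[OF Y])
  have "\<exists>!g. thom T X E g \<and> (\<forall>x\<in>car X. \<forall>y\<in>car Y. f x y = ?\<epsilon> (g x) y)"
    if X: "Md X" and f: "bihom T X Y Z f" for X f
  proof -
    let ?R = "prod_model T X Y"
    let ?a = "\<lambda>z\<in>prod_set (car X) (car Y). fs z" and ?b = "\<lambda>z\<in>prod_set (car X) (car Y). sn z"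
    let ?f = "\<lambda>z\<in>prod_set (car X) (car Y). f (fs z) (sn z)"
    have R: "Md ?R" using X Y by (rule prod_model_model)
    have fR: "thom T ?R Z ?f" using X Y f by (rule bihom_thom)
    have "\<exists>!g. thom T X E g \<and> (\<exists>k. thom T ?R P k \<and> (\<lambda>z\<in>car ?R. p (k z)) = (\<lambda>z\<in>car ?R. g (?a z)) \<and>
       (\<lambda>z\<in>car ?R. q (k z)) = ?b \<and> (\<lambda>z\<in>car ?R. e (k z)) = ?f)"
      using is_exponential_lift[OF exp X is_product_prod_model[OF X Y] fR] .
    \<comment> \<open>The arrow \<open>k\<close> into \<open>P\<close> is forced by its two
      components, so the existential statement only says that evaluation after \<open>g\<close> is
      \<open>f\<close>.\<close>
    moreover have "(\<exists>k. thom T ?R P k \<and> (\<lambda>z\<in>car ?R. p (k z)) = (\<lambda>z\<in>car ?R. g (?a z)) \<and>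
       (\<lambda>z\<in>car ?R. q (k z)) = ?b \<and> (\<lambda>z\<in>car ?R. e (k z)) = ?f) \<longleftrightarrow>
       (\<forall>x\<in>car X. \<forall>y\<in>car Y. f x y = ?\<epsilon> (g x) y)" (is "?lhs = ?rhs") if g: "thom T X E g" for g
    proof -
      let ?k = "\<lambda>z\<in>car ?R. h (pr (g (fs z)) (sn z))"
      have "thom T ?R ?Q (\<lambda>z\<in>car ?R. pr ((\<lambda>z\<in>car ?R. g (?a z)) z) (?b z))"
        by (rule thom_pair[OF E Y R thom_comp[OF R thom_fs[OF X Y] g] thom_sn[OF X Y]])
      from thom_comp[OF R this h] have k: "thom T ?R P ?k"
        by (simp add: restrict_def cong: if_cong)
      have in': "pr (g (fs z)) (sn z) \<in> prod_set (car E) (car Y)" if "z \<in> prod_set (car X) (car Y)" for z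
        using that thom_in[OF g] by (auto simp: fs_prod_set sn_prod_set)
      have pk: "p (?k z) = g (fs z)" "q (?k z) = sn z" if "z \<in> car ?R" for z
        using that in' by (auto simp: ph)
      show ?thesis
      proof
        assume ?lhs
        then obtain k' where k': "thom T ?R P k'" "(\<lambda>z\<in>car ?R. p (k' z)) = (\<lambda>z\<in>car ?R. g (?a z))"
          "(\<lambda>z\<in>car ?R. q (k' z)) = ?b" "(\<lambda>z\<in>car ?R. e (k' z)) = ?f" by blast
        have k'': "p (k' z) = g (fs z)" "q (k' z) = sn z" "e (k' z) = f (fs z) (sn z)"
          if "z \<in> car ?R" for z
          using k'(2-4)[THEN fun_cong, of z] that by auto
        have "k' = ?k"
          by (rule is_product_cancel[OF P R k'(1) k]) (auto simp only: k'' pk)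
        show ?rhs
        proof (intro ballI)
          fix x y assume "x \<in> car X" "y \<in> car Y"
          then have "pr x y \<in> car ?R" by simp
          from k''(3)[OF this] this show "f x y = ?\<epsilon> (g x) y" unfolding \<open>k' = ?k\<close> by simp
        qed
      next
        assume r: ?rhs
        have "(\<lambda>z\<in>car ?R. p (?k z)) = (\<lambda>z\<in>car ?R. g (?a z))" "(\<lambda>z\<in>car ?R. q (?k z)) = ?b"
          using pk by (auto simp: fun_eq_iff)
        moreover have "(\<lambda>z\<in>car ?R. e (?k z)) = ?f"
          using r by (auto simp: fun_eq_iff fs_prod_set sn_prod_set)
        ultimately show ?lhs using k by blast
      qed
    qed
    ultimately show ?thesis by (simp cong: conj_cong)
  qed
  then show ?thesis using E \<epsilon> unfolding exponential_model_def by blast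
qed

text \<open>The universal property must be verified against every product \<open>Q\<close> of
  \<open>X\<close> and \<open>Y\<close>. The comparison \<open>k\<close> from the concrete product
  to \<open>Q\<close> is inverted by pairing the projections of \<open>Q\<close>, so a homomorphism
  out of \<open>Q\<close> amounts to a \<open>bihom\<close>.\<close>

lemma exponential_model_cartesian_closed:
  assumes ex: "\<And>Y Z. \<lbrakk>Md Y; Md Z\<rbrakk> \<Longrightarrow> \<exists>E \<epsilon>. exponential_model T Y Z E \<epsilon>"
  shows "cartesian_closed (cat_of (theory_Mod T))"
  unfolding cartesian_closed_def
proof (intro conjI ballI)
  let ?C = "cat_of (theory_Mod T)"
  show "category ?C" using concrete_category_theory_Mod by (simp add: concrete_category_def)
  show "\<exists>X. is_terminal ?C X" by (rule ex1_terminal_model)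
  fix Y Z assume "Y \<in> Ob ?C" "Z \<in> Ob ?C"
  then have Y: "Md Y" and Z: "Md Z" by auto
  show "\<exists>P p q. is_product ?C Y Z P p q" using is_product_prod_model[OF Y Z] by blast
  obtain E \<epsilon> where exp: "exponential_model T Y Z E \<epsilon>" using ex[OF Y Z] by blast
  then have E: "Md E" and \<epsilon>: "bihom T E Y Z \<epsilon>" by (auto simp: exponential_model_def)
  let ?P = "prod_model T E Y"
  let ?p = "\<lambda>z\<in>prod_set (car E) (car Y). fs z" and ?q = "\<lambda>z\<in>prod_set (car E) (car Y). sn z"
  let ?e = "\<lambda>z\<in>prod_set (car E) (car Y). \<epsilon> (fs z) (sn z)"
  have "is_exponential ?C Y Z E ?P ?p ?q ?e"
    unfolding is_exponential_def
  proof (intro conjI ballI allI impI)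
    show "E \<in> Ob ?C" using E by simp
    show "is_product ?C E Y ?P ?p ?q" using E Y by (rule is_product_prod_model)
    show "?e \<in> Hom ?C ?P Z" using bihom_thom[OF E Y \<epsilon>] by simp
    fix X Q a b f assume "X \<in> Ob ?C" and Q: "is_product ?C X Y Q a b" and "f \<in> Hom ?C Q Z"
    then have X: "Md X" and f: "thom T Q Z f" by auto
    have QM: "Md Q" and a: "thom T Q X a" and b: "thom T Q Y b" using Q by (auto simp: is_product_def)
    let ?R = "prod_model T X Y"
    have R: "Md ?R" using X Y by (rule prod_model_model)
    have "\<exists>!h. thom T ?R Q h \<and> (\<lambda>z\<in>car ?R. a (h z)) = (\<lambda>z\<in>car ?R. fs z) \<and>
      (\<lambda>z\<in>car ?R. b (h z)) = (\<lambda>z\<in>car ?R. sn z)"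
      using is_product_lift[OF Q R thom_fs[OF X Y] thom_sn[OF X Y]] by simp
    then obtain k where k: "thom T ?R Q k" and "(\<lambda>z\<in>car ?R. a (k z)) = (\<lambda>z\<in>car ?R. fs z)"
      and "(\<lambda>z\<in>car ?R. b (k z)) = (\<lambda>z\<in>car ?R. sn z)" by blast
    then have ak: "a (k z) = fs z" "b (k z) = sn z" if "z \<in> prod_set (car X) (car Y)" for z
      using that by (metis car_prod_model restrict_apply')+
    \<comment> \<open>Both sides have the same two projections, and these determine a homomorphism
      into the product \<open>Q\<close>.\<close>
    have kab: "k (pr (a z) (b z)) = z" if z: "z \<in> car Q" for z
    proof -
      have "(\<lambda>z\<in>car Q. k ((\<lambda>z\<in>car Q. pr (a z) (b z)) z)) = (\<lambda>z\<in>car Q. z)"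
      proof (rule is_product_cancel[OF Q QM])
        show "thom T Q Q (\<lambda>z\<in>car Q. k ((\<lambda>z\<in>car Q. pr (a z) (b z)) z))"
          using QM thom_pair[OF X Y QM a b] k by (rule thom_comp)
        show "thom T Q Q (\<lambda>z\<in>car Q. z)"
          by (rule thomI) (use QM in \<open>auto simp: op_in\<close>)
      qed (use thom_in[OF a] thom_in[OF b] in \<open>auto simp: ak\<close>)
      from fun_cong[OF this, of z] show ?thesis using z by simp
    qed
    have "bihom T X Y Z (\<lambda>x y. (\<lambda>z\<in>car ?R. f (k z)) (pr x y))"
      by (rule thom_bihom[OF X Y thom_comp[OF R k f]])
    then have "bihom T X Y Z (\<lambda>x y. f (k (pr x y)))"
      by (auto simp: bihom_def op_in[OF X] op_in[OF Y])
    then have ex1: "\<exists>!g. thom T X E g \<and> (\<forall>x\<in>car X. \<forall>y\<in>car Y. f (k (pr x y)) = \<epsilon> (g x) y)"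
      using exp X by (simp add: exponential_model_def)
    have "(\<exists>h. thom T Q ?P h \<and> (\<lambda>z\<in>car Q. ?p (h z)) = (\<lambda>z\<in>car Q. g (a z)) \<and>
        (\<lambda>z\<in>car Q. ?q (h z)) = b \<and> (\<lambda>z\<in>car Q. ?e (h z)) = f) \<longleftrightarrow>
      (\<forall>x\<in>car X. \<forall>y\<in>car Y. f (k (pr x y)) = \<epsilon> (g x) y)" (is "?lhs = ?rhs") if g: "thom T X E g" for g
    proof
      assume ?lhs
      then obtain h where h: "thom T Q ?P h" and e: "(\<lambda>z\<in>car Q. ?p (h z)) = (\<lambda>z\<in>car Q. g (a z))"
        "(\<lambda>z\<in>car Q. ?q (h z)) = b" "(\<lambda>z\<in>car Q. ?e (h z)) = f" by blast
      show ?rhs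
      proof (intro ballI)
        fix x y assume xy: "x \<in> car X" "y \<in> car Y"
        let ?z = "k (pr x y)"
        have z: "?z \<in> car Q" using thom_in[OF k] xy by simp
        then have "h ?z \<in> prod_set (car E) (car Y)" using thom_in[OF h] by simp
        then show "f ?z = \<epsilon> (g x) y"
          using e[THEN fun_cong, of ?z] z xy ak[of "pr x y"] by simp
      qed
    next
      assume r: ?rhs
      let ?h = "\<lambda>z\<in>car Q. pr ((\<lambda>z\<in>car Q. g (a z)) z) (b z)"
      have h: "thom T Q ?P ?h" by (rule thom_pair[OF E Y QM thom_comp[OF QM a g] b])
      have i: "a z \<in> car X" "b z \<in> car Y" "g (a z) \<in> car E" if "z \<in> car Q" for z
        using that thom_in[OF a] thom_in[OF b] thom_in[OF g] by auto
      have "f z = \<epsilon> (g (a z)) (b z)" if "z \<in> car Q" for z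
        using r i[OF that] kab[OF that] by metis
      then have "(\<lambda>z\<in>car Q. ?p (?h z)) = (\<lambda>z\<in>car Q. g (a z))" "(\<lambda>z\<in>car Q. ?q (?h z)) = b"
        "(\<lambda>z\<in>car Q. ?e (?h z)) = f"
        using thom_ext[OF b] thom_ext[OF f] i by (auto simp: fun_eq_iff extensional_def)
      then show ?lhs using h by blast
    qed
    then have "\<exists>!g. thom T X E g \<and> (\<exists>h. thom T Q ?P h \<and> (\<lambda>z\<in>car Q. ?p (h z)) = (\<lambda>z\<in>car Q. g (a z)) \<and>
        (\<lambda>z\<in>car Q. ?q (h z)) = b \<and> (\<lambda>z\<in>car Q. ?e (h z)) = f)"
      using ex1 by (simp cong: conj_cong)
    then show "\<exists>!g. g \<in> Hom ?C X E \<and> (\<exists>h\<in>Hom ?C Q ?P. cmp ?C Q ?P E ?p h = cmp ?C Q X E g a \<and>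
        cmp ?C Q ?P Y ?q h = b \<and> cmp ?C Q ?P Z ?e h = f)"
      unfolding Hom_cat_of cmp_cat_of und_theory_Mod chom_theory_Mod Bex_def .
  qed
  then show "\<exists>E P p q e. is_exponential ?C Y Z E P p q e" by blast
qed

end

section \<open>Hyperaffine operations\<close>

definition ap :: "'u::universe alg \<Rightarrow> 'u \<Rightarrow> 'u \<Rightarrow> 'u" where
  "ap X m x = op X (fin 1) m (\<lambda>_. x)"

context alg_th
begin

lemma ap_in: "\<lbrakk>Md X; m \<in> opn T (fin 1); x \<in> car X\<rbrakk> \<Longrightarrow> ap X m x \<in> car X"
  by (simp add: ap_def op_in)

lemma ap_F_in: "\<lbrakk>small K; m \<in> opn T (fin 1); x \<in> opn T K\<rbrakk> \<Longrightarrow> ap (F K) m x \<in> opn T K"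
  using ap_in[OF F_model] by simp

lemma app1_eq_ap: "\<lbrakk>small K; m \<in> opn T (fin 1); a \<in> opn T K\<rbrakk> \<Longrightarrow> app1 T K m a = ap (F K) m a"
  by (simp add: app1_def ap_def op_F)

text \<open>The identity as a unary operation; it is also the generator of the free model on one
  element and the unit of the monoid of unary operations.\<close>

definition e1 :: 'u where "e1 = pro T (fin 1) (num 1)"

lemma e1_in [simp]: "e1 \<in> opn T (fin 1)"
  unfolding e1_def by (rule pro_opn) simp_all

lemma ap_e1: "\<lbrakk>Md X; x \<in> car X\<rbrakk> \<Longrightarrow> ap X e1 x = x"
  unfolding ap_def e1_def by (rule op_pro) simp_all

lemma ap_op:
  "\<lbrakk>Md X; small I; t \<in> opn T I; \<And>i. i \<in> I \<Longrightarrow> u i \<in> opn T (fin 1); x \<in> car X\<rbrakk>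
    \<Longrightarrow> ap X (op (F (fin 1)) I t u) x = op X I t (\<lambda>i. ap X (u i) x)"
  unfolding ap_def by (rule op_op) simp_all

lemma ap_ap:
  "\<lbrakk>Md X; m \<in> opn T (fin 1); n \<in> opn T (fin 1); x \<in> car X\<rbrakk>
    \<Longrightarrow> ap X (ap (F (fin 1)) m n) x = ap X m (ap X n x)"
  using ap_op[of X "fin 1" m "\<lambda>_. n"] unfolding ap_def by simp

lemma op_ap:
  "\<lbrakk>Md X; small I; t \<in> opn T I; m \<in> opn T (fin 1); \<And>i. i \<in> I \<Longrightarrow> f i \<in> car X\<rbrakk>
    \<Longrightarrow> op X I (ap (F I) m t) f = ap X m (op X I t f)"
  using op_op[of X "fin 1" I m "\<lambda>_. t" f] unfolding ap_def by simp

text \<open>As hyperaffine operations are affine, this is the unary part of any decomposition of \<open>t\<close>.\<close>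

definition dm :: "'u set \<Rightarrow> 'u \<Rightarrow> 'u" where
  "dm I t = op (F (fin 1)) I t (\<lambda>_. e1)"

lemma dm_in: "\<lbrakk>small I; t \<in> opn T I\<rbrakk> \<Longrightarrow> dm I t \<in> opn T (fin 1)"
  unfolding dm_def by (rule op_F_in) simp_all

lemma ap_dm: "\<lbrakk>Md X; small I; t \<in> opn T I; x \<in> car X\<rbrakk> \<Longrightarrow> ap X (dm I t) x = op X I t (\<lambda>_. x)"
  unfolding dm_def by (simp add: ap_op ap_e1)

lemma ap_F1_e1: "m \<in> opn T (fin 1) \<Longrightarrow> ap (F (fin 1)) m e1 = m"
proof -
  assume m: "m \<in> opn T (fin 1)"
  have "ap (F (fin 1)) m e1 = op (F (fin 1)) (fin 1) m (pro T (fin 1))"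
    unfolding ap_def e1_def by (rule op_cong) (simp add: fin_1)
  then show ?thesis using m by (simp add: op_F_pros)
qed

lemma op_eqI:
  "\<lbrakk>small I; s \<in> opn T I; t \<in> opn T I; op (F I) I s (pro T I) = op (F I) I t (pro T I)\<rbrakk> \<Longrightarrow> s = t"
  by (simp add: op_F_pros)

lemma dm_op:
  "\<lbrakk>small I; small J; s \<in> opn T J; \<And>j. j \<in> J \<Longrightarrow> t j \<in> opn T I\<rbrakk>
    \<Longrightarrow> dm I (op (F I) J s t) = op (F (fin 1)) J s (\<lambda>j. dm I (t j))"
  unfolding dm_def by (rule op_op) (simp_all add: F_model)

lemma dm_ap:
  "\<lbrakk>small I; m \<in> opn T (fin 1); t \<in> opn T I\<rbrakk> \<Longrightarrow> dm I (ap (F I) m t) = ap (F (fin 1)) m (dm I t)"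
  using dm_op[of I "fin 1" m "\<lambda>_. t"] unfolding ap_def by simp

lemma dm_fin1: "m \<in> opn T (fin 1) \<Longrightarrow> dm (fin 1) m = m"
  using ap_F1_e1 by (simp add: dm_def ap_def)

lemma dm_pro: "\<lbrakk>small I; i \<in> I\<rbrakk> \<Longrightarrow> dm I (pro T I i) = e1"
  unfolding dm_def by (rule op_F_pro) simp_all

lemma hyperaffineI:
  assumes "small I" "t \<in> opn T I"
    and "\<And>K x. \<lbrakk>small K; x \<in> opn T K\<rbrakk> \<Longrightarrow> op (F K) I t (\<lambda>_. x) = x"
    and "\<And>K x. \<lbrakk>small K; \<And>i j. \<lbrakk>i \<in> I; j \<in> I\<rbrakk> \<Longrightarrow> x i j \<in> opn T K\<rbrakk>
      \<Longrightarrow> op (F K) I t (\<lambda>i. op (F K) I t (x i)) = op (F K) I t (\<lambda>i. x i i)"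
  shows "hyperaffine T I t"
  unfolding hyperaffine_def affine_def
proof (intro conjI allI impI ballI)
  fix K x assume "small K" "x \<in> opn T K"
  then show "subst T I K t (\<lambda>i\<in>I. x) = x" using assms by (simp add: op_F)
next
  fix K and x :: "'u \<Rightarrow> 'u \<Rightarrow> 'u" assume K: "small K" and x: "\<forall>i\<in>I. \<forall>j\<in>I. x i j \<in> opn T K"
  then have r: "(\<lambda>i\<in>I. op (F K) I t (x i)) = (\<lambda>i\<in>I. subst T I K t (restrict (x i) I))"
    using assms(1,2) by (intro restrict_ext) (simp add: op_F)
  have "op (F K) I t (\<lambda>i. op (F K) I t (x i)) = op (F K) I t (\<lambda>i. x i i)"
    using K x by (intro assms) auto
  moreover have "op (F K) I t (\<lambda>i. op (F K) I t (x i)) = subst T I K t (\<lambda>i\<in>I. op (F K) I t (x i))"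
    using assms(1,2) K x by (intro op_F) (auto simp: op_F_in)
  moreover have "op (F K) I t (\<lambda>i. x i i) = subst T I K t (\<lambda>i\<in>I. x i i)"
    using assms(1,2) K x by (simp add: op_F)
  ultimately show "subst T I K t (\<lambda>i\<in>I. subst T I K t (\<lambda>j\<in>I. x i j)) = subst T I K t (\<lambda>i\<in>I. x i i)"
    unfolding r by simp
qed

lemma
  assumes h: "hyperaffine T I t" and I: "small I" and t: "t \<in> opn T I"
  shows haff_F_const: "\<lbrakk>small K; x \<in> opn T K\<rbrakk> \<Longrightarrow> op (F K) I t (\<lambda>_. x) = x"
    and haff_F_diag: "\<lbrakk>small K; \<And>i j. \<lbrakk>i \<in> I; j \<in> I\<rbrakk> \<Longrightarrow> y i j \<in> opn T K\<rbrakk>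
      \<Longrightarrow> op (F K) I t (\<lambda>i. op (F K) I t (y i)) = op (F K) I t (\<lambda>i. y i i)"
proof -
  assume K: "small K" and x: "x \<in> opn T K"
  then show "op (F K) I t (\<lambda>_. x) = x"
    using h I t by (simp add: op_F hyperaffine_def affine_def)
next
  assume K: "small K" and y: "\<And>i j. \<lbrakk>i \<in> I; j \<in> I\<rbrakk> \<Longrightarrow> y i j \<in> opn T K"
  have r: "(\<lambda>i\<in>I. op (F K) I t (y i)) = (\<lambda>i\<in>I. subst T I K t (restrict (y i) I))"
    using I t y by (intro restrict_ext) (simp add: op_F)
  have "op (F K) I t (\<lambda>i. op (F K) I t (y i)) = subst T I K t (\<lambda>i\<in>I. op (F K) I t (y i))"
    using I t K y by (intro op_F) (auto simp: op_F_in)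
  also have "\<dots> = subst T I K t (\<lambda>i\<in>I. y i i)"
    unfolding r using h K y by (simp add: hyperaffine_def)
  finally show "op (F K) I t (\<lambda>i. op (F K) I t (y i)) = op (F K) I t (\<lambda>i. y i i)"
    using I t y by (simp add: op_F)
qed

text \<open>Identities between derived operations pass from the free model on \<open>car X\<close> to \<open>X\<close> along the
  homomorphism extending the identity.\<close>

lemma
  assumes h: "hyperaffine T I t" and I: "small I" and t: "t \<in> opn T I" and X: "Md X"
  shows haff_const: "x \<in> car X \<Longrightarrow> op X I t (\<lambda>_. x) = x"
    and haff_diag: "(\<And>i j. \<lbrakk>i \<in> I; j \<in> I\<rbrakk> \<Longrightarrow> x' i j \<in> car X)
      \<Longrightarrow> op X I t (\<lambda>i. op X I t (x' i)) = op X I t (\<lambda>i. x' i i)"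
proof -
  let ?K = "car X" and ?p = "pro T (car X)"
  let ?e = "\<lambda>s. op X ?K s (\<lambda>z. z)"
  have K: "small ?K" using X by (rule small_car)
  have e: "?e (op (F ?K) I t f) = op X I t (\<lambda>i. ?e (f i))" if "\<And>i. i \<in> I \<Longrightarrow> f i \<in> opn T ?K" for f
    using that X I t K by (simp add: op_op)
  have ep: "?e (?p x) = x" if "x \<in> ?K" for x using X K that by (simp add: op_pro)
  show "op X I t (\<lambda>_. x) = x" if x: "x \<in> car X"
    using e[of "\<lambda>_. ?p x"] haff_F_const[OF h I t K, of "?p x"] x K by (simp add: ep pro_opn)
  show "op X I t (\<lambda>i. op X I t (x' i)) = op X I t (\<lambda>i. x' i i)" if x: "\<And>i j. \<lbrakk>i \<in> I; j \<in> I\<rbrakk> \<Longrightarrow> x' i j \<in> car X"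
  proof -
    have "?e (op (F ?K) I t (\<lambda>i. op (F ?K) I t (\<lambda>j. ?p (x' i j)))) = ?e (op (F ?K) I t (\<lambda>i. ?p (x' i i)))"
      by (rule arg_cong[where f = ?e]) (rule haff_F_diag[OF h I t K], simp add: pro_opn K x)
    then show ?thesis using x I t K by (simp add: e ep pro_opn op_F_in)
  qed
qed

lemma hyperaffine_pro: "\<lbrakk>small I; i \<in> I\<rbrakk> \<Longrightarrow> hyperaffine T I (pro T I i)"
  by (rule hyperaffineI) (simp_all add: pro_opn op_F_pro)

text \<open>The equation is required only at the generic family of projections; by substitution it
  then holds for all families in all models, as \<open>decomp_op\<close> and
  \<open>decomp_iff\<close> record.\<close>

definition decomp :: "'u set \<Rightarrow> 'u \<Rightarrow> 'u \<Rightarrow> 'u \<Rightarrow> bool" where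
  "decomp I t h m \<longleftrightarrow> h \<in> opn T I \<and> hyperaffine T I h \<and> m \<in> opn T (fin 1) \<and>
     t = op (F I) I h (\<lambda>i. ap (F I) m (pro T I i))"

lemma decomp_op:
  assumes "decomp I t h m" "small I" "Md X" "\<And>i. i \<in> I \<Longrightarrow> x i \<in> car X"
  shows "op X I t x = op X I h (\<lambda>i. ap X m (x i))"
  using assms unfolding decomp_def by (simp add: op_op op_ap op_pro pro_opn ap_F_in)

lemma decomp_iff:
  assumes I: "small I" and t: "t \<in> opn T I"
  shows "decomp I t h m \<longleftrightarrow> h \<in> opn T I \<and> hyperaffine T I h \<and> m \<in> opn T (fin 1) \<and>
     (\<forall>K. small K \<longrightarrow> (\<forall>x \<in> I \<rightarrow>\<^sub>E opn T K.
        subst T I K t x = subst T I K h (\<lambda>i\<in>I. app1 T K m (x i))))" (is "_ \<longleftrightarrow> ?R")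
proof -
  have s: "subst T I K t x = op (F K) I t x \<and>
      subst T I K h (\<lambda>i\<in>I. app1 T K m (x i)) = op (F K) I h (\<lambda>i. ap (F K) m (x i))"
    if "h \<in> opn T I" "m \<in> opn T (fin 1)" "small K" "x \<in> I \<rightarrow>\<^sub>E opn T K" for K x
  proof -
    have x: "x i \<in> opn T K" if "i \<in> I" for i using \<open>x \<in> I \<rightarrow>\<^sub>E opn T K\<close> that by auto
    have "(\<lambda>i\<in>I. app1 T K m (x i)) = (\<lambda>i\<in>I. ap (F K) m (x i))"
      using that x by (intro restrict_ext app1_eq_ap)
    then show ?thesis using that x I t by (simp add: op_F ap_F_in PiE_restrict)
  qed
  show ?thesis
  proof
    assume d: "decomp I t h m"
    then have hm: "h \<in> opn T I" "m \<in> opn T (fin 1)" by (simp_all add: decomp_def)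
    have "subst T I K t x = subst T I K h (\<lambda>i\<in>I. app1 T K m (x i))"
      if "small K" "x \<in> I \<rightarrow>\<^sub>E opn T K" for K x
      using s[OF hm that] decomp_op[OF d I F_model[OF that(1)], of x] that(2) by (auto simp: PiE_mem)
    then show ?R using d by (simp add: decomp_def)
  next
    assume r: ?R
    then have hm: "h \<in> opn T I" "m \<in> opn T (fin 1)" by simp_all
    have p: "restrict (pro T I) I \<in> I \<rightarrow>\<^sub>E opn T I" using I by (simp add: pro_opn)
    have "subst T I I t (restrict (pro T I) I)
        = subst T I I h (\<lambda>i\<in>I. app1 T I m (restrict (pro T I) I i))" using r I p by blast
    also have "\<dots> = op (F I) I h (\<lambda>i. ap (F I) m (restrict (pro T I) I i))"
      using s[OF hm I p] by (rule conjunct2)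
    also have "\<dots> = op (F I) I h (\<lambda>i. ap (F I) m (pro T I i))" by (rule op_cong) simp
    finally have "subst T I I t (restrict (pro T I) I) = op (F I) I h (\<lambda>i. ap (F I) m (pro T I i))" .
    then show "decomp I t h m" using r I t by (simp add: decomp_def subst_pro)
  qed
qed

lemma hyperaffine_unary_iff:
  "hyperaffine_unary T \<longleftrightarrow> (\<forall>I. small I \<longrightarrow> (\<forall>t\<in>opn T I. \<exists>!(h, m). decomp I t h m))"
  unfolding hyperaffine_unary_def using T by (auto simp: decomp_iff)

lemma decomp_dm:
  assumes d: "decomp I t h m" and I: "small I" shows "m = dm I t"
proof -
  have m: "m \<in> opn T (fin 1)" and h: "hyperaffine T I h" "h \<in> opn T I" using d by (auto simp: decomp_def)
  have "dm I t = op (F (fin 1)) I h (\<lambda>i. ap (F (fin 1)) m e1)"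
    unfolding dm_def using decomp_op[OF d I F_model] by simp
  also have "\<dots> = m" using haff_F_const[OF h(1) I h(2), of "fin 1" m] m by (simp add: ap_F1_e1)
  finally show ?thesis by simp
qed

end

section \<open>Hyperaffine and unary parts of operations\<close>

locale hau = alg_th T for T :: "'u::universe alg_theory" +
  assumes hau: "hyperaffine_unary T"
begin

definition hd :: "'u set \<Rightarrow> 'u \<Rightarrow> 'u" where
  "hd I t = (SOME h. \<exists>m. decomp I t h m)"

lemma decomp_hd: "\<lbrakk>small I; t \<in> opn T I\<rbrakk> \<Longrightarrow> decomp I t (hd I t) (dm I t)"
proof -
  assume I: "small I" and t: "t \<in> opn T I"
  then have "\<exists>!(h, m). decomp I t h m" using hau by (simp add: hyperaffine_unary_iff)
  then have "\<exists>h m. decomp I t h m" by auto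
  then have "\<exists>m. decomp I t (hd I t) m" unfolding hd_def by (rule someI_ex)
  then show ?thesis using decomp_dm[OF _ I] by blast
qed

lemma hd_unique: "\<lbrakk>small I; t \<in> opn T I; decomp I t h m\<rbrakk> \<Longrightarrow> hd I t = h"
  using decomp_hd[of I t] hau unfolding hyperaffine_unary_iff by fastforce

lemma hd_in: "\<lbrakk>small I; t \<in> opn T I\<rbrakk> \<Longrightarrow> hd I t \<in> opn T I"
  and hyperaffine_hd: "\<lbrakk>small I; t \<in> opn T I\<rbrakk> \<Longrightarrow> hyperaffine T I (hd I t)"
  using decomp_hd by (auto simp: decomp_def)

lemma op_hd:
  "\<lbrakk>small I; t \<in> opn T I; Md X; \<And>i. i \<in> I \<Longrightarrow> x i \<in> car X\<rbrakk>
    \<Longrightarrow> op X I t x = op X I (hd I t) (\<lambda>i. ap X (dm I t) (x i))"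
  using decomp_op[OF decomp_hd] by blast

text \<open>A hyperaffine \<open>t\<close> decomposes as itself with the identity as unary part, and
  decompositions are unique.\<close>

lemma hd_haff:
  assumes "small I" "t \<in> opn T I" "hyperaffine T I t"
  shows "hd I t = t" "dm I t = e1"
proof -
  have "op (F I) I t (\<lambda>i. ap (F I) e1 (pro T I i)) = op (F I) I t (pro T I)"
    using assms by (intro op_cong) (simp add: ap_e1 F_model pro_opn)
  then have d: "decomp I t t e1" using assms by (simp add: decomp_def op_F_pros)
  show "hd I t = t" by (rule hd_unique[OF assms(1,2) d])
  show "dm I t = e1" using decomp_dm[OF d] assms(1) by simp
qed

text \<open>With the identity as unary part, the decomposition reads \<open>t = hd I t\<close>.
  Since \<open>dm I t = e1\<close> says that \<open>t\<close> is affine, hyperaffineness follows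
  from affineness alone; the closure properties below rely on this.\<close>

lemma hyperaffine_if_affine:
  assumes I: "small I" and t: "t \<in> opn T I" and d: "dm I t = e1"
  shows "hyperaffine T I t"
proof -
  have "op (F I) I t (pro T I) = op (F I) I (hd I t) (\<lambda>i. ap (F I) e1 (pro T I i))"
    using op_hd[OF I t F_model[OF I], of "pro T I"] I d by (simp add: pro_opn)
  also have "\<dots> = op (F I) I (hd I t) (pro T I)"
    using I by (intro op_cong) (simp add: ap_e1 F_model pro_opn)
  finally have "t = hd I t" using I t by (simp add: op_F_pros hd_in)
  then show ?thesis using hyperaffine_hd[OF I t] by simp
qed

text \<open>Affine operations are closed under composition, and here an affine operation is
  hyperaffine.\<close>

lemma hyperaffine_op:
  assumes "small I" "small J" "k \<in> opn T I" "hyperaffine T I k"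
    and l: "\<And>i. i \<in> I \<Longrightarrow> l i \<in> opn T J" "\<And>i. i \<in> I \<Longrightarrow> hyperaffine T J (l i)"
  shows "hyperaffine T J (op (F J) I k l)"
proof (rule hyperaffine_if_affine)
  have "dm J (op (F J) I k l) = op (F (fin 1)) I k (\<lambda>i. e1)"
    using assms by (simp add: dm_op hd_haff)
  also have "\<dots> = e1" using assms by (intro haff_F_const) simp_all
  finally show "dm J (op (F J) I k l) = e1" .
qed (use assms in \<open>simp_all add: op_F_in\<close>)

text \<open>The composite \<open>s\<close> of \<open>k\<close> and \<open>l\<close> on \<open>I \<times> J\<close> is affine, hence hyperaffine; diagonalising \<open>s\<close>
  on a family that ignores two of the four indices gives commutation.\<close>

lemma haff_commute:
  assumes I: "small I" and J: "small J" and k: "k \<in> opn T I" "hyperaffine T I k"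
    and l: "l \<in> opn T J" "hyperaffine T J l" and X: "Md X"
    and x: "\<And>i j. \<lbrakk>i \<in> I; j \<in> J\<rbrakk> \<Longrightarrow> x i j \<in> car X"
  shows "op X I k (\<lambda>i. op X J l (x i)) = op X J l (\<lambda>j. op X I k (\<lambda>i. x i j))"
proof -
  let ?S = "prod_set I J"
  have S: "small ?S" using I J by (rule small_prod_set)
  define s where "s = op (F ?S) I k (\<lambda>i. op (F ?S) J l (\<lambda>j. pro T ?S (pr i j)))"
  have s: "s \<in> opn T ?S" using I J S k l by (simp add: s_def op_F_in pro_opn)
  have op_s: "op Y ?S s f = op Y I k (\<lambda>i. op Y J l (\<lambda>j. f (pr i j)))"
    if "Md Y" "\<And>z. z \<in> ?S \<Longrightarrow> f z \<in> car Y" for Y f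
    using that I J S k l by (simp add: s_def op_op op_F_in pro_opn op_pro)
  have "dm ?S s = e1"
    unfolding dm_def using I J k l by (simp add: op_s F_model haff_F_const)
  then have sh: "hyperaffine T ?S s" by (rule hyperaffine_if_affine[OF S s])
  have "op X I k (\<lambda>i. op X J l (x i)) = op X ?S s (\<lambda>z. x (fs z) (sn z))"
    using x X by (subst op_s) (auto elim: prod_setE)
  \<comment> \<open>The first index is read off the inner copy of \<open>s\<close>, the second off
    the outer one; on the diagonal \<open>w = z\<close> the original family returns.\<close>
  also have "\<dots> = op X ?S s (\<lambda>z. op X ?S s (\<lambda>w. x (fs w) (sn z)))"
    using x by (intro haff_diag[OF sh S s X, symmetric]) (auto elim!: prod_setE)
  also have "\<dots> = op X I k (\<lambda>i. op X J l (\<lambda>j. op X I k (\<lambda>i'. op X J l (\<lambda>j'. x i' j))))"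
  proof -
    have "op X ?S s (\<lambda>w. x (fs w) (sn z)) = op X I k (\<lambda>i'. op X J l (\<lambda>j'. x i' (sn z)))"
      if "z \<in> ?S" for z using x X that by (subst op_s) (auto elim!: prod_setE)
    then have "op X ?S s (\<lambda>z. op X ?S s (\<lambda>w. x (fs w) (sn z)))
      = op X ?S s (\<lambda>z. op X I k (\<lambda>i'. op X J l (\<lambda>j'. x i' (sn z))))" by (rule op_cong)
    also have "\<dots> = op X I k (\<lambda>i. op X J l (\<lambda>j. op X I k (\<lambda>i'. op X J l (\<lambda>j'. x i' j))))"
      using x X I J k l by (subst op_s) (auto elim!: prod_setE simp: op_in)
    finally show ?thesis .
  qed
  \<comment> \<open>The outermost \<open>k\<close> and the innermost \<open>l\<close> act on
    constant families and disappear by affineness.\<close>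
  also have "\<dots> = op X J l (\<lambda>j. op X I k (\<lambda>i. x i j))"
    using x X I J k l by (simp add: haff_const op_in)
  finally show ?thesis .
qed

text \<open>The inner \<open>k\<close> commutes with \<open>l j\<close>; then two copies of
  \<open>k\<close> are adjacent, and \<open>haff_diag\<close> merges \<open>j'\<close> with
  \<open>j\<close>. A \<open>k\<close> that reappears inside can thus be dropped, which is the
  identity behind the composition laws below.\<close>

lemma haff_absorb:
  assumes I: "small I" and J: "small J" and k: "k \<in> opn T J" "hyperaffine T J k"
    and l: "\<And>j. j \<in> J \<Longrightarrow> l j \<in> opn T I" "\<And>j. j \<in> J \<Longrightarrow> hyperaffine T I (l j)" and X: "Md X"
    and y: "\<And>i j. \<lbrakk>j \<in> J; i \<in> I\<rbrakk> \<Longrightarrow> y j i \<in> car X"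
  shows "op X J k (\<lambda>j. op X I (l j) (\<lambda>i. op X J k (\<lambda>j'. y j' i))) = op X J k (\<lambda>j. op X I (l j) (y j))"
proof -
  have "op X J k (\<lambda>j. op X I (l j) (\<lambda>i. op X J k (\<lambda>j'. y j' i)))
      = op X J k (\<lambda>j. op X J k (\<lambda>j'. op X I (l j) (y j')))"
    using assms by (intro op_cong haff_commute) simp_all
  also have "\<dots> = op X J k (\<lambda>j. op X I (l j) (y j))"
    using assms by (intro haff_diag) (simp_all add: op_in)
  finally show ?thesis .
qed

text \<open>For hyperaffine \<open>k\<close>, the composite \<open>k(u)\<close> has hyperaffine part
  \<open>k(hd u)\<close> and unary part \<open>k(dm u)\<close>: the latter puts a second
  \<open>k\<close> inside, and \<open>haff_absorb\<close> removes it.\<close>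

lemma hd_op_haff:
  assumes I: "small I" and J: "small J" and k: "k \<in> opn T J" "hyperaffine T J k"
    and u: "\<And>j. j \<in> J \<Longrightarrow> u j \<in> opn T I"
  shows "hd I (op (F I) J k u) = op (F I) J k (\<lambda>j. hd I (u j))"
proof (rule hd_unique)
  let ?m = "op (F (fin 1)) J k (\<lambda>j. dm I (u j))"
  let ?y = "\<lambda>j i. ap (F I) (dm I (u j)) (pro T I i)"
  have y: "?y j i \<in> opn T I" if "j \<in> J" "i \<in> I" for j i
    using that I u by (simp add: ap_F_in dm_in pro_opn)
  have "op (F I) I (op (F I) J k (\<lambda>j. hd I (u j))) (\<lambda>i. ap (F I) ?m (pro T I i))
      = op (F I) J k (\<lambda>j. op (F I) I (hd I (u j)) (\<lambda>i. op (F I) J k (\<lambda>j'. ?y j' i)))"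
    using I J k u by (simp add: op_op F_model hd_in ap_op dm_in pro_opn op_F_in ap_F_in)
  also have "\<dots> = op (F I) J k (\<lambda>j. op (F I) I (hd I (u j)) (?y j))"
    using I J k u y by (intro haff_absorb) (simp_all add: hd_in hyperaffine_hd F_model)
  also have "\<dots> = op (F I) J k (\<lambda>j. op (F I) I (u j) (pro T I))"
    using I u by (intro op_cong) (simp add: op_hd[of I "u _" "F I" "pro T I"] F_model pro_opn)
  also have "\<dots> = op (F I) J k u" using I u by (intro op_cong) (simp add: op_F_pros)
  finally show "decomp I (op (F I) J k u) (op (F I) J k (\<lambda>j. hd I (u j))) ?m"
    unfolding decomp_def using I J k u
    by (simp add: op_F_in hd_in hyperaffine_op hyperaffine_hd dm_in)
qed (use assms in \<open>simp_all add: op_F_in\<close>)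

text \<open>As \<open>hd I t\<close> is affine, \<open>m(hd I t)\<close> has unary part
  \<open>m\<close>, so \<open>m\<close> moves inside at the price of a new hyperaffine operation.
  Doing this in \<open>m(t)\<close>, with \<open>t\<close> decomposed, identifies the new operation
  as the hyperaffine part of \<open>m(t)\<close>.\<close>

lemma ap_op_hd:
  assumes I: "small I" and t: "t \<in> opn T I" and m: "m \<in> opn T (fin 1)"
    and X: "Md X" and x: "\<And>i. i \<in> I \<Longrightarrow> x i \<in> car X"
  shows "ap X m (op X I (hd I t) x) = op X I (hd I (ap (F I) m t)) (\<lambda>i. ap X m (x i))"
proof -
  let ?s = "ap (F I) m (hd I t)"
  have h: "hd I t \<in> opn T I" "hyperaffine T I (hd I t)" using I t by (simp_all add: hd_in hyperaffine_hd)
  have s: "?s \<in> opn T I" using I m h by (simp add: ap_F_in)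
  have dms: "dm I ?s = m" using I m h by (simp add: dm_ap hd_haff ap_F1_e1)
  have k: "ap Y m (op Y I (hd I t) y) = op Y I (hd I ?s) (\<lambda>i. ap Y m (y i))"
    if "Md Y" "\<And>i. i \<in> I \<Longrightarrow> y i \<in> car Y" for Y y
    using op_hd[OF I s that] op_ap[OF that(1) I h(1) m that(2)] dms by simp
  have "hd I (ap (F I) m t) = hd I ?s"
  proof (rule hd_unique)
    have "ap (F I) m t = ap (F I) m (op (F I) I (hd I t) (\<lambda>i. ap (F I) (dm I t) (pro T I i)))"
      using op_hd[OF I t F_model[OF I], of "pro T I"] I t by (simp add: op_F_pros pro_opn)
    also have "\<dots> = op (F I) I (hd I ?s) (\<lambda>i. ap (F I) m (ap (F I) (dm I t) (pro T I i)))"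
      using I t by (intro k) (simp_all add: F_model ap_F_in dm_in pro_opn)
    finally show "decomp I (ap (F I) m t) (hd I ?s) (ap (F (fin 1)) m (dm I t))"
      using I s m t by (simp add: decomp_def hd_in hyperaffine_hd ap_F_in dm_in ap_ap F_model pro_opn)
  qed (use I m t in \<open>simp_all add: ap_F_in\<close>)
  then show ?thesis using k[OF X x] by simp
qed

text \<open>In other words, \<open>(t, f) \<mapsto> hd(t)(f)\<close> is a homomorphism from
  \<open>F I \<times> X^I\<close> to \<open>X\<close>, the same law that is later asked of
  \<open>gives_hyperaffine_part\<close>. With \<open>s\<close> decomposed into \<open>k\<close> and
  \<open>m\<close>, the outer \<open>k\<close> passes through \<open>hd\<close>, the inner one is
  absorbed, and \<open>m\<close> moves out by \<open>ap_op_hd\<close>.\<close>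

lemma op_hd_op:
  assumes I: "small I" and J: "small J" and s: "s \<in> opn T J" and t: "\<And>j. j \<in> J \<Longrightarrow> t j \<in> opn T I"
    and X: "Md X" and x: "\<And>i j. \<lbrakk>j \<in> J; i \<in> I\<rbrakk> \<Longrightarrow> x j i \<in> car X"
  shows "op X I (hd I (op (F I) J s t)) (\<lambda>i. op X J s (\<lambda>j. x j i))
    = op X J s (\<lambda>j. op X I (hd I (t j)) (x j))"
proof -
  let ?k = "hd J s" and ?m = "dm J s"
  have k: "?k \<in> opn T J" "hyperaffine T J ?k" and m: "?m \<in> opn T (fin 1)"
    using J s by (simp_all add: hd_in hyperaffine_hd dm_in)
  have "op (F I) J s t = op (F I) J ?k (\<lambda>j. ap (F I) ?m (t j))"
    using I J s t by (intro op_hd) (simp_all add: F_model)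
  then have "hd I (op (F I) J s t) = op (F I) J ?k (\<lambda>j. hd I (ap (F I) ?m (t j)))"
    using hd_op_haff[OF I J k, of "\<lambda>j. ap (F I) ?m (t j)"] I m t by (simp add: ap_F_in)
  then have "op X I (hd I (op (F I) J s t)) (\<lambda>i. op X J s (\<lambda>j. x j i))
    = op X I (op (F I) J ?k (\<lambda>j. hd I (ap (F I) ?m (t j)))) (\<lambda>i. op X J ?k (\<lambda>j. ap X ?m (x j i)))"
    using J s X x by (auto intro!: op_cong op_hd)
  also have "\<dots> = op X J ?k (\<lambda>j. op X I (hd I (ap (F I) ?m (t j))) (\<lambda>i. op X J ?k (\<lambda>j'. ap X ?m (x j' i))))"
    using I J k m t X x by (intro op_op) (simp_all add: hd_in ap_F_in op_in ap_in)
  also have "\<dots> = op X J ?k (\<lambda>j. op X I (hd I (ap (F I) ?m (t j))) (\<lambda>i. ap X ?m (x j i)))"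
    using I J k m t X x by (intro haff_absorb) (simp_all add: hd_in ap_F_in hyperaffine_hd ap_in)
  also have "\<dots> = op X J ?k (\<lambda>j. ap X ?m (op X I (hd I (t j)) (x j)))"
    using I J k m t X x by (intro op_cong) (simp add: ap_op_hd)
  also have "\<dots> = op X J s (\<lambda>j. op X I (hd I (t j)) (x j))"
    using I J s t X x by (intro op_hd[symmetric]) (simp_all add: op_in hd_in)
  finally show ?thesis .
qed

lemma hd_ap_pro:
  assumes "small I" "i \<in> I" "b \<in> opn T (fin 1)"
  shows "hd I (ap (F I) b (pro T I i)) = pro T I i"
proof (rule hd_unique)
  show "decomp I (ap (F I) b (pro T I i)) (pro T I i) b"
    using assms by (simp add: decomp_def pro_opn hyperaffine_pro op_F_pro ap_F_in)
qed (use assms in \<open>simp_all add: ap_F_in pro_opn\<close>)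

end

section \<open>Cartesian closed varieties\<close>

text \<open>The small set \<open>C\<close> codes the homomorphisms from the product of
  \<open>X\<close> and \<open>Y\<close> to \<open>Z\<close>; \<open>v\<close> decodes and
  \<open>enc\<close> encodes. A decoded function agrees with the original one on the carriers only,
  and closure of the carriers under the operations makes it a \<open>bihom\<close>
  nevertheless.\<close>

lemma bihom_code:
  fixes X Y Z :: "'u::universe alg"
  assumes "small (car X)" "small (car Y)" "small (car Z)"
    and op_closed: "\<And>I t x. \<lbrakk>small I; t \<in> opn T I; \<And>i. i \<in> I \<Longrightarrow> x i \<in> car X\<rbrakk> \<Longrightarrow> op X I t x \<in> car X"
      "\<And>I t y. \<lbrakk>small I; t \<in> opn T I; \<And>i. i \<in> I \<Longrightarrow> y i \<in> car Y\<rbrakk> \<Longrightarrow> op Y I t y \<in> car Y"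
  obtains C :: "'u set" and v enc where "small C" "\<And>c. c \<in> C \<Longrightarrow> bihom T X Y Z (v c)"
    "\<And>\<psi>. bihom T X Y Z \<psi> \<Longrightarrow> enc \<psi> \<in> C"
    "\<And>\<psi> n y. \<lbrakk>bihom T X Y Z \<psi>; n \<in> car X; y \<in> car Y\<rbrakk> \<Longrightarrow> v (enc \<psi>) n y = \<psi> n y"
    "\<And>c d. \<lbrakk>c \<in> C; d \<in> C; \<And>n y. \<lbrakk>n \<in> car X; y \<in> car Y\<rbrakk> \<Longrightarrow> v c n y = v d n y\<rbrakk> \<Longrightarrow> c = d"
proof -
  let ?A = "prod_set (car X) (car Y)" and ?B = "car Z"
  obtain e :: "('u \<Rightarrow> 'u) \<Rightarrow> 'u" where e: "inj_on e (?A \<rightarrow>\<^sub>E ?B)" "small (e ` (?A \<rightarrow>\<^sub>E ?B))"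
    using small_funspace_code[OF small_prod_set[OF assms(1,2)] assms(3)] .
  define g where "g \<psi> = (\<lambda>z\<in>?A. \<psi> (fs z) (sn z))" for \<psi> :: "'u \<Rightarrow> 'u \<Rightarrow> 'u"
  define enc where "enc \<psi> = e (g \<psi>)" for \<psi>
  define C where "C = enc ` {\<psi>. bihom T X Y Z \<psi>}"
  define v where "v c n y = inv_into (?A \<rightarrow>\<^sub>E ?B) e c (pr n y)" for c n y
  have g: "g \<psi> \<in> ?A \<rightarrow>\<^sub>E ?B" if "bihom T X Y Z \<psi>" for \<psi>
    using that by (auto simp: g_def bihom_in elim!: prod_setE)
  have v: "v (enc \<psi>) n y = \<psi> n y" if "bihom T X Y Z \<psi>" "n \<in> car X" "y \<in> car Y" for \<psi> n y
    using that by (simp add: v_def enc_def inv_into_f_f[OF e(1) g]) (simp add: g_def)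
  show ?thesis
  proof (rule that[of C v enc])
    show "small C" using g by (intro small_subset[OF e(2)]) (auto simp: C_def enc_def)
    fix c assume "c \<in> C"
    then obtain \<psi> where \<psi>: "bihom T X Y Z \<psi>" "c = enc \<psi>" by (auto simp: C_def)
    show "bihom T X Y Z (v c)"
      unfolding bihom_def \<psi>(2)
      by (auto simp: v[OF \<psi>(1)] bihom_in[OF \<psi>(1)] bihom_op[OF \<psi>(1)] op_closed)
  next
    fix c d assume "c \<in> C" "d \<in> C" and eq: "\<And>n y. \<lbrakk>n \<in> car X; y \<in> car Y\<rbrakk> \<Longrightarrow> v c n y = v d n y"
    then obtain \<psi> \<chi> where h: "bihom T X Y Z \<psi>" "c = enc \<psi>" "bihom T X Y Z \<chi>" "d = enc \<chi>"
      by (auto simp: C_def)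
    have "g \<psi> = g \<chi>"
      unfolding g_def using eq v[OF h(1)] v[OF h(3)] h(2,4)
      by (auto intro!: restrict_ext elim!: prod_setE)
    then show "c = d" using h by (simp add: enc_def)
  qed (use v in \<open>auto simp: C_def\<close>)
qed

section \<open>Exponentials of models of a hyperaffine--unary theory\<close>

context hau
begin

text \<open>The elements \<open>c\<close> of \<open>Z\<^sup>Y\<close> are the homomorphisms from \<open>F 1 \<times> Y\<close> to \<open>Z\<close>, thought of as
  \<open>(n, y) \<mapsto> (n c)(y)\<close>. This forces the operations: if \<open>n t\<close> decomposes as \<open>h(\<lambda>i. m(x\<^sub>i))\<close>, then
  \<open>(n t(c))(y) = h(\<lambda>i. (m c\<^sub>i)(y))\<close> as \<open>h\<close> is affine, so that \<open>y = h(\<lambda>i. y)\<close>.\<close>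

theorem exponential_model_exists:
  assumes Y: "Md Y" and Z: "Md Z"
  shows "\<exists>E \<epsilon>. exponential_model T Y Z E \<epsilon>"
proof -
  let ?U = "F (fin 1)"
  have U: "Md ?U" by (simp add: F_model)
  obtain C :: "'u set" and v enc where C: "small C" and v: "\<And>c. c \<in> C \<Longrightarrow> bihom T ?U Y Z (v c)"
    and enc: "\<And>\<psi>. bihom T ?U Y Z \<psi> \<Longrightarrow> enc \<psi> \<in> C"
    and v_enc: "\<And>\<psi> n y. \<lbrakk>bihom T ?U Y Z \<psi>; n \<in> car ?U; y \<in> car Y\<rbrakk> \<Longrightarrow> v (enc \<psi>) n y = \<psi> n y"
    and C_eqI: "\<And>c d. \<lbrakk>c \<in> C; d \<in> C; \<And>n y. \<lbrakk>n \<in> car ?U; y \<in> car Y\<rbrakk> \<Longrightarrow> v c n y = v d n y\<rbrakk> \<Longrightarrow> c = d"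
  proof (rule bihom_code[of ?U Y Z T], goal_cases)
    case (6 C v enc)
    show ?case by (rule that[of C v enc]; fact 6)
  qed (use U Y Z in \<open>simp_all add: small_car op_in F_model small_opn op_F_in\<close>)
  have v_in: "v c n y \<in> car Z" if "c \<in> C" "n \<in> opn T (fin 1)" "y \<in> car Y" for c n y
    using bihom_in[OF v[OF that(1)]] that by simp
  define a where "a I t x n y =
      op Z I (hd I (ap (F I) n t)) (\<lambda>i. v (x i) (dm I (ap (F I) n t)) y)" for I t x n y
  have a_bihom: "bihom T ?U Y Z (a I t x)"
    if I: "small I" and t: "t \<in> opn T I" and x: "\<And>i. i \<in> I \<Longrightarrow> x i \<in> C" for I t x
    unfolding bihom_def
  proof (intro conjI ballI allI impI)
    fix n y assume n: "n \<in> car ?U" and y: "y \<in> car Y"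
    then show "a I t x n y \<in> car Z"
      unfolding a_def using I t x Z by (simp add: op_in hd_in ap_F_in v_in dm_in)
  next
    fix J s n y assume J: "small J" and s: "s \<in> opn T J"
      and n: "\<forall>j\<in>J. n j \<in> car ?U" and y: "\<forall>j\<in>J. y j \<in> car Y"
    let ?nt = "\<lambda>j. ap (F I) (n j) t"
    have nt: "?nt j \<in> opn T I" "dm I (?nt j) \<in> opn T (fin 1)" if "j \<in> J" for j
      using that n I t by (simp_all add: ap_F_in dm_in)
    have e: "ap (F I) (op ?U J s n) t = op (F I) J s ?nt"
      using n by (intro ap_op) (simp_all add: I J s t F_model)
    have d: "dm I (op (F I) J s ?nt) = op ?U J s (\<lambda>j. dm I (?nt j))"
      using nt by (intro dm_op I J s)
    have "a I t x (op ?U J s n) (op Y J s y)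
      = op Z I (hd I (op (F I) J s ?nt)) (\<lambda>i. v (x i) (op ?U J s (\<lambda>j. dm I (?nt j))) (op Y J s y))"
      by (simp add: a_def e d)
    also have "\<dots> = op Z I (hd I (op (F I) J s ?nt)) (\<lambda>i. op Z J s (\<lambda>j. v (x i) (dm I (?nt j)) (y j)))"
      using nt y J s x by (intro op_cong bihom_op[OF v]) simp_all
    \<comment> \<open>Moving \<open>s\<close> outside by \<open>op_hd_op\<close> is exactly what
      makes \<open>a I t x\<close> a homomorphism.\<close>
    also have "\<dots> = op Z J s (\<lambda>j. op Z I (hd I (?nt j)) (\<lambda>i. v (x i) (dm I (?nt j)) (y j)))"
      using nt y x by (intro op_hd_op I J s Z) (simp_all add: v_in)
    finally show "a I t x (op ?U J s n) (op Y J s y) = op Z J s (\<lambda>j. a I t x (n j) (y j))"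
      by (simp add: a_def)
  qed
  define E where "E = mk_alg T C (\<lambda>I t x. enc (a I t x))"
  have op_E: "op E I t x = enc (a I t (restrict x I))"
    if "small I" "t \<in> opn T I" "\<And>i. i \<in> I \<Longrightarrow> x i \<in> C" for I t x
    using that by (simp add: E_def op_mk_alg)
  have a_restrict: "a I t (restrict x I) n y = a I t x n y" for I t x n y
    by (simp add: a_def)
  have car_E [simp]: "car E = C" by (simp add: E_def)
  have v_op_E: "v (op E I t x) n y = a I t x n y"
    if "small I" "t \<in> opn T I" "\<And>i. i \<in> I \<Longrightarrow> x i \<in> C" "n \<in> opn T (fin 1)" "y \<in> car Y" for I t x n y
    using that a_bihom[of I t "restrict x I"] by (simp add: op_E v_enc a_restrict)
  have E: "Md E"
    unfolding E_def
  proof (rule theory_model_mk_alg[OF C])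
    fix I t x assume "small I" "t \<in> opn T I" "x \<in> I \<rightarrow>\<^sub>E C"
    then show "enc (a I t x) \<in> C" by (intro enc a_bihom) (auto simp: PiE_mem)
  next
    fix I :: "'u set" and i x assume I: "small I" and i: "i \<in> I" and x: "x \<in> I \<rightarrow>\<^sub>E C"
    then have xi: "\<And>i. i \<in> I \<Longrightarrow> x i \<in> C" by auto
    have p: "pro T I i \<in> opn T I" using I i by (rule pro_opn)
    note b = a_bihom[OF I p xi]
    show "enc (a I (pro T I i) x) = x i"
    proof (rule C_eqI[OF enc[OF b] xi[OF i]])
      fix n y assume n: "n \<in> car ?U" and y: "y \<in> car Y"
      have "dm I (ap (F I) n (pro T I i)) = n"
        using n I i by (simp add: dm_ap p dm_pro ap_F1_e1)
      then show "v (enc (a I (pro T I i) x)) n y = v (x i) n y"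
        using n y I i xi Z by (simp add: v_enc[OF b] a_def hd_ap_pro op_pro v_in)
    qed
  next
    fix I J :: "'u set" and t u x
    assume I: "small I" and J: "small J" and t: "t \<in> opn T I" and u: "u \<in> I \<rightarrow>\<^sub>E opn T J"
      and x: "x \<in> J \<rightarrow>\<^sub>E C"
    have ui: "\<And>i. i \<in> I \<Longrightarrow> u i \<in> opn T J" and xj: "\<And>j. j \<in> J \<Longrightarrow> x j \<in> C" using u x by auto
    have tu: "subst T I J t u = op (F J) I t u" using u I t ui by (simp add: op_F PiE_restrict)
    have tu_in: "op (F J) I t u \<in> opn T J" using I J t ui by (rule op_F_in)
    let ?x = "\<lambda>i\<in>I. enc (a J (u i) x)"
    have bu: "bihom T ?U Y Z (a J (u i) x)" if "i \<in> I" for i using J ui[OF that] xj by (rule a_bihom)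
    have xi: "?x i \<in> C" if "i \<in> I" for i using that bu enc by simp
    have b: "bihom T ?U Y Z (a J (op (F J) I t u) x)" "bihom T ?U Y Z (a I t ?x)"
      using J tu_in xj I t xi by (blast intro: a_bihom)+
    have "enc (a J (op (F J) I t u) x) = enc (a I t ?x)"
    proof (rule C_eqI[OF enc[OF b(1)] enc[OF b(2)]])
      fix n y assume "n \<in> car ?U" and y: "y \<in> car Y"
      then have n: "n \<in> opn T (fin 1)" by simp
      let ?t = "ap (F I) n t"
      let ?h = "hd I ?t" and ?m = "dm I ?t"
      have t': "?t \<in> opn T I" using I n t by (rule ap_F_in)
      have h: "?h \<in> opn T I" "hyperaffine T I ?h" and m: "?m \<in> opn T (fin 1)"
        using I t' by (simp_all add: hd_in hyperaffine_hd dm_in)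
      let ?w = "\<lambda>i. ap (F J) ?m (u i)"
      have w: "?w i \<in> opn T J" "dm J (?w i) \<in> opn T (fin 1)" if "i \<in> I" for i
        using that J m ui by (simp_all add: ap_F_in dm_in)
      \<comment> \<open>With \<open>n t\<close> decomposed into \<open>?h\<close> and
        \<open>?m\<close>, the operation \<open>n t(u)\<close> becomes \<open>?h\<close> applied to
        the \<open>?w i\<close>, so that the laws of the hyperaffine \<open>?h\<close>
        apply.\<close>
      have "ap (F J) n (op (F J) I t u) = op (F J) I ?t u"
        using I J n t ui by (simp add: op_ap F_model)
      also have "\<dots> = op (F J) I ?h ?w"
        using I J t' ui by (intro op_hd) (simp_all add: F_model)
      finally have nu: "ap (F J) n (op (F J) I t u) = op (F J) I ?h ?w" .
      have d: "dm J (op (F J) I ?h ?w) = op ?U I ?h (\<lambda>i. dm J (?w i))"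
        using w by (intro dm_op I J h)
      have "a J (op (F J) I t u) x n y
        = op Z J (hd J (op (F J) I ?h ?w)) (\<lambda>j. v (x j) (op ?U I ?h (\<lambda>i. dm J (?w i))) y)"
        by (simp add: a_def nu d)
      also have "\<dots> = op Z J (hd J (op (F J) I ?h ?w)) (\<lambda>j. op Z I ?h (\<lambda>i. v (x j) (dm J (?w i)) y))"
      proof (rule op_cong)
        fix j assume j: "j \<in> J"
        \<comment> \<open>The second argument is written as \<open>?h\<close> of the constant family
          \<open>y\<close>, since a homomorphism needs the same operation in both arguments.\<close>
        have "v (x j) (op ?U I ?h (\<lambda>i. dm J (?w i))) (op Y I ?h (\<lambda>i. y)) = op Z I ?h (\<lambda>i. v (x j) (dm J (?w i)) y)"
          using w y I h xj[OF j] by (intro bihom_op[OF v]) simp_all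
        then show "v (x j) (op ?U I ?h (\<lambda>i. dm J (?w i))) y = op Z I ?h (\<lambda>i. v (x j) (dm J (?w i)) y)"
          using I h Y y by (simp add: haff_const)
      qed
      also have "\<dots> = op Z I ?h (\<lambda>i. op Z J (hd J (?w i)) (\<lambda>j. v (x j) (dm J (?w i)) y))"
        using w y xj by (intro op_hd_op I J h Z) (simp_all add: v_in)
      also have "\<dots> = a I t ?x n y"
        using m y bu by (simp add: a_def[of I] v_enc) (simp add: a_def)
      finally show "v (enc (a J (op (F J) I t u) x)) n y = v (enc (a I t ?x)) n y"
        using n y v_enc[OF b(1)] v_enc[OF b(2)] by simp
    qed
    then show "enc (a J (subst T I J t u) x) = enc (a I t ?x)" by (simp add: tu)
  qed
  \<comment> \<open>Evaluation is \<open>(n c)(y)\<close> for the identity \<open>n\<close>.\<close>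
  let ?\<epsilon> = "\<lambda>c y. v c e1 y"
  have \<epsilon>: "bihom T E Y Z ?\<epsilon>"
    unfolding bihom_def
  proof (intro conjI ballI allI impI)
    fix I t c y assume I: "small I" and t: "t \<in> opn T I" and "\<forall>i\<in>I. c i \<in> car E" and y: "\<forall>i\<in>I. y i \<in> car Y"
    then have c: "\<And>i. i \<in> I \<Longrightarrow> c i \<in> C" by simp
    have m: "dm I t \<in> opn T (fin 1)" using I t by (rule dm_in)
    have "v (op E I t c) e1 (op Y I t y) = op Z I (hd I t) (\<lambda>i. v (c i) (dm I t) (op Y I t y))"
      using I t c y Y by (simp add: v_op_E op_in a_def ap_e1 F_model)
    \<comment> \<open>Writing \<open>t\<close> as \<open>t\<close> of the projections prepares for
      \<open>op_hd_op\<close> with the projections as inner operations; their hyperaffine parts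
      select a coordinate.\<close>
    also have "\<dots> = op Z I (hd I (op (F I) I t (pro T I))) (\<lambda>i. op Z I t (\<lambda>j. v (c i) e1 (y j)))"
    proof -
      have "v (c i) (op ?U I t (\<lambda>_. e1)) (op Y I t y) = op Z I t (\<lambda>j. v (c i) e1 (y j))" if "i \<in> I" for i
        using I t y c that by (intro bihom_op[OF v]) simp_all
      then show ?thesis using I t by (simp add: dm_def[of I t] op_F_pros)
    qed
    also have "\<dots> = op Z I t (\<lambda>j. op Z I (hd I (pro T I j)) (\<lambda>i. v (c i) e1 (y j)))"
      using I t y c Z by (intro op_hd_op) (simp_all add: pro_opn v_in)
    also have "\<dots> = op Z I t (\<lambda>j. v (c j) e1 (y j))"
      using I y c Z by (intro op_cong) (simp add: hd_haff pro_opn hyperaffine_pro op_pro v_in)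
    finally show "v (op E I t c) e1 (op Y I t y) = op Z I t (\<lambda>j. v (c j) e1 (y j))" .
  qed (simp add: v_in)
  have "\<exists>!g. thom T X E g \<and> (\<forall>x\<in>car X. \<forall>y\<in>car Y. f x y = ?\<epsilon> (g x) y)"
    if X: "Md X" and f: "bihom T X Y Z f" for X f
  proof -
    \<comment> \<open>\<open>k x\<close> is the value at \<open>x\<close> that a transpose
      \<open>g\<close> must have: \<open>(n (g x))(y) = (g (n x))(y) = f (n x) y\<close>.\<close>
    define k where "k x n y = f (ap X n x) y" for x n y
    have f_in: "f (ap X n x) y \<in> car Z" if "x \<in> car X" "n \<in> opn T (fin 1)" "y \<in> car Y" for x n y
      using bihom_in[OF f] that X by (simp add: ap_in)
    have k: "bihom T ?U Y Z (k x)" if x: "x \<in> car X" for x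
      unfolding bihom_def
    proof (intro conjI ballI allI impI)
      fix I t n y assume "small I" "t \<in> opn T I" "\<forall>i\<in>I. n i \<in> car ?U" "\<forall>i\<in>I. y i \<in> car Y"
      then show "k x (op ?U I t n) (op Y I t y) = op Z I t (\<lambda>i. k x (n i) (y i))"
        using x X unfolding k_def by (simp add: ap_op bihom_op[OF f] ap_in)
    qed (use x f_in in \<open>simp add: k_def\<close>)
    show ?thesis
    proof (intro ex1I[of _ "\<lambda>x\<in>car X. enc (k x)"] conjI ballI)
      show "thom T X E (\<lambda>x\<in>car X. enc (k x))"
      proof (rule thomI)
        fix I t x assume I: "small I" and t: "t \<in> opn T I" and x: "\<And>i. i \<in> I \<Longrightarrow> x i \<in> car X"
        have tx: "op X I t x \<in> car X" using X I t x by (rule op_in)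
        have ek: "\<And>i. i \<in> I \<Longrightarrow> enc (k (x i)) \<in> C" using x k enc by blast
        have "enc (k (op X I t x)) = op E I t (\<lambda>i. enc (k (x i)))"
        proof (rule C_eqI)
          show "enc (k (op X I t x)) \<in> C" using k[OF tx] by (rule enc)
          show "op E I t (\<lambda>i. enc (k (x i))) \<in> C" using op_in[OF E I t, of "\<lambda>i. enc (k (x i))"] ek by simp
          fix n y assume "n \<in> car ?U" and y: "y \<in> car Y"
          then have n: "n \<in> opn T (fin 1)" by simp
          let ?h = "hd I (ap (F I) n t)" and ?m = "dm I (ap (F I) n t)"
          have nt: "ap (F I) n t \<in> opn T I" using I n t by (rule ap_F_in)
          have h: "?h \<in> opn T I" "hyperaffine T I ?h" and m: "?m \<in> opn T (fin 1)"
            using I nt by (simp_all add: hd_in hyperaffine_hd dm_in)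
          have "k (op X I t x) n y = f (op X I (ap (F I) n t) x) y"
            using X I t n x by (simp add: k_def op_ap)
          \<comment> \<open>Again \<open>y\<close> is \<open>?h\<close> of a constant family, so
            that \<open>f\<close> meets the same operation in both arguments.\<close>
          also have "\<dots> = f (op X I ?h (\<lambda>i. ap X ?m (x i))) (op Y I ?h (\<lambda>_. y))"
            using X Y I nt x y h by (simp add: op_hd[of I "ap (F I) n t" X x] haff_const)
          also have "\<dots> = op Z I ?h (\<lambda>i. f (ap X ?m (x i)) y)"
            using X I h m x y by (intro bihom_op[OF f]) (simp_all add: ap_in)
          also have "\<dots> = a I t (\<lambda>i. enc (k (x i))) n y"
            using k x m y by (simp add: a_def v_enc) (simp add: k_def)
          finally show "v (enc (k (op X I t x))) n y = v (op E I t (\<lambda>i. enc (k (x i)))) n y"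
            using I t n y ek k[OF tx] by (simp add: v_enc v_op_E)
        qed
        then show "(\<lambda>x\<in>car X. enc (k x)) (op X I t x) = op E I t (\<lambda>i. (\<lambda>x\<in>car X. enc (k x)) (x i))"
          using tx x by simp
      qed (use k enc in auto)
      fix x y assume "x \<in> car X" "y \<in> car Y"
      then show "f x y = v ((\<lambda>x\<in>car X. enc (k x)) x) e1 y"
        using k X by (simp add: v_enc) (simp add: k_def ap_e1)
    next
      fix g assume "thom T X E g \<and> (\<forall>x\<in>car X. \<forall>y\<in>car Y. f x y = v (g x) e1 y)"
      then have g: "thom T X E g" and fg: "\<And>x y. \<lbrakk>x \<in> car X; y \<in> car Y\<rbrakk> \<Longrightarrow> f x y = v (g x) e1 y" by auto
      have gC: "g x \<in> C" if "x \<in> car X" for x using thom_in[OF g that] by simp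
      have "g x = enc (k x)" if x: "x \<in> car X" for x
      proof (rule C_eqI[OF gC[OF x] enc[OF k[OF x]]])
        fix n y assume "n \<in> car ?U" and y: "y \<in> car Y"
        then have n: "n \<in> opn T (fin 1)" by simp
        have n1: "ap ?U n (pro T (fin 1) (num 1)) = n" using n ap_F1_e1 by (simp add: e1_def)
        have "hd (fin 1) n = pro T (fin 1) (num 1)" using hd_ap_pro[OF _ _ n, of "fin 1" "num 1"] by (simp add: n1)
        moreover have "ap ?U e1 n = n" using n U by (simp add: ap_e1)
        \<comment> \<open>The value of \<open>g x\<close> at \<open>n\<close> is recovered by
          evaluating \<open>n (g x) = g (n x)\<close> at the identity; hence \<open>f\<close>
          determines \<open>g\<close>.\<close>
        ultimately have "v (op E (fin 1) n (\<lambda>_. g x)) e1 y = v (g x) n y"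
          using n y gC[OF x] Z by (simp add: v_op_E a_def dm_fin1 op_pro v_in)
        moreover have "op E (fin 1) n (\<lambda>_. g x) = g (ap X n x)"
          unfolding ap_def using n x by (intro thom_op[OF g, symmetric]) simp_all
        ultimately show "v (g x) n y = v (enc (k x)) n y"
          using fg[of "ap X n x" y] n x y X k[OF x] by (simp add: v_enc ap_in) (simp add: k_def)
      qed
      then show "g = (\<lambda>x\<in>car X. enc (k x))"
        using thom_ext[OF g] by (auto simp: extensional_def fun_eq_iff)
    qed
  qed
  then show ?thesis using E \<epsilon> unfolding exponential_model_def by blast
qed

corollary cartesian_closed: "cartesian_closed (cat_of (theory_Mod T))"
  using exponential_model_cartesian_closed exponential_model_exists by blast

end

section \<open>Powers of a model\<close>

context alg_th
begin

text \<open>A power of \<open>Z\<close> indexed by \<open>I\<close>, recorded by its projections and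
  tupling. Its elements will be codes of functions, and these laws are all that is used of the
  coding.\<close>

definition power_model ::
  "'u set \<Rightarrow> 'u alg \<Rightarrow> 'u alg \<Rightarrow> ('u \<Rightarrow> 'u \<Rightarrow> 'u) \<Rightarrow> (('u \<Rightarrow> 'u) \<Rightarrow> 'u) \<Rightarrow> bool" where
  "power_model I Z P prj tup \<longleftrightarrow> Md P \<and> (\<forall>i\<in>I. thom T P Z (prj i)) \<and>
     (\<forall>f. (\<forall>i\<in>I. f i \<in> car Z) \<longrightarrow> tup f \<in> car P \<and> (\<forall>i\<in>I. prj i (tup f) = f i)) \<and>
     (\<forall>p\<in>car P. \<forall>q\<in>car P. (\<forall>i\<in>I. prj i p = prj i q) \<longrightarrow> p = q)"

lemma power_model_exists:
  assumes I: "small I" and Z: "Md Z"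
  shows "\<exists>P prj tup. power_model I Z P prj tup"
proof -
  obtain e :: "('u \<Rightarrow> 'u) \<Rightarrow> 'u" where e: "inj_on e (I \<rightarrow>\<^sub>E car Z)" "small (e ` (I \<rightarrow>\<^sub>E car Z))"
    using small_funspace_code[OF I small_car[OF Z]] .
  define C where "C = e ` (I \<rightarrow>\<^sub>E car Z)"
  define d where "d = inv_into (I \<rightarrow>\<^sub>E car Z) e"
  define tup where "tup f = e (restrict f I)" for f
  have dC: "d c \<in> I \<rightarrow>\<^sub>E car Z" "e (d c) = c" if "c \<in> C" for c
    using that unfolding C_def d_def by (rule inv_into_into, rule f_inv_into_f)
  have di: "d c i \<in> car Z" if "c \<in> C" "i \<in> I" for c i using dC(1)[OF that(1)] that(2) by auto
  have tup: "tup f \<in> C" and d_tup: "\<And>i. i \<in> I \<Longrightarrow> d (tup f) i = f i"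
    if "\<And>i. i \<in> I \<Longrightarrow> f i \<in> car Z" for f
    using that unfolding tup_def C_def d_def by (auto simp: inv_into_f_f[OF e(1)])
  have eqI: "c = c'" if "c \<in> C" "c' \<in> C" "\<And>i. i \<in> I \<Longrightarrow> d c i = d c' i" for c c'
    using dC[OF that(1)] dC[OF that(2)] PiE_ext[of "d c" I "\<lambda>_. car Z" "d c'"] that(3) by metis
  define P where "P = mk_alg T C (\<lambda>J s x. tup (\<lambda>i. op Z J s (\<lambda>j. d (x j) i)))"
  have car_P: "car P = C" by (simp add: P_def)
  have op_P: "op P J s x = tup (\<lambda>i. op Z J s (\<lambda>j. d (x j) i))"
    if "small J" "s \<in> opn T J" "\<And>j. j \<in> J \<Longrightarrow> x j \<in> C" for J s x
    unfolding P_def using that by (simp add: op_mk_alg)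
  have "Md P" unfolding P_def
  proof (rule theory_model_mk_alg)
    show "small C" using e(2) by (simp add: C_def)
    fix J s x assume "small J" "s \<in> opn T J" "x \<in> J \<rightarrow>\<^sub>E C"
    then show "tup (\<lambda>i. op Z J s (\<lambda>j. d (x j) i)) \<in> C"
      using Z di by (intro tup op_in) (auto simp: PiE_mem)
  next
    fix J :: "'u set" and j x assume J: "small J" "j \<in> J" and "x \<in> J \<rightarrow>\<^sub>E C"
    then have x: "\<And>j. j \<in> J \<Longrightarrow> x j \<in> C" by auto
    show "tup (\<lambda>i. op Z J (pro T J j) (\<lambda>j. d (x j) i)) = x j"
      by (rule eqI) (use J x Z in \<open>simp_all add: tup d_tup op_pro di\<close>)
  next
    fix J K s u x assume h: "small J" "small K" "s \<in> opn T J" "u \<in> J \<rightarrow>\<^sub>E opn T K" and "x \<in> K \<rightarrow>\<^sub>E C"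
    then have x: "\<And>j. j \<in> K \<Longrightarrow> x j \<in> C" and u: "\<And>j. j \<in> J \<Longrightarrow> u j \<in> opn T K" by auto
    have s: "op Z K (subst T J K s u) (\<lambda>k. d (x k) i) = op Z J s (\<lambda>j. op Z K (u j) (\<lambda>k. d (x k) i))"
      if "i \<in> I" for i
      using op_subst[OF Z h(1-3), of u "\<lambda>k. d (x k) i"] u di[OF x that] h(4) by (simp add: PiE_restrict)
    show "tup (\<lambda>i. op Z K (subst T J K s u) (\<lambda>k. d (x k) i)) =
      tup (\<lambda>i. op Z J s (\<lambda>j. d ((\<lambda>j\<in>J. tup (\<lambda>i. op Z K (u j) (\<lambda>k. d (x k) i))) j) i))"
      by (rule eqI) (use s h x u Z in \<open>simp_all add: tup d_tup op_in di subst_opn\<close>)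
  qed
  moreover have "thom T P Z (\<lambda>c\<in>C. d c i)" if "i \<in> I" for i
  proof (rule thomI)
    fix J s x assume "small J" "s \<in> opn T J" "\<And>j. j \<in> J \<Longrightarrow> x j \<in> car P"
    then show "(\<lambda>c\<in>C. d c i) (op P J s x) = op Z J s (\<lambda>j. (\<lambda>c\<in>C. d c i) (x j))"
      using that Z by (simp add: car_P op_P tup d_tup di op_in)
  qed (use that in \<open>auto simp: car_P di\<close>)
  ultimately have "power_model I Z P (\<lambda>i. \<lambda>c\<in>C. d c i) tup"
    unfolding power_model_def using tup d_tup eqI by (simp add: car_P)
  then show ?thesis by blast
qed

lemma
  assumes "power_model I Z P prj tup"
  shows power_Md: "Md P"
    and power_prj: "i \<in> I \<Longrightarrow> thom T P Z (prj i)"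
    and power_tup: "(\<And>i. i \<in> I \<Longrightarrow> f i \<in> car Z) \<Longrightarrow> tup f \<in> car P"
    and power_prj_tup: "\<lbrakk>\<And>i. i \<in> I \<Longrightarrow> f i \<in> car Z; i \<in> I\<rbrakk> \<Longrightarrow> prj i (tup f) = f i"
    and power_eqI: "\<lbrakk>p \<in> car P; q \<in> car P; \<And>i. i \<in> I \<Longrightarrow> prj i p = prj i q\<rbrakk> \<Longrightarrow> p = q"
  using assms unfolding power_model_def by simp_all

lemma power_tup_op:
  assumes P: "power_model I Z P prj tup" and Z: "Md Z" and s: "small J" "s \<in> opn T J"
    and x: "\<And>i j. \<lbrakk>i \<in> I; j \<in> J\<rbrakk> \<Longrightarrow> x j i \<in> car Z"
  shows "tup (\<lambda>i. op Z J s (\<lambda>j. x j i)) = op P J s (\<lambda>j. tup (x j))"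
  by (rule power_eqI[OF P])
    (use s x Z in \<open>simp_all add: op_in power_Md[OF P] power_tup[OF P] power_prj_tup[OF P]
      thom_op[OF power_prj[OF P]]\<close>)

lemma exponential_eqI:
  assumes E: "exponential_model T Y Z E \<epsilon>" and X: "Md X"
    and g: "thom T X E g" "thom T X E h"
    and eq: "\<And>x y. \<lbrakk>x \<in> car X; y \<in> car Y\<rbrakk> \<Longrightarrow> \<epsilon> (g x) y = \<epsilon> (h x) y"
  shows "g = h"
proof -
  have \<epsilon>: "bihom T E Y Z \<epsilon>" using E by (simp add: exponential_model_def)
  have "bihom T X Y Z (\<lambda>x y. \<epsilon> (g x) y)"
    unfolding bihom_def using thom_in[OF g(1)]
    by (simp add: bihom_in[OF \<epsilon>] bihom_op[OF \<epsilon>] thom_op[OF g(1)])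
  then have "\<exists>!k. thom T X E k \<and> (\<forall>x\<in>car X. \<forall>y\<in>car Y. \<epsilon> (g x) y = \<epsilon> (k x) y)"
    using E X by (simp add: exponential_model_def)
  then show ?thesis using g eq by blast
qed

lemma hom_ap: "\<lbrakk>Md X; x \<in> car X\<rbrakk> \<Longrightarrow> thom T (F (fin 1)) X (\<lambda>b\<in>opn T (fin 1). ap X b x)"
  unfolding ap_def by (rule op_hom) simp_all

end

section \<open>Cartesian closed varieties have hyperaffine--unary theories\<close>

locale cc_th = alg_th T for T :: "'u::universe alg_theory" +
  assumes exponentials: "\<And>Y Z. \<lbrakk>theory_model T Y; theory_model T Z\<rbrakk> \<Longrightarrow> \<exists>E \<epsilon>. exponential_model T Y Z E \<epsilon>"
begin

text \<open>\<open>F I\<close> is the coproduct of \<open>I\<close> copies of \<open>F 1\<close>, and \<open>(-) \<times> X\<close> preserves coproducts.\<close>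

lemma bihom_free_eqI:
  assumes I: "small I" and X: "Md X" and Z: "Md Z" and g: "bihom T (F I) X Z g" "bihom T (F I) X Z h"
    and eq: "\<And>b i x. \<lbrakk>b \<in> opn T (fin 1); i \<in> I; x \<in> car X\<rbrakk>
      \<Longrightarrow> g (ap (F I) b (pro T I i)) x = h (ap (F I) b (pro T I i)) x"
    and t: "t \<in> opn T I" and x: "x \<in> car X"
  shows "g t x = h t x"
proof -
  obtain E \<epsilon> where E: "exponential_model T X Z E \<epsilon>" using exponentials[OF X Z] by blast
  note FI = F_model[OF I]
  obtain k where k: "thom T (F I) E k" "\<And>t x. \<lbrakk>t \<in> car (F I); x \<in> car X\<rbrakk> \<Longrightarrow> g t x = \<epsilon> (k t) x"
    using E FI g(1) unfolding exponential_model_def by metis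
  obtain l where l: "thom T (F I) E l" "\<And>t x. \<lbrakk>t \<in> car (F I); x \<in> car X\<rbrakk> \<Longrightarrow> h t x = \<epsilon> (l t) x"
    using E FI g(2) unfolding exponential_model_def by metis
  have "k (pro T I i) = l (pro T I i)" if i: "i \<in> I" for i
  proof -
    have p: "pro T I i \<in> opn T I" using I i by (rule pro_opn)
    let ?c = "\<lambda>b\<in>opn T (fin 1). ap (F I) b (pro T I i)"
    have c: "thom T (F (fin 1)) (F I) ?c" using hom_ap[OF FI] p by simp
    have U: "Md (F (fin 1))" by (simp add: F_model)
    \<comment> \<open>The transposes are compared on the copy of \<open>F 1\<close> belonging to the
      index \<open>i\<close>, where the hypothesis applies; at \<open>e1\<close> this gives their
      values on the generator.\<close>
    have "(\<lambda>b\<in>car (F (fin 1)). k (?c b)) = (\<lambda>b\<in>car (F (fin 1)). l (?c b))"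
    proof (rule exponential_eqI[OF E U thom_comp[OF U c k(1)] thom_comp[OF U c l(1)]])
      fix b y assume h: "b \<in> car (F (fin 1))" "y \<in> car X"
      then have "ap (F I) b (pro T I i) \<in> car (F I)" using I p by (simp add: ap_F_in)
      then show "\<epsilon> ((\<lambda>b\<in>car (F (fin 1)). k (?c b)) b) y = \<epsilon> ((\<lambda>b\<in>car (F (fin 1)). l (?c b)) b) y"
        using h eq[of b i y] i k(2) l(2) by simp
    qed
    from fun_cong[OF this, of e1] show ?thesis using p FI by (simp add: ap_e1)
  qed
  then have "k t = l t" using hom_F[OF k(1) I t] hom_F[OF l(1) I t] by (simp cong: op_cong)
  then show ?thesis using k(2) l(2) t x by simp
qed

text \<open>Regarded as a map on \<open>F 1 \<times> X\<close> that ignores its first argument,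
  \<open>p i\<close> has a transpose from \<open>F 1\<close> to the exponential, that is, a point
  \<open>c i\<close> of it. Since \<open>F I\<close> is free, \<open>t \<mapsto> t(c)\<close> is a
  homomorphism into the exponential, and it transposes back to \<open>g\<close>.\<close>

lemma bihom_free_exists:
  assumes I: "small I" and X: "Md X" and Z: "Md Z" and p: "\<And>i. i \<in> I \<Longrightarrow> thom T X Z (p i)"
  shows "\<exists>g. bihom T (F I) X Z g \<and>
    (\<forall>b\<in>opn T (fin 1). \<forall>i\<in>I. \<forall>x\<in>car X. g (ap (F I) b (pro T I i)) x = p i x)"
proof -
  obtain E \<epsilon> where E: "exponential_model T X Z E \<epsilon>" using exponentials[OF X Z] by blast
  then have EM: "Md E" and \<epsilon>: "bihom T E X Z \<epsilon>" by (auto simp: exponential_model_def)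
  have U: "Md (F (fin 1))" by (simp add: F_model)
  have "\<exists>c\<in>car E. \<forall>b\<in>opn T (fin 1). \<forall>x\<in>car X. p i x = \<epsilon> (ap E b c) x" if i: "i \<in> I" for i
  proof -
    have "bihom T (F (fin 1)) X Z (\<lambda>b x. p i x)"
      unfolding bihom_def using thom_in[OF p[OF i]] by (simp add: thom_op[OF p[OF i]])
    then obtain k where k: "thom T (F (fin 1)) E k" "\<And>b x. \<lbrakk>b \<in> opn T (fin 1); x \<in> car X\<rbrakk> \<Longrightarrow> p i x = \<epsilon> (k b) x"
      using E U unfolding exponential_model_def by (metis car_F)
    have "k b = ap E b (k e1)" if "b \<in> opn T (fin 1)" for b
      using thom_op[OF k(1), of "fin 1" b "\<lambda>_. e1"] that ap_F1_e1[OF that] by (simp add: ap_def)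
    moreover have "k e1 \<in> car E" using thom_in[OF k(1)] by simp
    ultimately show ?thesis using k(2) by metis
  qed
  then obtain c where c: "\<And>i. i \<in> I \<Longrightarrow> c i \<in> car E"
    and pc: "\<And>i b x. \<lbrakk>i \<in> I; b \<in> opn T (fin 1); x \<in> car X\<rbrakk> \<Longrightarrow> p i x = \<epsilon> (ap E b (c i)) x"
    by metis
  let ?g = "\<lambda>t x. \<epsilon> (op E I t c) x"
  have "bihom T (F I) X Z ?g"
    unfolding bihom_def using c EM I
    by (auto simp: bihom_in[OF \<epsilon>] op_in op_op bihom_op[OF \<epsilon>])
  moreover have "?g (ap (F I) b (pro T I i)) x = p i x" if "b \<in> opn T (fin 1)" "i \<in> I" "x \<in> car X" for b i x
    using that I c EM pc by (simp add: op_ap pro_opn op_pro)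
  ultimately show ?thesis by blast
qed

text \<open>As \<open>(-) \<times> Z\<^sup>I\<close> preserves coproducts, the projections \<open>Z\<^sup>I \<rightarrow> Z\<close> combine to a homomorphism
  \<open>F I \<times> Z\<^sup>I \<rightarrow> Z\<close>. It is natural in \<open>Z\<close>, hence of the form \<open>(t, f) \<mapsto> h(t)(f)\<close>, and \<open>h(t)\<close> will be the
  hyperaffine part of \<open>t\<close>.\<close>

definition gives_hyperaffine_part :: "'u set \<Rightarrow> ('u \<Rightarrow> 'u) \<Rightarrow> bool" where
  "gives_hyperaffine_part I h \<longleftrightarrow> (\<forall>t\<in>opn T I. h t \<in> opn T I) \<and>
    (\<forall>Z b i f. Md Z \<longrightarrow> b \<in> opn T (fin 1) \<longrightarrow> i \<in> I \<longrightarrow> (\<forall>i\<in>I. f i \<in> car Z) \<longrightarrow>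
       op Z I (h (ap (F I) b (pro T I i))) f = f i) \<and>
    (\<forall>Z J s t x. Md Z \<longrightarrow> small J \<longrightarrow> s \<in> opn T J \<longrightarrow> (\<forall>j\<in>J. t j \<in> opn T I) \<longrightarrow>
       (\<forall>j\<in>J. \<forall>i\<in>I. x j i \<in> car Z) \<longrightarrow>
       op Z I (h (op (F I) J s t)) (\<lambda>i. op Z J s (\<lambda>j. x j i)) = op Z J s (\<lambda>j. op Z I (h (t j)) (x j)))"

lemma
  assumes "gives_hyperaffine_part I h"
  shows hpart_in: "t \<in> opn T I \<Longrightarrow> h t \<in> opn T I"
    and hpart_gen: "\<lbrakk>Md Z; b \<in> opn T (fin 1); i \<in> I; \<And>i. i \<in> I \<Longrightarrow> f i \<in> car Z\<rbrakk> \<Longrightarrow>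
       op Z I (h (ap (F I) b (pro T I i))) f = f i"
    and hpart_op: "\<lbrakk>Md Z; small J; s \<in> opn T J; \<And>j. j \<in> J \<Longrightarrow> u j \<in> opn T I;
       \<And>i j. \<lbrakk>j \<in> J; i \<in> I\<rbrakk> \<Longrightarrow> x j i \<in> car Z\<rbrakk> \<Longrightarrow>
       op Z I (h (op (F I) J s u)) (\<lambda>i. op Z J s (\<lambda>j. x j i)) = op Z J s (\<lambda>j. op Z I (h (u j)) (x j))"
  using assms unfolding gives_hyperaffine_part_def by blast+

text \<open>As in the Yoneda lemma, \<open>h t\<close> is the value of the combined projection
  \<open>G\<close> for \<open>Z = F I\<close> at the generic tuple \<open>pro T I\<close>.
  Naturality along the homomorphism from \<open>F I\<close> to \<open>Z\<close> given by
  \<open>f\<close> then says that the operation \<open>h t\<close> acts on every \<open>Z\<close> as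
  the combined projection does.\<close>

lemma hyperaffine_part_exists:
  assumes I: "small I"
  shows "\<exists>h. gives_hyperaffine_part I h"
proof -
  note FI = F_model[OF I]
  obtain P prj tup where P: "power_model I (F I) P prj tup" using power_model_exists[OF I FI] by blast
  note PM = power_Md[OF P]
  obtain G where G: "bihom T (F I) P (F I) G"
    and Gp: "\<And>b i x. \<lbrakk>b \<in> opn T (fin 1); i \<in> I; x \<in> car P\<rbrakk> \<Longrightarrow> G (ap (F I) b (pro T I i)) x = prj i x"
    using bihom_free_exists[OF I PM FI, of prj] power_prj[OF P] by blast
  have tp: "tup (pro T I) \<in> car P" using I by (intro power_tup[OF P]) (simp add: pro_opn)
  define h where "h t = G t (tup (pro T I))" for t
  have h: "h t \<in> opn T I" if "t \<in> opn T I" for t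
    using bihom_in[OF G _ tp] that by (simp add: h_def)
  have h2: "\<exists>P' prj' tup' G'. power_model I Z P' prj' tup' \<and> bihom T (F I) P' Z G' \<and>
      (\<forall>b\<in>opn T (fin 1). \<forall>i\<in>I. \<forall>x\<in>car P'. G' (ap (F I) b (pro T I i)) x = prj' i x) \<and>
      (\<forall>t\<in>opn T I. \<forall>f. (\<forall>i\<in>I. f i \<in> car Z) \<longrightarrow> op Z I (h t) f = G' t (tup' f))"
    if Z: "Md Z" for Z
  proof -
    obtain P' prj' tup' where P': "power_model I Z P' prj' tup'" using power_model_exists[OF I Z] by blast
    note PM' = power_Md[OF P']
    obtain G' where G': "bihom T (F I) P' Z G'"
      and Gp': "\<And>b i x. \<lbrakk>b \<in> opn T (fin 1); i \<in> I; x \<in> car P'\<rbrakk> \<Longrightarrow> G' (ap (F I) b (pro T I i)) x = prj' i x"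
      using bihom_free_exists[OF I PM' Z, of prj'] power_prj[OF P'] by blast
    have "op Z I (h t) f = G' t (tup' f)" if t: "t \<in> opn T I" and "\<forall>i\<in>I. f i \<in> car Z" for t f
    proof -
      have f: "\<And>i. i \<in> I \<Longrightarrow> f i \<in> car Z" using that by blast
      have prj_in: "prj i x \<in> opn T I" if "i \<in> I" "x \<in> car P" for i x
        using thom_in[OF power_prj[OF P that(1)] that(2)] by simp
      have fp: "op Z I (prj i x) f \<in> car Z" if "i \<in> I" "x \<in> car P" for i x
        using that f Z I by (simp add: op_in prj_in)
      \<comment> \<open>Naturality for the homomorphism that \<open>f\<close> induces: both sides
        are homomorphisms on \<open>F I \<times> P\<close> and agree on the summands, where they are
        projections.\<close>
      have "op Z I (G t (tup (pro T I))) f = G' t (tup' (\<lambda>i. op Z I (prj i (tup (pro T I))) f))"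
      proof (rule bihom_free_eqI[OF I PM Z _ _ _ t tp])
        show "bihom T (F I) P Z (\<lambda>t x. op Z I (G t x) f)"
          unfolding bihom_def using f I Z bihom_in[OF G]
          by (auto simp: op_in bihom_op[OF G] op_op)
        show "bihom T (F I) P Z (\<lambda>t x. G' t (tup' (\<lambda>i. op Z I (prj i x) f)))"
          unfolding bihom_def
        proof (intro conjI ballI allI impI)
          fix J s u x assume J: "small J" and s: "s \<in> opn T J" and u: "\<forall>j\<in>J. u j \<in> car (F I)"
            and x: "\<forall>j\<in>J. x j \<in> car P"
          have "tup' (\<lambda>i. op Z I (prj i (op P J s x)) f) = tup' (\<lambda>i. op Z J s (\<lambda>j. op Z I (prj i (x j)) f))"
          proof (rule power_eqI[OF P'])
            have "op Z I (prj i (op P J s x)) f = op Z J s (\<lambda>j. op Z I (prj i (x j)) f)" if "i \<in> I" for i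
              using that J s x I f Z by (simp add: thom_op[OF power_prj[OF P]] op_op prj_in)
            then show "prj' i (tup' (\<lambda>i. op Z I (prj i (op P J s x)) f)) =
              prj' i (tup' (\<lambda>i. op Z J s (\<lambda>j. op Z I (prj i (x j)) f)))" if "i \<in> I" for i
              using that J s x Z by (simp add: power_prj_tup[OF P'] op_in fp)
          qed (use J s x Z PM in \<open>simp_all add: power_tup[OF P'] op_in fp\<close>)
          also have "\<dots> = op P' J s (\<lambda>j. tup' (\<lambda>i. op Z I (prj i (x j)) f))"
            using J s x Z by (intro power_tup_op[OF P']) (simp_all add: fp)
          finally show "G' (op (F I) J s u) (tup' (\<lambda>i. op Z I (prj i (op P J s x)) f))
              = op Z J s (\<lambda>j. G' (u j) (tup' (\<lambda>i. op Z I (prj i (x j)) f)))"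
            using J s u x by (simp add: bihom_op[OF G'] power_tup[OF P'] fp)
        qed (use fp in \<open>simp add: bihom_in[OF G'] power_tup[OF P']\<close>)
        fix b i x assume "b \<in> opn T (fin 1)" "i \<in> I" "x \<in> car P"
        then show "op Z I (G (ap (F I) b (pro T I i)) x) f =
          G' (ap (F I) b (pro T I i)) (tup' (\<lambda>i. op Z I (prj i x) f))"
          by (simp add: Gp Gp' power_tup[OF P'] power_prj_tup[OF P'] fp)
      qed
      also have "tup' (\<lambda>i. op Z I (prj i (tup (pro T I))) f) = tup' f"
        by (rule power_eqI[OF P']) (use f I Z in \<open>simp_all add: power_tup[OF P'] power_prj_tup[OF P']
            power_prj_tup[OF P] pro_opn op_pro tp fp\<close>)
      finally show ?thesis by (simp add: h_def)
    qed
    then show ?thesis using P' G' Gp' by blast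
  qed
  show ?thesis
    unfolding gives_hyperaffine_part_def
  proof (intro exI[of _ h] conjI allI impI ballI h)
    fix Z b i f assume Z: "Md Z" and b: "b \<in> opn T (fin 1)" and i: "i \<in> I" and f: "\<forall>i\<in>I. f i \<in> car Z"
    obtain P' prj' tup' G' where P': "power_model I Z P' prj' tup'"
      and Gp': "\<forall>b\<in>opn T (fin 1). \<forall>i\<in>I. \<forall>x\<in>car P'. G' (ap (F I) b (pro T I i)) x = prj' i x"
      and hG: "\<forall>t\<in>opn T I. \<forall>f. (\<forall>i\<in>I. f i \<in> car Z) \<longrightarrow> op Z I (h t) f = G' t (tup' f)"
      using h2[OF Z] by blast
    show "op Z I (h (ap (F I) b (pro T I i))) f = f i"
      using hG Gp' b i f I by (simp add: ap_F_in pro_opn power_tup[OF P'] power_prj_tup[OF P'])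
  next
    fix Z J s t x assume Z: "Md Z" and J: "small J" and s: "s \<in> opn T J"
      and t: "\<forall>j\<in>J. t j \<in> opn T I" and x: "\<forall>j\<in>J. \<forall>i\<in>I. x j i \<in> car Z"
    obtain P' prj' tup' G' where P': "power_model I Z P' prj' tup'" and G': "bihom T (F I) P' Z G'"
      and hG: "\<forall>t\<in>opn T I. \<forall>f. (\<forall>i\<in>I. f i \<in> car Z) \<longrightarrow> op Z I (h t) f = G' t (tup' f)"
      using h2[OF Z] by blast
    have "op Z I (h (op (F I) J s t)) (\<lambda>i. op Z J s (\<lambda>j. x j i))
      = G' (op (F I) J s t) (tup' (\<lambda>i. op Z J s (\<lambda>j. x j i)))"
      using hG I J s t x Z by (simp add: op_F_in op_in)
    also have "tup' (\<lambda>i. op Z J s (\<lambda>j. x j i)) = op P' J s (\<lambda>j. tup' (x j))"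
      using J s x Z by (intro power_tup_op[OF P']) simp_all
    also have "G' (op (F I) J s t) (op P' J s (\<lambda>j. tup' (x j))) = op Z J s (\<lambda>j. G' (t j) (tup' (x j)))"
      using J s t x by (intro bihom_op[OF G']) (simp_all add: power_tup[OF P'])
    finally show "op Z I (h (op (F I) J s t)) (\<lambda>i. op Z J s (\<lambda>j. x j i)) = op Z J s (\<lambda>j. op Z I (h (t j)) (x j))"
      using hG t x by simp
  qed
qed

text \<open>Affineness and the diagonal law equate homomorphisms out of \<open>F I\<close> times
  \<open>Z\<close> or a power of \<open>Z\<close>, so it suffices to see them on the summands, where
  \<open>h\<close> selects a coordinate. The decomposition and its uniqueness come from the
  compatibility of \<open>h\<close> with composition, applied to families that do not depend on the
  outer index.\<close>

theorem hyperaffine_unary_if_cartesian_closed: "hyperaffine_unary T"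
  unfolding hyperaffine_unary_iff
proof (intro allI impI ballI)
  fix I t assume I: "small I" and t: "t \<in> opn T I"
  note FI = F_model[OF I]
  obtain h where H: "gives_hyperaffine_part I h" using hyperaffine_part_exists[OF I] by blast
  note h = hpart_in[OF H] and gen = hpart_gen[OF H] and K = hpart_op[OF H]
  have gen1: "op Z I (h (pro T I i)) f = f i" if "Md Z" "i \<in> I" "\<And>i. i \<in> I \<Longrightarrow> f i \<in> car Z" for Z i f
    using gen[of Z e1 i f] that I FI by (simp add: ap_e1 pro_opn)
  have affine: "op Z I (h t) (\<lambda>_. z) = z" if Z: "Md Z" and t: "t \<in> opn T I" and z: "z \<in> car Z" for Z t z
  proof (rule bihom_free_eqI[OF I Z Z _ _ _ t z])
    show "bihom T (F I) Z Z (\<lambda>t z. op Z I (h t) (\<lambda>_. z))"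
      unfolding bihom_def using h I Z K[OF Z, of _ _ _ "\<lambda>j i. _ j"] by (simp add: op_in)
  qed (use Z gen in \<open>simp_all add: bihom_def op_in\<close>)
  have diag: "op Z I (h t) (\<lambda>i. op Z I (h t) (x i)) = op Z I (h t) (\<lambda>i. x i i)"
    if Z: "Md Z" and t: "t \<in> opn T I" and x: "\<And>i j. \<lbrakk>i \<in> I; j \<in> I\<rbrakk> \<Longrightarrow> x i j \<in> car Z" for Z t x
  proof -
    \<comment> \<open>A doubly indexed family becomes one element of a power of \<open>Z\<close>,
      because \<open>bihom_free_eqI\<close> compares functions of a single element.\<close>
    obtain P prj tup where P: "power_model (prod_set I I) Z P prj tup"
      using power_model_exists[OF small_prod_set[OF I I] Z] by blast
    note PM = power_Md[OF P]
    have prj: "prj (pr i j) p \<in> car Z" if "i \<in> I" "j \<in> I" "p \<in> car P" for i j p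
      using thom_in[OF power_prj[OF P]] that by simp
    let ?p = "tup (\<lambda>z. x (fs z) (sn z))"
    have x': "x (fs z) (sn z) \<in> car Z" if "z \<in> prod_set I I" for z using that x by (auto elim: prod_setE)
    have p: "?p \<in> car P" using x' by (rule power_tup[OF P])
    have prj_op: "prj (pr i j) (op P J s y) = op Z J s (\<lambda>k. prj (pr i j) (y k))"
      if "i \<in> I" "j \<in> I" "small J" "s \<in> opn T J" "\<And>k. k \<in> J \<Longrightarrow> y k \<in> car P" for i j J s y
      using thom_op[OF power_prj[OF P]] that by simp
    have "op Z I (h t) (\<lambda>i. op Z I (h t) (\<lambda>j. prj (pr i j) ?p)) = op Z I (h t) (\<lambda>i. prj (pr i i) ?p)"
    proof (rule bihom_free_eqI[OF I PM Z _ _ _ t p])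
      show "bihom T (F I) P Z (\<lambda>t p. op Z I (h t) (\<lambda>i. op Z I (h t) (\<lambda>j. prj (pr i j) p)))"
        unfolding bihom_def using h I Z
        by (simp add: op_in prj prj_op K)
      show "bihom T (F I) P Z (\<lambda>t p. op Z I (h t) (\<lambda>i. prj (pr i i) p))"
        unfolding bihom_def using h I Z
        by (simp add: op_in prj prj_op K)
      fix b i p assume "b \<in> opn T (fin 1)" "i \<in> I" "p \<in> car P"
      then show "op Z I (h (ap (F I) b (pro T I i))) (\<lambda>i'. op Z I (h (ap (F I) b (pro T I i))) (\<lambda>j. prj (pr i' j) p))
        = op Z I (h (ap (F I) b (pro T I i))) (\<lambda>i. prj (pr i i) p)"
        using Z I h by (simp add: gen prj op_in ap_F_in pro_opn)
    qed
    then show ?thesis using x' by (simp add: power_prj_tup[OF P])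
  qed
  have hh: "hyperaffine T I (h t)"
    by (rule hyperaffineI[OF I h[OF t]]) (use t affine diag in \<open>auto simp: F_model\<close>)
  have d: "decomp I t (h t) (dm I t)"
  proof -
    \<comment> \<open>On the left \<open>t\<close> acts on constant families, hence through its
      unary part; on the right \<open>h\<close> selects projections, which gives \<open>t\<close>
      back.\<close>
    have "op (F I) I (h (op (F I) I t (pro T I))) (\<lambda>i. op (F I) I t (\<lambda>j. pro T I i))
      = op (F I) I t (\<lambda>j. op (F I) I (h (pro T I j)) (pro T I))"
      using I t by (intro K FI) (simp_all add: pro_opn)
    then have "op (F I) I (h t) (\<lambda>i. ap (F I) (dm I t) (pro T I i)) = op (F I) I t (pro T I)"
      using I t FI by (simp add: op_F_pros ap_dm gen1 pro_opn)
    then show ?thesis using I t h hh by (simp add: decomp_def op_F_pros dm_in)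
  qed
  show "\<exists>!(h, m). decomp I t h m"
  proof (rule ex1I[of _ "(h t, dm I t)"])
    fix km assume "case km of (k, m) \<Rightarrow> decomp I t k m"
    then obtain k m where km: "km = (k, m)" and dk: "decomp I t k m" by (cases km) auto
    have k: "k \<in> opn T I" "hyperaffine T I k" and m: "m \<in> opn T (fin 1)"
      and tk: "t = op (F I) I k (\<lambda>i. ap (F I) m (pro T I i))"
      using dk by (auto simp: decomp_def)
    \<comment> \<open>The same law for \<open>k\<close> in place of \<open>t\<close>: on the left
      \<open>k\<close> drops out by affineness, on the right \<open>h\<close> selects projections,
      and \<open>h t = k\<close> results.\<close>
    have "op (F I) I (h (op (F I) I k (\<lambda>i. ap (F I) m (pro T I i)))) (\<lambda>i. op (F I) I k (\<lambda>j. pro T I i))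
      = op (F I) I k (\<lambda>j. op (F I) I (h (ap (F I) m (pro T I j))) (pro T I))"
      using I k m by (intro K FI) (simp_all add: pro_opn ap_F_in)
    then have "op (F I) I (h t) (pro T I) = op (F I) I k (pro T I)"
      unfolding tk[symmetric] using I t FI k m by (simp add: gen pro_opn haff_const)
    then have "h t = k" using op_eqI[OF I h[OF t] k(1)] by simp
    then show "km = (h t, dm I t)" using decomp_dm[OF dk I] km by simp
  qed (use d in simp)
qed

end

theorem (in alg_th) cartesian_closed_iff_hyperaffine_unary:
  "cartesian_closed (cat_of (theory_Mod T)) \<longleftrightarrow> hyperaffine_unary T"
proof
  assume "cartesian_closed (cat_of (theory_Mod T))"
  then interpret cc_th T using cartesian_closed_exponential_model by unfold_locales blast
  show "hyperaffine_unary T" by (rule hyperaffine_unary_if_cartesian_closed)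
next
  assume "hyperaffine_unary T"
  then interpret hau T by unfold_locales
  show "cartesian_closed (cat_of (theory_Mod T))" by (rule cartesian_closed)
qed

section \<open>Theories and their categories of models\<close>

lemma alg_eqI:
  assumes "is_alg \<Sigma> ar X" "is_alg \<Sigma> ar Y" "car X = car Y"
    and "\<And>s x. \<lbrakk>s \<in> \<Sigma>; x \<in> ar s \<rightarrow>\<^sub>E car X\<rbrakk> \<Longrightarrow> itp X s x = itp Y s x"
  shows "X = Y"
proof (rule alg.equality)
  have m: "itp X s \<in> (ar s \<rightarrow>\<^sub>E car X) \<rightarrow>\<^sub>E car X" "itp Y s \<in> (ar s \<rightarrow>\<^sub>E car X) \<rightarrow>\<^sub>E car X" if "s \<in> \<Sigma>" for s
    using assms(1,2) that unfolding is_alg_def assms(3) by (meson PiE_mem)+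
  have e: "itp X \<in> extensional \<Sigma>" "itp Y \<in> extensional \<Sigma>"
    using assms(1,2) by (auto simp: is_alg_def PiE_def)
  show "itp X = itp Y"
  proof (rule extensionalityI[OF e])
    fix s assume s: "s \<in> \<Sigma>"
    show "itp X s = itp Y s"
      by (rule PiE_ext[OF m[OF s]]) (rule assms(4)[OF s])
  qed
qed (use assms in simp_all)

lemma theory_model_eqI:
  assumes "theory_model T X" "theory_model T Y" "car X = car Y"
    and "\<And>I t x. \<lbrakk>small I; t \<in> opn T I; \<And>i. i \<in> I \<Longrightarrow> x i \<in> car X\<rbrakk> \<Longrightarrow> op X I t x = op Y I t x"
  shows "X = Y"
proof (rule alg_eqI)
  show "is_alg (theory_syms T) sym_arity X" "is_alg (theory_syms T) sym_arity Y"
    using assms by (auto simp: theory_model_def)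
  fix s x assume "s \<in> theory_syms T" and x: "x \<in> sym_arity s \<rightarrow>\<^sub>E car X"
  then obtain I t where s: "s = OpSym I t" "small I" "t \<in> opn T I" by (auto elim: theory_symsE)
  then have "op X I t x = op Y I t x" using x by (intro assms) auto
  then show "itp X s x = itp Y s x" using x s by (simp add: op_def PiE_restrict)
qed (fact assms)

section \<open>Homomorphisms of theories\<close>

lemma theory_hom_opn: "\<lbrakk>theory_hom S T \<phi>; small I; t \<in> opn S I\<rbrakk> \<Longrightarrow> \<phi> I t \<in> opn T I"
  and theory_hom_pro: "\<lbrakk>theory_hom S T \<phi>; small I; i \<in> I\<rbrakk> \<Longrightarrow> \<phi> I (pro S I i) = pro T I i"
  and theory_hom_subst: "\<lbrakk>theory_hom S T \<phi>; small I; small J; t \<in> opn S I; u \<in> I \<rightarrow>\<^sub>E opn S J\<rbrakk>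
     \<Longrightarrow> \<phi> J (subst S I J t u) = subst T I J (\<phi> I t) (\<lambda>i\<in>I. \<phi> J (u i))"
  unfolding theory_hom_def by simp_all

lemma theory_hom_op:
  fixes S T :: "'u::universe alg_theory"
  assumes S: "algebraic_theory S" and T: "algebraic_theory T" and \<phi>: "theory_hom S T \<phi>"
    and "small I" "small J" "t \<in> opn S I" "\<And>i. i \<in> I \<Longrightarrow> u i \<in> opn S J"
  shows "\<phi> J (op (free_model S J) I t u) = op (free_model T J) I (\<phi> I t) (\<lambda>i. \<phi> J (u i))"
proof -
  interpret S: alg_th S by unfold_locales fact
  interpret T: alg_th T by unfold_locales fact
  have "(\<lambda>i\<in>I. \<phi> J (restrict u I i)) = (\<lambda>i\<in>I. \<phi> J (u i))" by auto
  then show ?thesis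
    using assms theory_hom_subst[OF \<phi>, of I J t "restrict u I"]
    by (simp add: S.op_F T.op_F theory_hom_opn[OF \<phi>])
qed

lemma theory_hom_eqI:
  assumes "theory_hom S T \<phi>" "theory_hom S T \<psi>"
    and "\<And>I t. \<lbrakk>small I; t \<in> opn S I\<rbrakk> \<Longrightarrow> \<phi> I t = \<psi> I t"
  shows "\<phi> = \<psi>"
proof -
  have "\<phi> = restrict_map (opn S) \<phi>" "\<psi> = restrict_map (opn S) \<psi>"
    using assms(1,2) by (simp_all add: theory_hom_def)
  moreover have "restrict_map (opn S) \<phi> = restrict_map (opn S) \<psi>"
    using assms(3) by (auto simp: restrict_map_def fun_eq_iff)
  ultimately show ?thesis by simp
qed

lemma restrict_map_apply [simp]: "\<lbrakk>small I; t \<in> A I\<rbrakk> \<Longrightarrow> restrict_map A \<phi> I t = \<phi> I t"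
  by (simp add: restrict_map_def)

lemma restrict_map_idem [simp]: "restrict_map A (restrict_map A \<phi>) = restrict_map A \<phi>"
  by (auto simp: restrict_map_def fun_eq_iff)

lemma theory_homI:
  fixes S T :: "'u::universe alg_theory"
  assumes S: "algebraic_theory S" and T: "algebraic_theory T"
    and "\<And>I t. \<lbrakk>small I; t \<in> opn S I\<rbrakk> \<Longrightarrow> \<phi> I t \<in> opn T I"
    and "\<And>I i. \<lbrakk>small I; i \<in> I\<rbrakk> \<Longrightarrow> \<phi> I (pro S I i) = pro T I i"
    and sub: "\<And>I J t u. \<lbrakk>small I; small J; t \<in> opn S I; \<And>i. i \<in> I \<Longrightarrow> u i \<in> opn S J\<rbrakk> \<Longrightarrow>
      \<phi> J (op (free_model S J) I t u) = op (free_model T J) I (\<phi> I t) (\<lambda>i. \<phi> J (u i))"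
  shows "theory_hom S T (restrict_map (opn S) \<phi>)"
proof -
  interpret S: alg_th S by unfold_locales fact
  interpret T: alg_th T by unfold_locales fact
  show ?thesis
    unfolding theory_hom_def
  proof (intro conjI allI impI ballI)
    fix I J t u assume h: "small I" "small J" "t \<in> opn S I" and "u \<in> I \<rightarrow>\<^sub>E opn S J"
    then have u: "\<And>i. i \<in> I \<Longrightarrow> u i \<in> opn S J" and r: "restrict u I = u" by (auto simp: PiE_restrict)
    have "\<phi> J (subst S I J t u) = subst T I J (\<phi> I t) (\<lambda>i\<in>I. \<phi> J (u i))"
      using sub[OF h, of u] h u assms(3) by (simp add: S.op_F T.op_F r)
    moreover have "(\<lambda>i\<in>I. restrict_map (opn S) \<phi> J (u i)) = (\<lambda>i\<in>I. \<phi> J (u i))"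
      using h u by (intro restrict_ext) simp
    ultimately show "restrict_map (opn S) \<phi> J (subst S I J t u) =
       subst T I J (restrict_map (opn S) \<phi> I t) (\<lambda>i\<in>I. restrict_map (opn S) \<phi> J (u i))"
      using h \<open>u \<in> I \<rightarrow>\<^sub>E opn S J\<close> by (simp add: S.subst_opn)
  qed (use assms in \<open>simp_all add: S.pro_opn\<close>)
qed

lemma theory_hom_id: "algebraic_theory (T :: 'u::universe alg_theory) \<Longrightarrow> theory_hom T T (theory_id T)"
  unfolding theory_id_def by (rule theory_homI) simp_all

lemma theory_hom_comp:
  fixes R S T :: "'u::universe alg_theory"
  assumes "algebraic_theory R" "algebraic_theory S" "algebraic_theory T"
    "theory_hom R S \<phi>" "theory_hom S T \<psi>"
  shows "theory_hom R T (theory_comp R \<psi> \<phi>)"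
  unfolding theory_comp_def
proof (rule theory_homI)
  interpret R: alg_th R by unfold_locales fact
  fix I J t u assume h: "small I" "small J" "t \<in> opn R I" "\<And>i. i \<in> I \<Longrightarrow> u i \<in> opn R J"
  have "\<psi> J (\<phi> J (op (free_model R J) I t u)) = \<psi> J (op (free_model S J) I (\<phi> I t) (\<lambda>i. \<phi> J (u i)))"
    using theory_hom_op[OF assms(1,2,4) h] by simp
  also have "\<dots> = op (free_model T J) I (\<psi> I (\<phi> I t)) (\<lambda>i. \<psi> J (\<phi> J (u i)))"
    using h by (intro theory_hom_op[OF assms(2,3,5)] theory_hom_opn[OF assms(4)])
  finally show "\<psi> J (\<phi> J (op (free_model R J) I t u)) =
    op (free_model T J) I (\<psi> I (\<phi> I t)) (\<lambda>i. \<psi> J (\<phi> J (u i)))" .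
qed (use assms in \<open>simp_all add: theory_hom_opn[of R S] theory_hom_opn[of S T] theory_hom_pro[of R S]
    theory_hom_pro[of S T]\<close>)

lemma hau_algebraic: "hyperaffine_unary T \<Longrightarrow> algebraic_theory T"
  by (simp add: hyperaffine_unary_def)

lemma
  shows Ob_HAffUn [simp]: "T \<in> Ob HAffUn \<longleftrightarrow> hyperaffine_unary T \<and> nondegenerate T"
    and Hom_HAffUn [simp]: "\<phi> \<in> Hom HAffUn S T \<longleftrightarrow> theory_hom S T \<phi>"
    and ident_HAffUn [simp]: "ident HAffUn = theory_id"
    and cmp_HAffUn [simp]: "cmp HAffUn R S T \<psi> \<phi> = theory_comp R \<psi> \<phi>"
  by (simp_all add: HAffUn_def)

lemma category_HAffUn: "category (HAffUn :: ('u::universe alg_theory, 'u theory_map) cat)"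
  unfolding category_def
proof (intro conjI ballI)
  fix X Y :: "'u alg_theory" and f assume h: "X \<in> Ob HAffUn" "Y \<in> Ob HAffUn" "f \<in> Hom HAffUn X Y"
  then have a: "algebraic_theory X" "algebraic_theory Y" and f: "theory_hom X Y f"
    by (auto simp: hau_algebraic)
  have i: "theory_hom X X (theory_id X)" "theory_hom Y Y (theory_id Y)" using a by (auto intro: theory_hom_id)
  have "theory_comp X f (theory_id X) = f"
    by (rule theory_hom_eqI[OF theory_hom_comp[OF a(1,1,2) i(1) f] f])
      (simp add: theory_comp_def theory_id_def)
  then show "cmp HAffUn X X Y f (ident HAffUn X) = f" by simp
  have "theory_comp X (theory_id Y) f = f"
    by (rule theory_hom_eqI[OF theory_hom_comp[OF a(1,2,2) f i(2)] f])
      (simp add: theory_comp_def theory_id_def theory_hom_opn[OF f])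
  then show "cmp HAffUn X Y Y (ident HAffUn Y) f = f" by simp
next
  fix W X Y Z :: "'u alg_theory" and f g h
  assume "W \<in> Ob HAffUn" "X \<in> Ob HAffUn" "Y \<in> Ob HAffUn" "Z \<in> Ob HAffUn" and
    "f \<in> Hom HAffUn W X" "g \<in> Hom HAffUn X Y" "h \<in> Hom HAffUn Y Z"
  then have f: "theory_hom W X f" by simp
  show "cmp HAffUn W Y Z h (cmp HAffUn W X Y g f) = cmp HAffUn W X Z (cmp HAffUn X Y Z h g) f"
    by (auto simp: theory_comp_def restrict_map_def fun_eq_iff theory_hom_opn[OF f])
qed (auto simp: hau_algebraic intro: theory_hom_id theory_hom_comp[OF hau_algebraic hau_algebraic hau_algebraic])

section \<open>Restriction of models along homomorphisms of theories\<close>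

definition theory_renaming :: "'u theory_map \<Rightarrow> 'u fsym \<Rightarrow> 'u fsym" where
  "theory_renaming \<phi> = case_fsym (\<lambda>I t. OpSym I (\<phi> I t)) ActSym"

lemma theory_renaming_OpSym [simp]: "theory_renaming \<phi> (OpSym I t) = OpSym I (\<phi> I t)"
  by (simp add: theory_renaming_def)

lemma car_reduct [simp]: "car (reduct \<Sigma> \<sigma> X) = car X"
  by (simp add: reduct_def)

lemma op_reduct:
  "OpSym I t \<in> \<Sigma> \<Longrightarrow> \<sigma> (OpSym I t) = OpSym I t' \<Longrightarrow> op (reduct \<Sigma> \<sigma> X) I t f = op X I t' f"
  by (simp add: op_def reduct_def)

lemma reduct_fctr_eq: "reduct_fctr C \<Sigma> \<sigma> = conc_functor C (reduct \<Sigma> \<sigma>)"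
  by (simp add: reduct_fctr_def conc_functor_def)

lemma is_alg_reduct:
  assumes "is_alg \<Sigma>' ar' X" "\<And>s. s \<in> \<Sigma> \<Longrightarrow> \<sigma> s \<in> \<Sigma>' \<and> ar' (\<sigma> s) = ar s"
  shows "is_alg \<Sigma> ar (reduct \<Sigma> \<sigma> X)"
proof -
  have "itp X (\<sigma> s) \<in> (ar s \<rightarrow>\<^sub>E car X) \<rightarrow>\<^sub>E car X" if "s \<in> \<Sigma>" for s
  proof -
    have "itp X (\<sigma> s) \<in> (ar' (\<sigma> s) \<rightarrow>\<^sub>E car X) \<rightarrow>\<^sub>E car X"
      using assms that unfolding is_alg_def by (meson PiE_mem)
    then show ?thesis using assms(2)[OF that] by simp
  qed
  then show ?thesis using assms(1) by (auto simp: is_alg_def reduct_def)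
qed

lemma conc_map_theory_reduct:
  fixes S T :: "'u::universe alg_theory"
  assumes S: "algebraic_theory S" and T: "algebraic_theory T" and \<phi>: "theory_hom S T \<phi>"
  shows "conc_map (theory_Mod T) (theory_Mod S) (reduct (theory_syms S) (theory_renaming \<phi>))"
proof -
  interpret S: alg_th S by unfold_locales fact
  interpret T: alg_th T by unfold_locales fact
  let ?r = "reduct (theory_syms S) (theory_renaming \<phi>)"
  have op: "op (?r X) I t f = op X I (\<phi> I t) f" if "small I" "t \<in> opn S I" for X I t f
    using that by (simp add: op_reduct)
  have "S.Md (?r X)" if X: "T.Md X" for X
  proof -
    have rx: "itp (?r X) (OpSym I t) x = op X I (\<phi> I t) x" if "small I" "t \<in> opn S I" "x \<in> I \<rightarrow>\<^sub>E car X" for I t x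
      using op[OF that(1,2), of X x] that by (simp add: op_def PiE_restrict)
    have "is_alg (theory_syms S) sym_arity (?r X)"
      using X by (intro is_alg_reduct[of "theory_syms T" sym_arity])
        (auto simp: theory_model_def theory_hom_opn[OF \<phi>] elim!: theory_symsE)
    moreover have "model_laws S (?r X)"
      unfolding model_laws_def
    proof (intro conjI allI impI ballI)
      fix I :: "'u set" and i x assume h: "small I" "i \<in> I" "x \<in> I \<rightarrow>\<^sub>E car (?r X)"
      then show "itp (?r X) (OpSym I (pro S I i)) x = x i"
        using T.op_pro[OF X h(1,2), of x] by (auto simp: rx S.pro_opn theory_hom_pro[OF \<phi>] PiE_mem)
    next
      fix I J t u x assume h: "small I" "small J" "t \<in> opn S I" "u \<in> I \<rightarrow>\<^sub>E opn S J" "x \<in> J \<rightarrow>\<^sub>E car (?r X)"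
      have u: "u i \<in> opn S J" if "i \<in> I" for i using h(4) that by auto
      have x: "x j \<in> car X" if "j \<in> J" for j using h(5) that by auto
      have e: "(\<lambda>i\<in>I. itp (?r X) (OpSym J (u i)) x) = (\<lambda>i\<in>I. op X J (\<phi> J (u i)) x)"
        using h u by (intro restrict_ext) (simp add: rx)
      have "(\<lambda>i\<in>I. op X J (\<phi> J (u i)) x) \<in> I \<rightarrow>\<^sub>E car X"
        using h u x X by (auto intro!: T.op_in theory_hom_opn[OF \<phi>])
      then show "itp (?r X) (OpSym J (subst S I J t u)) x =
          itp (?r X) (OpSym I t) (\<lambda>i\<in>I. itp (?r X) (OpSym J (u i)) x)"
        unfolding e using h u x X
        by (simp add: rx S.subst_opn theory_hom_subst[OF \<phi>] T.op_subst theory_hom_opn[OF \<phi>])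
    qed
    ultimately show ?thesis by (simp add: theory_model_def)
  qed
  moreover have "thom S (?r X) (?r Y) f" if "thom T X Y f" for X Y f
    using that unfolding thom_iff by (simp add: op theory_hom_opn[OF \<phi>])
  ultimately show ?thesis by (auto simp: conc_map_def)
qed

lemma fob_theory_Mod_functor [simp]: "fob theory_Mod_functor = theory_Mod"
  by (simp add: theory_Mod_functor_def)

lemma far_theory_Mod_functor:
  "far theory_Mod_functor S T \<phi> =
    conc_functor (theory_Mod T) (reduct (theory_syms S) (theory_renaming \<phi>))"
  by (simp add: theory_Mod_functor_def reduct_fctr_eq theory_renaming_def)

lemma nondegenerate_theory_Mod:
  fixes T :: "'u::universe alg_theory"
  assumes "algebraic_theory T" "nondegenerate T" shows "nondegenerate_variety (theory_Mod T)"
proof -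
  interpret alg_th T by unfold_locales fact
  have f: "num 1 \<in> (fin 2 :: 'u set)" "num 2 \<in> (fin 2 :: 'u set)" by (auto simp: fin_def)
  have "pro T (fin 2) (num 1) \<in> car (F (fin 2))" "pro T (fin 2) (num 2) \<in> car (F (fin 2))"
    using f by (simp_all add: pro_opn)
  then show ?thesis
    using F_model[of "fin 2"] assms(2) unfolding nondegenerate_variety_def nondegenerate_def
    by (metis cob_theory_Mod small_fin und_theory_Mod)
qed

lemma
  shows Ob_ccVar [simp]: "C \<in> Ob ccVar \<longleftrightarrow> concrete_category C \<and> variety C \<and>
      nondegenerate_variety C \<and> cartesian_closed (cat_of C)"
    and Hom_ccVar [simp]: "F \<in> Hom ccVar C D \<longleftrightarrow> concrete_functor C D F"
    and ident_ccVar [simp]: "ident ccVar = ident Conc"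
    and cmp_ccVar [simp]: "cmp ccVar = cmp Conc"
    and isomorphic_ccVar [simp]: "isomorphic ccVar = isomorphic Conc"
    and inverse_arrows_ccVar: "inverse_arrows ccVar = inverse_arrows Conc"
  by (auto simp: ccVar_def Variety_def inverse_arrows_def fun_eq_iff)

lemma category_ccVar: "category ccVar"
  unfolding ccVar_def Variety_def by (intro category_full_subcat category_Conc)

lemma theory_Mod_in_ccVar: "(T :: 'u::universe alg_theory) \<in> Ob HAffUn \<Longrightarrow> theory_Mod T \<in> Ob ccVar"
proof -
  assume h: "T \<in> Ob HAffUn"
  then interpret alg_th T by unfold_locales (simp add: hau_algebraic)
  show ?thesis
    using h concrete_category_theory_Mod variety_theory_Mod nondegenerate_theory_Mod[OF T]
      cartesian_closed_iff_hyperaffine_unary by simp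
qed

lemma is_functor_theory_Mod: "is_functor (HAffUn :: ('u::universe alg_theory, 'u theory_map) cat) (op_cat ccVar)
    theory_Mod_functor"
  unfolding is_functor_def
proof (intro conjI ballI)
  show "category (HAffUn :: ('u alg_theory, 'u theory_map) cat)" by (rule category_HAffUn)
  show "category (op_cat ccVar)" by (intro category_op_cat category_ccVar)
  fix X :: "'u alg_theory" assume X: "X \<in> Ob HAffUn"
  then interpret X: alg_th X by unfold_locales (simp add: hau_algebraic)
  show "fob theory_Mod_functor X \<in> Ob (op_cat ccVar)" using theory_Mod_in_ccVar[OF X] by simp
  have "reduct (theory_syms X) (theory_renaming (theory_id X)) Y = Y" if Y: "Y \<in> cob (theory_Mod X)" for Y
  proof (rule theory_model_eqI[of X])
    show "theory_model X (reduct (theory_syms X) (theory_renaming (theory_id X)) Y)"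
      using conc_mapD(1)[OF conc_map_theory_reduct[OF X.T X.T theory_hom_id[OF X.T]] Y] by simp
  qed (use Y in \<open>simp_all add: op_reduct theory_id_def\<close>)
  then show "far theory_Mod_functor X X (ident HAffUn X) = ident (op_cat ccVar) (fob theory_Mod_functor X)"
    by (simp add: far_theory_Mod_functor ident_Conc conc_functor_eq_iff)
next
  fix X Y :: "'u alg_theory" and f assume "X \<in> Ob HAffUn" "Y \<in> Ob HAffUn" "f \<in> Hom HAffUn X Y"
  then have a: "algebraic_theory X" "algebraic_theory Y" "theory_hom X Y f" by (auto simp: hau_algebraic)
  then interpret X: alg_th X + Y: alg_th Y by unfold_locales
  show "far theory_Mod_functor X Y f \<in> Hom (op_cat ccVar) (fob theory_Mod_functor X) (fob theory_Mod_functor Y)"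
    using concrete_functor_conc_functor[OF Y.concrete_category_theory_Mod X.concrete_category_theory_Mod
        conc_map_theory_reduct[OF a]]
    by (simp add: far_theory_Mod_functor)
next
  fix X Y Z :: "'u alg_theory" and f g
  assume "X \<in> Ob HAffUn" "Y \<in> Ob HAffUn" "Z \<in> Ob HAffUn" "f \<in> Hom HAffUn X Y" "g \<in> Hom HAffUn Y Z"
  then have a: "algebraic_theory X" "algebraic_theory Y" "algebraic_theory Z"
    and f: "theory_hom X Y f" and g: "theory_hom Y Z g" by (auto simp: hau_algebraic)
  then interpret X: alg_th X + Y: alg_th Y + Z: alg_th Z by unfold_locales
  let ?R = "\<lambda>S \<phi>. reduct (theory_syms S) (theory_renaming \<phi>)"
  have "?R X (theory_comp X g f) W = ?R X f (?R Y g W)" if W: "W \<in> cob (theory_Mod Z)" for W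
  proof (rule theory_model_eqI[of X])
    show "theory_model X (?R X (theory_comp X g f) W)"
      using conc_mapD(1)[OF conc_map_theory_reduct[OF a(1,3) theory_hom_comp[OF a f g]] W] by simp
    show "theory_model X (?R X f (?R Y g W))"
      using conc_mapD(1)[OF conc_map_theory_reduct[OF a(1,2) f]
          conc_mapD(1)[OF conc_map_theory_reduct[OF a(2,3) g] W]] by simp
  qed (simp_all add: op_reduct theory_comp_def theory_hom_opn[OF f])
  then show "far theory_Mod_functor X Z (cmp HAffUn X Y Z g f) =
    cmp (op_cat ccVar) (fob theory_Mod_functor X) (fob theory_Mod_functor Y) (fob theory_Mod_functor Z)
      (far theory_Mod_functor Y Z g) (far theory_Mod_functor X Y f)"
    by (simp add: far_theory_Mod_functor cmp_Conc[OF conc_map_theory_reduct[OF a(2,3) g]] conc_functor_eq_iff)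
qed

text \<open>A homomorphism \<phi> is recovered from its functor by evaluating the restricted
  operation \<open>t\<close> at the projections in \<open>F I\<close>. For a concrete functor
  \<open>G\<close> the same recipe defines \<phi>: homomorphisms from \<open>F I\<close> to
  \<open>X\<close> remain homomorphisms under \<open>G\<close>, and they carry the value at the
  projections to all families in \<open>X\<close>.\<close>

lemma fully_faithful_theory_Mod: "fully_faithful (HAffUn :: ('u::universe alg_theory, 'u theory_map) cat) (op_cat ccVar)
    theory_Mod_functor"
  unfolding fully_faithful_def
proof (intro ballI)
  fix S T :: "'u alg_theory" assume "S \<in> Ob HAffUn" "T \<in> Ob HAffUn"
  then have a: "algebraic_theory S" "algebraic_theory T" by (auto simp: hau_algebraic)
  then interpret S: alg_th S + T: alg_th T by unfold_locales
  let ?R = "\<lambda>\<phi>. reduct (theory_syms S) (theory_renaming \<phi>)"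
  let ?M = "theory_Mod_functor :: ('u alg_theory, 'u theory_map, ('u alg, 'u) conc, ('u alg, 'u) conc_fctr) fctr"
  have "inj_on (far ?M S T) {\<phi>. theory_hom S T \<phi>}"
  proof (rule inj_onI)
    fix \<phi> \<psi> assume "\<phi> \<in> {\<phi>. theory_hom S T \<phi>}" "\<psi> \<in> {\<phi>. theory_hom S T \<phi>}"
      and eq: "far ?M S T \<phi> = far ?M S T \<psi>"
    then have h: "theory_hom S T \<phi>" "theory_hom S T \<psi>" by auto
    show "\<phi> = \<psi>"
    proof (rule theory_hom_eqI[OF h])
      fix I t assume I: "small I" and t: "t \<in> opn S I"
      have "?R \<phi> (T.F I) = ?R \<psi> (T.F I)"
        using eq T.F_model[OF I] by (simp add: far_theory_Mod_functor conc_functor_eq_iff)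
      then have "op (?R \<phi> (T.F I)) I t (pro T I) = op (?R \<psi> (T.F I)) I t (pro T I)" by simp
      then show "\<phi> I t = \<psi> I t"
        using I t h by (simp add: op_reduct T.op_F_pros theory_hom_opn)
    qed
  qed
  moreover have "far ?M S T ` {\<phi>. theory_hom S T \<phi>} = {G. concrete_functor (theory_Mod T) (theory_Mod S) G}"
  proof (intro subset_antisym subsetI)
    fix G assume "G \<in> far ?M S T ` {\<phi>. theory_hom S T \<phi>}"
    then show "G \<in> {G. concrete_functor (theory_Mod T) (theory_Mod S) G}"
      using concrete_functor_conc_functor[OF T.concrete_category_theory_Mod S.concrete_category_theory_Mod
        conc_map_theory_reduct[OF a]] by (auto simp: far_theory_Mod_functor)
  next
    fix G assume "G \<in> {G. concrete_functor (theory_Mod T) (theory_Mod S) G}"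
    then have G: "conc_map (theory_Mod T) (theory_Mod S) (fob G)"
      and Geq: "G = conc_functor (theory_Mod T) (fob G)" using concrete_functorD by blast+
    let ?G = "fob G"
    have GM: "S.Md (?G X)" and Gc: "car (?G X) = car X" if "T.Md X" for X
      using conc_mapD(1,2)[OF G, of X] that by auto
    have Gh: "thom S (?G X) (?G Y) f" if "T.Md X" "T.Md Y" "thom T X Y f" for X Y f
      using conc_mapD(3)[OF G, of X Y f] that by auto
    \<comment> \<open>\<open>G (F I)\<close> has the carrier \<open>opn T I\<close>, so an operation
      of \<open>S\<close> evaluated there is an operation of \<open>T\<close>.\<close>
    define \<phi> where "\<phi> I t = op (?G (T.F I)) I t (pro T I)" for I t
    have \<phi>_in: "\<phi> I t \<in> opn T I" if "small I" "t \<in> opn S I" for I t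
      using S.op_in[OF GM[OF T.F_model] that(1) that(2), of I "pro T I"] that
      by (simp add: \<phi>_def Gc T.F_model T.pro_opn)
    have key: "op (?G X) I t x = op X I (\<phi> I t) x"
      if X: "T.Md X" and I: "small I" and t: "t \<in> opn S I" and x: "\<And>i. i \<in> I \<Longrightarrow> x i \<in> car X" for X I t x
    proof -
      let ?e = "\<lambda>s\<in>opn T I. op X I s x"
      have e: "thom S (?G (T.F I)) (?G X) ?e"
        using Gh[OF T.F_model[OF I] X T.op_hom[OF X I x]] by simp
      have "?e (op (?G (T.F I)) I t (pro T I)) = op (?G X) I t (\<lambda>i. ?e (pro T I i))"
        using I by (intro thom_op[OF e I t]) (simp add: Gc T.F_model T.pro_opn)
      then show ?thesis using I t X x \<phi>_in[OF I t] by (simp add: \<phi>_def T.pro_opn T.op_pro)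
    qed
    have h: "theory_hom S T (restrict_map (opn S) \<phi>)"
    proof (rule theory_homI[OF a \<phi>_in])
      fix I :: "'u set" and i assume "small I" "i \<in> I"
      then show "\<phi> I (pro S I i) = pro T I i"
        by (simp add: \<phi>_def S.op_pro GM T.F_model Gc T.pro_opn)
    next
      fix I J t u assume h: "small I" "small J" "t \<in> opn S I" "\<And>i. i \<in> I \<Longrightarrow> u i \<in> opn S J"
      have "\<phi> J (op (S.F J) I t u) = op (?G (T.F J)) I t (\<lambda>i. \<phi> J (u i))"
        unfolding \<phi>_def using h by (intro S.op_op) (simp_all add: GM T.F_model Gc T.pro_opn)
      also have "\<dots> = op (T.F J) I (\<phi> I t) (\<lambda>i. \<phi> J (u i))"
        using h by (intro key) (simp_all add: T.F_model \<phi>_in)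
      finally show "\<phi> J (op (S.F J) I t u) = op (T.F J) I (\<phi> I t) (\<lambda>i. \<phi> J (u i))" .
    qed
    have "?R (restrict_map (opn S) \<phi>) X = ?G X" if X: "X \<in> cob (theory_Mod T)" for X
    proof (rule theory_model_eqI[of S])
      show "theory_model S (?R (restrict_map (opn S) \<phi>) X)"
        using conc_mapD(1)[OF conc_map_theory_reduct[OF a h] X] by simp
    qed (use X in \<open>simp_all add: GM Gc op_reduct key\<close>)
    then have "far ?M S T (restrict_map (opn S) \<phi>) = G"
      by (subst Geq) (simp add: far_theory_Mod_functor conc_functor_eq_iff)
    then show "G \<in> far ?M S T ` {\<phi>. theory_hom S T \<phi>}" using h by blast
  qed
  moreover have "Hom HAffUn S T = {\<phi>. theory_hom S T \<phi>}" by auto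
  moreover have "Hom (op_cat ccVar) (fob ?M S) (fob ?M T) = {G. concrete_functor (theory_Mod T) (theory_Mod S) G}"
    by auto
  ultimately show "bij_betw (far ?M S T) (Hom HAffUn S T) (Hom (op_cat ccVar) (fob ?M S) (fob ?M T))"
    by (simp add: bij_betw_def)
qed

section \<open>The theory of a variety\<close>

lemma alg_homD:
  assumes "alg_hom \<Sigma> ar X Y f"
  shows "f \<in> car X \<rightarrow>\<^sub>E car Y" "x \<in> car X \<Longrightarrow> f x \<in> car Y"
    "\<lbrakk>s \<in> \<Sigma>; x' \<in> ar s \<rightarrow>\<^sub>E car X\<rbrakk> \<Longrightarrow> f (itp X s x') = itp Y s (\<lambda>i\<in>ar s. f (x' i))"
  using assms by (auto simp: alg_hom_def)

text \<open>An operation of arity \<open>K\<close> of the theory of a variety is an element of the free model on \<open>K\<close>.\<close>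

locale free_objects =
  fixes E :: "'u::universe eqn_theory" and Fr :: "'u set \<Rightarrow> 'u alg" and \<eta> :: "'u set \<Rightarrow> 'u \<Rightarrow> 'u"
  assumes E: "equational_theory E"
    and Fr_model: "small K \<Longrightarrow> eqn_model E (Fr K)"
    and \<eta>_in: "small K \<Longrightarrow> \<eta> K \<in> K \<rightarrow>\<^sub>E car (Fr K)"
    and free: "\<lbrakk>small K; eqn_model E X; f \<in> K \<rightarrow>\<^sub>E car X\<rbrakk>
      \<Longrightarrow> \<exists>!g. alg_hom (syms E) (arity E) (Fr K) X g \<and> (\<forall>k\<in>K. g (\<eta> K k) = f k)"
begin

abbreviation eh where "eh \<equiv> alg_hom (syms E) (arity E)"

definition ext :: "'u set \<Rightarrow> 'u alg \<Rightarrow> ('u \<Rightarrow> 'u) \<Rightarrow> 'u \<Rightarrow> 'u" where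
  "ext K X f = (THE g. eh (Fr K) X g \<and> (\<forall>k\<in>K. g (\<eta> K k) = f k))"

lemma
  assumes "small K" "eqn_model E X" "f \<in> K \<rightarrow>\<^sub>E car X"
  shows ext_hom: "eh (Fr K) X (ext K X f)" and ext_\<eta>: "k \<in> K \<Longrightarrow> ext K X f (\<eta> K k) = f k"
  using theI'[OF free[OF assms]] unfolding ext_def by auto

lemma ext_unique:
  "\<lbrakk>small K; eqn_model E X; f \<in> K \<rightarrow>\<^sub>E car X; eh (Fr K) X g; \<And>k. k \<in> K \<Longrightarrow> g (\<eta> K k) = f k\<rbrakk> \<Longrightarrow> ext K X f = g"
  unfolding ext_def by (rule the1_equality[OF free]) auto

lemma ext_in: "\<lbrakk>small K; eqn_model E X; f \<in> K \<rightarrow>\<^sub>E car X; t \<in> car (Fr K)\<rbrakk> \<Longrightarrow> ext K X f t \<in> car X"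
  using alg_homD(2)[OF ext_hom] by blast

lemma small_arity: "s \<in> syms E \<Longrightarrow> small (arity E s)"
  using E by (simp add: equational_theory_def)

lemma itp_in: "\<lbrakk>eqn_model E X; s \<in> syms E; x \<in> arity E s \<rightarrow>\<^sub>E car X\<rbrakk> \<Longrightarrow> itp X s x \<in> car X"
  unfolding eqn_model_def by (blast intro: is_alg_itp)

lemma eh_comp:
  assumes "eqn_model E X" "eh X Y f" "eh Y Z g" shows "eh X Z (\<lambda>x\<in>car X. g (f x))"
proof -
  have 1: "(\<lambda>x\<in>car X. g (f x)) \<in> car X \<rightarrow>\<^sub>E car Z" using assms(2,3) by (auto dest: alg_homD(2))
  show ?thesis unfolding alg_hom_def
  proof (intro conjI ballI 1)
    fix s x assume s: "s \<in> syms E" and x: "x \<in> arity E s \<rightarrow>\<^sub>E car X"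
    then have x': "x i \<in> car X" if "i \<in> arity E s" for i using that by auto
    have fx: "(\<lambda>i\<in>arity E s. f (x i)) \<in> arity E s \<rightarrow>\<^sub>E car Y" using x' assms(2) by (auto dest: alg_homD(2))
    have "(\<lambda>i\<in>arity E s. g ((\<lambda>i\<in>arity E s. f (x i)) i)) = (\<lambda>i\<in>arity E s. (\<lambda>x\<in>car X. g (f x)) (x i))"
      using x' by (intro restrict_ext) simp
    moreover have "(\<lambda>x\<in>car X. g (f x)) (itp X s x) = g (itp Y s (\<lambda>i\<in>arity E s. f (x i)))"
      using itp_in[OF assms(1) s x] alg_homD(3)[OF assms(2) s x] by simp
    ultimately show "(\<lambda>x\<in>car X. g (f x)) (itp X s x) = itp Z s (\<lambda>i\<in>arity E s. (\<lambda>x\<in>car X. g (f x)) (x i))"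
      using alg_homD(3)[OF assms(3) s fx] by (simp only:)
  qed
qed

lemma eh_id: "eqn_model E X \<Longrightarrow> eh X X (\<lambda>x\<in>car X. x)"
  using concrete_category_eqn_Mod[of E] ident_in_Hom[of "cat_of (eqn_Mod E)" X]
  by (simp add: concrete_category_def) (simp add: eqn_Mod_def)

text \<open>Both sides are homomorphisms on the free model with the same values on the generators;
  this will be associativity of substitution in \<open>fth\<close>.\<close>

lemma eh_ext_comp:
  assumes "small K" "eqn_model E X" "eqn_model E Y" "x \<in> K \<rightarrow>\<^sub>E car X" "eh X Y f" "t \<in> car (Fr K)"
  shows "f (ext K X x t) = ext K Y (\<lambda>k\<in>K. f (x k)) t"
proof -
  have "ext K Y (\<lambda>k\<in>K. f (x k)) = (\<lambda>t\<in>car (Fr K). f (ext K X x t))"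
  proof (rule ext_unique)
    show "(\<lambda>k\<in>K. f (x k)) \<in> K \<rightarrow>\<^sub>E car Y" using assms(4) alg_homD(2)[OF assms(5)] by auto
    show "eh (Fr K) Y (\<lambda>t\<in>car (Fr K). f (ext K X x t))"
      using assms by (intro eh_comp[of _ X]) (auto simp: Fr_model ext_hom)
    fix k assume k: "k \<in> K"
    then have "\<eta> K k \<in> car (Fr K)" using \<eta>_in[OF assms(1)] by auto
    then show "(\<lambda>t\<in>car (Fr K). f (ext K X x t)) (\<eta> K k) = (\<lambda>k\<in>K. f (x k)) k"
      using assms k by (simp add: ext_\<eta>)
  qed (use assms in simp_all)
  then show ?thesis using assms by simp
qed

definition fth :: "'u alg_theory" where
  "fth = \<lparr>opn = (\<lambda>K. car (Fr K)), pro = \<eta>, subst = (\<lambda>I J t u. ext I (Fr J) u t)\<rparr>"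

lemma fth_simps [simp]:
  "opn fth K = car (Fr K)" "pro fth = \<eta>" "subst fth I J t u = ext I (Fr J) u t"
  by (simp_all add: fth_def)

lemma algebraic_fth: "algebraic_theory fth"
  unfolding algebraic_theory_def fth_simps
proof (intro conjI allI impI ballI)
  fix I :: "'u set" assume I: "small I"
  show "small (car (Fr I))" using Fr_model[OF I] by (simp add: eqn_model_def is_alg_def)
  fix t assume t: "t \<in> car (Fr I)"
  have "ext I (Fr I) (\<eta> I) = (\<lambda>x\<in>car (Fr I). x)"
  proof (rule ext_unique[OF I Fr_model[OF I] \<eta>_in[OF I]])
    show "eh (Fr I) (Fr I) (\<lambda>x\<in>car (Fr I). x)" using I by (intro eh_id Fr_model)
  qed (use \<eta>_in[OF I] in auto)
  then show "ext I (Fr I) (\<lambda>i\<in>I. \<eta> I i) t = t" using t \<eta>_in[OF I] by (simp add: restrict_PiE_self)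
next
  fix I J K t u v assume h: "small I" "small J" "small K" "t \<in> car (Fr I)"
    "u \<in> I \<rightarrow>\<^sub>E car (Fr J)" "v \<in> J \<rightarrow>\<^sub>E car (Fr K)"
  then show "ext J (Fr K) v (ext I (Fr J) u t) = ext I (Fr K) (\<lambda>i\<in>I. ext J (Fr K) v (u i)) t"
    by (intro eh_ext_comp) (simp_all add: Fr_model ext_hom)
qed (use \<eta>_in in \<open>auto simp: ext_in Fr_model ext_\<eta>\<close>)

sublocale alg_th fth by unfold_locales (rule algebraic_fth)

definition to_fth :: "'u alg \<Rightarrow> 'u alg" where
  "to_fth X = mk_alg fth (car X) (\<lambda>I t x. ext I X x t)"

text \<open>The symbol \<open>s\<close> as an operation of the theory: \<open>s\<close> applied to
  the generic variables of its arity.\<close>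

definition sy :: "'u fsym \<Rightarrow> 'u" where
  "sy s = itp (Fr (arity E s)) s (\<eta> (arity E s))"

definition of_fth :: "'u alg \<Rightarrow> 'u alg" where
  "of_fth Y = \<lparr>car = car Y, itp = (\<lambda>s\<in>syms E. \<lambda>x\<in>arity E s \<rightarrow>\<^sub>E car Y. op Y (arity E s) (sy s) x)\<rparr>"

lemma car_fth [simp]: "car (to_fth X) = car X" "car (of_fth X) = car X"
  by (simp_all add: to_fth_def of_fth_def)

lemma op_to_fth: "\<lbrakk>small I; t \<in> car (Fr I); \<And>i. i \<in> I \<Longrightarrow> x i \<in> car X\<rbrakk>
    \<Longrightarrow> op (to_fth X) I t x = ext I X (restrict x I) t"
  unfolding to_fth_def by (rule op_mk_alg) simp_all

lemma itp_of_fth: "\<lbrakk>s \<in> syms E; x \<in> arity E s \<rightarrow>\<^sub>E car Y\<rbrakk> \<Longrightarrow> itp (of_fth Y) s x = op Y (arity E s) (sy s) x"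
  by (simp add: of_fth_def)

lemma to_fth_model: "eqn_model E X \<Longrightarrow> Md (to_fth X)"
  unfolding to_fth_def
proof (rule theory_model_mk_alg)
  assume X: "eqn_model E X"
  then show "small (car X)" by (simp add: eqn_model_def is_alg_def)
  fix I J t u x assume "small I" "small J" "t \<in> opn fth I" "u \<in> I \<rightarrow>\<^sub>E opn fth J" "x \<in> J \<rightarrow>\<^sub>E car X"
  then show "ext J X x (subst fth I J t u) = ext I X (\<lambda>i\<in>I. ext J X x (u i)) t"
    using X unfolding fth_simps by (intro eh_ext_comp) (simp_all add: Fr_model ext_hom)
qed (auto simp: ext_in ext_\<eta>)

lemma sy_in: "s \<in> syms E \<Longrightarrow> sy s \<in> car (Fr (arity E s))"
  unfolding sy_def by (intro itp_in Fr_model \<eta>_in small_arity)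

lemma itp_eq_ext:
  assumes X: "eqn_model E X" and s: "s \<in> syms E" and x: "x \<in> arity E s \<rightarrow>\<^sub>E car X"
  shows "itp X s x = ext (arity E s) X x (sy s)"
proof -
  note ar = small_arity[OF s]
  have "ext (arity E s) X x (sy s) = itp X s (\<lambda>i\<in>arity E s. ext (arity E s) X x (\<eta> (arity E s) i))"
    unfolding sy_def by (rule alg_homD(3)[OF ext_hom[OF ar X x] s \<eta>_in[OF ar]])
  also have "(\<lambda>i\<in>arity E s. ext (arity E s) X x (\<eta> (arity E s) i)) = restrict x (arity E s)"
    by (rule restrict_ext) (rule ext_\<eta>[OF ar X x])
  finally show ?thesis using x by (simp add: PiE_restrict)
qed

lemma op_itp_Fr:
  assumes Y: "Md Y" and K: "small K" and s: "s \<in> syms E" and w: "w \<in> arity E s \<rightarrow>\<^sub>E car (Fr K)"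
    and \<rho>: "\<And>k. k \<in> K \<Longrightarrow> \<rho> k \<in> car Y"
  shows "op Y K (itp (Fr K) s w) \<rho> = op Y (arity E s) (sy s) (\<lambda>i. op Y K (w i) \<rho>)"
proof -
  have "itp (Fr K) s w = subst fth (arity E s) K (sy s) (restrict w (arity E s))"
    using itp_eq_ext[OF Fr_model[OF K] s w] w by (simp add: PiE_restrict)
  then show ?thesis
    using op_subst[OF Y small_arity[OF s] K, of "sy s" w \<rho>] sy_in[OF s] w \<rho> by auto
qed

lemma is_alg_of_fth: "Md Y \<Longrightarrow> is_alg (syms E) (arity E) (of_fth Y)"
proof -
  assume Y: "Md Y"
  have "op Y (arity E s) (sy s) x \<in> car Y" if "s \<in> syms E" "x \<in> arity E s \<rightarrow>\<^sub>E car Y" for s x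
    using that Y by (intro op_in) (auto simp: small_arity sy_in)
  then show ?thesis
    using Y by (simp add: is_alg_def of_fth_def small_car restrict_PiE_iff Pi_iff)
qed

text \<open>A term in variables from \<open>K\<close> names an element of the free model on
  \<open>K\<close>, and as an operation of \<open>fth\<close> this element computes the term in
  \<open>of_fth Y\<close>. So the equations of \<open>E\<close>, which hold in the free model, hold
  in \<open>of_fth Y\<close>.\<close>

lemma ev_of_fth:
  assumes Y: "Md Y" and K: "small K" and \<rho>: "\<rho> \<in> K \<rightarrow>\<^sub>E car Y"
  shows "is_trm (syms E) (arity E) K a \<Longrightarrow> ev (arity E) (Fr K) (\<eta> K) a \<in> car (Fr K) \<and>
    ev (arity E) (of_fth Y) \<rho> a = op Y K (ev (arity E) (Fr K) (\<eta> K) a) \<rho>"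
proof (induction rule: is_trm.induct)
  case (1 k)
  have "\<And>k. k \<in> K \<Longrightarrow> \<rho> k \<in> car Y" using \<rho> by auto
  from op_pro[OF Y K 1 this] show ?case using PiE_mem[OF \<eta>_in[OF K] 1] by simp
next
  case (2 s ts)
  let ?w = "\<lambda>i\<in>arity E s. ev (arity E) (Fr K) (\<eta> K) (ts i)"
  have w: "?w \<in> arity E s \<rightarrow>\<^sub>E car (Fr K)" using 2 by auto
  have \<rho>': "\<And>k. k \<in> K \<Longrightarrow> \<rho> k \<in> car Y" using \<rho> by auto
  have r: "(\<lambda>i\<in>arity E s. ev (arity E) (of_fth Y) \<rho> (ts i)) = (\<lambda>i\<in>arity E s. op Y K (?w i) \<rho>)"
    using 2 by (intro restrict_ext) simp
  have "(\<lambda>i\<in>arity E s. op Y K (?w i) \<rho>) \<in> arity E s \<rightarrow>\<^sub>E car Y"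
    using w \<rho>' Y K by (auto intro!: op_in)
  then have "ev (arity E) (of_fth Y) \<rho> (App s ts) = op Y (arity E s) (sy s) (\<lambda>i. op Y K (?w i) \<rho>)"
    unfolding ev.simps r using 2(1) by (simp add: itp_of_fth del: restrict_apply) simp
  also have "\<dots> = op Y K (itp (Fr K) s ?w) \<rho>"
    using op_itp_Fr[OF Y K 2(1) w \<rho>'] by simp
  finally show ?case using itp_in[OF Fr_model[OF K] 2(1) w] by simp
qed

lemma of_fth_model: "Md Y \<Longrightarrow> eqn_model E (of_fth Y)"
  unfolding eqn_model_def
proof (intro conjI ballI, goal_cases)
  case 1 then show ?case by (rule is_alg_of_fth)
next
  case (2 q)
  obtain K a b where q: "q = (K, a, b)" by (cases q)
  have K: "small K" and ab: "is_trm (syms E) (arity E) K a" "is_trm (syms E) (arity E) K b"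
    using E 2(2) unfolding q equational_theory_def by auto
  have "ev (arity E) (Fr K) (\<eta> K) a = ev (arity E) (Fr K) (\<eta> K) b"
    using Fr_model[OF K] \<eta>_in[OF K] 2(2) unfolding q eqn_model_def by auto
  then have "ev (arity E) (of_fth Y) \<rho> a = ev (arity E) (of_fth Y) \<rho> b" if "\<rho> \<in> K \<rightarrow>\<^sub>E car Y" for \<rho>
    using ev_of_fth[OF 2(1) K that ab(1)] ev_of_fth[OF 2(1) K that ab(2)] by simp
  then show ?case by (simp add: q)
qed

lemma of_to_fth: assumes X: "eqn_model E X" shows "of_fth (to_fth X) = X"
proof (rule alg_eqI)
  show "is_alg (syms E) (arity E) (of_fth (to_fth X))" by (rule is_alg_of_fth[OF to_fth_model[OF X]])
  show "is_alg (syms E) (arity E) X" using X by (simp add: eqn_model_def)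
  fix s x assume s: "s \<in> syms E" and "x \<in> arity E s \<rightarrow>\<^sub>E car (of_fth (to_fth X))"
  then have x: "x \<in> arity E s \<rightarrow>\<^sub>E car X" by simp
  have "op (to_fth X) (arity E s) (sy s) x = ext (arity E s) X (restrict x (arity E s)) (sy s)"
    using s x by (intro op_to_fth small_arity sy_in) auto
  then show "itp (of_fth (to_fth X)) s x = itp X s x"
    using s x by (simp add: itp_of_fth itp_eq_ext[OF X s x] PiE_restrict)
qed simp

lemma to_of_fth: assumes Y: "Md Y" shows "to_fth (of_fth Y) = Y"
proof (rule theory_model_eqI[OF to_fth_model[OF of_fth_model[OF Y]] Y])
  fix I t x assume I: "small I" and "t \<in> opn fth I" and "\<And>i. i \<in> I \<Longrightarrow> x i \<in> car (to_fth (of_fth Y))"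
  then have t: "t \<in> car (Fr I)" and x: "\<And>i. i \<in> I \<Longrightarrow> x i \<in> car Y" by auto
  \<comment> \<open>By freeness it suffices that evaluation at \<open>x\<close> is a homomorphism
    with the same values on the generators.\<close>
  have "ext I (of_fth Y) (restrict x I) = (\<lambda>t\<in>car (Fr I). op Y I t x)"
  proof (rule ext_unique[OF I of_fth_model[OF Y]])
    show "eh (Fr I) (of_fth Y) (\<lambda>t\<in>car (Fr I). op Y I t x)"
      unfolding alg_hom_def
    proof (intro conjI ballI)
      show "(\<lambda>t\<in>car (Fr I). op Y I t x) \<in> car (Fr I) \<rightarrow>\<^sub>E car (of_fth Y)"
        using x Y I by (auto intro!: op_in)
      fix s w assume s: "s \<in> syms E" and w: "w \<in> arity E s \<rightarrow>\<^sub>E car (Fr I)"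
      have w': "w i \<in> car (Fr I)" if "i \<in> arity E s" for i using w that by auto
      have "(\<lambda>i\<in>arity E s. (\<lambda>t\<in>car (Fr I). op Y I t x) (w i)) \<in> arity E s \<rightarrow>\<^sub>E car Y"
        using w' x Y I by (auto intro!: op_in)
      then show "(\<lambda>t\<in>car (Fr I). op Y I t x) (itp (Fr I) s w) =
         itp (of_fth Y) s (\<lambda>i\<in>arity E s. (\<lambda>t\<in>car (Fr I). op Y I t x) (w i))"
        using s w' itp_in[OF Fr_model[OF I] s w] op_itp_Fr[OF Y I s w x] by (simp add: itp_of_fth)
    qed
    fix k assume k: "k \<in> I"
    then have "\<eta> I k \<in> car (Fr I)" using \<eta>_in[OF I] by auto
    then show "(\<lambda>t\<in>car (Fr I). op Y I t x) (\<eta> I k) = restrict x I k"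
      using k op_pro[OF Y I k x] by simp
  qed (use x in auto)
  then show "op (to_fth (of_fth Y)) I t x = op Y I t x"
    using t op_to_fth[OF I t, of x "of_fth Y"] x by simp
qed simp

text \<open>Both constructions keep carriers and functions and are mutually inverse; the variety is
  thus isomorphic, not just equivalent, to the category of models of \<open>fth\<close>.\<close>

lemma conc_iso_fth: "conc_iso (eqn_Mod E) (theory_Mod fth) to_fth of_fth"
  unfolding conc_iso_def conc_map_def
proof (intro conjI ballI subsetI)
  fix X Y f assume "X \<in> cob (eqn_Mod E)" "Y \<in> cob (eqn_Mod E)" "f \<in> chom (eqn_Mod E) X Y"
  then have X: "eqn_model E X" and Y: "eqn_model E Y" and f: "eh X Y f" by (auto simp: eqn_Mod_def)
  have "thom fth (to_fth X) (to_fth Y) f"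
  proof (rule thomI)
    fix I t x assume I: "small I" and t: "t \<in> opn fth I" and "\<And>i. i \<in> I \<Longrightarrow> x i \<in> car (to_fth X)"
    then have x: "restrict x I \<in> I \<rightarrow>\<^sub>E car X" "\<And>i. i \<in> I \<Longrightarrow> x i \<in> car X" by auto
    have "(\<lambda>k\<in>I. f (restrict x I k)) = (\<lambda>k\<in>I. f (x k))" by (rule restrict_ext) simp
    then show "f (op (to_fth X) I t x) = op (to_fth Y) I t (\<lambda>i. f (x i))"
      using eh_ext_comp[OF I X Y x(1) f, of t] I t x alg_homD(2)[OF f] by (simp add: op_to_fth)
  qed (use alg_homD[OF f] in \<open>auto simp: PiE_def\<close>)
  then show "f \<in> chom (theory_Mod fth) (to_fth X) (to_fth Y)" by simp
next
  fix X Y f assume "X \<in> cob (theory_Mod fth)" "Y \<in> cob (theory_Mod fth)" "f \<in> chom (theory_Mod fth) X Y"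
  then have X: "Md X" and Y: "Md Y" and f: "thom fth X Y f" by auto
  have "eh (of_fth X) (of_fth Y) f"
    unfolding alg_hom_def
  proof (intro conjI ballI)
    show "f \<in> car (of_fth X) \<rightarrow>\<^sub>E car (of_fth Y)" using f by (simp add: thom_iff)
    fix s x assume s: "s \<in> syms E" and "x \<in> arity E s \<rightarrow>\<^sub>E car (of_fth X)"
    then have x: "x \<in> arity E s \<rightarrow>\<^sub>E car X" "\<And>i. i \<in> arity E s \<Longrightarrow> x i \<in> car X" by auto
    have "(\<lambda>i\<in>arity E s. f (x i)) \<in> arity E s \<rightarrow>\<^sub>E car Y" using x(2) thom_in[OF f] by auto
    moreover have "f (op X (arity E s) (sy s) x) = op Y (arity E s) (sy s) (\<lambda>i. f (x i))"
      using s x(2) by (intro thom_op[OF f]) (simp_all add: small_arity sy_in)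
    ultimately show "f (itp (of_fth X) s x) = itp (of_fth Y) s (\<lambda>i\<in>arity E s. f (x i))"
      using s x by (simp add: itp_of_fth)
  qed
  then show "f \<in> chom (eqn_Mod E) (of_fth X) (of_fth Y)" by (simp add: eqn_Mod_def)
qed (auto simp: eqn_Mod_def to_fth_model of_fth_model to_of_fth of_to_fth)

end

lemma variety_theory:
  fixes C :: "('u::universe alg, 'u) conc"
  assumes "variety C"
  obtains T :: "'u alg_theory" and fo go where "algebraic_theory T" "conc_iso C (theory_Mod T) fo go"
proof -
  obtain E where E: "equational_theory E" and C: "C = eqn_Mod E" and fr: "has_free_objects C"
    using assms by (auto simp: variety_def)
  define P where "P K F \<eta> \<longleftrightarrow> eqn_model E F \<and> \<eta> \<in> K \<rightarrow>\<^sub>E car F \<and>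
      (\<forall>X f. eqn_model E X \<longrightarrow> f \<in> K \<rightarrow>\<^sub>E car X \<longrightarrow>
        (\<exists>!g. alg_hom (syms E) (arity E) F X g \<and> (\<forall>k\<in>K. g (\<eta> k) = f k)))"
    for K :: "'u set" and F \<eta>
  have "\<exists>F \<eta>. P K F \<eta>" if K: "small K" for K :: "'u set"
  proof -
    obtain F where F: "F \<in> cob C" "\<exists>\<eta> \<in> K \<rightarrow>\<^sub>E und C F. \<forall>X\<in>cob C. \<forall>f \<in> K \<rightarrow>\<^sub>E und C X.
        \<exists>!g. g \<in> chom C F X \<and> (\<forall>k\<in>K. g (\<eta> k) = f k)"
      using fr[unfolded has_free_objects_def, rule_format, OF K] by (rule bexE)
    obtain \<eta> where "\<eta> \<in> K \<rightarrow>\<^sub>E und C F" "\<forall>X\<in>cob C. \<forall>f \<in> K \<rightarrow>\<^sub>E und C X.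
        \<exists>!g. g \<in> chom C F X \<and> (\<forall>k\<in>K. g (\<eta> k) = f k)"
      using F(2) by (rule bexE)
    then have "P K F \<eta>" using F(1) unfolding P_def C eqn_Mod_def by simp
    then show ?thesis by blast
  qed
  then obtain Fr \<eta> where "\<And>K :: 'u set. small K \<Longrightarrow> P K (Fr K) (\<eta> K)" by metis
  then interpret free_objects E Fr \<eta> using E unfolding P_def by unfold_locales blast+
  show ?thesis using that[OF algebraic_fth] conc_iso_fth C by blast
qed

lemma nondegenerate_if_variety:
  fixes T :: "'u::universe alg_theory"
  assumes "algebraic_theory T" "nondegenerate_variety (theory_Mod T)" shows "nondegenerate T"
  unfolding nondegenerate_def
proof
  interpret alg_th T by unfold_locales fact
  have f: "num 1 \<in> (fin 2 :: 'u set)" "num 2 \<in> (fin 2 :: 'u set)" by (auto simp: fin_def)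
  assume e: "pro T (fin 2) (num 1) = pro T (fin 2) (num 2)"
  obtain X x y where X: "Md X" and xy: "x \<in> car X" "y \<in> car X" "x \<noteq> y"
    using assms(2) by (auto simp: nondegenerate_variety_def)
  let ?f = "\<lambda>k :: 'u. if k = num 1 then x else y"
  have "op X (fin 2) (pro T (fin 2) (num 1)) ?f = x" "op X (fin 2) (pro T (fin 2) (num 2)) ?f = y"
    using op_pro[OF X small_fin f(1), of ?f] op_pro[OF X small_fin f(2), of ?f] xy by auto
  then show False using e xy by simp
qed

lemma ess_surjective_theory_Mod:
  "ess_surjective (HAffUn :: ('u::universe alg_theory, 'u theory_map) cat) (op_cat ccVar) theory_Mod_functor"
  unfolding ess_surjective_def
proof
  fix C :: "('u alg, 'u) conc" assume "C \<in> Ob (op_cat ccVar)"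
  then have C: "concrete_category C" "variety C" "nondegenerate_variety C" "cartesian_closed (cat_of C)" by auto
  obtain T :: "'u alg_theory" and fo go where T: "algebraic_theory T" and i: "conc_iso C (theory_Mod T) fo go"
    using variety_theory[OF C(2)] .
  interpret alg_th T by unfold_locales fact
  have "hyperaffine_unary T"
    using conc_iso_cartesian_closed[OF i concrete_category_theory_Mod C(4)]
    by (simp add: cartesian_closed_iff_hyperaffine_unary)
  moreover have "nondegenerate T"
    using nondegenerate_if_variety[OF T conc_iso_nondegenerate[OF i C(3)]] .
  moreover have "isomorphic Conc (theory_Mod T) C"
    by (rule isomorphic_ConcI[OF concrete_category_theory_Mod C(1) conc_iso_sym[OF i]])
  ultimately show "\<exists>T\<in>Ob (HAffUn :: ('u alg_theory, 'u theory_map) cat).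
      isomorphic (op_cat ccVar) (fob theory_Mod_functor T) C"
    by auto
qed

section \<open>Finitary varieties\<close>

context alg_th
begin

text \<open>A support is a finite subset of the arity itself instead of a map from some
  \<open>fin n\<close>, so supports can be united and enlarged without enumeration.\<close>

definition supported :: "'u set \<Rightarrow> 'u set \<Rightarrow> 'u \<Rightarrow> 'u \<Rightarrow> bool" where
  "supported I J w t \<longleftrightarrow> finite J \<and> J \<subseteq> I \<and> w \<in> opn T J \<and> t = op (F I) J w (pro T I)"

lemma supported_op:
  assumes "supported I J w t" "small I" "Md X" "\<And>i. i \<in> I \<Longrightarrow> x i \<in> car X"
  shows "op X I t x = op X J w x"
proof -
  have J: "small J" "\<And>j. j \<in> J \<Longrightarrow> j \<in> I" using assms by (auto simp: supported_def small_finite)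
  have "op X I (op (F I) J w (pro T I)) x = op X J w (\<lambda>j. op X I (pro T I j) x)"
    using assms J by (intro op_op) (auto simp: supported_def pro_opn)
  also have "\<dots> = op X J w x" using assms J by (intro op_cong op_pro) auto
  finally show ?thesis using assms by (simp add: supported_def)
qed

lemma supported_pro: "\<lbrakk>small I; i \<in> I\<rbrakk> \<Longrightarrow> supported I {i} (pro T {i} i) (pro T I i)"
proof -
  assume i: "small I" "i \<in> I"
  then have "op (F I) {i} (pro T {i} i) (pro T I) = pro T I i"
    by (intro op_F_pro) (auto simp: small_finite pro_opn)
  then show ?thesis using i by (simp add: supported_def small_finite pro_opn)
qed

text \<open>A map from \<open>fin n\<close> is replaced by its image, arguments being identified
  along the map; conversely a finite support is enumerated.\<close>

lemma finitary_iff: "finitary T \<longleftrightarrow> (\<forall>I. small I \<longrightarrow> (\<forall>t\<in>opn T I. \<exists>J w. supported I J w t))"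
proof -
  have "(\<exists>n. \<exists>s \<in> fin n \<rightarrow> I. \<exists>u \<in> opn T (fin n). \<forall>K. small K \<longrightarrow> (\<forall>x \<in> I \<rightarrow>\<^sub>E opn T K.
         subst T I K t x = subst T (fin n) K u (\<lambda>k\<in>fin n. x (s k)))) \<longleftrightarrow> (\<exists>J w. supported I J w t)"
    (is "?L \<longleftrightarrow> ?R") if I: "small I" and t: "t \<in> opn T I" for I t
  proof
    assume ?L
    then obtain n s u where s: "\<And>k. k \<in> fin n \<Longrightarrow> s k \<in> I" and u: "u \<in> opn T (fin n)"
      and eq: "\<And>K x. \<lbrakk>small K; x \<in> I \<rightarrow>\<^sub>E opn T K\<rbrakk> \<Longrightarrow> subst T I K t x = subst T (fin n) K u (\<lambda>k\<in>fin n. x (s k))"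
      by blast
    let ?J = "s ` fin n"
    have J: "small ?J" "?J \<subseteq> I" using s by (auto simp: small_finite)
    let ?w = "op (F ?J) (fin n) u (\<lambda>k. pro T ?J (s k))"
    have "t = subst T (fin n) I u (\<lambda>k\<in>fin n. restrict (pro T I) I (s k))"
      using eq[OF I, of "restrict (pro T I) I"] I t by (simp add: pro_opn subst_pro)
    also have "(\<lambda>k\<in>fin n. restrict (pro T I) I (s k)) = (\<lambda>k\<in>fin n. pro T I (s k))"
      using s by (intro restrict_ext) simp
    also have "subst T (fin n) I u (\<lambda>k\<in>fin n. pro T I (s k)) = op (F I) (fin n) u (\<lambda>k. pro T I (s k))"
      using u s I by (intro op_F[symmetric]) (simp_all add: pro_opn)
    finally have "t = op (F I) (fin n) u (\<lambda>k. pro T I (s k))" .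
    also have "\<dots> = op (F I) ?J ?w (pro T I)"
    proof -
      have pI: "\<And>j. j \<in> ?J \<Longrightarrow> pro T I j \<in> opn T I" using s I by (auto simp: pro_opn)
      have pJ: "\<And>k. k \<in> fin n \<Longrightarrow> pro T ?J (s k) \<in> opn T ?J" using J by (simp add: pro_opn)
      have "op (F I) ?J ?w (pro T I) = op (F I) (fin n) u (\<lambda>k. op (F I) ?J (pro T ?J (s k)) (pro T I))"
        using u I J pI pJ by (intro op_op) (simp_all add: F_model)
      also have "\<dots> = op (F I) (fin n) u (\<lambda>k. pro T I (s k))"
        using I J pI by (intro op_cong op_F_pro) simp_all
      finally show ?thesis by simp
    qed
    finally have "supported I ?J ?w t"
      using u J by (simp add: supported_def op_F_in pro_opn)
    then show ?R by blast
  next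
    assume ?R
    then obtain J w where sp: "supported I J w t" by blast
    then have J: "finite J" "J \<subseteq> I" "small J" and w: "w \<in> opn T J" by (auto simp: supported_def small_finite)
    obtain e :: "'u \<Rightarrow> 'u" where e: "bij_betw e (fin (card J)) J" using finite_bij_fin[OF J(1)] .
    let ?n = "card J"
    let ?i = "inv_into (fin ?n) e"
    have i: "?i j \<in> fin ?n" "e (?i j) = j" if "j \<in> J" for j
      using e that by (auto simp: bij_betw_def inv_into_into f_inv_into_f)
    have ei: "e k \<in> J" if "k \<in> fin ?n" for k using e that by (auto simp: bij_betw_def)
    let ?u = "op (F (fin ?n)) J w (\<lambda>j. pro T (fin ?n) (?i j))"
    have u: "?u \<in> opn T (fin ?n)" using J w i by (intro op_F_in) (simp_all add: pro_opn)
    have "subst T I K t x = subst T (fin ?n) K ?u (\<lambda>k\<in>fin ?n. x (e k))"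
      if K: "small K" and "x \<in> I \<rightarrow>\<^sub>E opn T K" for K x
    proof -
      have x: "\<And>i. i \<in> I \<Longrightarrow> x i \<in> opn T K" and r: "restrict x I = x" using that by (auto simp: PiE_restrict)
      have xe: "\<And>k. k \<in> fin ?n \<Longrightarrow> x (e k) \<in> opn T K" using x ei J by auto
      have "subst T I K t x = op (F K) I t x" using I t x r by (simp add: op_F)
      also have "\<dots> = op (F K) J w x" using supported_op[OF sp I F_model[OF K]] x by simp
      also have "\<dots> = op (F K) J w (\<lambda>j. op (F K) (fin ?n) (pro T (fin ?n) (?i j)) (\<lambda>k. x (e k)))"
        using i K xe by (intro op_cong) (simp add: op_F_pro)
      also have "\<dots> = op (F K) (fin ?n) ?u (\<lambda>k. x (e k))"
        using J w i K xe by (intro op_op[symmetric]) (simp_all add: F_model pro_opn)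
      also have "\<dots> = subst T (fin ?n) K ?u (\<lambda>k\<in>fin ?n. x (e k))"
        using u xe by (intro op_F) simp_all
      finally show ?thesis .
    qed
    moreover have "e \<in> fin ?n \<rightarrow> I" using ei J by auto
    ultimately show ?L using u by blast
  qed
  then show ?thesis unfolding finitary_def by (simp cong: ball_cong)
qed

lemma supported_enlarge:
  assumes "supported I J w t" "finite L" "J \<subseteq> L" "L \<subseteq> I" "small I"
  shows "supported I L (op (F L) J w (pro T L)) t"
proof -
  have J: "small J" "small L" and w: "w \<in> opn T J" and t: "t = op (F I) J w (pro T I)"
    using assms by (auto simp: supported_def small_finite intro: finite_subset)
  have "op (F I) L (op (F L) J w (pro T L)) (pro T I) = op (F I) J w (\<lambda>j. op (F I) L (pro T L j) (pro T I))"
    using assms J w by (intro op_op) (auto simp: F_model pro_opn)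
  also have "\<dots> = t" unfolding t using assms J by (intro op_cong op_F_pro) (auto simp: pro_opn)
  finally have "op (F I) L (op (F L) J w (pro T L)) (pro T I) = t" .
  moreover have "op (F L) J w (pro T L) \<in> opn T L"
    using J w assms(3) by (intro op_F_in) (auto simp: pro_opn)
  ultimately show ?thesis using assms by (simp add: supported_def)
qed

lemma supported_family:
  assumes A: "finite A" and I: "small I" and v: "\<And>a. a \<in> A \<Longrightarrow> \<exists>J w. supported I J w (v a)"
  shows "\<exists>J w. finite J \<and> J \<subseteq> I \<and> (\<forall>a\<in>A. supported I J (w a) (v a))"
proof -
  obtain J w where s: "\<And>a. a \<in> A \<Longrightarrow> supported I (J a) (w a) (v a)" using v by metis
  let ?L = "\<Union>a\<in>A. J a"
  have "finite ?L" "?L \<subseteq> I" using s A by (auto simp: supported_def)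
  moreover have "supported I ?L (op (F ?L) (J a) (w a) (pro T ?L)) (v a)" if "a \<in> A" for a
    using that calculation I by (intro supported_enlarge[OF s]) auto
  ultimately show ?thesis by (intro exI[of _ ?L] exI[of _ "\<lambda>a. op (F ?L) (J a) (w a) (pro T ?L)"]) simp
qed

text \<open>The arities are all finite subsets of the universe, not only the sets
  \<open>fin n\<close>, so that the supports of an operation are arities of this signature.\<close>

definition fin_eqns :: "'u eqn_theory" where
  "fin_eqns = \<lparr>syms = {OpSym I t | I t. finite I \<and> t \<in> opn T I}, arity = sym_arity,
     eqns = {(I, App (OpSym I (pro T I i)) Var, Var i) | I i. finite I \<and> i \<in> I} \<union>
       {(J, App (OpSym J (subst T I J t u)) Var, App (OpSym I t) (\<lambda>i. App (OpSym J (u i)) Var)) | I J t u.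
          finite I \<and> finite J \<and> t \<in> opn T I \<and> u \<in> I \<rightarrow>\<^sub>E opn T J}\<rparr>"

lemma syms_fin_eqns [simp]: "OpSym I t \<in> syms fin_eqns \<longleftrightarrow> finite I \<and> t \<in> opn T I"
  and arity_fin_eqns [simp]: "arity fin_eqns = sym_arity"
  by (auto simp: fin_eqns_def)

lemma syms_fin_eqnsE:
  assumes "s \<in> syms fin_eqns" obtains I t where "s = OpSym I t" "finite I" "t \<in> opn T I"
  using assms by (auto simp: fin_eqns_def)

lemma equational_fin_eqns: "equational_theory fin_eqns"
  unfolding equational_theory_def
proof (intro conjI)
  have "syms fin_eqns \<subseteq> theory_syms T"
    by (auto elim!: syms_fin_eqnsE simp: small_finite)
  then have "|syms fin_eqns| \<le>o |theory_syms T|" by (rule card_of_mono1)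
  also have "|theory_syms T| \<le>o |UNIV :: 'u set|" using card_OpSyms by (simp add: theory_syms_def)
  finally show "|syms fin_eqns| \<le>o |UNIV :: 'u set|" .
  show "\<forall>s\<in>syms fin_eqns. small (arity fin_eqns s)"
    by (auto elim!: syms_fin_eqnsE simp: small_finite)
  show "\<forall>(K, a, b)\<in>eqns fin_eqns. small K \<and>
     is_trm (syms fin_eqns) (arity fin_eqns) K a \<and> is_trm (syms fin_eqns) (arity fin_eqns) K b"
    by (auto simp: fin_eqns_def pro_opn subst_opn small_finite intro!: is_trm.intros)
qed

lemma eqn_model_fin_eqns: "eqn_model fin_eqns Y \<longleftrightarrow> is_alg (syms fin_eqns) sym_arity Y \<and>
     (\<forall>I i x. finite I \<and> i \<in> I \<longrightarrow> x \<in> I \<rightarrow>\<^sub>E car Y \<longrightarrow> itp Y (OpSym I (pro T I i)) x = x i) \<and>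
     (\<forall>I J t u x. finite I \<and> finite J \<and> t \<in> opn T I \<and> u \<in> I \<rightarrow>\<^sub>E opn T J \<longrightarrow> x \<in> J \<rightarrow>\<^sub>E car Y \<longrightarrow>
        itp Y (OpSym J (subst T I J t u)) x = itp Y (OpSym I t) (\<lambda>i\<in>I. itp Y (OpSym J (u i)) x))"
  unfolding eqn_model_def fin_eqns_def eqn_theory.simps
    ball_Un ball_Collect2 ball_Collect4 prod.case ev.simps sym_arity.simps
  by (auto simp: restrict_PiE_self)

lemma
  assumes Y: "eqn_model fin_eqns Y"
  shows fin_op_in: "\<lbrakk>finite I; t \<in> opn T I; \<And>i. i \<in> I \<Longrightarrow> x i \<in> car Y\<rbrakk> \<Longrightarrow> op Y I t x \<in> car Y"
    and fin_op_pro: "\<lbrakk>finite I; i \<in> I; \<And>i. i \<in> I \<Longrightarrow> x i \<in> car Y\<rbrakk> \<Longrightarrow> op Y I (pro T I i) x = x i"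
    and fin_op_op: "\<lbrakk>finite I; finite J; t \<in> opn T I; \<And>i. i \<in> I \<Longrightarrow> u i \<in> opn T J; \<And>j. j \<in> J \<Longrightarrow> x j \<in> car Y\<rbrakk>
      \<Longrightarrow> op Y J (op (F J) I t u) x = op Y I t (\<lambda>i. op Y J (u i) x)"
proof -
  show "op Y I t x \<in> car Y" if "finite I" "t \<in> opn T I" "\<And>i. i \<in> I \<Longrightarrow> x i \<in> car Y" for I t x
    unfolding op_def using Y that by (intro is_alg_itp[of "syms fin_eqns" sym_arity]) (auto simp: eqn_model_fin_eqns)
  show "op Y I (pro T I i) x = x i" if "finite I" "i \<in> I" "\<And>i. i \<in> I \<Longrightarrow> x i \<in> car Y" for I i x
  proof -
    have "restrict x I \<in> I \<rightarrow>\<^sub>E car Y" using that by auto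
    then have "itp Y (OpSym I (pro T I i)) (restrict x I) = restrict x I i"
      using Y that(1,2) unfolding eqn_model_fin_eqns by blast
    then show ?thesis using that(2) by (simp add: op_def)
  qed
  show "op Y J (op (F J) I t u) x = op Y I t (\<lambda>i. op Y J (u i) x)"
    if h: "finite I" "finite J" "t \<in> opn T I" and u: "\<And>i. i \<in> I \<Longrightarrow> u i \<in> opn T J" and x: "\<And>j. j \<in> J \<Longrightarrow> x j \<in> car Y"
    for I J t u x
  proof -
    have "restrict u I \<in> I \<rightarrow>\<^sub>E opn T J" "restrict x J \<in> J \<rightarrow>\<^sub>E car Y" using u x by auto
    then have "itp Y (OpSym J (subst T I J t (restrict u I))) (restrict x J)
      = itp Y (OpSym I t) (\<lambda>i\<in>I. itp Y (OpSym J (restrict u I i)) (restrict x J))"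
      using h Y[unfolded eqn_model_fin_eqns, THEN conjunct2, THEN conjunct2, rule_format,
          of I J t "restrict u I" "restrict x J"] by simp
    moreover have "(\<lambda>i\<in>I. itp Y (OpSym J (restrict u I i)) (restrict x J)) = (\<lambda>i\<in>I. op Y J (u i) x)"
      by (rule restrict_ext) (simp add: op_def)
    ultimately show ?thesis
      using h u by (simp add: op_F small_finite) (simp add: op_def)
  qed
qed

text \<open>Both supports are enlarged to one finite \<open>L\<close>. Retracting the arity
  \<open>I\<close> onto \<open>L\<close> turns \<open>t\<close> into an operation of arity
  \<open>L\<close> that equals both enlargements, so the comparison takes place in finite arities,
  where the laws of \<open>Y\<close> apply.\<close>

lemma supported_unique:
  assumes Y: "eqn_model fin_eqns Y" and I: "small I"
    and s: "supported I J w t" "supported I J' w' t" and x: "\<And>i. i \<in> I \<Longrightarrow> x i \<in> car Y"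
  shows "op Y J w x = op Y J' w' x"
proof -
  \<comment> \<open>The extra element keeps \<open>L\<close> nonempty whenever \<open>I\<close> is,
    so that the retraction \<open>r\<close> has a value for indices outside
    \<open>L\<close>.\<close>
  define L where "L = J \<union> J' \<union> (if I = {} then {} else {SOME i. i \<in> I})"
  have "(SOME i. i \<in> I) \<in> I" if "I \<noteq> {}" using that by (simp add: some_in_eq)
  then have L: "finite L" "L \<subseteq> I" "J \<subseteq> L" "J' \<subseteq> L" and ne: "I \<noteq> {} \<Longrightarrow> L \<noteq> {}"
    using s by (auto simp: L_def supported_def)
  define r where "r i = (if i \<in> L then i else (SOME l. l \<in> L))" for i
  have r: "r i \<in> L" if "i \<in> I" for i using ne that by (auto simp: r_def some_in_eq)
  have sL: "small L" using L by (simp add: small_finite)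
  have "op (F L) I t (\<lambda>i. pro T L (r i)) = op (F L) J w (pro T L)" if "supported I J w t" "J \<subseteq> L" for J w
  proof -
    have "op (F L) I t (\<lambda>i. pro T L (r i)) = op (F L) J w (\<lambda>i. pro T L (r i))"
      using that I r sL by (intro supported_op) (simp_all add: F_model pro_opn)
    also have "\<dots> = op (F L) J w (pro T L)" using that by (intro op_cong) (auto simp: r_def)
    finally show ?thesis .
  qed
  then have e: "op (F L) J w (pro T L) = op (F L) J' w' (pro T L)" using s L by metis
  have "op Y L (op (F L) J w (pro T L)) x = op Y J w x" if "supported I J w t" "J \<subseteq> L" for J w
  proof -
    have h: "finite J" "w \<in> opn T J" and jl: "\<And>j. j \<in> J \<Longrightarrow> j \<in> L" using that by (auto simp: supported_def)
    have xl: "\<And>l. l \<in> L \<Longrightarrow> x l \<in> car Y" using x L by auto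
    have "op Y L (op (F L) J w (pro T L)) x = op Y J w (\<lambda>j. op Y L (pro T L j) x)"
      using h L sL jl xl by (intro fin_op_op[OF Y]) (simp_all add: pro_opn)
    also have "\<dots> = op Y J w x" using L jl xl by (intro op_cong fin_op_pro[OF Y]) simp_all
    finally show ?thesis .
  qed
  then show ?thesis using e s L by metis
qed

text \<open>The finitary operations determine the others: \<open>t\<close> acts through any of its
  supports, and \<open>supported_unique\<close> makes the choice irrelevant. Forgetting the
  infinitary operations and restoring them in this way are mutually inverse.\<close>

lemma finitary_variety_if_finitary:
  assumes fin: "finitary T" shows "finitary_variety (theory_Mod T)"
proof -
  have "\<exists>p. supported I (fst p) (snd p) t" if "small I" "t \<in> opn T I" for I t
    using fin that by (auto simp: finitary_iff)
  then obtain p where p: "\<And>I t. \<lbrakk>small I; t \<in> opn T I\<rbrakk> \<Longrightarrow> supported I (fst (p I t)) (snd (p I t)) t"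
    by metis
  define val where "val Y I t x = op Y (fst (p I t)) (snd (p I t)) x" for Y I t x
  have val: "val Y I t x = op Y J w x"
    if "eqn_model fin_eqns Y" "small I" "supported I J w t" "\<And>i. i \<in> I \<Longrightarrow> x i \<in> car Y" for Y I J w t x
  proof -
    have "t \<in> opn T I" using that by (auto simp: supported_def intro!: op_F_in pro_opn small_finite)
    then show ?thesis unfolding val_def using supported_unique[OF that(1,2) p that(3)] that by blast
  qed
  define up where "up Y = mk_alg T (car Y) (val Y)" for Y
  have op_up: "op (up Y) I t x = op Y J w x"
    if "eqn_model fin_eqns Y" "small I" "supported I J w t" "\<And>i. i \<in> I \<Longrightarrow> x i \<in> car Y" for Y I J w t x
  proof -
    have "t \<in> opn T I" using that by (auto simp: supported_def intro!: op_F_in pro_opn small_finite)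
    then have "op (up Y) I t x = val Y I t (restrict x I)"
      unfolding up_def using that by (intro op_mk_alg)
    also have "\<dots> = op Y J w (restrict x I)" using that by (intro val) simp_all
    also have "\<dots> = op Y J w x" using that(3) by (intro op_cong) (auto simp: supported_def)
    finally show ?thesis .
  qed
  have up_model: "Md (up Y)" if Y: "eqn_model fin_eqns Y" for Y
    unfolding up_def
  proof (rule theory_model_mk_alg)
    show "small (car Y)" using Y by (simp add: eqn_model_def is_alg_def)
    fix I t x assume h: "small I" "t \<in> opn T I" "x \<in> I \<rightarrow>\<^sub>E car Y"
    have "finite (fst (p I t))" "fst (p I t) \<subseteq> I" "snd (p I t) \<in> opn T (fst (p I t))"
      using p[OF h(1,2)] by (auto simp: supported_def)
    then show "val Y I t x \<in> car Y" unfolding val_def using h(3) by (intro fin_op_in[OF Y]) auto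
  next
    fix I :: "'u set" and i x assume h: "small I" "i \<in> I" "x \<in> I \<rightarrow>\<^sub>E car Y"
    then have x: "\<And>i. i \<in> I \<Longrightarrow> x i \<in> car Y" by auto
    have "supported I {i} (pro T {i} i) (pro T I i)" using h by (intro supported_pro)
    then have "val Y I (pro T I i) x = op Y {i} (pro T {i} i) x" using x by (intro val[OF Y h(1)])
    also have "\<dots> = x i" using x h by (intro fin_op_pro[OF Y]) simp_all
    finally show "val Y I (pro T I i) x = x i" .
  next
    fix I J t u x assume h: "small I" "small J" "t \<in> opn T I" "u \<in> I \<rightarrow>\<^sub>E opn T J" "x \<in> J \<rightarrow>\<^sub>E car Y"
    have u: "\<And>i. i \<in> I \<Longrightarrow> u i \<in> opn T J" and x: "\<And>j. j \<in> J \<Longrightarrow> x j \<in> car Y" and ur: "restrict u I = u"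
      using h by (auto simp: PiE_restrict)
    obtain I0 t0 where t0: "supported I I0 t0 t" using p h by blast
    then have I0: "finite I0" "small I0" "t0 \<in> opn T I0" and I0I: "\<And>i. i \<in> I0 \<Longrightarrow> i \<in> I"
      by (auto simp: supported_def small_finite)
    \<comment> \<open>Only the finitely many \<open>u i\<close> with \<open>i\<close> in the support
      \<open>I0\<close> of \<open>t\<close> matter, and one finite \<open>J0\<close> supports all of
      them; composing on these supports yields a support of the composite.\<close>
    obtain J0 w where J0: "finite J0" "J0 \<subseteq> J" and w: "\<And>i. i \<in> I0 \<Longrightarrow> supported J J0 (w i) (u i)"
      using supported_family[OF I0(1) h(2), of u] p h(2) u I0I by metis
    have w_in: "w i \<in> opn T J0" "u i = op (F J) J0 (w i) (pro T J)" if "i \<in> I0" for i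
      using w[OF that] by (auto simp: supported_def)
    have J0': "small J0" "\<And>j. j \<in> J0 \<Longrightarrow> j \<in> J" using J0 by (auto simp: small_finite)
    have "subst T I J t u = op (F J) I t u" using h u by (simp add: op_F ur)
    also have "\<dots> = op (F J) I0 t0 u" using t0 h u by (intro supported_op) (simp_all add: F_model)
    also have "\<dots> = op (F J) I0 t0 (\<lambda>i. op (F J) J0 (w i) (pro T J))" using w_in by (intro op_cong) blast
    also have "\<dots> = op (F J) J0 (op (F J0) I0 t0 w) (pro T J)"
      using I0 J0' h w_in by (intro op_op[symmetric]) (simp_all add: F_model pro_opn)
    finally have "supported J J0 (op (F J0) I0 t0 w) (subst T I J t u)"
      using J0 J0' I0 w_in by (simp add: supported_def op_F_in)
    then have "val Y J (subst T I J t u) x = op Y J0 (op (F J0) I0 t0 w) x" using h x by (intro val[OF Y])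
    also have "\<dots> = op Y I0 t0 (\<lambda>i. op Y J0 (w i) x)"
      using J0 J0' I0 w_in x by (intro fin_op_op[OF Y]) simp_all
    also have "\<dots> = op Y I0 t0 (\<lambda>i\<in>I. val Y J (u i) x)"
      using I0I x h by (intro op_cong) (simp add: val[OF Y _ w])
    also have "\<dots> = val Y I t (\<lambda>i\<in>I. val Y J (u i) x)"
    proof (intro val[OF Y h(1) t0, symmetric])
      fix i assume i: "i \<in> I"
      have q: "finite (fst (p J (u i)))" "fst (p J (u i)) \<subseteq> J" "snd (p J (u i)) \<in> opn T (fst (p J (u i)))"
        using p[OF h(2) u[OF i]] by (auto simp: supported_def)
      then show "(\<lambda>i\<in>I. val Y J (u i) x) i \<in> car Y"
        using i x by (simp add: val_def) (intro fin_op_in[OF Y], auto)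
    qed
    finally show "val Y J (subst T I J t u) x = val Y I t (\<lambda>i\<in>I. val Y J (u i) x)" .
  qed
  let ?d = "reduct (syms fin_eqns) (\<lambda>s. s)"
  have op_d: "op (?d X) I t x = op X I t x" if "finite I" "t \<in> opn T I" for X I t x
    using that by (intro op_reduct) simp_all
  have itp_d: "itp (?d X) (OpSym I t) x = op X I t x" if "finite I" "t \<in> opn T I" "x \<in> I \<rightarrow>\<^sub>E car X" for X I t x
    using that by (simp add: reduct_def op_def PiE_restrict)
  have d_model: "eqn_model fin_eqns (?d X)" if X: "Md X" for X
    unfolding eqn_model_fin_eqns
  proof (intro conjI allI impI)
    show "is_alg (syms fin_eqns) sym_arity (?d X)"
      using X by (intro is_alg_reduct[of "theory_syms T" sym_arity])
        (auto simp: theory_model_def small_finite elim!: syms_fin_eqnsE)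
    fix I :: "'u set" and i x assume h: "finite I \<and> i \<in> I" "x \<in> I \<rightarrow>\<^sub>E car (?d X)"
    then have "op X I (pro T I i) x = x i" using X by (intro op_pro) (auto simp: small_finite)
    then show "itp (?d X) (OpSym I (pro T I i)) x = x i"
      using h by (simp add: itp_d pro_opn small_finite)
  next
    fix I J t u x assume h: "finite I \<and> finite J \<and> t \<in> opn T I \<and> u \<in> I \<rightarrow>\<^sub>E opn T J" "x \<in> J \<rightarrow>\<^sub>E car (?d X)"
    then have u: "\<And>i. i \<in> I \<Longrightarrow> u i \<in> opn T J" and x: "\<And>j. j \<in> J \<Longrightarrow> x j \<in> car X" and ur: "restrict u I = u"
      by (auto simp: PiE_restrict)
    have sm: "small I" "small J" using h by (simp_all add: small_finite)
    have e: "(\<lambda>i\<in>I. itp (?d X) (OpSym J (u i)) x) = (\<lambda>i\<in>I. op X J (u i) x)"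
      using h u by (intro restrict_ext) (simp add: itp_d)
    have "(\<lambda>i\<in>I. op X J (u i) x) \<in> I \<rightarrow>\<^sub>E car X" using u x X sm by (auto intro!: op_in)
    moreover have "op X J (subst T I J t u) x = op X I t (\<lambda>i. op X J (u i) x)"
      using op_subst[OF X sm, of t u x] h u x by (simp add: ur)
    ultimately show "itp (?d X) (OpSym J (subst T I J t u)) x =
        itp (?d X) (OpSym I t) (\<lambda>i\<in>I. itp (?d X) (OpSym J (u i)) x)"
      unfolding e using h sm by (simp add: itp_d subst_opn)
  qed
  have "conc_iso (theory_Mod T) (eqn_Mod fin_eqns) ?d up"
    unfolding conc_iso_def conc_map_def
  proof (intro conjI ballI subsetI)
    fix X Y f assume "X \<in> cob (theory_Mod T)" "Y \<in> cob (theory_Mod T)" "f \<in> chom (theory_Mod T) X Y"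
    then have f: "thom T X Y f" by simp
    have "alg_hom (syms fin_eqns) sym_arity (?d X) (?d Y) f"
      unfolding alg_hom_def
    proof (intro conjI ballI)
      fix s x assume "s \<in> syms fin_eqns" and x: "x \<in> sym_arity s \<rightarrow>\<^sub>E car (?d X)"
      then obtain I t where s: "s = OpSym I t" "finite I" "t \<in> opn T I" by (auto elim: syms_fin_eqnsE)
      have x': "\<And>i. i \<in> I \<Longrightarrow> x i \<in> car X" using x s by auto
      have "(\<lambda>i\<in>I. f (x i)) \<in> I \<rightarrow>\<^sub>E car Y" using x' thom_in[OF f] by auto
      then show "f (itp (?d X) s x) = itp (?d Y) s (\<lambda>i\<in>sym_arity s. f (x i))"
        using s x thom_op[OF f _ s(3) x'] by (simp add: itp_d small_finite)
    qed (use f in \<open>simp add: thom_iff\<close>)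
    then show "f \<in> chom (eqn_Mod fin_eqns) (?d X) (?d Y)" by (simp add: eqn_Mod_def)
  next
    fix X Y f assume "X \<in> cob (eqn_Mod fin_eqns)" "Y \<in> cob (eqn_Mod fin_eqns)" "f \<in> chom (eqn_Mod fin_eqns) X Y"
    then have X: "eqn_model fin_eqns X" and Y: "eqn_model fin_eqns Y"
      and f: "alg_hom (syms fin_eqns) sym_arity X Y f" by (auto simp: eqn_Mod_def)
    have "thom T (up X) (up Y) f"
    proof (rule thomI)
      fix I t x assume I: "small I" and t: "t \<in> opn T I" and "\<And>i. i \<in> I \<Longrightarrow> x i \<in> car (up X)"
      then have x: "\<And>i. i \<in> I \<Longrightarrow> x i \<in> car X" by (simp add: up_def)
      obtain J w where s: "supported I J w t" using p[OF I t] by blast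
      then have J: "finite J" "w \<in> opn T J" and xJ: "restrict x J \<in> J \<rightarrow>\<^sub>E car X"
        using x by (auto simp: supported_def)
      have "f (itp X (OpSym J w) (restrict x J)) = itp Y (OpSym J w) (\<lambda>i\<in>J. f (restrict x J i))"
        using alg_homD(3)[OF f, of "OpSym J w" "restrict x J"] J xJ by simp
      also have "(\<lambda>i\<in>J. f (restrict x J i)) = (\<lambda>i\<in>J. f (x i))" by (rule restrict_ext) simp
      finally have "f (op X J w x) = op Y J w (\<lambda>i. f (x i))" unfolding op_def .
      then show "f (op (up X) I t x) = op (up Y) I t (\<lambda>i. f (x i))"
        using op_up[OF X I s x] op_up[OF Y I s, of "\<lambda>i. f (x i)"] alg_homD(2)[OF f x] by simp
    qed (use alg_homD[OF f] in \<open>auto simp: up_def PiE_def\<close>)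
    then show "f \<in> chom (theory_Mod T) (up X) (up Y)" by simp
  next
    fix X assume "X \<in> cob (theory_Mod T)"
    then have X: "Md X" by simp
    show "up (?d X) = X"
    proof (rule theory_model_eqI[OF up_model[OF d_model[OF X]] X])
      fix I t x assume I: "small I" and t: "t \<in> opn T I" and "\<And>i. i \<in> I \<Longrightarrow> x i \<in> car (up (?d X))"
      then have x: "\<And>i. i \<in> I \<Longrightarrow> x i \<in> car X" by (simp add: up_def)
      obtain J w where s: "supported I J w t" using p[OF I t] by blast
      then have "finite J" "w \<in> opn T J" by (auto simp: supported_def)
      then show "op (up (?d X)) I t x = op X I t x"
        using op_up[OF d_model[OF X] I s, of x] supported_op[OF s I X x] x by (simp add: op_d)
    qed (simp add: up_def)
  next
    fix Y assume "Y \<in> cob (eqn_Mod fin_eqns)"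
    then have Y: "eqn_model fin_eqns Y" by (simp add: eqn_Mod_def)
    show "?d (up Y) = Y"
    proof (rule alg_eqI)
      show "is_alg (syms fin_eqns) sym_arity (?d (up Y))" "is_alg (syms fin_eqns) sym_arity Y"
        using d_model[OF up_model[OF Y]] Y by (auto simp: eqn_model_fin_eqns)
      fix s x assume "s \<in> syms fin_eqns" and x: "x \<in> sym_arity s \<rightarrow>\<^sub>E car (?d (up Y))"
      then obtain I t where s: "s = OpSym I t" "finite I" "t \<in> opn T I" by (auto elim: syms_fin_eqnsE)
      then have x': "x \<in> I \<rightarrow>\<^sub>E car Y" using x by (simp add: up_def)
      \<comment> \<open>A finite arity supports its own operations, so \<open>up Y\<close> extends
        the given finitary ones.\<close>
      have "supported I I t t" using s by (simp add: supported_def op_F_pros small_finite)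
      then have "op (up Y) I t x = op Y I t x" using s x' by (intro op_up[OF Y]) (auto simp: small_finite)
      then show "itp (?d (up Y)) s x = itp Y s x"
        using s x' by (simp add: itp_d up_def) (simp add: op_def PiE_restrict)
    qed (simp add: up_def)
  qed (auto simp: eqn_Mod_def d_model up_model, auto simp: up_def)
  then have "isomorphic Conc (theory_Mod T) (eqn_Mod fin_eqns)"
    by (intro isomorphic_ConcI concrete_category_theory_Mod concrete_category_eqn_Mod)
  moreover have "\<forall>s\<in>syms fin_eqns. finite (arity fin_eqns s)" by (auto elim: syms_fin_eqnsE)
  ultimately show ?thesis
    unfolding finitary_variety_def using variety_theory_Mod equational_fin_eqns by blast
qed

text \<open>The finitely supported elements of \<open>F K\<close> form a subalgebra containing the generators.\<close>

lemma finitary_if_finitary_variety: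
  assumes "finitary_variety (theory_Mod T)" shows "finitary T"
proof -
  obtain E where E: "equational_theory E" and far: "\<And>s. s \<in> syms E \<Longrightarrow> finite (arity E s)"
    and iso: "isomorphic Conc (theory_Mod T) (eqn_Mod E)"
    using assms by (auto simp: finitary_variety_def)
  obtain fo go where i: "conc_iso (theory_Mod T) (eqn_Mod E) fo go" using iso by (rule isomorphic_ConcE)
  have fo: "conc_map (theory_Mod T) (eqn_Mod E) fo" and go: "conc_map (eqn_Mod E) (theory_Mod T) go"
    and gofo: "\<And>X. Md X \<Longrightarrow> go (fo X) = X"
    using i by (auto simp: conc_iso_def)
  have foM: "eqn_model E (fo X)" "car (fo X) = car X" if "Md X" for X
    using conc_mapD(1,2)[OF fo, of X] that by (auto simp: eqn_Mod_def)
  show ?thesis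
    unfolding finitary_iff
  proof (intro allI impI ballI)
    fix K t assume K: "small K" and t: "t \<in> opn T K"
    let ?A = "fo (F K)"
    have A: "eqn_model E ?A" "car ?A = opn T K" using foM[OF F_model[OF K]] by simp_all
    define B where "B = {t \<in> opn T K. \<exists>J w. supported K J w t}"
    have BA: "B \<subseteq> car ?A" using A by (auto simp: B_def)
    \<comment> \<open>As \<open>arity E s\<close> is finite, the arguments share a finite support
      \<open>J\<close>. They come from \<open>F J\<close> along a homomorphism to
      \<open>F K\<close>, and so does the result.\<close>
    have closed: "itp ?A s x \<in> B" if s: "s \<in> syms E" and "x \<in> arity E s \<rightarrow>\<^sub>E B" for s x
    proof -
      have "\<And>a. a \<in> arity E s \<Longrightarrow> \<exists>J w. supported K J w (x a)" using that by (auto simp: B_def dest: PiE_mem)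
      then obtain J w where J: "finite J" "J \<subseteq> K" and w: "\<And>a. a \<in> arity E s \<Longrightarrow> supported K J (w a) (x a)"
        using supported_family[OF far[OF s] K, of x] by metis
      let ?g = "\<lambda>w\<in>opn T J. op (F K) J w (pro T K)"
      have sJ: "small J" and pJ: "\<And>j. j \<in> J \<Longrightarrow> pro T K j \<in> opn T K" using J K by (auto simp: small_finite pro_opn)
      have "thom T (F J) (F K) ?g" using op_hom[OF F_model[OF K] sJ, of "pro T K"] pJ by simp
      then have g: "alg_hom (syms E) (arity E) (fo (F J)) ?A ?g"
        using conc_mapD(3)[OF fo, of "F J" "F K" ?g] sJ K by (simp add: F_model) (simp add: eqn_Mod_def)
      have FJ: "eqn_model E (fo (F J))" "car (fo (F J)) = opn T J" using foM[OF F_model[OF sJ]] by simp_all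
      have wJ: "restrict w (arity E s) \<in> arity E s \<rightarrow>\<^sub>E car (fo (F J))"
        using w FJ by (auto simp: supported_def)
      have "(\<lambda>a\<in>arity E s. ?g (restrict w (arity E s) a)) = (\<lambda>a\<in>arity E s. x a)"
        using w by (intro restrict_ext) (auto simp: supported_def)
      also have "\<dots> = x" using that(2) by (rule restrict_PiE_self)
      finally have eq: "(\<lambda>a\<in>arity E s. ?g (restrict w (arity E s) a)) = x" .
      have "?g (itp (fo (F J)) s (restrict w (arity E s))) = itp ?A s x"
        using alg_homD(3)[OF g s wJ] unfolding eq .
      moreover have z: "itp (fo (F J)) s (restrict w (arity E s)) \<in> opn T J"
        using is_alg_itp[of "syms E" "arity E" "fo (F J)" s] FJ s wJ by (simp add: eqn_model_def)
      ultimately have "itp ?A s x = op (F K) J (itp (fo (F J)) s (restrict w (arity E s))) (pro T K)"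
        by simp
      moreover from this have "itp ?A s x \<in> opn T K" using sJ K z pJ by (simp add: op_F_in)
      ultimately show ?thesis using J z unfolding B_def supported_def by blast
    qed
    \<comment> \<open>The subalgebra is formed among the algebras of \<open>E\<close>, whose symbols
      have finite arity; \<open>go\<close> turns it into a model of \<open>T\<close>.\<close>
    define Bm where "Bm = \<lparr>car = B, itp = (\<lambda>s\<in>syms E. \<lambda>x\<in>arity E s \<rightarrow>\<^sub>E B. itp ?A s x)\<rparr>"
    have itpB: "itp Bm s x = itp ?A s x" if "s \<in> syms E" "x \<in> arity E s \<rightarrow>\<^sub>E B" for s x
      using that by (simp add: Bm_def)
    have algB: "is_alg (syms E) (arity E) Bm"
      using closed small_subset[OF small_car[OF F_model[OF K]], of B] BA A(2)
      by (simp add: is_alg_def Bm_def restrict_PiE_iff Pi_iff)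
    have evB: "is_trm (syms E) (arity E) L a \<Longrightarrow>
        ev (arity E) Bm \<rho> a \<in> B \<and> ev (arity E) Bm \<rho> a = ev (arity E) ?A \<rho> a" if \<rho>: "\<rho> \<in> L \<rightarrow>\<^sub>E B" for L \<rho> a
    proof (induction rule: is_trm.induct)
      case (1 k) then show ?case using \<rho> by auto
    next
      case (2 s ts)
      let ?x = "\<lambda>i\<in>arity E s. ev (arity E) ?A \<rho> (ts i)"
      have e: "(\<lambda>i\<in>arity E s. ev (arity E) Bm \<rho> (ts i)) = ?x" using 2 by (intro restrict_ext) simp
      have "ev (arity E) ?A \<rho> (ts i) \<in> B" if "i \<in> arity E s" for i using 2(3)[OF that] by metis
      then have x: "?x \<in> arity E s \<rightarrow>\<^sub>E B" by auto
      show ?case unfolding ev.simps e using 2(1) closed[OF 2(1) x] itpB[OF 2(1) x] by (simp only:)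
    qed
    have "eqn_model E Bm"
      unfolding eqn_model_def
    proof (intro conjI algB ballI)
      fix q assume q: "q \<in> eqns E"
      obtain L a b where qe: "q = (L, a, b)" by (cases q)
      have "ev (arity E) Bm \<rho> a = ev (arity E) Bm \<rho> b"
        if "is_trm (syms E) (arity E) L a" "is_trm (syms E) (arity E) L b" "\<rho> \<in> L \<rightarrow>\<^sub>E B" for \<rho>
      proof -
        have "\<rho> \<in> L \<rightarrow>\<^sub>E car ?A" using that(3) BA by (auto simp: PiE_def Pi_def)
        then have "ev (arity E) ?A \<rho> a = ev (arity E) ?A \<rho> b"
          using A(1) q unfolding qe eqn_model_def by auto
        then show ?thesis using evB[OF that(3) that(1)] evB[OF that(3) that(2)] by simp
      qed
      moreover have "is_trm (syms E) (arity E) L a" "is_trm (syms E) (arity E) L b"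
        using E q unfolding qe equational_theory_def by auto
      ultimately show "case q of (K, a, b) \<Rightarrow>
          \<forall>\<rho>\<in>K \<rightarrow>\<^sub>E car Bm. ev (arity E) Bm \<rho> a = ev (arity E) Bm \<rho> b"
        by (simp add: qe Bm_def)
    qed
    moreover have "alg_hom (syms E) (arity E) Bm ?A (\<lambda>b\<in>B. b)"
      unfolding alg_hom_def
    proof (intro conjI ballI)
      fix s x assume s: "s \<in> syms E" and "x \<in> arity E s \<rightarrow>\<^sub>E car Bm"
      then have x: "x \<in> arity E s \<rightarrow>\<^sub>E B" by (simp add: Bm_def)
      have "(\<lambda>i\<in>arity E s. (\<lambda>b\<in>B. b) (x i)) = (\<lambda>i\<in>arity E s. x i)"
        using x by (intro restrict_ext) (auto dest: PiE_mem)
      then show "(\<lambda>b\<in>B. b) (itp Bm s x) = itp ?A s (\<lambda>i\<in>arity E s. (\<lambda>b\<in>B. b) (x i))"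
        using closed[OF s x] itpB[OF s x] restrict_PiE_self[OF x] by simp
    qed (use BA in \<open>auto simp: Bm_def\<close>)
    moreover have "car Bm = B" by (simp add: Bm_def)
    moreover have "und (eqn_Mod E) = car" "X \<in> cob (eqn_Mod E) \<longleftrightarrow> eqn_model E X"
      "f \<in> chom (eqn_Mod E) X Y \<longleftrightarrow> alg_hom (syms E) (arity E) X Y f" for X Y f
      by (simp_all add: eqn_Mod_def)
    ultimately have gB: "Md (go Bm)" "car (go Bm) = B" and "thom T (go Bm) (go ?A) (\<lambda>b\<in>B. b)"
      using conc_mapD(1,2)[OF go, of Bm] conc_mapD(3)[OF go, of Bm ?A "\<lambda>b\<in>B. b"] A(1) by simp_all
    then have inc: "thom T (go Bm) (F K) (\<lambda>b\<in>B. b)" using gofo[OF F_model[OF K]] by simp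
    have pB: "pro T K k \<in> B" if k: "k \<in> K" for k
    proof -
      have "supported K {k} (pro T {k} k) (pro T K k)" using K k by (rule supported_pro)
      then show ?thesis using k K by (auto simp: B_def pro_opn)
    qed
    \<comment> \<open>The inclusion is a homomorphism of models of \<open>T\<close>, so
      \<open>t\<close> evaluated at the projections inside the subalgebra is \<open>t\<close>
      itself.\<close>
    have "op (go Bm) K t (pro T K) \<in> B" using op_in[OF gB(1) K t, of "pro T K"] pB gB(2) by simp
    moreover have "(\<lambda>b\<in>B. b) (op (go Bm) K t (pro T K)) = op (F K) K t (\<lambda>k. (\<lambda>b\<in>B. b) (pro T K k))"
      using pB gB(2) by (intro thom_op[OF inc K t]) simp
    ultimately have "t \<in> B" using pB K t by (simp add: op_F_pros)
    then show "\<exists>J w. supported K J w t" by (simp add: B_def)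
  qed
qed

theorem finitary_variety_iff: "finitary_variety (theory_Mod T) \<longleftrightarrow> finitary T"
  using finitary_variety_if_finitary finitary_if_finitary_variety by blast

end

section \<open>Matched pairs\<close>

lemma (in alg_th) subst_eq_op: "\<lbrakk>small I; t \<in> opn T I; u \<in> I \<rightarrow>\<^sub>E opn T J\<rbrakk> \<Longrightarrow> subst T I J t u = op (F J) I t u"
  using op_F[of I t u J] PiE_mem[of u I "\<lambda>_. opn T J"] by (simp add: PiE_restrict)

text \<open>The identity is the only unary operation, since an affine one fixes \<open>e1\<close>.
  So \<open>(t, e1)\<close> is the only decomposition, and the calculus of hyperaffine--unary
  theories becomes available for the theory in a matched pair.\<close>

lemma (in alg_th) hyperaffine_unary_if_hyperaffine:
  assumes "hyperaffine_theory T" shows "hyperaffine_unary T"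
  unfolding hyperaffine_unary_iff
proof (intro allI impI ballI)
  fix I t assume I: "small I" and t: "t \<in> opn T I"
  have ha: "hyperaffine T K s" if "small K" "s \<in> opn T K" for K s
    using that assms by (simp add: hyperaffine_theory_def)
  have u: "m = e1" if m: "m \<in> opn T (fin 1)" for m
  proof -
    have "ap (F (fin 1)) m e1 = e1"
      unfolding ap_def using m by (intro haff_F_const ha) simp_all
    then show ?thesis using ap_F1_e1[OF m] by simp
  qed
  have e: "op (F I) I k (\<lambda>i. ap (F I) e1 (pro T I i)) = k" if "k \<in> opn T I" for k
    using that I by (simp add: ap_e1 F_model pro_opn op_F_pros)
  show "\<exists>!(h, m). decomp I t h m"
    by (rule ex1I[of _ "(t, e1)"]) (use I t e ha u in \<open>auto simp: decomp_def\<close>)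
qed

section \<open>The laws of a matched pair on arbitrary families\<close>

locale mp =
  fixes P :: "'u::universe matched"
  assumes matched: "matched_pair P"
begin

abbreviation C where "C \<equiv> carrier (mon P)"
abbreviation mul (infixl "\<odot>" 70) where "mul \<equiv> monoid.mult (mon P)"
abbreviation "u1 \<equiv> monoid.one (mon P)"

definition ps :: "'u set \<Rightarrow> 'u \<Rightarrow> ('u \<Rightarrow> 'u) \<Rightarrow> 'u" where
  "ps I h n = push P I h (restrict n I)"

lemma hyperaffine_hth: "hyperaffine_theory (hth P)" and monoid_mon: "monoid (mon P)" and small_C: "small C"
  using matched unfolding matched_pair_def Let_def by simp_all

sublocale H: alg_th "hth P"
  using hyperaffine_hth by unfold_locales (simp add: hyperaffine_theory_def)

sublocale H: hau "hth P"
  using H.hyperaffine_unary_if_hyperaffine[OF hyperaffine_hth] by unfold_locales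

sublocale M: monoid "mon P" by (rule monoid_mon)

lemma haff: "small I \<Longrightarrow> h \<in> opn (hth P) I \<Longrightarrow> hyperaffine (hth P) I h"
  using hyperaffine_hth by (simp add: hyperaffine_theory_def)

lemma ps_cong: "(\<And>i. i \<in> I \<Longrightarrow> m i = n i) \<Longrightarrow> ps I h m = ps I h n"
  unfolding ps_def by (metis restrict_ext)

lemma push_eq: "n \<in> I \<rightarrow>\<^sub>E C \<Longrightarrow> push P I h n = ps I h n"
  by (simp add: ps_def PiE_restrict)

lemma pull_in: "\<lbrakk>small I; m \<in> C; h \<in> opn (hth P) I\<rbrakk> \<Longrightarrow> pull P I m h \<in> opn (hth P) I"
  and pull_pro: "\<lbrakk>small I; m \<in> C; i \<in> I\<rbrakk> \<Longrightarrow> pull P I m (pro (hth P) I i) = pro (hth P) I i"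
  and pull_one: "\<lbrakk>small I; h \<in> opn (hth P) I\<rbrakk> \<Longrightarrow> pull P I u1 h = h"
  and pull_pull: "\<lbrakk>small I; m \<in> C; n \<in> C; h \<in> opn (hth P) I\<rbrakk> \<Longrightarrow> pull P I m (pull P I n h) = pull P I (m \<odot> n) h"
  using matched unfolding matched_pair_def Let_def by simp_all

lemma ps_in: "\<lbrakk>small I; h \<in> opn (hth P) I; \<And>i. i \<in> I \<Longrightarrow> n i \<in> C\<rbrakk> \<Longrightarrow> ps I h n \<in> C"
  unfolding ps_def using matched unfolding matched_pair_def Let_def by simp

lemma ps_pro: "\<lbrakk>small I; i \<in> I; \<And>i. i \<in> I \<Longrightarrow> n i \<in> C\<rbrakk> \<Longrightarrow> ps I (pro (hth P) I i) n = n i"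
  unfolding ps_def using matched unfolding matched_pair_def Let_def by simp

lemmas pull_subst_law =
  matched[unfolded matched_pair_def Let_def, THEN conjunct2, THEN conjunct2, THEN conjunct2, THEN conjunct2, THEN conjunct2, THEN conjunct2, THEN conjunct1, rule_format]
lemmas push_subst_law =
  matched[unfolded matched_pair_def Let_def, THEN conjunct2, THEN conjunct2, THEN conjunct2, THEN conjunct2, THEN conjunct2, THEN conjunct2, THEN conjunct2, THEN conjunct2, THEN conjunct2, THEN conjunct2, THEN conjunct1, rule_format]
lemmas push_mult_law =
  matched[unfolded matched_pair_def Let_def, THEN conjunct2, THEN conjunct2, THEN conjunct2, THEN conjunct2, THEN conjunct2, THEN conjunct2, THEN conjunct2, THEN conjunct2, THEN conjunct2, THEN conjunct2, THEN conjunct2, THEN conjunct1, rule_format]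
lemmas mult_push_law =
  matched[unfolded matched_pair_def Let_def, THEN conjunct2, THEN conjunct2, THEN conjunct2, THEN conjunct2, THEN conjunct2, THEN conjunct2, THEN conjunct2, THEN conjunct2, THEN conjunct2, THEN conjunct2, THEN conjunct2, THEN conjunct2, THEN conjunct1, rule_format]
lemmas pull_push_law =
  matched[unfolded matched_pair_def Let_def, THEN conjunct2, THEN conjunct2, THEN conjunct2, THEN conjunct2, THEN conjunct2, THEN conjunct2, THEN conjunct2, THEN conjunct2, THEN conjunct2, THEN conjunct2, THEN conjunct2, THEN conjunct2, THEN conjunct2, rule_format]

lemma pull_op:
  assumes "small I" "small J" "m \<in> C" "h \<in> opn (hth P) I" "\<And>i. i \<in> I \<Longrightarrow> k i \<in> opn (hth P) J"
  shows "pull P J m (op (H.F J) I h k) = op (H.F J) I (pull P I m h) (\<lambda>i. pull P J m (k i))"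
proof -
  have k: "restrict k I \<in> I \<rightarrow>\<^sub>E opn (hth P) J" using assms by auto
  have "pull P J m (op (H.F J) I h k) = pull P J m (subst (hth P) I J h (restrict k I))"
    using assms by (simp add: H.op_F)
  also have "\<dots> = subst (hth P) I J (pull P I m h) (\<lambda>i\<in>I. pull P J m (restrict k I i))"
    using assms k by (intro pull_subst_law)
  also have "(\<lambda>i\<in>I. pull P J m (restrict k I i)) = (\<lambda>i\<in>I. pull P J m (k i))" by (rule restrict_ext) simp
  also have "subst (hth P) I J (pull P I m h) \<dots> = op (H.F J) I (pull P I m h) (\<lambda>i. pull P J m (k i))"
    using assms by (simp add: H.op_F pull_in)
  finally show ?thesis .
qed

lemma ps_op:
  assumes "small I" "small J" "h \<in> opn (hth P) I" "\<And>i. i \<in> I \<Longrightarrow> k i \<in> opn (hth P) J" "\<And>j. j \<in> J \<Longrightarrow> m j \<in> C"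
  shows "ps J (op (H.F J) I h k) m = ps I h (\<lambda>i. ps J (k i) m)"
proof -
  have k: "restrict k I \<in> I \<rightarrow>\<^sub>E opn (hth P) J" "restrict m J \<in> J \<rightarrow>\<^sub>E C" using assms by auto
  have "ps J (op (H.F J) I h k) m = push P J (subst (hth P) I J h (restrict k I)) (restrict m J)"
    unfolding ps_def using assms by (simp add: H.op_F)
  also have "\<dots> = push P I h (\<lambda>i\<in>I. push P J (restrict k I i) (restrict m J))"
    using assms k by (intro push_subst_law)
  also have "(\<lambda>i\<in>I. push P J (restrict k I i) (restrict m J)) = (\<lambda>i\<in>I. push P J (k i) (restrict m J))"
    by (rule restrict_ext) simp
  finally show ?thesis unfolding ps_def .
qed

lemma ps_mult:
  assumes "small I" "h \<in> opn (hth P) I" "\<And>i. i \<in> I \<Longrightarrow> m i \<in> C" "n \<in> C"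
  shows "ps I h m \<odot> n = ps I h (\<lambda>i. m i \<odot> n)"
proof -
  have "restrict m I \<in> I \<rightarrow>\<^sub>E C" using assms by auto
  then have "push P I h (restrict m I) \<odot> n = push P I h (\<lambda>i\<in>I. restrict m I i \<odot> n)"
    using assms by (intro push_mult_law)
  also have "(\<lambda>i\<in>I. restrict m I i \<odot> n) = (\<lambda>i\<in>I. m i \<odot> n)" by (rule restrict_ext) simp
  finally show ?thesis unfolding ps_def .
qed

lemma mult_ps:
  assumes "small I" "h \<in> opn (hth P) I" "\<And>i. i \<in> I \<Longrightarrow> m i \<in> C" "n \<in> C"
  shows "n \<odot> ps I h m = ps I (pull P I n h) (\<lambda>i. n \<odot> m i)"
proof -
  have "restrict m I \<in> I \<rightarrow>\<^sub>E C" using assms by auto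
  then have "n \<odot> push P I h (restrict m I) = push P I (pull P I n h) (\<lambda>i\<in>I. n \<odot> restrict m I i)"
    using assms by (intro mult_push_law)
  also have "(\<lambda>i\<in>I. n \<odot> restrict m I i) = (\<lambda>i\<in>I. n \<odot> m i)" by (rule restrict_ext) simp
  finally show ?thesis unfolding ps_def .
qed

lemma pull_ps:
  assumes "small I" "small J" "h \<in> opn (hth P) I" "k \<in> opn (hth P) J" "\<And>j. j \<in> J \<Longrightarrow> m j \<in> C"
  shows "pull P I (ps J k m) h = op (H.F I) J k (\<lambda>j. pull P I (m j) h)"
proof -
  have m: "restrict m J \<in> J \<rightarrow>\<^sub>E C" using assms by auto
  have "pull P I (ps J k m) h = subst (hth P) J I k (\<lambda>j\<in>J. pull P I (restrict m J j) h)"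
    unfolding ps_def using assms m by (intro pull_push_law)
  also have "(\<lambda>j\<in>J. pull P I (restrict m J j) h) = (\<lambda>j\<in>J. pull P I (m j) h)" by (rule restrict_ext) simp
  also have "subst (hth P) J I k \<dots> = op (H.F I) J k (\<lambda>j. pull P I (m j) h)"
    using assms by (simp add: H.op_F pull_in)
  finally show ?thesis .
qed

end

lemma matched_pairI:
  fixes P :: "'u::universe matched"
  assumes H: "hyperaffine_theory (hth P)" and "monoid (mon P)" "small (carrier (mon P))"
    and "\<And>I m h. \<lbrakk>small I; m \<in> carrier (mon P); h \<in> opn (hth P) I\<rbrakk> \<Longrightarrow> pull P I m h \<in> opn (hth P) I"
    and "\<And>I h n. \<lbrakk>small I; h \<in> opn (hth P) I; n \<in> I \<rightarrow>\<^sub>E carrier (mon P)\<rbrakk> \<Longrightarrow> push P I h n \<in> carrier (mon P)"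
    and "\<And>I m i. \<lbrakk>small I; m \<in> carrier (mon P); i \<in> I\<rbrakk> \<Longrightarrow> pull P I m (pro (hth P) I i) = pro (hth P) I i"
    and "\<And>I J m h k. \<lbrakk>small I; small J; m \<in> carrier (mon P); h \<in> opn (hth P) I; k \<in> I \<rightarrow>\<^sub>E opn (hth P) J\<rbrakk> \<Longrightarrow>
      pull P J m (subst (hth P) I J h k) = subst (hth P) I J (pull P I m h) (\<lambda>i\<in>I. pull P J m (k i))"
    and "\<And>I h. \<lbrakk>small I; h \<in> opn (hth P) I\<rbrakk> \<Longrightarrow> pull P I \<one>\<^bsub>mon P\<^esub> h = h"
    and "\<And>I m n h. \<lbrakk>small I; m \<in> carrier (mon P); n \<in> carrier (mon P); h \<in> opn (hth P) I\<rbrakk> \<Longrightarrow>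
      pull P I m (pull P I n h) = pull P I (m \<otimes>\<^bsub>mon P\<^esub> n) h"
    and "\<And>I i m. \<lbrakk>small I; i \<in> I; m \<in> I \<rightarrow>\<^sub>E carrier (mon P)\<rbrakk> \<Longrightarrow> push P I (pro (hth P) I i) m = m i"
    and "\<And>I J h k m. \<lbrakk>small I; small J; h \<in> opn (hth P) I; k \<in> I \<rightarrow>\<^sub>E opn (hth P) J; m \<in> J \<rightarrow>\<^sub>E carrier (mon P)\<rbrakk> \<Longrightarrow>
      push P J (subst (hth P) I J h k) m = push P I h (\<lambda>i\<in>I. push P J (k i) m)"
    and "\<And>I h m n. \<lbrakk>small I; h \<in> opn (hth P) I; m \<in> I \<rightarrow>\<^sub>E carrier (mon P); n \<in> carrier (mon P)\<rbrakk> \<Longrightarrow>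
      push P I h m \<otimes>\<^bsub>mon P\<^esub> n = push P I h (\<lambda>i\<in>I. m i \<otimes>\<^bsub>mon P\<^esub> n)"
    and "\<And>I h m n. \<lbrakk>small I; h \<in> opn (hth P) I; m \<in> I \<rightarrow>\<^sub>E carrier (mon P); n \<in> carrier (mon P)\<rbrakk> \<Longrightarrow>
      n \<otimes>\<^bsub>mon P\<^esub> push P I h m = push P I (pull P I n h) (\<lambda>i\<in>I. n \<otimes>\<^bsub>mon P\<^esub> m i)"
    and "\<And>I J h k m. \<lbrakk>small I; small J; h \<in> opn (hth P) I; k \<in> opn (hth P) J; m \<in> J \<rightarrow>\<^sub>E carrier (mon P)\<rbrakk> \<Longrightarrow>
      pull P I (push P J k m) h = subst (hth P) J I k (\<lambda>j\<in>J. pull P I (m j) h)"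
  shows "matched_pair P"
  unfolding matched_pair_def Let_def by (intro conjI allI impI ballI; rule assms; assumption)

section \<open>The matched pair of a hyperaffine--unary theory\<close>

context hau
begin

abbreviation Hp where "Hp \<equiv> hyperaffine_part T"

lemma Hp_simps [simp]: "opn Hp I = {t \<in> opn T I. hyperaffine T I t}" "pro Hp = pro T" "subst Hp = subst T"
  by (simp_all add: hyperaffine_part_def)

lemma algebraic_Hp: "algebraic_theory Hp"
  unfolding algebraic_theory_def
proof (intro conjI allI impI ballI)
  fix I :: "'u set" assume I: "small I"
  show "small (opn Hp I)" using small_opn[OF I] by (rule small_subset) auto
next
  fix I J t u assume h: "small I" "small J" "t \<in> opn Hp I" "u \<in> I \<rightarrow>\<^sub>E opn Hp J"
  then have u: "\<And>i. i \<in> I \<Longrightarrow> u i \<in> opn T J" "\<And>i. i \<in> I \<Longrightarrow> hyperaffine T J (u i)" "u \<in> I \<rightarrow>\<^sub>E opn T J"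
    by (auto simp: PiE_iff)
  show "subst Hp I J t u \<in> opn Hp J"
    using h(1-3) u by (simp add: subst_eq_op op_F_in hyperaffine_op)
next
  fix I J K t u v assume h: "small I" "small J" "small K" "t \<in> opn Hp I" "u \<in> I \<rightarrow>\<^sub>E opn Hp J" "v \<in> J \<rightarrow>\<^sub>E opn Hp K"
  then have "u \<in> I \<rightarrow>\<^sub>E opn T J" "v \<in> J \<rightarrow>\<^sub>E opn T K" by (auto simp: PiE_iff)
  then show "subst Hp J K (subst Hp I J t u) v = subst Hp I K t (\<lambda>i\<in>I. subst Hp J K (u i) v)"
    using h by (simp add: subst_subst)
next
  fix I J :: "'u set" and i u assume h: "small I" "small J" "i \<in> I" "u \<in> I \<rightarrow>\<^sub>E opn Hp J"
  then have "u \<in> I \<rightarrow>\<^sub>E opn T J" by (auto simp: PiE_iff)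
  then show "subst Hp I J (pro Hp I i) u = u i" using h by (simp add: pro_subst)
qed (simp_all add: pro_opn hyperaffine_pro subst_pro)

lemma hyperaffine_Hp: "hyperaffine_theory Hp"
  unfolding hyperaffine_theory_def
  using algebraic_Hp by (auto simp: hyperaffine_def affine_def)

sublocale Hp: alg_th Hp by unfold_locales (rule algebraic_Hp)

lemma op_Hp: "\<lbrakk>small I; t \<in> opn Hp I; \<And>i. i \<in> I \<Longrightarrow> u i \<in> opn Hp J\<rbrakk> \<Longrightarrow> op (Hp.F J) I t u = op (F J) I t u"
  by (simp add: Hp.op_F op_F)

text \<open>This is \<open>m^*h\<close> in the form provided by decompositions: by affineness of
  \<open>h\<close> the operation \<open>m(h(x))\<close> has unary part \<open>m\<close>, and its
  hyperaffine part is the operation sought.\<close>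

definition pl :: "'u set \<Rightarrow> 'u \<Rightarrow> 'u \<Rightarrow> 'u" where
  "pl I m h = hd I (ap (F I) m h)"

lemma pl_in: "\<lbrakk>small I; m \<in> opn T (fin 1); h \<in> opn T I\<rbrakk> \<Longrightarrow> pl I m h \<in> opn T I"
  and hyperaffine_pl: "\<lbrakk>small I; m \<in> opn T (fin 1); h \<in> opn T I\<rbrakk> \<Longrightarrow> hyperaffine T I (pl I m h)"
  unfolding pl_def by (simp_all add: hd_in hyperaffine_hd ap_F_in)

lemma ap_op_pl:
  "\<lbrakk>small I; m \<in> opn T (fin 1); h \<in> opn T I; hyperaffine T I h; Md X; \<And>i. i \<in> I \<Longrightarrow> x i \<in> car X\<rbrakk>
    \<Longrightarrow> ap X m (op X I h x) = op X I (pl I m h) (\<lambda>i. ap X m (x i))"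
  unfolding pl_def using ap_op_hd[of I h m X x] by (simp add: hd_haff)

lemma ap_pl:
  "\<lbrakk>small I; m \<in> opn T (fin 1); h \<in> opn T I; hyperaffine T I h\<rbrakk>
    \<Longrightarrow> ap (F I) m h = op (F I) I (pl I m h) (\<lambda>i. ap (F I) m (pro T I i))"
  using ap_op_pl[of I m h "F I" "pro T I"] by (simp add: F_model pro_opn op_F_pros)

lemma pl_unique:
  "\<lbrakk>small I; m \<in> opn T (fin 1); h \<in> opn T I; k \<in> opn T I; hyperaffine T I k;
    ap (F I) m h = op (F I) I k (\<lambda>i. ap (F I) m (pro T I i))\<rbrakk> \<Longrightarrow> pl I m h = k"
  unfolding pl_def by (rule hd_unique[of _ _ _ m], assumption, rule ap_F_in) (simp_all add: decomp_def)

lemma hd_ap: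
  assumes I: "small I" and m: "m \<in> opn T (fin 1)" and t: "t \<in> opn T I"
  shows "hd I (ap (F I) m t) = pl I m (hd I t)"
proof (rule pl_unique[symmetric])
  have "ap (F I) m (op (F I) I (hd I t) (pro T I)) = op (F I) I (hd I (ap (F I) m t)) (\<lambda>i. ap (F I) m (pro T I i))"
    using assms by (intro ap_op_hd) (simp_all add: F_model pro_opn)
  then show "ap (F I) m (hd I t) = op (F I) I (hd I (ap (F I) m t)) (\<lambda>i. ap (F I) m (pro T I i))"
    using assms by (simp add: op_F_pros hd_in)
qed (use assms in \<open>simp_all add: hd_in hyperaffine_hd ap_F_in\<close>)

text \<open>The description in \<open>down\<close> speaks of all families in all free models. It is
  equivalent to a single equation at the projections, which is a decomposition and so has a unique
  solution.\<close>

lemma pull_down: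
  assumes I: "small I" and m: "m \<in> opn T (fin 1)" and h: "h \<in> opn T I" "hyperaffine T I h"
  shows "pull (down T) I m h = pl I m h"
proof -
  have iff: "(\<forall>K. small K \<longrightarrow> (\<forall>x \<in> I \<rightarrow>\<^sub>E opn T K.
        app1 T K m (subst T I K h x) = subst T I K k (\<lambda>i\<in>I. app1 T K m (x i)))) \<longleftrightarrow>
      ap (F I) m h = op (F I) I k (\<lambda>i. ap (F I) m (pro T I i))" if k: "k \<in> opn T I" for k
  proof -
    have a: "ap (F I) m h \<in> opn T I" using I m h by (simp add: ap_F_in)
    have e: "app1 T K m (subst T I K h x) = subst T I K (ap (F I) m h) x"
      if K: "small K" and x: "x \<in> I \<rightarrow>\<^sub>E opn T K" for K x
    proof -
      have x': "\<And>i. i \<in> I \<Longrightarrow> x i \<in> opn T K" using x by auto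
      show ?thesis using I K m h a x x' by (simp add: subst_eq_op app1_eq_ap op_F_in op_ap F_model)
    qed
    have "subst T I K k (\<lambda>i\<in>I. app1 T K m (x i)) = op (F K) I k (\<lambda>i. ap (F K) m (x i))"
      if K: "small K" and x: "x \<in> I \<rightarrow>\<^sub>E opn T K" for K x
    proof -
      have x': "\<And>i. i \<in> I \<Longrightarrow> x i \<in> opn T K" using x by auto
      have "(\<lambda>i\<in>I. app1 T K m (x i)) = (\<lambda>i\<in>I. ap (F K) m (x i))"
        using x' K m by (intro restrict_ext app1_eq_ap)
      then show ?thesis using I K k m x' by (simp add: op_F ap_F_in)
    qed
    note e2 = this
    show ?thesis
    proof
      assume L: "\<forall>K. small K \<longrightarrow> (\<forall>x \<in> I \<rightarrow>\<^sub>E opn T K.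
        app1 T K m (subst T I K h x) = subst T I K k (\<lambda>i\<in>I. app1 T K m (x i)))"
      have x: "restrict (pro T I) I \<in> I \<rightarrow>\<^sub>E opn T I" using I by (simp add: pro_opn)
      have "subst T I I (ap (F I) m h) (restrict (pro T I) I) = op (F I) I k (\<lambda>i. ap (F I) m (restrict (pro T I) I i))"
        using L e[OF I x] e2[OF I x] I x by metis
      then show "ap (F I) m h = op (F I) I k (\<lambda>i. ap (F I) m (pro T I i))"
        using I a by (simp add: subst_pro)
    next
      assume R: "ap (F I) m h = op (F I) I k (\<lambda>i. ap (F I) m (pro T I i))"
      show "\<forall>K. small K \<longrightarrow> (\<forall>x \<in> I \<rightarrow>\<^sub>E opn T K.
        app1 T K m (subst T I K h x) = subst T I K k (\<lambda>i\<in>I. app1 T K m (x i)))"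
      proof (intro allI impI ballI)
        fix K x assume K: "small K" and x: "x \<in> I \<rightarrow>\<^sub>E opn T K"
        then have x': "\<And>i. i \<in> I \<Longrightarrow> x i \<in> opn T K" by auto
        have "subst T I K (ap (F I) m h) x = op (F K) I (op (F I) I k (\<lambda>i. ap (F I) m (pro T I i))) x"
          using I a x by (simp add: subst_eq_op R[symmetric])
        also have "\<dots> = op (F K) I k (\<lambda>i. ap (F K) m (x i))"
          using I K k m x' by (simp add: op_op F_model ap_F_in pro_opn op_ap op_F_pro)
        finally show "app1 T K m (subst T I K h x) = subst T I K k (\<lambda>i\<in>I. app1 T K m (x i))"
          using e[OF K x] e2[OF K x] by simp
      qed
    qed
  qed
  have "pull (down T) I m h = (THE k. k \<in> opn T I \<and> hyperaffine T I k \<and>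
      ap (F I) m h = op (F I) I k (\<lambda>i. ap (F I) m (pro T I i)))"
    unfolding down_def matched.simps using iff by (intro arg_cong[where f = The]) (auto simp: fun_eq_iff)
  also have "\<dots> = pl I m h"
  proof (rule the_equality)
    show "pl I m h \<in> opn T I \<and> hyperaffine T I (pl I m h) \<and>
        ap (F I) m h = op (F I) I (pl I m h) (\<lambda>i. ap (F I) m (pro T I i))"
      using assms by (intro conjI pl_in hyperaffine_pl ap_pl)
  qed (use pl_unique[OF I m h(1)] in blast)
  finally show ?thesis .
qed

lemma down_simps [simp]:
  "hth (down T) = Hp" "carrier (mon (down T)) = opn T (fin 1)" "\<one>\<^bsub>mon (down T)\<^esub> = e1"
  by (simp_all add: down_def unary_monoid_def e1_def)

lemma mult_down: "\<lbrakk>m \<in> opn T (fin 1); n \<in> opn T (fin 1)\<rbrakk> \<Longrightarrow> m \<otimes>\<^bsub>mon (down T)\<^esub> n = ap (F (fin 1)) m n"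
  by (simp add: down_def unary_monoid_def app1_eq_ap)

lemma push_down: "\<lbrakk>small I; h \<in> opn T I; \<And>i. i \<in> I \<Longrightarrow> n i \<in> opn T (fin 1)\<rbrakk>
    \<Longrightarrow> push (down T) I h n = op (F (fin 1)) I h n"
  by (simp add: down_def op_F)

text \<open>For the composition laws of \<open>pull\<close>, the right-hand side is hyperaffine and
  solves the equation that characterises the left-hand side, so uniqueness applies. The laws of
  \<open>push\<close> and of the monoid are computed in the free model on one element.\<close>

lemma matched_pair_down: "matched_pair (down T)"
proof (rule matched_pairI; (simp only: down_simps)?)
  show "hyperaffine_theory Hp" by (rule hyperaffine_Hp)
  show "monoid (mon (down T))"
    by (rule monoidI) (simp_all add: mult_down ap_F_in ap_ap F_model ap_e1 ap_F1_e1)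
  show "small (opn T (fin 1))" by (simp add: small_opn)
  show "pull (down T) I m h \<in> opn Hp I" if "small I" "m \<in> opn T (fin 1)" "h \<in> opn Hp I" for I m h
    using that by (simp add: pull_down pl_in hyperaffine_pl)
  show "push (down T) I h n \<in> opn T (fin 1)" if "small I" "h \<in> opn Hp I" "n \<in> I \<rightarrow>\<^sub>E opn T (fin 1)" for I h n
    using that push_down[of I h n] PiE_mem[OF that(3)] by (simp add: op_F_in)
  show "pull (down T) I m (pro Hp I i) = pro Hp I i" if "small I" "m \<in> opn T (fin 1)" "i \<in> I" for I m i
    using that by (simp add: pull_down pro_opn hyperaffine_pro pl_def hd_ap_pro)
  show "pull (down T) J m (subst Hp I J h k) = subst Hp I J (pull (down T) I m h) (\<lambda>i\<in>I. pull (down T) J m (k i))"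
    if I: "small I" and J: "small J" and m: "m \<in> opn T (fin 1)" and "h \<in> opn Hp I" "k \<in> I \<rightarrow>\<^sub>E opn Hp J" for I J m h k
  proof -
    have h: "h \<in> opn T I" "hyperaffine T I h" and k: "\<And>i. i \<in> I \<Longrightarrow> k i \<in> opn T J" "\<And>i. i \<in> I \<Longrightarrow> hyperaffine T J (k i)"
      and kE: "k \<in> I \<rightarrow>\<^sub>E opn T J" using that by (auto simp: PiE_iff)
    have "pl J m (op (F J) I h k) = op (F J) I (pl I m h) (\<lambda>i. pl J m (k i))"
    proof (rule pl_unique)
      have "ap (F J) m (op (F J) I h k) = op (F J) I (pl I m h) (\<lambda>i. ap (F J) m (k i))"
        using I J m h k by (intro ap_op_pl) (simp_all add: F_model)
      also have "\<dots> = op (F J) I (pl I m h) (\<lambda>i. op (F J) J (pl J m (k i)) (\<lambda>j. ap (F J) m (pro T J j)))"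
        using J m k by (intro op_cong ap_pl)
      also have "\<dots> = op (F J) J (op (F J) I (pl I m h) (\<lambda>i. pl J m (k i))) (\<lambda>j. ap (F J) m (pro T J j))"
        using I J m h k by (intro op_op[symmetric]) (simp_all add: F_model pl_in ap_F_in pro_opn)
      finally show "ap (F J) m (op (F J) I h k) = op (F J) J (op (F J) I (pl I m h) (\<lambda>i. pl J m (k i))) (\<lambda>j. ap (F J) m (pro T J j))" .
    qed (use I J m h k in \<open>simp_all add: op_F_in pl_in hyperaffine_op hyperaffine_pl\<close>)
    moreover have "(\<lambda>i\<in>I. pull (down T) J m (k i)) = (\<lambda>i\<in>I. pl J m (k i))"
      using J m k by (intro restrict_ext pull_down)
    ultimately show ?thesis
      using I J m h k kE op_F[of I "pl I m h" "\<lambda>i. pl J m (k i)" J]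
      by (simp add: subst_eq_op[of I h k J] pull_down op_F_in hyperaffine_op pl_in)
  qed
  show "pull (down T) I e1 h = h" if "small I" "h \<in> opn Hp I" for I h
    using that by (simp add: pull_down pl_def ap_e1 F_model hd_haff)
  show "pull (down T) I m (pull (down T) I n h) = pull (down T) I (m \<otimes>\<^bsub>mon (down T)\<^esub> n) h"
    if I: "small I" and m: "m \<in> opn T (fin 1)" and n: "n \<in> opn T (fin 1)" and "h \<in> opn Hp I" for I m n h
  proof -
    have h: "h \<in> opn T I" "hyperaffine T I h" using that by auto
    have "pl I (ap (F (fin 1)) m n) h = pl I m (pl I n h)"
    proof (rule pl_unique)
      have "ap (F I) (ap (F (fin 1)) m n) h = ap (F I) m (op (F I) I (pl I n h) (\<lambda>i. ap (F I) n (pro T I i)))"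
        using I m n h by (simp add: ap_ap F_model ap_pl)
      also have "\<dots> = op (F I) I (pl I m (pl I n h)) (\<lambda>i. ap (F I) m (ap (F I) n (pro T I i)))"
        using I m n h by (intro ap_op_pl) (simp_all add: pl_in hyperaffine_pl F_model ap_F_in pro_opn)
      also have "\<dots> = op (F I) I (pl I m (pl I n h)) (\<lambda>i. ap (F I) (ap (F (fin 1)) m n) (pro T I i))"
        using I m n by (intro op_cong) (simp add: ap_ap F_model pro_opn)
      finally show "ap (F I) (ap (F (fin 1)) m n) h = op (F I) I (pl I m (pl I n h)) (\<lambda>i. ap (F I) (ap (F (fin 1)) m n) (pro T I i))" .
    qed (use I m n h in \<open>simp_all add: ap_F_in pl_in hyperaffine_pl\<close>)
    then show ?thesis using I m n h by (simp add: mult_down pull_down pl_in hyperaffine_pl ap_F_in)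
  qed
  show "push (down T) I (pro Hp I i) m = m i" if "small I" "i \<in> I" "m \<in> I \<rightarrow>\<^sub>E opn T (fin 1)" for I i m
    using that PiE_mem[OF that(3)] by (simp add: push_down pro_opn op_F_pro)
  show "push (down T) J (subst Hp I J h k) m = push (down T) I h (\<lambda>i\<in>I. push (down T) J (k i) m)"
    if I: "small I" and J: "small J" and "h \<in> opn Hp I" "k \<in> I \<rightarrow>\<^sub>E opn Hp J" "m \<in> J \<rightarrow>\<^sub>E opn T (fin 1)" for I J h k m
  proof -
    have h: "h \<in> opn T I" and k: "\<And>i. i \<in> I \<Longrightarrow> k i \<in> opn T J" and kE: "k \<in> I \<rightarrow>\<^sub>E opn T J"
      and m: "\<And>j. j \<in> J \<Longrightarrow> m j \<in> opn T (fin 1)" using that by (auto simp: PiE_iff)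
    show ?thesis using I J h k kE m by (simp add: subst_eq_op push_down op_F_in op_op F_model)
  qed
  show "push (down T) I h m \<otimes>\<^bsub>mon (down T)\<^esub> n = push (down T) I h (\<lambda>i\<in>I. m i \<otimes>\<^bsub>mon (down T)\<^esub> n)"
    if "small I" "h \<in> opn Hp I" "m \<in> I \<rightarrow>\<^sub>E opn T (fin 1)" "n \<in> opn T (fin 1)" for I h m n
    using that PiE_mem[OF that(3)] by (simp add: mult_down push_down ap_F_in op_F_in ap_op F_model)
  show "n \<otimes>\<^bsub>mon (down T)\<^esub> push (down T) I h m = push (down T) I (pull (down T) I n h) (\<lambda>i\<in>I. n \<otimes>\<^bsub>mon (down T)\<^esub> m i)"
    if "small I" "h \<in> opn Hp I" "m \<in> I \<rightarrow>\<^sub>E opn T (fin 1)" "n \<in> opn T (fin 1)" for I h m n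
    using that PiE_mem[OF that(3)]
    by (simp add: mult_down push_down pull_down ap_F_in op_F_in pl_in ap_op_pl F_model)
  show "pull (down T) I (push (down T) J k m) h = subst Hp J I k (\<lambda>j\<in>J. pull (down T) I (m j) h)"
    if I: "small I" and J: "small J" and "h \<in> opn Hp I" "k \<in> opn Hp J" "m \<in> J \<rightarrow>\<^sub>E opn T (fin 1)" for I J h k m
  proof -
    have h: "h \<in> opn T I" "hyperaffine T I h" and k: "k \<in> opn T J" "hyperaffine T J k"
      and m: "\<And>j. j \<in> J \<Longrightarrow> m j \<in> opn T (fin 1)" using that by auto
    let ?m = "op (F (fin 1)) J k m"
    have m1: "?m \<in> opn T (fin 1)" using J k m by (simp add: op_F_in)
    have "pl I ?m h = op (F I) J k (\<lambda>j. pl I (m j) h)"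
    proof (rule pl_unique)
      have "ap (F I) ?m h = op (F I) J k (\<lambda>j. ap (F I) (m j) h)"
        using I J h k m by (intro ap_op) (simp_all add: F_model)
      also have "\<dots> = op (F I) J k (\<lambda>j. op (F I) I (pl I (m j) h) (\<lambda>i. ap (F I) (m j) (pro T I i)))"
        using I h m by (intro op_cong ap_pl)
      \<comment> \<open>Absorption is used backwards: once \<open>k\<close> stands inside as well,
        the unary arguments no longer depend on \<open>j\<close> and combine to
        \<open>?m\<close>.\<close>
      also have "\<dots> = op (F I) J k (\<lambda>j. op (F I) I (pl I (m j) h) (\<lambda>i. op (F I) J k (\<lambda>j'. ap (F I) (m j') (pro T I i))))"
        using I J h k m by (intro haff_absorb[symmetric]) (simp_all add: F_model pl_in hyperaffine_pl ap_F_in pro_opn)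
      also have "\<dots> = op (F I) J k (\<lambda>j. op (F I) I (pl I (m j) h) (\<lambda>i. ap (F I) ?m (pro T I i)))"
        using I J k m by (intro op_cong) (simp add: ap_op F_model pro_opn)
      also have "\<dots> = op (F I) I (op (F I) J k (\<lambda>j. pl I (m j) h)) (\<lambda>i. ap (F I) ?m (pro T I i))"
        using I J h k m m1 by (intro op_op[symmetric]) (simp_all add: F_model pl_in ap_F_in pro_opn)
      finally show "ap (F I) ?m h = op (F I) I (op (F I) J k (\<lambda>j. pl I (m j) h)) (\<lambda>i. ap (F I) ?m (pro T I i))" .
    qed (use I J h k m m1 in \<open>simp_all add: op_F_in pl_in hyperaffine_op hyperaffine_pl\<close>)
    moreover have "(\<lambda>j\<in>J. pull (down T) I (m j) h) = (\<lambda>j\<in>J. pl I (m j) h)"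
      using I h m by (intro restrict_ext pull_down)
    ultimately show ?thesis using I J h k m m1 by (simp add: push_down pull_down op_F pl_in)
  qed
qed

end

section \<open>The category of matched pairs\<close>

lemma
  assumes "matched_hom P Q (\<phi>, f)"
  shows matched_hom_theory: "theory_hom (hth P) (hth Q) \<phi>"
    and matched_hom_in: "m \<in> carrier (mon P) \<Longrightarrow> f m \<in> carrier (mon Q)"
    and matched_hom_mult: "\<lbrakk>m \<in> carrier (mon P); n \<in> carrier (mon P)\<rbrakk> \<Longrightarrow>
      f (m \<otimes>\<^bsub>mon P\<^esub> n) = f m \<otimes>\<^bsub>mon Q\<^esub> f n"
    and matched_hom_ext: "f \<in> extensional (carrier (mon P))"
    and matched_hom_one: "f \<one>\<^bsub>mon P\<^esub> = \<one>\<^bsub>mon Q\<^esub>"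
    and matched_hom_pull: "\<lbrakk>small I; m \<in> carrier (mon P); h \<in> opn (hth P) I\<rbrakk> \<Longrightarrow>
      \<phi> I (pull P I m h) = pull Q I (f m) (\<phi> I h)"
    and matched_hom_push: "\<lbrakk>small I; h \<in> opn (hth P) I; k \<in> I \<rightarrow>\<^sub>E carrier (mon P)\<rbrakk> \<Longrightarrow>
      f (push P I h k) = push Q I (\<phi> I h) (\<lambda>i\<in>I. f (k i))"
  using assms by (auto simp: matched_hom_def hom_def)

lemma matched_homI:
  assumes "theory_hom (hth P) (hth Q) \<phi>"
    and "\<And>m. m \<in> carrier (mon P) \<Longrightarrow> f m \<in> carrier (mon Q)"
    and "\<And>m n. \<lbrakk>m \<in> carrier (mon P); n \<in> carrier (mon P)\<rbrakk> \<Longrightarrow>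
      f (m \<otimes>\<^bsub>mon P\<^esub> n) = f m \<otimes>\<^bsub>mon Q\<^esub> f n"
    and "f \<in> extensional (carrier (mon P))" "f \<one>\<^bsub>mon P\<^esub> = \<one>\<^bsub>mon Q\<^esub>"
    and "\<And>I m h. \<lbrakk>small I; m \<in> carrier (mon P); h \<in> opn (hth P) I\<rbrakk> \<Longrightarrow>
      \<phi> I (pull P I m h) = pull Q I (f m) (\<phi> I h)"
    and "\<And>I h n. \<lbrakk>small I; h \<in> opn (hth P) I; n \<in> I \<rightarrow>\<^sub>E carrier (mon P)\<rbrakk> \<Longrightarrow>
      f (push P I h n) = push Q I (\<phi> I h) (\<lambda>i\<in>I. f (n i))"
  shows "matched_hom P Q (\<phi>, f)"
  unfolding matched_hom_def prod.case hom_def using assms by auto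

lemma matched_hom_eqI:
  assumes "matched_hom P Q (\<phi>, f)" "matched_hom P Q' (\<psi>, g)"
    and "\<And>I h. \<lbrakk>small I; h \<in> opn (hth P) I\<rbrakk> \<Longrightarrow> \<phi> I h = \<psi> I h"
    and "\<And>m. m \<in> carrier (mon P) \<Longrightarrow> f m = g m"
  shows "\<phi> = \<psi>" "f = g"
proof -
  have "\<phi> = restrict_map (opn (hth P)) \<phi>" "\<psi> = restrict_map (opn (hth P)) \<psi>"
    using assms(1,2) by (simp_all add: matched_hom_def theory_hom_def)
  moreover have "restrict_map (opn (hth P)) \<phi> = restrict_map (opn (hth P)) \<psi>"
    using assms(3) by (auto simp: restrict_map_def fun_eq_iff)
  ultimately show "\<phi> = \<psi>" by simp
  show "f = g"
    using matched_hom_ext[OF assms(1)] matched_hom_ext[OF assms(2)] assms(4) by (rule extensionalityI)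
qed

definition matched_comp :: "'u matched \<Rightarrow> 'u matched_map \<Rightarrow> 'u matched_map \<Rightarrow> 'u matched_map" where
  "matched_comp P G F = (theory_comp (hth P) (fst G) (fst F), \<lambda>m\<in>carrier (mon P). snd G (snd F m))"

lemma
  shows Ob_HAff_Un [simp]: "P \<in> Ob HAff_Un \<longleftrightarrow> matched_pair P \<and> nondegenerate (hth P)"
    and Hom_HAff_Un [simp]: "F \<in> Hom HAff_Un P Q \<longleftrightarrow> matched_hom P Q F"
    and ident_HAff_Un [simp]: "ident HAff_Un P = (theory_id (hth P), \<lambda>m\<in>carrier (mon P). m)"
    and cmp_HAff_Un [simp]: "cmp HAff_Un P Q R G F = matched_comp P G F"
  by (simp_all add: HAff_Un_def matched_comp_def case_prod_beta)

lemma matched_hom_id: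
  fixes P :: "'u::universe matched"
  assumes "matched_pair P" shows "matched_hom P P (theory_id (hth P), \<lambda>m\<in>carrier (mon P). m)"
proof -
  interpret mp P by unfold_locales fact
  show ?thesis
  proof (rule matched_homI)
    show "theory_hom (hth P) (hth P) (theory_id (hth P))" by (rule theory_hom_id[OF H.T])
    fix I h n assume h: "small I" "h \<in> opn (hth P) I" "n \<in> I \<rightarrow>\<^sub>E carrier (mon P)"
    have "(\<lambda>i\<in>I. (\<lambda>m\<in>carrier (mon P). m) (n i)) = (\<lambda>i\<in>I. n i)"
      using h(3) by (intro restrict_ext) (auto dest: PiE_mem)
    also have "\<dots> = n" using h(3) by (rule restrict_PiE_self)
    finally have e: "(\<lambda>i\<in>I. (\<lambda>m\<in>carrier (mon P). m) (n i)) = n" .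
    have "push P I h n \<in> carrier (mon P)"
      using h ps_in[of I h n] PiE_mem[OF h(3)] by (simp add: push_eq)
    then show "(\<lambda>m\<in>carrier (mon P). m) (push P I h n) =
      push P I (theory_id (hth P) I h) (\<lambda>i\<in>I. (\<lambda>m\<in>carrier (mon P). m) (n i))"
      unfolding e using h by (simp add: theory_id_def)
  qed (simp_all add: theory_id_def pull_in)
qed

lemma matched_hom_comp:
  fixes P Q R :: "'u::universe matched"
  assumes PQR: "matched_pair P" "matched_pair Q" "matched_pair R"
    and F: "matched_hom P Q F" and G: "matched_hom Q R G"
  shows "matched_hom P R (matched_comp P G F)"
proof -
  obtain \<phi> f \<psi> g where FG: "F = (\<phi>, f)" "G = (\<psi>, g)" by (cases F, cases G) auto
  note F' = F[unfolded FG] and G' = G[unfolded FG]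
  interpret P: mp P by unfold_locales fact
  interpret Q: mp Q by unfold_locales fact
  interpret R: mp R by unfold_locales fact
  note th = matched_hom_theory[OF F'] matched_hom_theory[OF G']
  show ?thesis
    unfolding matched_comp_def FG fst_conv snd_conv
  proof (rule matched_homI)
    show "theory_hom (hth P) (hth R) (theory_comp (hth P) \<psi> \<phi>)"
      using P.H.T Q.H.T R.H.T th by (rule theory_hom_comp)
    fix I h n assume h: "small I" "h \<in> opn (hth P) I" "n \<in> I \<rightarrow>\<^sub>E carrier (mon P)"
    have n: "\<And>i. i \<in> I \<Longrightarrow> n i \<in> carrier (mon P)" using h(3) by auto
    have fn: "(\<lambda>i\<in>I. f (n i)) \<in> I \<rightarrow>\<^sub>E carrier (mon Q)" using n matched_hom_in[OF F'] by auto
    have "g (f (push P I h n)) = push R I (\<psi> I (\<phi> I h)) (\<lambda>i\<in>I. g ((\<lambda>i\<in>I. f (n i)) i))"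
      unfolding matched_hom_push[OF F' h]
      by (rule matched_hom_push[OF G' h(1) theory_hom_opn[OF th(1) h(1,2)] fn])
    also have "(\<lambda>i\<in>I. g ((\<lambda>i\<in>I. f (n i)) i)) = (\<lambda>i\<in>I. (\<lambda>m\<in>carrier (mon P). g (f m)) (n i))"
      using n by (intro restrict_ext) simp
    finally have e: "g (f (push P I h n)) = push R I (\<psi> I (\<phi> I h)) (\<lambda>i\<in>I. (\<lambda>m\<in>carrier (mon P). g (f m)) (n i))" .
    have "push P I h n \<in> carrier (mon P)" using h n P.ps_in[of I h n] by (simp add: P.push_eq)
    then show "(\<lambda>m\<in>carrier (mon P). g (f m)) (push P I h n) =
      push R I (theory_comp (hth P) \<psi> \<phi> I h) (\<lambda>i\<in>I. (\<lambda>m\<in>carrier (mon P). g (f m)) (n i))"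
      using e h by (simp only: restrict_apply' theory_comp_def restrict_map_apply)
  qed (simp_all add: theory_comp_def P.pull_in matched_hom_in[OF F'] matched_hom_in[OF G'] matched_hom_mult[OF F']
      matched_hom_mult[OF G'] matched_hom_one[OF F'] matched_hom_one[OF G'] matched_hom_pull[OF F']
      matched_hom_pull[OF G'] theory_hom_opn[OF th(1)])
qed

lemma category_HAff_Un: "category (HAff_Un :: ('u::universe matched, 'u matched_map) cat)"
  unfolding category_def
proof (intro conjI ballI)
  fix X Y :: "'u matched" and F assume h: "X \<in> Ob HAff_Un" "Y \<in> Ob HAff_Un" "F \<in> Hom HAff_Un X Y"
  obtain \<phi> f where F: "F = (\<phi>, f)" by (cases F)
  have XY: "matched_pair X" "matched_pair Y" and Fh: "matched_hom X Y (\<phi>, f)" using h F by auto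
  note c1 = matched_hom_comp[OF XY(1,1,2) matched_hom_id[OF XY(1)] Fh]
  note c2 = matched_hom_comp[OF XY(1,2,2) Fh matched_hom_id[OF XY(2)]]
  show "cmp HAff_Un X X Y F (ident HAff_Un X) = F"
    using matched_hom_eqI[OF c1[unfolded matched_comp_def] Fh]
    by (simp add: F matched_comp_def) (simp add: theory_comp_def theory_id_def)
  show "cmp HAff_Un X Y Y (ident HAff_Un Y) F = F"
    using matched_hom_eqI[OF c2[unfolded matched_comp_def] Fh]
    by (simp add: F matched_comp_def)
      (simp add: theory_comp_def theory_id_def theory_hom_opn[OF matched_hom_theory[OF Fh]] matched_hom_in[OF Fh])
next
  fix W X Y Z :: "'u matched" and f g h
  assume "W \<in> Ob HAff_Un" "X \<in> Ob HAff_Un" "Y \<in> Ob HAff_Un" "Z \<in> Ob HAff_Un" and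
    "f \<in> Hom HAff_Un W X" "g \<in> Hom HAff_Un X Y" "h \<in> Hom HAff_Un Y Z"
  then have f: "matched_hom W X (fst f, snd f)" by simp
  show "cmp HAff_Un W Y Z h (cmp HAff_Un W X Y g f) = cmp HAff_Un W X Z (cmp HAff_Un X Y Z h g) f"
    by (auto simp: matched_comp_def theory_comp_def restrict_map_def fun_eq_iff
        theory_hom_opn[OF matched_hom_theory[OF f]] matched_hom_in[OF f])
qed (auto intro: matched_hom_id matched_hom_comp)

section \<open>The functor from theories to matched pairs\<close>

lemma fob_down_functor [simp]: "fob down_functor = down"
  and far_down_functor: "far down_functor S T \<phi> =
    (restrict_map (opn (hyperaffine_part S)) \<phi>, restrict (\<phi> (fin 1)) (opn S (fin 1)))"
  by (simp_all add: down_functor_def)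

locale hau_hom = S: hau S + T: hau T for S T :: "'u::universe alg_theory" +
  fixes \<phi> assumes \<phi>: "theory_hom S T \<phi>"
begin

lemma \<phi>_op: "\<lbrakk>small I; small J; t \<in> opn S I; \<And>i. i \<in> I \<Longrightarrow> u i \<in> opn S J\<rbrakk>
    \<Longrightarrow> \<phi> J (op (S.F J) I t u) = op (T.F J) I (\<phi> I t) (\<lambda>i. \<phi> J (u i))"
  by (rule theory_hom_op[OF S.T T.T \<phi>])

lemma \<phi>_in: "\<lbrakk>small I; t \<in> opn S I\<rbrakk> \<Longrightarrow> \<phi> I t \<in> opn T I"
  by (rule theory_hom_opn[OF \<phi>])

lemma \<phi>_pro: "\<lbrakk>small I; i \<in> I\<rbrakk> \<Longrightarrow> \<phi> I (pro S I i) = pro T I i"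
  by (rule theory_hom_pro[OF \<phi>])

lemma \<phi>_e1: "\<phi> (fin 1) S.e1 = T.e1"
  unfolding S.e1_def T.e1_def by (rule \<phi>_pro) simp_all

lemma \<phi>_ap: "\<lbrakk>small I; m \<in> opn S (fin 1); t \<in> opn S I\<rbrakk> \<Longrightarrow> \<phi> I (ap (S.F I) m t) = ap (T.F I) (\<phi> (fin 1) m) (\<phi> I t)"
  unfolding ap_def by (rule \<phi>_op) simp_all

text \<open>For operations of \<open>S\<close> and \<open>T\<close>, affineness is the one equation
  that the unary part is \<open>e1\<close>. It is preserved by \<phi>, and in \<open>T\<close> it
  implies hyperaffineness.\<close>

lemma \<phi>_hyperaffine:
  assumes I: "small I" and h: "h \<in> opn S I" "hyperaffine S I h" shows "hyperaffine T I (\<phi> I h)"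
proof (rule T.hyperaffine_if_affine[OF I \<phi>_in[OF I h(1)]])
  have "T.dm I (\<phi> I h) = \<phi> (fin 1) (S.dm I h)"
    unfolding S.dm_def T.dm_def using I h by (simp add: \<phi>_op \<phi>_e1)
  then show "T.dm I (\<phi> I h) = T.e1" using I h by (simp add: S.hd_haff \<phi>_e1)
qed

lemma \<phi>_pl:
  assumes I: "small I" and m: "m \<in> opn S (fin 1)" and h: "h \<in> opn S I" "hyperaffine S I h"
  shows "\<phi> I (S.pl I m h) = T.pl I (\<phi> (fin 1) m) (\<phi> I h)"
proof (rule T.pl_unique[symmetric])
  have "\<phi> I (ap (S.F I) m h) = \<phi> I (op (S.F I) I (S.pl I m h) (\<lambda>i. ap (S.F I) m (pro S I i)))"
    using S.ap_pl[OF assms] by simp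
  then show "ap (T.F I) (\<phi> (fin 1) m) (\<phi> I h) =
      op (T.F I) I (\<phi> I (S.pl I m h)) (\<lambda>i. ap (T.F I) (\<phi> (fin 1) m) (pro T I i))"
    using I m h by (simp add: \<phi>_ap \<phi>_op S.pl_in S.ap_F_in S.pro_opn \<phi>_pro)
qed (use assms in \<open>simp_all add: \<phi>_in S.pl_in \<phi>_hyperaffine S.hyperaffine_pl\<close>)

lemma matched_hom_down: "matched_hom (down S) (down T) (far down_functor S T \<phi>)"
  unfolding far_down_functor
proof (rule matched_homI; (simp only: S.down_simps T.down_simps)?)
  show "theory_hom S.Hp T.Hp (restrict_map (opn S.Hp) \<phi>)"
  proof (rule theory_homI[OF S.algebraic_Hp T.algebraic_Hp])
    fix I J t u assume h: "small I" "small J" "t \<in> opn S.Hp I" "\<And>i. i \<in> I \<Longrightarrow> u i \<in> opn S.Hp J"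
    then show "\<phi> J (op (S.Hp.F J) I t u) = op (T.Hp.F J) I (\<phi> I t) (\<lambda>i. \<phi> J (u i))"
      by (simp add: S.op_Hp T.op_Hp \<phi>_op \<phi>_in \<phi>_hyperaffine)
  qed (simp_all add: \<phi>_in \<phi>_hyperaffine \<phi>_pro)
  show "restrict (\<phi> (fin 1)) (opn S (fin 1)) (m \<otimes>\<^bsub>mon (down S)\<^esub> n) =
    restrict (\<phi> (fin 1)) (opn S (fin 1)) m \<otimes>\<^bsub>mon (down T)\<^esub> restrict (\<phi> (fin 1)) (opn S (fin 1)) n"
    if "m \<in> opn S (fin 1)" "n \<in> opn S (fin 1)" for m n
    using that by (simp add: S.mult_down T.mult_down S.ap_F_in \<phi>_in \<phi>_ap)
  show "restrict_map (opn S.Hp) \<phi> I (pull (down S) I m h) =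
    pull (down T) I (restrict (\<phi> (fin 1)) (opn S (fin 1)) m) (restrict_map (opn S.Hp) \<phi> I h)"
    if "small I" "m \<in> opn S (fin 1)" "h \<in> opn S.Hp I" for I m h
    using that by (simp add: S.pull_down T.pull_down S.pl_in S.hyperaffine_pl \<phi>_in \<phi>_hyperaffine \<phi>_pl)
  show "restrict (\<phi> (fin 1)) (opn S (fin 1)) (push (down S) I h n) =
    push (down T) I (restrict_map (opn S.Hp) \<phi> I h) (\<lambda>i\<in>I. restrict (\<phi> (fin 1)) (opn S (fin 1)) (n i))"
    if "small I" "h \<in> opn S.Hp I" "n \<in> I \<rightarrow>\<^sub>E opn S (fin 1)" for I h n
    using that PiE_mem[OF that(3)]
    by (simp add: S.push_down T.push_down S.op_F_in \<phi>_in \<phi>_op)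
qed (simp_all add: \<phi>_in \<phi>_e1)

end

lemma down_in_HAff_Un: "(T :: 'u::universe alg_theory) \<in> Ob HAffUn \<Longrightarrow> down T \<in> Ob HAff_Un"
proof -
  assume "T \<in> Ob HAffUn"
  then have *: "hyperaffine_unary T" "nondegenerate T" by auto
  then interpret hau T by unfold_locales (auto simp: hau_algebraic)
  show ?thesis using matched_pair_down *(2) by (simp add: nondegenerate_def)
qed

lemma is_functor_down:
  "is_functor (HAffUn :: ('u::universe alg_theory, 'u theory_map) cat) HAff_Un down_functor"
  unfolding is_functor_def
proof (intro conjI ballI)
  show "category (HAffUn :: ('u alg_theory, 'u theory_map) cat)" by (rule category_HAffUn)
  show "category (HAff_Un :: ('u matched, 'u matched_map) cat)" by (rule category_HAff_Un)
  fix X :: "'u alg_theory" assume X: "X \<in> Ob HAffUn"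
  then show "fob down_functor X \<in> Ob HAff_Un" using down_in_HAff_Un by simp
  interpret X: hau X using X by unfold_locales (auto simp: hau_algebraic)
  show "far down_functor X X (ident HAffUn X) = ident HAff_Un (fob down_functor X)"
    by (auto simp: far_down_functor theory_id_def restrict_map_def fun_eq_iff)
next
  fix X Y :: "'u alg_theory" and f assume "X \<in> Ob HAffUn" "Y \<in> Ob HAffUn" "f \<in> Hom HAffUn X Y"
  then interpret hau_hom X Y f by unfold_locales (auto simp: hau_algebraic)
  show "far down_functor X Y f \<in> Hom HAff_Un (fob down_functor X) (fob down_functor Y)"
    using matched_hom_down by simp
next
  fix X Y Z :: "'u alg_theory" and f g
  assume "X \<in> Ob HAffUn" "Y \<in> Ob HAffUn" "Z \<in> Ob HAffUn" "f \<in> Hom HAffUn X Y" "g \<in> Hom HAffUn Y Z"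
  then interpret f: hau_hom X Y f + g: hau_hom Y Z g by unfold_locales (auto simp: hau_algebraic)
  show "far down_functor X Z (cmp HAffUn X Y Z g f) = cmp HAff_Un (fob down_functor X) (fob down_functor Y)
      (fob down_functor Z) (far down_functor Y Z g) (far down_functor X Y f)"
    by (auto simp: far_down_functor matched_comp_def theory_comp_def restrict_map_def fun_eq_iff
        f.\<phi>_in f.\<phi>_hyperaffine)
qed

lemma (in hau) op_hd_F: "\<lbrakk>small I; t \<in> opn T I\<rbrakk> \<Longrightarrow> t = op (F I) I (hd I t) (\<lambda>i. ap (F I) (dm I t) (pro T I i))"
  using decomp_hd by (simp add: decomp_def)

text \<open>Through decompositions a homomorphism is given by its restrictions to hyperaffine and to
  unary operations, and a pair \<open>(\<chi>, f)\<close> is extended by the same formula. That the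
  extension respects substitution follows by comparing the two parts of a composite.\<close>

lemma fully_faithful_down:
  "fully_faithful (HAffUn :: ('u::universe alg_theory, 'u theory_map) cat) HAff_Un down_functor"
  unfolding fully_faithful_def
proof (intro ballI)
  fix S T :: "'u alg_theory" assume "S \<in> Ob HAffUn" "T \<in> Ob HAffUn"
  then interpret S: hau S + T: hau T by unfold_locales (auto simp: hau_algebraic)
  let ?D = "far down_functor S T :: 'u theory_map \<Rightarrow> 'u matched_map"
  have "inj_on ?D {\<phi>. theory_hom S T \<phi>}"
  proof (rule inj_onI)
    fix \<phi> \<psi> assume "\<phi> \<in> {\<phi>. theory_hom S T \<phi>}" "\<psi> \<in> {\<phi>. theory_hom S T \<phi>}" and eq: "?D \<phi> = ?D \<psi>"
    then interpret p: hau_hom S T \<phi> + q: hau_hom S T \<psi> by unfold_locales auto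
    have "restrict_map (opn S.Hp) \<phi> I h = restrict_map (opn S.Hp) \<psi> I h" for I h
      using eq by (simp add: far_down_functor)
    then have h: "\<phi> I h = \<psi> I h" if "small I" "h \<in> opn S I" "hyperaffine S I h" for I h
      using that by (metis (mono_tags, lifting) S.Hp_simps(1) mem_Collect_eq restrict_map_apply)
    have "restrict (\<phi> (fin 1)) (opn S (fin 1)) m = restrict (\<psi> (fin 1)) (opn S (fin 1)) m" for m
      using eq by (simp add: far_down_functor)
    then have m: "\<phi> (fin 1) m = \<psi> (fin 1) m" if "m \<in> opn S (fin 1)" for m using that by (metis restrict_apply')
    show "\<phi> = \<psi>"
    proof (rule theory_hom_eqI[OF p.\<phi> q.\<phi>])
      fix I t assume I: "small I" and t: "t \<in> opn S I"
      have "\<phi> I t = op (T.F I) I (\<phi> I (S.hd I t)) (\<lambda>i. ap (T.F I) (\<phi> (fin 1) (S.dm I t)) (pro T I i))"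
        by (subst S.op_hd_F[OF I t])
          (use I t in \<open>simp add: p.\<phi>_op p.\<phi>_ap S.hd_in S.ap_F_in S.dm_in S.pro_opn p.\<phi>_pro\<close>)
      moreover have "\<psi> I t = op (T.F I) I (\<psi> I (S.hd I t)) (\<lambda>i. ap (T.F I) (\<psi> (fin 1) (S.dm I t)) (pro T I i))"
        by (subst S.op_hd_F[OF I t])
          (use I t in \<open>simp add: q.\<phi>_op q.\<phi>_ap S.hd_in S.ap_F_in S.dm_in S.pro_opn q.\<phi>_pro\<close>)
      ultimately show "\<phi> I t = \<psi> I t" using I t by (simp add: h m S.hd_in S.dm_in S.hyperaffine_hd)
    qed
  qed
  moreover have "?D ` {\<phi>. theory_hom S T \<phi>} = {G. matched_hom (down S) (down T) G}"
  proof (intro subset_antisym subsetI)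
    fix G assume "G \<in> ?D ` {\<phi>. theory_hom S T \<phi>}"
    then obtain \<phi> where "theory_hom S T \<phi>" and G: "G = ?D \<phi>" by blast
    then interpret hau_hom S T \<phi> by unfold_locales
    show "G \<in> {G. matched_hom (down S) (down T) G}" using matched_hom_down G by simp
  next
    fix G assume "G \<in> {G. matched_hom (down S) (down T) G}"
    then obtain \<chi> f where Geq: "G = (\<chi>, f)" and G: "matched_hom (down S) (down T) (\<chi>, f)" by (cases G) auto
    note \<chi>H = matched_hom_theory[OF G, unfolded S.down_simps T.down_simps]
    have \<chi>_in: "\<chi> I h \<in> opn T I" "hyperaffine T I (\<chi> I h)" if "small I" "h \<in> opn S I" "hyperaffine S I h" for I h
      using theory_hom_opn[OF \<chi>H that(1), of h] that by auto
    have \<chi>_pro: "\<chi> I (pro S I i) = pro T I i" if "small I" "i \<in> I" for I i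
      using theory_hom_pro[OF \<chi>H that] by simp
    have \<chi>_op: "\<chi> J (op (S.F J) I t u) = op (T.F J) I (\<chi> I t) (\<lambda>i. \<chi> J (u i))"
      if "small I" "small J" "t \<in> opn S I" "hyperaffine S I t" "\<And>i. i \<in> I \<Longrightarrow> u i \<in> opn S J"
        "\<And>i. i \<in> I \<Longrightarrow> hyperaffine S J (u i)" for I J t u
      using theory_hom_op[OF S.algebraic_Hp T.algebraic_Hp \<chi>H that(1,2), of t u] that
      by (simp add: S.op_Hp T.op_Hp \<chi>_in)
    have f_in: "f m \<in> opn T (fin 1)" if "m \<in> opn S (fin 1)" for m
      using matched_hom_in[OF G, of m] that by simp
    have f_e1: "f S.e1 = T.e1" using matched_hom_one[OF G] by simp
    have f_ap: "f (ap (S.F (fin 1)) m n) = ap (T.F (fin 1)) (f m) (f n)"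
      if "m \<in> opn S (fin 1)" "n \<in> opn S (fin 1)" for m n
      using matched_hom_mult[OF G, of m n] that by (simp add: S.mult_down T.mult_down f_in)
    have \<chi>_pl: "\<chi> I (S.pl I m h) = T.pl I (f m) (\<chi> I h)"
      if "small I" "m \<in> opn S (fin 1)" "h \<in> opn S I" "hyperaffine S I h" for I m h
      using matched_hom_pull[OF G that(1), of m h] that by (simp add: S.pull_down T.pull_down f_in \<chi>_in)
    have f_op: "f (op (S.F (fin 1)) I h n) = op (T.F (fin 1)) I (\<chi> I h) (\<lambda>i. f (n i))"
      if "small I" "h \<in> opn S I" "hyperaffine S I h" and n: "\<And>i. i \<in> I \<Longrightarrow> n i \<in> opn S (fin 1)" for I h n
    proof -
      have "restrict n I \<in> I \<rightarrow>\<^sub>E carrier (mon (down S))" using n by auto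
      from matched_hom_push[OF G that(1) _ this, of h]
      have "f (push (down S) I h (restrict n I)) = push (down T) I (\<chi> I h) (\<lambda>i\<in>I. f (restrict n I i))"
        using that by simp
      moreover have "push (down S) I h (restrict n I) = op (S.F (fin 1)) I h n"
        using that by (simp add: S.push_down)
      moreover have "push (down T) I (\<chi> I h) (\<lambda>i\<in>I. f (restrict n I i)) = op (T.F (fin 1)) I (\<chi> I h) (\<lambda>i. f (n i))"
        using that f_in by (simp add: T.push_down \<chi>_in)
      ultimately show ?thesis by (simp only:)
    qed
    define \<phi> where "\<phi> I t = op (T.F I) I (\<chi> I (S.hd I t)) (\<lambda>i. ap (T.F I) (f (S.dm I t)) (pro T I i))" for I t
    have h: "theory_hom S T (restrict_map (opn S) \<phi>)"
    proof (rule theory_homI[OF S.T T.T])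
      show "\<phi> I t \<in> opn T I" if "small I" "t \<in> opn S I" for I t
        unfolding \<phi>_def using that
        by (intro T.op_F_in \<chi>_in T.ap_F_in f_in S.dm_in S.hd_in S.hyperaffine_hd T.pro_opn)
      show "\<phi> I (pro S I i) = pro T I i" if "small I" "i \<in> I" for I i
        unfolding \<phi>_def using that
        by (simp add: S.hd_haff S.pro_opn S.hyperaffine_pro f_e1 \<chi>_pro T.op_F_pro T.ap_F_in T.pro_opn T.ap_e1 T.F_model)
    next
      fix I J t u assume I: "small I" and J: "small J" and t: "t \<in> opn S I" and u: "\<And>i. i \<in> I \<Longrightarrow> u i \<in> opn S J"
      let ?k = "S.hd I t" and ?m = "S.dm I t"
      have k: "?k \<in> opn S I" "hyperaffine S I ?k" and m: "?m \<in> opn S (fin 1)"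
        using I t by (simp_all add: S.hd_in S.hyperaffine_hd S.dm_in)
      have hu: "S.hd J (u i) \<in> opn S J" "hyperaffine S J (S.hd J (u i))" "S.dm J (u i) \<in> opn S (fin 1)" if "i \<in> I" for i
        using that J u by (simp_all add: S.hd_in S.hyperaffine_hd S.dm_in)
      have tu: "op (S.F J) I t u = op (S.F J) I ?k (\<lambda>i. ap (S.F J) ?m (u i))"
        using I J t u by (intro S.op_hd) (simp_all add: S.F_model)
      have au: "ap (S.F J) ?m (u i) \<in> opn S J" if "i \<in> I" for i using that J m u by (simp add: S.ap_F_in)
      have hdtu: "S.hd J (op (S.F J) I t u) = op (S.F J) I ?k (\<lambda>i. S.pl J ?m (S.hd J (u i)))"
        unfolding tu using J I k au by (subst S.hd_op_haff) (simp_all add: S.hd_ap m u)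
      have dmtu: "S.dm J (op (S.F J) I t u) = op (S.F (fin 1)) I ?k (\<lambda>i. ap (S.F (fin 1)) ?m (S.dm J (u i)))"
        unfolding tu using J I k au by (simp add: S.dm_op S.dm_ap m u)
      let ?K = "\<chi> I ?k" and ?M = "f ?m" and ?L = "\<lambda>i. \<chi> J (S.hd J (u i))" and ?N = "\<lambda>i. f (S.dm J (u i))"
      have K: "?K \<in> opn T I" "hyperaffine T I ?K" and M: "?M \<in> opn T (fin 1)" using I k m by (simp_all add: \<chi>_in f_in)
      have L: "?L i \<in> opn T J" "hyperaffine T J (?L i)" "?N i \<in> opn T (fin 1)" if "i \<in> I" for i
        using J hu[OF that] by (simp_all add: \<chi>_in f_in)
      have MN: "ap (T.F (fin 1)) ?M (?N i) \<in> opn T (fin 1)" if "i \<in> I" for i using M L that by (simp add: T.ap_F_in)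
      have e1: "\<chi> J (S.hd J (op (S.F J) I t u)) = op (T.F J) I ?K (\<lambda>i. T.pl J ?M (?L i))"
        unfolding hdtu using I J k m hu by (simp add: \<chi>_op \<chi>_pl S.pl_in S.hyperaffine_pl)
      have e2: "f (S.dm J (op (S.F J) I t u)) = op (T.F (fin 1)) I ?K (\<lambda>i. ap (T.F (fin 1)) ?M (?N i))"
        unfolding dmtu using I k m hu by (simp add: f_op f_ap S.ap_F_in)
      have "\<phi> J (op (S.F J) I t u) = op (T.F J) J (op (T.F J) I ?K (\<lambda>i. T.pl J ?M (?L i)))
          (\<lambda>j. ap (T.F J) (op (T.F (fin 1)) I ?K (\<lambda>i. ap (T.F (fin 1)) ?M (?N i))) (pro T J j))"
        unfolding \<phi>_def e1 e2 ..
      also have "\<dots> = op (T.F J) I ?K (\<lambda>i. op (T.F J) J (T.pl J ?M (?L i))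
          (\<lambda>j. ap (T.F J) (op (T.F (fin 1)) I ?K (\<lambda>i. ap (T.F (fin 1)) ?M (?N i))) (pro T J j)))"
        using I J K M L MN by (intro T.op_op) (simp_all add: T.F_model T.pl_in T.ap_F_in T.op_F_in T.pro_opn)
      also have "\<dots> = op (T.F J) I ?K (\<lambda>i. op (T.F J) J (T.pl J ?M (?L i))
          (\<lambda>j. op (T.F J) I ?K (\<lambda>i'. ap (T.F J) (ap (T.F (fin 1)) ?M (?N i')) (pro T J j))))"
        using I J K MN by (intro op_cong T.ap_op) (simp_all add: T.F_model T.pro_opn)
      \<comment> \<open>The copy of \<open>?K\<close> that stems from the unary part of the
        composite is absorbed by the outer one.\<close>
      also have "\<dots> = op (T.F J) I ?K (\<lambda>i. op (T.F J) J (T.pl J ?M (?L i))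
          (\<lambda>j. ap (T.F J) (ap (T.F (fin 1)) ?M (?N i)) (pro T J j)))"
        using I J K M L MN
        by (intro T.haff_absorb) (simp_all add: T.F_model T.pl_in T.hyperaffine_pl T.ap_F_in T.pro_opn)
      also have "\<dots> = op (T.F J) I ?K (\<lambda>i. op (T.F J) J (T.pl J ?M (?L i))
          (\<lambda>j. ap (T.F J) ?M (ap (T.F J) (?N i) (pro T J j))))"
        using J M L by (intro op_cong) (simp add: T.ap_ap T.F_model T.pro_opn)
      also have "\<dots> = op (T.F J) I ?K (\<lambda>i. ap (T.F J) ?M (\<phi> J (u i)))"
        unfolding \<phi>_def using J M L
        by (intro op_cong T.ap_op_pl[symmetric]) (simp_all add: T.F_model T.ap_F_in T.pro_opn)
      also have "\<dots> = op (T.F J) I (\<phi> I t) (\<lambda>i. \<phi> J (u i))"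
      proof -
        have \<phi>u: "\<phi> J (u i) \<in> opn T J" if "i \<in> I" for i
          unfolding \<phi>_def using J L[OF that] by (simp add: T.op_F_in T.ap_F_in T.pro_opn)
        show ?thesis
          unfolding \<phi>_def[of I] using I J K M \<phi>u
          by (simp add: T.op_op T.F_model T.ap_F_in T.pro_opn T.op_ap T.op_pro)
      qed
      finally show "\<phi> J (op (S.F J) I t u) = op (T.F J) I (\<phi> I t) (\<lambda>i. \<phi> J (u i))" .
    qed
    then interpret p: hau_hom S T "restrict_map (opn S) \<phi>" by unfold_locales
    have 1: "\<phi> I h = \<chi> I h" if "small I" "h \<in> opn S I" "hyperaffine S I h" for I h
      unfolding \<phi>_def using that
      by (simp add: S.hd_haff f_e1 T.ap_e1 T.F_model T.pro_opn T.op_F_pros \<chi>_in)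
    have 2: "\<phi> (fin 1) m = f m" if m: "m \<in> opn S (fin 1)" for m
    proof -
      have "ap (S.F (fin 1)) m (pro S (fin 1) (num 1)) = m" using S.ap_F1_e1[OF m] by (simp add: S.e1_def)
      then have "S.hd (fin 1) m = pro S (fin 1) (num 1)"
        using S.hd_ap_pro[of "fin 1" "num 1" m] m by simp
      then have "\<phi> (fin 1) m = ap (T.F (fin 1)) (f m) T.e1"
        unfolding \<phi>_def using m by (simp add: S.dm_fin1 \<chi>_pro T.op_F_pro T.ap_F_in T.pro_opn f_in T.e1_def)
      then show ?thesis using T.ap_F1_e1[OF f_in[OF m]] by simp
    qed
    have "?D (restrict_map (opn S) \<phi>) = G"
      using matched_hom_eqI[OF p.matched_hom_down[unfolded far_down_functor] G] 1 2
      by (simp add: far_down_functor Geq)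
    then show "G \<in> ?D ` {\<phi>. theory_hom S T \<phi>}" using h by blast
  qed
  moreover have "Hom HAffUn S T = {\<phi>. theory_hom S T \<phi>}" by auto
  moreover have "Hom HAff_Un (fob down_functor S) (fob down_functor T) = {G. matched_hom (down S) (down T) G}"
    by auto
  ultimately show "bij_betw ?D (Hom HAffUn S T) (Hom HAff_Un (fob down_functor S) (fob down_functor T))"
    by (simp add: bij_betw_def)
qed

text \<open>In one direction \<open>t\<close> inherits a support of \<open>hd I t\<close>, the unary
  part being applied to each argument. In the other, the operation on the support is replaced by its
  hyperaffine part, so that it lies in the subtheory.\<close>

lemma (in hau) finitary_hyperaffine_part: "finitary Hp \<longleftrightarrow> finitary T"
proof
  assume fin: "finitary Hp"
  show "finitary T" unfolding finitary_iff
  proof (intro allI impI ballI)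
    fix I t assume I: "small I" and t: "t \<in> opn T I"
    have k: "hd I t \<in> opn Hp I" and m: "dm I t \<in> opn T (fin 1)"
      using I t by (simp_all add: hd_in hyperaffine_hd dm_in)
    obtain J w where s: "Hp.supported I J w (hd I t)" using fin I k unfolding Hp.finitary_iff by blast
    then have J: "finite J" "J \<subseteq> I" "small J" and w: "w \<in> opn T J" "hyperaffine T J w"
      by (auto simp: Hp.supported_def small_finite)
    have kw: "hd I t = op (F I) J w (pro T I)"
      using s I J w unfolding Hp.supported_def by (subst op_Hp[symmetric]) (auto simp: pro_opn hyperaffine_pro)
    let ?v = "op (F J) J w (\<lambda>j. ap (F J) (dm I t) (pro T J j))"
    have pJ: "\<And>j. j \<in> J \<Longrightarrow> pro T I j \<in> opn T I" using I J by (auto simp: pro_opn)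
    have "t = op (F I) J w (\<lambda>j. op (F I) I (pro T I j) (\<lambda>i. ap (F I) (dm I t) (pro T I i)))"
      by (subst op_hd_F[OF I t], subst kw) (use I J w m pJ in \<open>simp add: op_op F_model ap_F_in pro_opn\<close>)
    also have "\<dots> = op (F I) J w (\<lambda>j. ap (F I) (dm I t) (pro T I j))"
      using I J m by (intro op_cong op_F_pro) (auto simp: ap_F_in pro_opn)
    also have "\<dots> = op (F I) J ?v (pro T I)"
      using I J w m pJ by (simp add: op_op F_model ap_F_in pro_opn op_ap op_F_pro)
    finally have "supported I J ?v t"
      using J w m by (simp add: supported_def op_F_in ap_F_in pro_opn)
    then show "\<exists>J w. supported I J w t" by blast
  qed
next
  assume fin: "finitary T"
  show "finitary Hp" unfolding Hp.finitary_iff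
  proof (intro allI impI ballI)
    fix I h assume I: "small I" and "h \<in> opn Hp I"
    then have h: "h \<in> opn T I" "hyperaffine T I h" by auto
    obtain J w where s: "supported I J w h" using fin I h unfolding finitary_iff by blast
    then have J: "finite J" "J \<subseteq> I" "small J" and w: "w \<in> opn T J" and hw: "h = op (F I) J w (pro T I)"
      by (auto simp: supported_def small_finite)
    have pJ: "\<And>j. j \<in> J \<Longrightarrow> pro T I j \<in> opn T I" "\<And>j. j \<in> J \<Longrightarrow> hyperaffine T I (pro T I j)"
      using I J by (auto simp: pro_opn hyperaffine_pro)
    let ?k = "hd J w" and ?m = "dm J w"
    have k: "?k \<in> opn T J" "hyperaffine T J ?k" and m: "?m \<in> opn T (fin 1)"
      using J w by (simp_all add: hd_in hyperaffine_hd dm_in)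
    let ?h = "op (F I) J ?k (pro T I)"
    have "hd I h = ?h"
    proof (rule hd_unique[OF I h(1)])
      have "op (F I) I ?h (\<lambda>i. ap (F I) ?m (pro T I i)) = op (F I) J ?k (\<lambda>j. op (F I) I (pro T I j) (\<lambda>i. ap (F I) ?m (pro T I i)))"
        using I J k m pJ by (intro op_op) (simp_all add: F_model ap_F_in pro_opn)
      also have "\<dots> = op (F I) J ?k (\<lambda>j. ap (F I) ?m (pro T I j))"
        using I J m by (intro op_cong op_F_pro) (auto simp: ap_F_in pro_opn)
      also have "\<dots> = h" unfolding hw using I J w pJ by (intro op_hd[symmetric]) (simp_all add: F_model)
      finally show "decomp I h ?h ?m"
        using I J k m pJ by (simp add: decomp_def op_F_in hyperaffine_op)
    qed
    then have "h = ?h" using I h by (simp add: hd_haff)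
    then have "h = op (Hp.F I) J ?k (pro T I)" using J k pJ by (simp add: op_Hp)
    then have "Hp.supported I J ?k h" using J k by (simp add: Hp.supported_def)
    then show "\<exists>J w. Hp.supported I J w h" by blast
  qed
qed

section \<open>The theory of a matched pair\<close>

context mp
begin

lemma ps_full_cong [cong]: "\<lbrakk>I = I'; h = h'; \<And>i. i \<in> I' \<Longrightarrow> m i = n i\<rbrakk> \<Longrightarrow> ps I h m = ps I' h' n"
  using ps_cong by metis

text \<open>Two of the laws of \<open>push\<close> say that the monoid is a model of the hyperaffine
  theory; constant families, diagonals and absorption in it are then inherited from models.\<close>

definition Mm :: "'u alg" where "Mm = mk_alg (hth P) C (push P)"

lemma car_Mm [simp]: "car Mm = C" by (simp add: Mm_def)

lemma op_Mm: "\<lbrakk>small I; h \<in> opn (hth P) I; \<And>i. i \<in> I \<Longrightarrow> n i \<in> C\<rbrakk> \<Longrightarrow> op Mm I h n = ps I h n"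
  unfolding Mm_def ps_def by (rule op_mk_alg)

lemma Mm_model: "H.Md Mm"
  unfolding Mm_def
proof (rule H.theory_model_mk_alg[OF small_C])
  fix I h n assume h: "small I" "h \<in> opn (hth P) I" "n \<in> I \<rightarrow>\<^sub>E C"
  then show "push P I h n \<in> C" using ps_in[of I h n] PiE_mem[OF h(3)] by (simp add: push_eq)
next
  fix I :: "'u set" and i n assume h: "small I" "i \<in> I" "n \<in> I \<rightarrow>\<^sub>E C"
  then show "push P I (pro (hth P) I i) n = n i" using ps_pro[of I i n] PiE_mem[OF h(3)] by (simp add: push_eq)
next
  fix I J h k m assume h: "small I" "small J" "h \<in> opn (hth P) I" "k \<in> I \<rightarrow>\<^sub>E opn (hth P) J" "m \<in> J \<rightarrow>\<^sub>E C"
  then show "push P J (subst (hth P) I J h k) m = push P I h (\<lambda>i\<in>I. push P J (k i) m)"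
    by (intro push_subst_law)
qed

lemma ps_const: "\<lbrakk>small I; h \<in> opn (hth P) I; m \<in> C\<rbrakk> \<Longrightarrow> ps I h (\<lambda>_. m) = m"
  using H.haff_const[OF haff _ _ Mm_model, of I h m] by (simp add: op_Mm)

lemma ps_diag: "\<lbrakk>small I; h \<in> opn (hth P) I; \<And>i j. \<lbrakk>i \<in> I; j \<in> I\<rbrakk> \<Longrightarrow> m i j \<in> C\<rbrakk>
    \<Longrightarrow> ps I h (\<lambda>i. ps I h (m i)) = ps I h (\<lambda>i. m i i)"
  using H.haff_diag[OF haff _ _ Mm_model, of I h m] by (simp add: op_Mm ps_in)

lemma ps_absorb:
  "\<lbrakk>small I; small J; k \<in> opn (hth P) J; \<And>j. j \<in> J \<Longrightarrow> l j \<in> opn (hth P) I;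
    \<And>i j. \<lbrakk>j \<in> J; i \<in> I\<rbrakk> \<Longrightarrow> y j i \<in> C\<rbrakk>
    \<Longrightarrow> ps J k (\<lambda>j. ps I (l j) (\<lambda>i. ps J k (\<lambda>j'. y j' i))) = ps J k (\<lambda>j. ps I (l j) (y j))"
  using H.haff_absorb[of I J k l Mm y] Mm_model by (simp add: op_Mm ps_in haff)

text \<open>The pair \<open>(h, m)\<close> stands for the operation \<open>h(\<lambda>i. m(x\<^sub>i))\<close>.\<close>

definition up :: "'u alg_theory" where
  "up = \<lparr>opn = (\<lambda>I. prod_set (opn (hth P) I) C), pro = (\<lambda>I i. pr (pro (hth P) I i) u1),
    subst = (\<lambda>I J t u. pr (op (H.F J) I (fs t) (\<lambda>i. pull P J (sn t) (fs (u i))))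
                          (ps I (fs t) (\<lambda>i. sn t \<odot> sn (u i))))\<rparr>"

lemma up_simps:
  "opn up I = prod_set (opn (hth P) I) C" "pro up I i = pr (pro (hth P) I i) u1"
  "subst up I J t u = pr (op (H.F J) I (fs t) (\<lambda>i. pull P J (sn t) (fs (u i))))
                          (ps I (fs t) (\<lambda>i. sn t \<odot> sn (u i)))"
  by (simp_all add: up_def)

lemma pr_opn_up [simp]: "pr h m \<in> opn up I \<longleftrightarrow> h \<in> opn (hth P) I \<and> m \<in> C"
  by (simp add: up_simps)

lemma opn_upE:
  assumes "t \<in> opn up I" obtains h m where "t = pr h m" "h \<in> opn (hth P) I" "m \<in> C"
  using assms by (auto simp: up_simps elim: prod_setE)

lemma opn_upD: "t \<in> opn up I \<Longrightarrow> fs t \<in> opn (hth P) I" "t \<in> opn up I \<Longrightarrow> sn t \<in> C"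
  by (auto elim: opn_upE)

lemma algebraic_up: "algebraic_theory up"
  unfolding algebraic_theory_def
proof (intro conjI allI impI ballI)
  fix I :: "'u set" assume I: "small I"
  show "small (opn up I)" using H.small_opn[OF I] small_C by (simp add: up_simps small_prod_set)
  show "pro up I i \<in> opn up I" if "i \<in> I" for i
    using I that by (simp add: H.pro_opn up_simps)
  fix t assume "t \<in> opn up I"
  then obtain h m where t: "t = pr h m" "h \<in> opn (hth P) I" "m \<in> C" by (rule opn_upE)
  then show "subst up I I t (\<lambda>i\<in>I. pro up I i) = t"
    using I by (simp add: up_simps pull_pro H.op_F_pros ps_const)
next
  fix I J t u assume I: "small I" and J: "small J" and t: "t \<in> opn up I" and u: "u \<in> I \<rightarrow>\<^sub>E opn up J"
  have u': "fs (u i) \<in> opn (hth P) J" "sn (u i) \<in> C" if "i \<in> I" for i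
    using opn_upD PiE_mem[OF u that] by auto
  show "subst up I J t u \<in> opn up J"
    using I J u' opn_upD[OF t] by (simp add: up_simps(3) H.op_F_in pull_in ps_in)
next
  fix I J :: "'u set" and i u assume I: "small I" and J: "small J" and i: "i \<in> I" and u: "u \<in> I \<rightarrow>\<^sub>E opn up J"
  have u': "fs (u i) \<in> opn (hth P) J" "sn (u i) \<in> C" "pr (fs (u i)) (sn (u i)) = u i" if "i \<in> I" for i
    using opn_upD PiE_mem[OF u that] by (auto elim: opn_upE)
  show "subst up I J (pro up I i) u = u i"
    using I J i u' by (simp add: up_simps H.op_F_pro pull_one ps_pro)
next
  fix I J K t u v assume I: "small I" and J: "small J" and K: "small K" and "t \<in> opn up I"
    and u: "u \<in> I \<rightarrow>\<^sub>E opn up J" and v: "v \<in> J \<rightarrow>\<^sub>E opn up K"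
  then obtain h m where t: "t = pr h m" and h: "h \<in> opn (hth P) I" and m: "m \<in> C" by (auto elim: opn_upE)
  define k n l p where "k i = fs (u i)" and "n i = sn (u i)" and "l j = fs (v j)" and "p j = sn (v j)" for i j
  have k: "\<And>i. i \<in> I \<Longrightarrow> k i \<in> opn (hth P) J" and n: "\<And>i. i \<in> I \<Longrightarrow> n i \<in> C"
    and l: "\<And>j. j \<in> J \<Longrightarrow> l j \<in> opn (hth P) K" and p: "\<And>j. j \<in> J \<Longrightarrow> p j \<in> C"
    unfolding k_def n_def l_def p_def
    using opn_upD(1)[OF PiE_mem[OF u]] opn_upD(2)[OF PiE_mem[OF u]]
      opn_upD(1)[OF PiE_mem[OF v]] opn_upD(2)[OF PiE_mem[OF v]] by simp_all
  note ty = I J K h m k n l p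
  \<comment> \<open>The hyperaffine component of associativity: \<open>pull\<close> along a
    \<open>push\<close> brings a second copy of \<open>h\<close> inside, and absorption removes
    it.\<close>
  have "op (H.F K) J (op (H.F J) I h (\<lambda>i. pull P J m (k i))) (\<lambda>j. pull P K (ps I h (\<lambda>i. m \<odot> n i)) (l j))
    = op (H.F K) I h (\<lambda>i. op (H.F K) J (pull P J m (k i)) (\<lambda>j. op (H.F K) I h (\<lambda>i'. pull P K (m \<odot> n i') (l j))))"
    using ty by (simp add: pull_ps H.op_op H.F_model pull_in H.op_F_in)
  also have "\<dots> = op (H.F K) I h (\<lambda>i. op (H.F K) J (pull P J m (k i)) (\<lambda>j. pull P K (m \<odot> n i) (l j)))"
    using ty by (intro H.haff_absorb) (simp_all add: pull_in haff H.F_model)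
  also have "\<dots> = op (H.F K) I h (\<lambda>i. pull P K m (op (H.F K) J (k i) (\<lambda>j. pull P K (n i) (l j))))"
    using ty by (simp add: pull_op pull_in pull_pull)
  finally have 1: "op (H.F K) J (op (H.F J) I h (\<lambda>i. pull P J m (k i))) (\<lambda>j. pull P K (ps I h (\<lambda>i. m \<odot> n i)) (l j))
    = op (H.F K) I h (\<lambda>i. pull P K m (op (H.F K) J (k i) (\<lambda>j. pull P K (n i) (l j))))" .
  \<comment> \<open>The unary component, with absorption now taking place in the model
    \<open>Mm\<close>.\<close>
  have "ps J (op (H.F J) I h (\<lambda>i. pull P J m (k i))) (\<lambda>j. ps I h (\<lambda>i. m \<odot> n i) \<odot> p j)
    = ps I h (\<lambda>i. ps J (pull P J m (k i)) (\<lambda>j. ps I h (\<lambda>i'. m \<odot> n i' \<odot> p j)))"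
    using ty by (simp add: ps_mult ps_op pull_in ps_in)
  also have "\<dots> = ps I h (\<lambda>i. ps J (pull P J m (k i)) (\<lambda>j. m \<odot> n i \<odot> p j))"
    using ty by (intro ps_absorb) (simp_all add: pull_in)
  also have "\<dots> = ps I h (\<lambda>i. m \<odot> ps J (k i) (\<lambda>j. n i \<odot> p j))"
    using ty by (simp add: mult_ps M.m_assoc)
  finally have 2: "ps J (op (H.F J) I h (\<lambda>i. pull P J m (k i))) (\<lambda>j. ps I h (\<lambda>i. m \<odot> n i) \<odot> p j)
    = ps I h (\<lambda>i. m \<odot> ps J (k i) (\<lambda>j. n i \<odot> p j))" .
  show "subst up J K (subst up I J t u) v = subst up I K t (\<lambda>i\<in>I. subst up J K (u i) v)"
    using 1 2 unfolding t by (simp add: up_simps k_def[symmetric] n_def[symmetric] l_def[symmetric] p_def[symmetric])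
qed

sublocale U: alg_th up by unfold_locales (rule algebraic_up)

lemma op_U:
  assumes "small I" "h \<in> opn (hth P) I" "m \<in> C" "\<And>i. i \<in> I \<Longrightarrow> u i \<in> opn up J"
  shows "op (U.F J) I (pr h m) u = pr (op (H.F J) I h (\<lambda>i. pull P J m (fs (u i)))) (ps I h (\<lambda>i. m \<odot> sn (u i)))"
  using assms by (simp add: U.op_F) (simp add: up_simps)

lemma opn_H1: assumes h: "h \<in> opn (hth P) (fin 1)" shows "h = H.e1"
proof -
  have "ap (H.F (fin 1)) h H.e1 = H.e1"
    unfolding ap_def using h by (intro H.haff_F_const haff) simp_all
  then show ?thesis using H.ap_F1_e1[OF h] by simp
qed

lemma pull_e1: "m \<in> C \<Longrightarrow> pull P (fin 1) m H.e1 = H.e1"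
  by (rule opn_H1) (simp add: pull_in)

lemma e1_U: "U.e1 = pr H.e1 u1"
  by (simp add: U.e1_def H.e1_def up_simps)

lemma ap_U:
  assumes "small K" "m \<in> C" "k \<in> opn (hth P) K" "n \<in> C"
  shows "ap (U.F K) (pr H.e1 m) (pr k n) = pr (pull P K m k) (m \<odot> n)"
  using assms H.ap_e1[of "H.F K" "pull P K m k"] unfolding ap_def
  by (simp add: op_U H.F_model pull_in ps_const)

lemma hyperaffine_U: assumes I: "small I" and h: "h \<in> opn (hth P) I" shows "hyperaffine up I (pr h u1)"
proof (rule U.hyperaffineI)
  fix K x assume "small K" "x \<in> opn up K"
  then show "op (U.F K) I (pr h u1) (\<lambda>_. x) = x"
    using I h by (auto elim!: opn_upE simp: op_U pull_one H.haff_F_const haff ps_const)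
next
  fix K and x :: "'u \<Rightarrow> 'u \<Rightarrow> 'u" assume K: "small K" and x: "\<And>i j. \<lbrakk>i \<in> I; j \<in> I\<rbrakk> \<Longrightarrow> x i j \<in> opn up K"
  have x': "fs (x i j) \<in> opn (hth P) K" "sn (x i j) \<in> C" if "i \<in> I" "j \<in> I" for i j
    using opn_upD[OF x[OF that]] by auto
  show "op (U.F K) I (pr h u1) (\<lambda>i. op (U.F K) I (pr h u1) (x i)) = op (U.F K) I (pr h u1) (\<lambda>i. x i i)"
    using I K h x x' by (simp add: op_U U.op_F_in pull_one H.op_F_in ps_in H.haff_F_diag haff ps_diag)
qed (use I h in simp_all)

text \<open>Evaluation at the constant family \<open>U.e1\<close> returns the unary component, which
  affineness therefore forces to be the unit.\<close>

lemma hyperaffine_U_iff: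
  assumes I: "small I" and t: "t \<in> opn up I"
  shows "hyperaffine up I t \<longleftrightarrow> sn t = u1"
proof
  obtain h m where hm: "t = pr h m" "h \<in> opn (hth P) I" "m \<in> C" using t by (rule opn_upE)
  assume "hyperaffine up I t"
  then have "op (U.F (fin 1)) I t (\<lambda>_. U.e1) = U.e1" by (intro U.haff_F_const I t) simp_all
  then show "sn t = u1" using I hm by (simp add: op_U e1_U ps_const)
next
  assume "sn t = u1"
  then show "hyperaffine up I t" using hyperaffine_U[OF I] t by (auto elim!: opn_upE)
qed

text \<open>The pair \<open>(h, m)\<close> is the hyperaffine \<open>(h, 1)\<close> applied to the
  unary \<open>(e1, m)\<close>; in any decomposition the unit and \<open>e1\<close> are forced by
  \<open>hyperaffine_U_iff\<close> and \<open>opn_H1\<close>.\<close>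

lemma decomp_U:
  assumes I: "small I" and h: "h \<in> opn (hth P) I" and m: "m \<in> C"
  shows "U.decomp I (pr h m) k n \<longleftrightarrow> k = pr h u1 \<and> n = pr H.e1 m"
proof -
  have key: "op (U.F I) I (pr a u1) (\<lambda>i. ap (U.F I) (pr H.e1 b) (pro up I i)) = pr a b"
    if a: "a \<in> opn (hth P) I" and b: "b \<in> C" for a b
  proof -
    have "ap (U.F I) (pr H.e1 b) (pro up I i) = pr (pro (hth P) I i) b" if "i \<in> I" for i
      using I b that by (simp add: up_simps ap_U H.pro_opn pull_pro)
    then have "op (U.F I) I (pr a u1) (\<lambda>i. ap (U.F I) (pr H.e1 b) (pro up I i))
      = op (U.F I) I (pr a u1) (\<lambda>i. pr (pro (hth P) I i) b)" by (rule op_cong)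
    also have "\<dots> = pr a b" using I a b by (simp add: op_U H.pro_opn pull_one H.op_F_pros ps_const)
    finally show ?thesis .
  qed
  show ?thesis
  proof
    assume d: "U.decomp I (pr h m) k n"
    then obtain a where a: "k = pr a u1" "a \<in> opn (hth P) I"
      using hyperaffine_U_iff[OF I, of k] by (auto simp: U.decomp_def elim!: opn_upE)
    obtain b where b: "n = pr H.e1 b" "b \<in> C"
      using d opn_H1 by (auto simp: U.decomp_def elim!: opn_upE)
    have "pr h m = pr a b" using d key[OF a(2) b(2)] unfolding a b U.decomp_def by simp
    then show "k = pr h u1 \<and> n = pr H.e1 m" using a b by simp
  next
    assume "k = pr h u1 \<and> n = pr H.e1 m"
    then show "U.decomp I (pr h m) k n"
      using key[OF h m] h m I H.e1_in by (simp add: U.decomp_def hyperaffine_U)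
  qed
qed

lemma hyperaffine_unary_up: "hyperaffine_unary up"
  unfolding U.hyperaffine_unary_iff
proof (intro allI impI ballI)
  fix I t assume I: "small I" and "t \<in> opn up I"
  then obtain h m where t: "t = pr h m" "h \<in> opn (hth P) I" "m \<in> C" by (auto elim: opn_upE)
  show "\<exists>!(k, n). U.decomp I t k n"
    by (rule ex1I[of _ "(pr h u1, pr H.e1 m)"]) (auto simp: t decomp_U[OF I t(2,3)])
qed

sublocale U: hau up by unfold_locales (rule hyperaffine_unary_up)

lemma hd_U: "\<lbrakk>small I; h \<in> opn (hth P) I; m \<in> C\<rbrakk> \<Longrightarrow> U.hd I (pr h m) = pr h u1"
  using U.decomp_hd[of I "pr h m"] decomp_U by simp

lemma pl_U: "\<lbrakk>small I; h \<in> opn (hth P) I; m \<in> C\<rbrakk> \<Longrightarrow> U.pl I (pr H.e1 m) (pr h u1) = pr (pull P I m h) u1"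
  unfolding U.pl_def by (simp add: ap_U hd_U pull_in)

lemma opn_U_Hp: "small I \<Longrightarrow> opn U.Hp I = (\<lambda>h. pr h u1) ` opn (hth P) I"
  using hyperaffine_U_iff by (auto elim!: opn_upE)

lemma opn_U1: "opn up (fin 1) = pr H.e1 ` C"
  using opn_H1 H.e1_in by (auto elim!: opn_upE)

lemma op_U_Hp:
  assumes "small I" "small J" "h \<in> opn (hth P) I" "\<And>i. i \<in> I \<Longrightarrow> k i \<in> opn (hth P) J"
  shows "op (U.F J) I (pr h u1) (\<lambda>i. pr (k i) u1) = pr (op (H.F J) I h k) u1"
  using assms by (simp add: op_U pull_one ps_const)

lemma ps_U:
  assumes "small I" "h \<in> opn (hth P) I" "\<And>i. i \<in> I \<Longrightarrow> n i \<in> C"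
  shows "op (U.F (fin 1)) I (pr h u1) (\<lambda>i. pr H.e1 (n i)) = pr H.e1 (ps I h n)"
  using assms by (simp add: op_U pull_one H.haff_F_const haff)

lemma from_U: "matched_hom (down up) P (restrict_map (opn U.Hp) (\<lambda>I. fs), \<lambda>m\<in>opn up (fin 1). sn m)"
proof (rule matched_homI; (simp only: U.down_simps)?)
  show "theory_hom U.Hp (hth P) (restrict_map (opn U.Hp) (\<lambda>I. fs))"
  proof (rule theory_homI[OF U.algebraic_Hp H.T])
    fix I J t u assume I: "small I" and J: "small J" and t: "t \<in> opn U.Hp I" and u: "\<And>i. i \<in> I \<Longrightarrow> u i \<in> opn U.Hp J"
    obtain h where h: "t = pr h u1" "h \<in> opn (hth P) I" using t opn_U_Hp[OF I] by auto
    have u': "u i = pr (fs (u i)) u1" "fs (u i) \<in> opn (hth P) J" if "i \<in> I" for i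
      using u[OF that] unfolding opn_U_Hp[OF J] by auto
    have "op (U.Hp.F J) I t u = op (U.F J) I t u" using I t u by (rule U.op_Hp)
    also have "\<dots> = op (U.F J) I (pr h u1) (\<lambda>i. pr (fs (u i)) u1)" unfolding h using u' by (intro op_cong) simp
    also have "\<dots> = pr (op (H.F J) I h (\<lambda>i. fs (u i))) u1" using I J h u' by (intro op_U_Hp)
    finally show "fs (op (U.Hp.F J) I t u) = op (H.F J) I (fs t) (\<lambda>i. fs (u i))" by (simp add: h)
  qed (simp_all add: opn_U_Hp del: U.Hp_simps(1), auto simp: up_simps)
  show "(\<lambda>m\<in>opn up (fin 1). sn m) (m \<otimes>\<^bsub>mon (down up)\<^esub> n) =
      (\<lambda>m\<in>opn up (fin 1). sn m) m \<odot> (\<lambda>m\<in>opn up (fin 1). sn m) n"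
    if "m \<in> opn up (fin 1)" "n \<in> opn up (fin 1)" for m n
    using that by (auto simp: U.mult_down U.ap_F_in) (auto simp: opn_U1 ap_U)
  show "(\<lambda>m\<in>opn up (fin 1). sn m) m \<in> C" if "m \<in> opn up (fin 1)" for m
    using that by (auto simp: opn_U1)
  show "(\<lambda>m\<in>opn up (fin 1). sn m) U.e1 = u1" using U.e1_in by (simp add: e1_U)
  show "restrict_map (opn U.Hp) (\<lambda>I. fs) I (pull (down up) I m h) =
      pull P I ((\<lambda>m\<in>opn up (fin 1). sn m) m) (restrict_map (opn U.Hp) (\<lambda>I. fs) I h)"
    if I: "small I" and m: "m \<in> opn up (fin 1)" and h: "h \<in> opn U.Hp I" for I m h
  proof -
    have "pull (down up) I m h = U.pl I m h" "pull (down up) I m h \<in> opn U.Hp I"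
      using that by (simp_all add: U.pull_down U.pl_in U.hyperaffine_pl)
    moreover obtain k n where "h = pr k u1" "k \<in> opn (hth P) I" "m = pr H.e1 n" "n \<in> C"
      using m h unfolding opn_U_Hp[OF I] by (auto simp: opn_U1)
    ultimately show ?thesis using I m h by (simp add: pl_U del: U.Hp_simps(1))
  qed
  show "(\<lambda>m\<in>opn up (fin 1). sn m) (push (down up) I h n) =
      push P I (restrict_map (opn U.Hp) (\<lambda>I. fs) I h) (\<lambda>i\<in>I. (\<lambda>m\<in>opn up (fin 1). sn m) (n i))"
    if I: "small I" and h: "h \<in> opn U.Hp I" and n: "n \<in> I \<rightarrow>\<^sub>E opn up (fin 1)" for I h n
  proof -
    obtain k where k: "h = pr k u1" "k \<in> opn (hth P) I" using h opn_U_Hp[OF I] by auto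
    have n': "n i = pr H.e1 (sn (n i))" "sn (n i) \<in> C" "n i \<in> opn up (fin 1)" if "i \<in> I" for i
      using PiE_mem[OF n that] by (auto simp: opn_U1)
    have "push (down up) I h n = op (U.F (fin 1)) I (pr k u1) (\<lambda>i. pr H.e1 (sn (n i)))"
    proof -
      have "push (down up) I h n = op (U.F (fin 1)) I h n" using I h n' by (intro U.push_down) auto
      also have "\<dots> = op (U.F (fin 1)) I (pr k u1) (\<lambda>i. pr H.e1 (sn (n i)))"
        unfolding k using n'(1) by (intro op_cong)
      finally show ?thesis .
    qed
    also have "\<dots> = pr H.e1 (ps I k (\<lambda>i. sn (n i)))" using I k n' by (intro ps_U)
    finally have e: "push (down up) I h n = pr H.e1 (ps I k (\<lambda>i. sn (n i)))" .
    have r: "(\<lambda>i\<in>I. (\<lambda>m\<in>opn up (fin 1). sn m) (n i)) = (\<lambda>i\<in>I. sn (n i))"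
      using n' by (intro restrict_ext) simp
    have "ps I k (\<lambda>i. sn (n i)) \<in> C" using I k n' by (simp add: ps_in)
    then have "(\<lambda>m\<in>opn up (fin 1). sn m) (push (down up) I h n) = ps I k (\<lambda>i. sn (n i))"
      unfolding e using H.e1_in by simp
    moreover have "restrict_map (opn U.Hp) (\<lambda>I. fs) I h = k"
      unfolding restrict_map_def using I h k by (simp del: U.Hp_simps(1))
    ultimately show ?thesis unfolding r by (simp only: ps_def)
  qed
qed simp

lemma to_U: "matched_hom P (down up) (restrict_map (opn (hth P)) (\<lambda>I h. pr h u1), \<lambda>m\<in>C. pr H.e1 m)"
proof (rule matched_homI; (simp only: U.down_simps)?)
  show "theory_hom (hth P) U.Hp (restrict_map (opn (hth P)) (\<lambda>I h. pr h u1))"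
  proof (rule theory_homI[OF H.T U.algebraic_Hp])
    fix I J t u assume h: "small I" "small J" "t \<in> opn (hth P) I" "\<And>i. i \<in> I \<Longrightarrow> u i \<in> opn (hth P) J"
    then have "op (U.Hp.F J) I (pr t u1) (\<lambda>i. pr (u i) u1) = op (U.F J) I (pr t u1) (\<lambda>i. pr (u i) u1)"
      by (intro U.op_Hp) (simp_all add: hyperaffine_U)
    then show "pr (op (H.F J) I t u) u1 = op (U.Hp.F J) I (pr t u1) (\<lambda>i. pr (u i) u1)"
      using h by (simp add: op_U_Hp)
  qed (simp_all add: hyperaffine_U up_simps(2))
  show "restrict_map (opn (hth P)) (\<lambda>I h. pr h u1) I (pull P I m h) =
      pull (down up) I ((\<lambda>m\<in>C. pr H.e1 m) m) (restrict_map (opn (hth P)) (\<lambda>I h. pr h u1) I h)"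
    if "small I" "m \<in> C" "h \<in> opn (hth P) I" for I m h
    using that H.e1_in by (simp add: pull_in U.pull_down hyperaffine_U pl_U)
  show "(\<lambda>m\<in>C. pr H.e1 m) (push P I h n) =
      push (down up) I (restrict_map (opn (hth P)) (\<lambda>I h. pr h u1) I h) (\<lambda>i\<in>I. (\<lambda>m\<in>C. pr H.e1 m) (n i))"
    if h: "small I" "h \<in> opn (hth P) I" and n: "n \<in> I \<rightarrow>\<^sub>E C" for I h n
  proof -
    have n': "\<And>i. i \<in> I \<Longrightarrow> n i \<in> C" using n by auto
    have "push (down up) I (pr h u1) (\<lambda>i\<in>I. (\<lambda>m\<in>C. pr H.e1 m) (n i)) =
      op (U.F (fin 1)) I (pr h u1) (\<lambda>i\<in>I. (\<lambda>m\<in>C. pr H.e1 m) (n i))"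
      using h n' H.e1_in by (intro U.push_down) simp_all
    also have "\<dots> = op (U.F (fin 1)) I (pr h u1) (\<lambda>i. pr H.e1 (n i))" using n' by (intro op_cong) simp
    also have "\<dots> = pr H.e1 (ps I h n)" using h n' by (intro ps_U)
    finally show ?thesis using h n n' by (simp add: push_eq ps_in)
  qed
qed (use H.e1_in in \<open>simp_all add: e1_U U.mult_down ap_U pull_e1\<close>)

text \<open>The hyperaffine operations of \<open>up\<close> are the pairs \<open>(h, 1)\<close> and
  the unary ones the pairs \<open>(e1, m)\<close>, so the two homomorphisms only drop or insert a
  constant.\<close>

lemma isomorphic_down_up: "isomorphic HAff_Un (down up) P"
proof -
  let ?f = "(restrict_map (opn U.Hp) (\<lambda>I. fs), \<lambda>m\<in>opn up (fin 1). sn m) :: 'u matched_map"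
  let ?g = "(restrict_map (opn (hth P)) (\<lambda>I h. pr h u1), \<lambda>m\<in>C. pr H.e1 m) :: 'u matched_map"
  note mpU = U.matched_pair_down
  have "cmp HAff_Un (down up) P (down up) ?g ?f = ident HAff_Un (down up)"
  proof -
    have 1: "matched_hom (down up) (down up) (matched_comp (down up) ?g ?f)"
      by (rule matched_hom_comp[OF mpU matched mpU from_U to_U])
    note eq = matched_hom_eqI[OF 1[unfolded matched_comp_def fst_conv snd_conv] matched_hom_id[OF mpU],
        unfolded U.down_simps]
    have A: "theory_comp U.Hp (fst ?g) (fst ?f) I h = theory_id U.Hp I h" if "small I" "h \<in> opn U.Hp I" for I h
      using that by (auto simp: theory_comp_def theory_id_def opn_U_Hp simp del: U.Hp_simps(1))
    have B: "(\<lambda>m\<in>opn up (fin 1). snd ?g (snd ?f m)) m = (\<lambda>m\<in>opn up (fin 1). m) m" if "m \<in> opn up (fin 1)" for m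
      using that by (auto simp: opn_U1)
    have "theory_comp U.Hp (fst ?g) (fst ?f) = theory_id U.Hp"
      unfolding fst_conv by (rule eq(1)) (rule A[unfolded fst_conv], assumption+, rule B[unfolded snd_conv])
    moreover have "(\<lambda>m\<in>opn up (fin 1). snd ?g (snd ?f m)) = (\<lambda>m\<in>opn up (fin 1). m)"
      unfolding snd_conv by (rule eq(2)) (rule A[unfolded fst_conv], assumption+, rule B[unfolded snd_conv])
    ultimately show ?thesis unfolding cmp_HAff_Un ident_HAff_Un matched_comp_def U.down_simps by (simp only:)
  qed
  moreover have "cmp HAff_Un P (down up) P ?f ?g = ident HAff_Un P"
  proof -
    have 1: "matched_hom P P (matched_comp P ?f ?g)"
      by (rule matched_hom_comp[OF matched mpU matched to_U from_U])
    note eq = matched_hom_eqI[OF 1[unfolded matched_comp_def fst_conv snd_conv] matched_hom_id[OF matched]]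
    have A: "theory_comp (hth P) (fst ?f) (fst ?g) I h = theory_id (hth P) I h"
      if "small I" "h \<in> opn (hth P) I" for I h
      using that by (simp add: theory_comp_def theory_id_def opn_U_Hp del: U.Hp_simps(1))
    have B: "(\<lambda>m\<in>C. snd ?f (snd ?g m)) m = (\<lambda>m\<in>C. m) m" if "m \<in> C" for m
      using that H.e1_in by simp
    have "theory_comp (hth P) (fst ?f) (fst ?g) = theory_id (hth P)"
      unfolding fst_conv by (rule eq(1)) (rule A[unfolded fst_conv], assumption+, rule B[unfolded snd_conv])
    moreover have "(\<lambda>m\<in>C. snd ?f (snd ?g m)) = (\<lambda>m\<in>C. m)"
      unfolding snd_conv by (rule eq(2)) (rule A[unfolded fst_conv], assumption+, rule B[unfolded snd_conv])
    ultimately show ?thesis unfolding cmp_HAff_Un ident_HAff_Un matched_comp_def by (simp only:)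
  qed
  ultimately show ?thesis
    using from_U to_U unfolding isomorphic_def is_iso_def inverse_arrows_def Hom_HAff_Un by blast
qed

end

lemma ess_surjective_down:
  "ess_surjective (HAffUn :: ('u::universe alg_theory, 'u theory_map) cat) HAff_Un down_functor"
  unfolding ess_surjective_def
proof
  fix P :: "'u matched" assume P: "P \<in> Ob HAff_Un"
  then interpret mp P by unfold_locales simp
  have "nondegenerate up" using P by (simp add: nondegenerate_def up_simps)
  then show "\<exists>T\<in>Ob (HAffUn :: ('u alg_theory, 'u theory_map) cat). isomorphic HAff_Un (fob down_functor T) P"
    using isomorphic_down_up hyperaffine_unary_up by (intro bexI[of _ up]) simp_all
qed

section \<open>Models of matched pairs\<close>

lemma reduct_reduct:
  "(\<And>s. s \<in> \<Sigma> \<Longrightarrow> \<sigma> s \<in> \<Sigma>') \<Longrightarrow> reduct \<Sigma> \<sigma> (reduct \<Sigma>' \<sigma>' X) = reduct \<Sigma> (\<lambda>s. \<sigma>' (\<sigma> s)) X"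
  unfolding reduct_def by (auto intro!: restrict_ext)

lemma reduct_cong: "(\<And>s. s \<in> \<Sigma> \<Longrightarrow> \<sigma> s = \<sigma>' s) \<Longrightarrow> reduct \<Sigma> \<sigma> X = reduct \<Sigma> \<sigma>' X"
  unfolding reduct_def by (auto intro!: restrict_ext)

lemma reduct_id: "is_alg \<Sigma> ar X \<Longrightarrow> reduct \<Sigma> (\<lambda>s. s) X = X"
  unfolding reduct_def is_alg_def by (auto simp: PiE_restrict)

lemma matched_syms_simps [simp]:
  "OpSym I h \<in> matched_syms P \<longleftrightarrow> small I \<and> h \<in> opn (hth P) I"
  "ActSym m \<in> matched_syms P \<longleftrightarrow> m \<in> carrier (mon P)"
  by (auto simp: matched_syms_def)

lemma matched_symsE:
  assumes "s \<in> matched_syms P"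
  obtains I h where "s = OpSym I h" "small I" "h \<in> opn (hth P) I"
    | m where "s = ActSym m" "m \<in> carrier (mon P)"
  using assms by (auto simp: matched_syms_def elim: theory_symsE)

lemma act_reduct: "ActSym m \<in> \<Sigma> \<Longrightarrow> \<sigma> (ActSym m) = ActSym m' \<Longrightarrow> act (reduct \<Sigma> \<sigma> X) m x = act X m' x"
  by (simp add: act_def reduct_def)

lemma PiE_fin1: "x \<in> fin 1 \<rightarrow>\<^sub>E A \<longleftrightarrow> (\<exists>a\<in>A. x = (\<lambda>_\<in>fin 1. a))"
proof
  assume x: "x \<in> fin 1 \<rightarrow>\<^sub>E A"
  then have "x (num 1) \<in> A" by auto
  moreover have "x = (\<lambda>_\<in>fin 1. x (num 1))"
    using x by (auto simp: fin_1 PiE_def extensional_def fun_eq_iff)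
  ultimately show "\<exists>a\<in>A. x = (\<lambda>_\<in>fin 1. a)" by blast
qed auto

lemma ball_PiE_fin1: "(\<forall>x \<in> fin 1 \<rightarrow>\<^sub>E A. R x) \<longleftrightarrow> (\<forall>a\<in>A. R (\<lambda>_\<in>fin 1. a))"
  unfolding Ball_def PiE_fin1 by blast

text \<open>A family indexed by \<open>fin 1\<close> is a single element, so the condition for the
  symbols \<open>ActSym m\<close> becomes equivariance.\<close>

lemma matched_hom_alg_iff:
  "alg_hom (matched_syms P) sym_arity X Y f \<longleftrightarrow> f \<in> car X \<rightarrow>\<^sub>E car Y \<and>
     (\<forall>I h x. small I \<longrightarrow> h \<in> opn (hth P) I \<longrightarrow> (\<forall>i\<in>I. x i \<in> car X) \<longrightarrow>
        f (op X I h x) = op Y I h (\<lambda>i. f (x i))) \<and>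
     (\<forall>m\<in>carrier (mon P). \<forall>x\<in>car X. f (act X m x) = act Y m (f x))"
proof -
  have "alg_hom (matched_syms P) sym_arity X Y f \<longleftrightarrow> thom (hth P) X Y f \<and>
    (\<forall>m\<in>carrier (mon P). \<forall>x \<in> fin 1 \<rightarrow>\<^sub>E car X. f (itp X (ActSym m) x) = itp Y (ActSym m) (\<lambda>i\<in>fin 1. f (x i)))"
    unfolding alg_hom_def matched_syms_def by auto
  also have "(\<forall>m\<in>carrier (mon P). \<forall>x \<in> fin 1 \<rightarrow>\<^sub>E car X. f (itp X (ActSym m) x) = itp Y (ActSym m) (\<lambda>i\<in>fin 1. f (x i)))
    \<longleftrightarrow> (\<forall>m\<in>carrier (mon P). \<forall>x\<in>car X. f (act X m x) = act Y m (f x))"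
  proof -
    have e: "(\<lambda>i\<in>fin 1. f ((\<lambda>_\<in>fin 1. x) i)) = (\<lambda>_\<in>fin 1. f x)" for x by auto
    show ?thesis by (simp only: act_def ball_PiE_fin1 e)
  qed
  finally show ?thesis by (simp add: thom_iff)
qed

lemma model_laws_cong:
  assumes H: "algebraic_theory H" and "car X = car Y"
    and itp: "\<And>I t. \<lbrakk>small I; t \<in> opn H I\<rbrakk> \<Longrightarrow> itp X (OpSym I t) = itp Y (OpSym I t)"
    and X: "model_laws H X"
  shows "model_laws H (Y :: 'u::universe alg)"
proof -
  interpret alg_th H by unfold_locales fact
  show ?thesis
    unfolding model_laws_def
  proof (intro conjI allI impI ballI)
    fix I :: "'u set" and i x assume "small I" "i \<in> I" "x \<in> I \<rightarrow>\<^sub>E car Y"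
    moreover from this have "itp X (OpSym I (pro H I i)) x = x i"
      using X assms(2) by (simp add: model_laws_def)
    ultimately show "itp Y (OpSym I (pro H I i)) x = x i"
      using itp[of I "pro H I i"] by (metis pro_opn)
  next
    fix I J t u x assume h: "small I" "small J" "t \<in> opn H I" "u \<in> I \<rightarrow>\<^sub>E opn H J" "x \<in> J \<rightarrow>\<^sub>E car Y"
    then have "itp X (OpSym J (subst H I J t u)) x = itp X (OpSym I t) (\<lambda>i\<in>I. itp X (OpSym J (u i)) x)"
      using X assms(2) by (simp add: model_laws_def)
    also have "(\<lambda>i\<in>I. itp X (OpSym J (u i)) x) = (\<lambda>i\<in>I. itp Y (OpSym J (u i)) x)"
      using h by (intro restrict_ext) (simp add: itp[OF h(2)] PiE_mem[OF h(4)])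
    finally show "itp Y (OpSym J (subst H I J t u)) x = itp Y (OpSym I t) (\<lambda>i\<in>I. itp Y (OpSym J (u i)) x)"
      unfolding itp[OF h(1,3)] itp[OF h(2) subst_opn[OF h(1-4)]] .
  qed
qed

definition act_trm :: "'u \<Rightarrow> 'u trm \<Rightarrow> 'u trm" where
  "act_trm m a = App (ActSym m) (\<lambda>_. a)"

lemma ev_act_trm: "ev sym_arity X \<rho> (act_trm m a) = act X m (ev sym_arity X \<rho> a)"
  by (simp add: act_trm_def act_def)

text \<open>One equation for each instance of each law, so that the models coincide with
  \<open>matched_model\<close> on the nose.\<close>

definition matched_eqns :: "'u::universe matched \<Rightarrow> 'u eqn_theory" where
  "matched_eqns P = \<lparr>syms = matched_syms P, arity = sym_arity,
     eqns = {(I, App (OpSym I (pro (hth P) I i)) Var, Var i) | I i. small I \<and> i \<in> I} \<union>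
       {(J, App (OpSym J (subst (hth P) I J t u)) Var, App (OpSym I t) (\<lambda>i. App (OpSym J (u i)) Var)) | I J t u.
          small I \<and> small J \<and> t \<in> opn (hth P) I \<and> u \<in> I \<rightarrow>\<^sub>E opn (hth P) J} \<union>
       {(fin 1, act_trm \<one>\<^bsub>mon P\<^esub> (Var (num 1)), Var (num 1))} \<union>
       {(fin 1, act_trm (m \<otimes>\<^bsub>mon P\<^esub> n) (Var (num 1)), act_trm m (act_trm n (Var (num 1)))) | m n.
          m \<in> carrier (mon P) \<and> n \<in> carrier (mon P)} \<union>
       {(fin 1, act_trm (push P I h m) (Var (num 1)), App (OpSym I h) (\<lambda>i. act_trm (m i) (Var (num 1)))) | I h m.
          small I \<and> h \<in> opn (hth P) I \<and> m \<in> I \<rightarrow>\<^sub>E carrier (mon P)} \<union>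
       {(I, act_trm n (App (OpSym I h) Var), App (OpSym I (pull P I n h)) (\<lambda>i. act_trm n (Var i))) | I h n.
          small I \<and> h \<in> opn (hth P) I \<and> n \<in> carrier (mon P)}\<rparr>"

lemma eqn_model_matched_eqns: "eqn_model (matched_eqns P) X \<longleftrightarrow> matched_model P X"
  unfolding eqn_model_def matched_model_def model_laws_def matched_eqns_def eqn_theory.simps Let_def
    ball_Un ball_Collect2 ball_Collect3 ball_Collect4 prod.case ev.simps ev_act_trm sym_arity.simps ball_simps
    ball_PiE_fin1
  by (auto simp: restrict_PiE_self)

context mp
begin

lemma is_trm_act: "m \<in> C \<Longrightarrow> is_trm (matched_syms P) sym_arity K a \<Longrightarrow> is_trm (matched_syms P) sym_arity K (act_trm m a)"
  unfolding act_trm_def by (intro is_trm.intros) simp_all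

lemma equational_matched_eqns: "equational_theory (matched_eqns P)"
  unfolding equational_theory_def
proof (intro conjI)
  have "|ActSym ` C| \<le>o |UNIV :: 'u set|"
    by (rule ordLeq_transitive[OF card_of_image card_of_mono1]) simp
  moreover have "|theory_syms (hth P)| \<le>o |UNIV :: 'u set|" using card_OpSyms by (simp add: theory_syms_def)
  ultimately have "|theory_syms (hth P) \<union> ActSym ` C| \<le>o |UNIV :: 'u set|"
    by (intro card_of_Un_ordLeq_infinite_Field[OF _ _ _ card_of_Card_order]) (auto simp: infinite_universe Field_card_of)
  then show "|syms (matched_eqns P)| \<le>o |UNIV :: 'u set|"
    by (simp add: matched_eqns_def matched_syms_def)
  show "\<forall>s\<in>syms (matched_eqns P). small (arity (matched_eqns P) s)"
    by (auto simp: matched_eqns_def elim!: matched_symsE)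
  have ps': "push P I h m \<in> C" if "small I" "h \<in> opn (hth P) I" "m \<in> I \<rightarrow>\<^sub>E C" for I h m
    using ps_in[OF that(1,2), of m] PiE_mem[OF that(3)] push_eq[OF that(3)] by simp
  show "\<forall>(K, a, b)\<in>eqns (matched_eqns P). small K \<and>
     is_trm (syms (matched_eqns P)) (arity (matched_eqns P)) K a \<and> is_trm (syms (matched_eqns P)) (arity (matched_eqns P)) K b"
    by (auto simp: matched_eqns_def H.pro_opn H.subst_opn pull_in ps' intro!: is_trm.intros is_trm_act)
qed

lemma matched_Mod_eq_eqn_Mod: "matched_Mod P = eqn_Mod (matched_eqns P)"
  unfolding matched_Mod_def eqn_Mod_def eqn_model_matched_eqns by (simp add: matched_eqns_def)

lemma concrete_category_matched_Mod: "concrete_category (matched_Mod P)"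
  using concrete_category_eqn_Mod matched_Mod_eq_eqn_Mod by metis

lemma
  shows cob_matched_Mod [simp]: "X \<in> cob (matched_Mod P) \<longleftrightarrow> matched_model P X"
    and und_matched_Mod [simp]: "und (matched_Mod P) = car"
    and chom_matched_Mod [simp]: "f \<in> chom (matched_Mod P) X Y \<longleftrightarrow> alg_hom (matched_syms P) sym_arity X Y f"
  by (simp_all add: matched_Mod_def)

text \<open>The underlying model of the hyperaffine theory, without the symbols for the action; it
  gives access to the results on models of theories.\<close>

abbreviation hr :: "'u alg \<Rightarrow> 'u alg" where "hr \<equiv> reduct (theory_syms (hth P)) (\<lambda>s. s)"

lemma op_hr: "small I \<Longrightarrow> h \<in> opn (hth P) I \<Longrightarrow> op (hr X) I h x = op X I h x"
  by (rule op_reduct) simp_all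

lemma hr_model: "matched_model P X \<Longrightarrow> H.Md (hr X)"
  unfolding theory_model_def
proof
  assume X: "matched_model P X"
  then show "is_alg (theory_syms (hth P)) sym_arity (hr X)"
    by (intro is_alg_reduct[of "matched_syms P" sym_arity])
      (auto simp: matched_model_def Let_def matched_syms_def)
  show "model_laws (hth P) (hr X)"
    by (rule model_laws_cong[OF H.T _ _ , of X]) (use X in \<open>simp_all add: matched_model_def Let_def reduct_def\<close>)
qed

lemma mm_op_in: "\<lbrakk>matched_model P X; small I; h \<in> opn (hth P) I; \<And>i. i \<in> I \<Longrightarrow> x i \<in> car X\<rbrakk> \<Longrightarrow> op X I h x \<in> car X"
  using H.op_in[OF hr_model, of X I h x] by (simp add: op_hr)

lemma mm_act_in: "\<lbrakk>matched_model P X; m \<in> C; x \<in> car X\<rbrakk> \<Longrightarrow> act X m x \<in> car X"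
  unfolding act_def by (rule is_alg_itp[of "matched_syms P" sym_arity]) (auto simp: matched_model_def Let_def)

lemma mm_act_one: "\<lbrakk>matched_model P X; x \<in> car X\<rbrakk> \<Longrightarrow> act X u1 x = x"
  and mm_act_mult: "\<lbrakk>matched_model P X; m \<in> C; n \<in> C; x \<in> car X\<rbrakk> \<Longrightarrow> act X (m \<odot> n) x = act X m (act X n x)"
  by (simp_all add: matched_model_def Let_def)

lemma mm_act_ps:
  assumes X: "matched_model P X" and "small I" "h \<in> opn (hth P) I" "\<And>i. i \<in> I \<Longrightarrow> m i \<in> C" "x \<in> car X"
  shows "act X (ps I h m) x = op X I h (\<lambda>i. act X (m i) x)"
proof -
  have "restrict m I \<in> I \<rightarrow>\<^sub>E C" using assms by auto
  then have "act X (push P I h (restrict m I)) x = itp X (OpSym I h) (\<lambda>i\<in>I. act X (restrict m I i) x)"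
    using assms unfolding matched_model_def Let_def by simp
  also have "(\<lambda>i\<in>I. act X (restrict m I i) x) = (\<lambda>i\<in>I. act X (m i) x)" by (rule restrict_ext) simp
  finally show ?thesis unfolding ps_def op_def .
qed

lemma mm_act_op:
  assumes X: "matched_model P X" and "small I" "h \<in> opn (hth P) I" "n \<in> C" "\<And>i. i \<in> I \<Longrightarrow> x i \<in> car X"
  shows "act X n (op X I h x) = op X I (pull P I n h) (\<lambda>i. act X n (x i))"
proof -
  have "restrict x I \<in> I \<rightarrow>\<^sub>E car X" using assms by auto
  then have "act X n (itp X (OpSym I h) (restrict x I)) = itp X (OpSym I (pull P I n h)) (\<lambda>i\<in>I. act X n (restrict x I i))"
    using assms unfolding matched_model_def Let_def by simp
  also have "(\<lambda>i\<in>I. act X n (restrict x I i)) = (\<lambda>i\<in>I. act X n (x i))" by (rule restrict_ext) simp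
  finally show ?thesis unfolding op_def .
qed

lemma mm_op_pro: "\<lbrakk>matched_model P X; small I; i \<in> I; \<And>i. i \<in> I \<Longrightarrow> x i \<in> car X\<rbrakk> \<Longrightarrow> op X I (pro (hth P) I i) x = x i"
  using H.op_pro[OF hr_model, of X I i x] by (simp add: op_hr H.pro_opn)

lemma mm_op_op:
  "\<lbrakk>matched_model P X; small I; small J; h \<in> opn (hth P) I; \<And>i. i \<in> I \<Longrightarrow> k i \<in> opn (hth P) J; \<And>j. j \<in> J \<Longrightarrow> x j \<in> car X\<rbrakk>
    \<Longrightarrow> op X J (op (H.F J) I h k) x = op X I h (\<lambda>i. op X J (k i) x)"
  using H.op_op[OF hr_model, of X I J h k x] by (simp add: op_hr H.op_F_in)

lemma mm_absorb:
  "\<lbrakk>matched_model P X; small I; small J; k \<in> opn (hth P) J; \<And>j. j \<in> J \<Longrightarrow> l j \<in> opn (hth P) I;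
    \<And>i j. \<lbrakk>j \<in> J; i \<in> I\<rbrakk> \<Longrightarrow> y j i \<in> car X\<rbrakk>
    \<Longrightarrow> op X J k (\<lambda>j. op X I (l j) (\<lambda>i. op X J k (\<lambda>j'. y j' i))) = op X J k (\<lambda>j. op X I (l j) (y j))"
  using H.haff_absorb[of I J k l "hr X" y] by (simp add: op_hr hr_model haff)

lemma matched_modelI:
  assumes a: "is_alg (matched_syms P) sym_arity X" "model_laws (hth P) X"
    and one: "\<And>x. x \<in> car X \<Longrightarrow> act X u1 x = x"
    and mult: "\<And>m n x. \<lbrakk>m \<in> C; n \<in> C; x \<in> car X\<rbrakk> \<Longrightarrow> act X (m \<odot> n) x = act X m (act X n x)"
    and p: "\<And>I h m x. \<lbrakk>small I; h \<in> opn (hth P) I; m \<in> I \<rightarrow>\<^sub>E C; x \<in> car X\<rbrakk> \<Longrightarrow>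
      act X (push P I h m) x = op X I h (\<lambda>i. act X (m i) x)"
    and q: "\<And>I h n x. \<lbrakk>small I; h \<in> opn (hth P) I; n \<in> C; \<And>i. i \<in> I \<Longrightarrow> x i \<in> car X\<rbrakk> \<Longrightarrow>
      act X n (op X I h x) = op X I (pull P I n h) (\<lambda>i. act X n (x i))"
  shows "matched_model P X"
  unfolding matched_model_def Let_def
proof (intro conjI allI impI ballI a one mult)
  show "act X (push P I h m) x = itp X (OpSym I h) (\<lambda>i\<in>I. act X (m i) x)"
    if "small I" "h \<in> opn (hth P) I" "m \<in> I \<rightarrow>\<^sub>E C" "x \<in> car X" for I h m x
    using p[OF that] by (simp only: op_def)
  show "act X n (itp X (OpSym I h) x) = itp X (OpSym I (pull P I n h)) (\<lambda>i\<in>I. act X n (x i))"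
    if "small I" "h \<in> opn (hth P) I" "n \<in> C" "x \<in> I \<rightarrow>\<^sub>E car X" for I h n x
    using q[OF that(1-3), of x] PiE_mem[OF that(4)] PiE_restrict[OF that(4)] unfolding op_def by simp
qed

end

lemma matched_model_eqI:
  assumes "matched_model P X" "matched_model P Y" "car X = car Y"
    and op: "\<And>I h x. \<lbrakk>small I; h \<in> opn (hth P) I; \<And>i. i \<in> I \<Longrightarrow> x i \<in> car X\<rbrakk> \<Longrightarrow> op X I h x = op Y I h x"
    and act: "\<And>m x. \<lbrakk>m \<in> carrier (mon P); x \<in> car X\<rbrakk> \<Longrightarrow> act X m x = act Y m x"
  shows "X = Y"
proof (rule alg_eqI)
  show "is_alg (matched_syms P) sym_arity X" "is_alg (matched_syms P) sym_arity Y"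
    using assms by (auto simp: matched_model_def Let_def)
  fix s x assume "s \<in> matched_syms P" and x: "x \<in> sym_arity s \<rightarrow>\<^sub>E car X"
  then show "itp X s x = itp Y s x"
  proof (cases rule: matched_symsE)
    case (1 I h)
    then have "op X I h x = op Y I h x" using x by (intro op) auto
    then show ?thesis using x 1 by (simp add: op_def PiE_restrict)
  next
    case (2 m)
    then obtain a where "x = (\<lambda>_\<in>fin 1. a)" "a \<in> car X" using x by (auto simp: PiE_fin1)
    then show ?thesis using act[of m a] 2 by (simp add: act_def)
  qed
qed (fact assms)

section \<open>Restriction of models along homomorphisms of matched pairs\<close>

definition matched_renaming :: "'u matched_map \<Rightarrow> 'u fsym \<Rightarrow> 'u fsym" where
  "matched_renaming F = case_fsym (\<lambda>I t. OpSym I (fst F I t)) (\<lambda>m. ActSym (snd F m))"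

lemma matched_renaming_simps [simp]:
  "matched_renaming F (OpSym I t) = OpSym I (fst F I t)" "matched_renaming F (ActSym m) = ActSym (snd F m)"
  by (simp_all add: matched_renaming_def)

lemma conc_map_matched_reduct:
  fixes P Q :: "'u::universe matched"
  assumes P: "matched_pair P" and Q: "matched_pair Q" and F: "matched_hom P Q F"
  shows "conc_map (matched_Mod Q) (matched_Mod P) (reduct (matched_syms P) (matched_renaming F))"
proof -
  interpret P: mp P by unfold_locales fact
  interpret Q: mp Q by unfold_locales fact
  obtain \<phi> f where Feq: "F = (\<phi>, f)" by (cases F)
  note F' = F[unfolded Feq]
  note th = matched_hom_theory[OF F']
  let ?r = "reduct (matched_syms P) (matched_renaming F)"
  have op: "op (?r X) I h x = op X I (\<phi> I h) x" if "small I" "h \<in> opn (hth P) I" for X I h x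
    using that by (intro op_reduct) (simp_all add: Feq)
  have ac: "act (?r X) m x = act X (f m) x" if "m \<in> carrier (mon P)" for X m x
    using that by (intro act_reduct) (simp_all add: Feq)
  have "matched_model P (?r X)" if X: "matched_model Q X" for X
  proof (rule P.matched_modelI)
    show "is_alg (matched_syms P) sym_arity (?r X)"
      using X by (intro is_alg_reduct[of "matched_syms Q" sym_arity])
        (auto simp: matched_model_def Let_def Feq theory_hom_opn[OF th] matched_hom_in[OF F'] elim!: matched_symsE)
    have t: "theory_model (hth P) (reduct (theory_syms (hth P)) (theory_renaming \<phi>) (Q.hr X))"
      using conc_mapD(1)[OF conc_map_theory_reduct[OF P.H.T Q.H.T th], of "Q.hr X"] Q.hr_model[OF X] by simp
    show "model_laws (hth P) (?r X)"
    proof (rule model_laws_cong[OF P.H.T])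
      show "model_laws (hth P) (reduct (theory_syms (hth P)) (theory_renaming \<phi>) (Q.hr X))"
        using t by (simp add: theory_model_def)
    qed (simp_all add: reduct_def Feq theory_hom_opn[OF th])
    show "act (?r X) P.u1 x = x" if "x \<in> car (?r X)" for x
      using that X by (simp add: ac matched_hom_one[OF F'] Q.mm_act_one)
    show "act (?r X) (m \<otimes>\<^bsub>mon P\<^esub> n) x = act (?r X) m (act (?r X) n x)"
      if "m \<in> carrier (mon P)" "n \<in> carrier (mon P)" "x \<in> car (?r X)" for m n x
      using that X by (simp add: ac matched_hom_mult[OF F'] matched_hom_in[OF F'] Q.mm_act_mult)
    show "act (?r X) (push P I h m) x = op (?r X) I h (\<lambda>i. act (?r X) (m i) x)"
      if "small I" "h \<in> opn (hth P) I" "m \<in> I \<rightarrow>\<^sub>E carrier (mon P)" "x \<in> car (?r X)" for I h m x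
    proof -
      have m: "\<And>i. i \<in> I \<Longrightarrow> m i \<in> carrier (mon P)" using that by auto
      have pin: "push P I h m \<in> carrier (mon P)"
        unfolding P.push_eq[OF that(3)] using that m by (simp add: P.ps_in)
      have "f (push P I h m) = Q.ps I (\<phi> I h) (\<lambda>i. f (m i))"
        using matched_hom_push[OF F' that(1-3)] by (simp add: Q.ps_def)
      then show ?thesis
        using that m pin X by (simp add: ac op Q.mm_act_ps theory_hom_opn[OF th] matched_hom_in[OF F'])
    qed
    show "act (?r X) n (op (?r X) I h x) = op (?r X) I (pull P I n h) (\<lambda>i. act (?r X) n (x i))"
      if "small I" "h \<in> opn (hth P) I" "n \<in> carrier (mon P)" "\<And>i. i \<in> I \<Longrightarrow> x i \<in> car (?r X)" for I h n x
      using that X by (simp add: ac op P.pull_in matched_hom_pull[OF F'] Q.mm_act_op theory_hom_opn[OF th]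
          matched_hom_in[OF F'])
  qed
  moreover have "alg_hom (matched_syms P) sym_arity (?r X) (?r Y) g" if "alg_hom (matched_syms Q) sym_arity X Y g" for X Y g
    using that unfolding matched_hom_alg_iff by (simp add: op ac theory_hom_opn[OF th] matched_hom_in[OF F'])
  ultimately show ?thesis by (auto simp: conc_map_def)
qed

lemma fob_matched_Mod_functor [simp]: "fob matched_Mod_functor = matched_Mod"
  by (simp add: matched_Mod_functor_def)

lemma far_matched_Mod_functor:
  "far matched_Mod_functor P Q F = conc_functor (matched_Mod Q) (reduct (matched_syms P) (matched_renaming F))"
  by (simp add: matched_Mod_functor_def reduct_fctr_eq matched_renaming_def case_prod_beta)

lemma matched_renaming_syms:
  fixes P Q :: "'u::universe matched"
  assumes "matched_hom P Q F" "s \<in> matched_syms P" shows "matched_renaming F s \<in> matched_syms Q"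
proof -
  obtain \<phi> f where F: "F = (\<phi>, f)" by (cases F)
  show ?thesis using assms(2)
    by (cases rule: matched_symsE)
      (simp_all add: F theory_hom_opn[OF matched_hom_theory[OF assms(1)[unfolded F]]] matched_hom_in[OF assms(1)[unfolded F]])
qed

text \<open>Operations decompose hyperaffinely, so models of \<open>T\<close> and of \<open>down T\<close> agree.\<close>

definition down_renaming :: "'u::universe fsym \<Rightarrow> 'u fsym" where
  "down_renaming = case_fsym OpSym (OpSym (fin 1))"

lemma down_renaming_simps [simp]:
  "down_renaming (OpSym I t) = OpSym I t" "down_renaming (ActSym m) = OpSym (fin 1) m"
  by (simp_all add: down_renaming_def)

context hau
begin

text \<open>The two parts of a composite follow the substitution formula for pairs: hyperaffine part
  \<open>h(m^*k_i)\<close> and unary part \<open>h \<rhd> (m n_i)\<close>.\<close>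

lemma hd_op:
  assumes I: "small I" and J: "small J" and t: "t \<in> opn T I" and u: "\<And>i. i \<in> I \<Longrightarrow> u i \<in> opn T J"
  shows "hd J (op (F J) I t u) = op (F J) I (hd I t) (\<lambda>i. pl J (dm I t) (hd J (u i)))"
    and "dm J (op (F J) I t u) = op (F (fin 1)) I (hd I t) (\<lambda>i. ap (F (fin 1)) (dm I t) (dm J (u i)))"
proof -
  have k: "hd I t \<in> opn T I" "hyperaffine T I (hd I t)" and m: "dm I t \<in> opn T (fin 1)"
    using I t by (simp_all add: hd_in hyperaffine_hd dm_in)
  have au: "ap (F J) (dm I t) (u i) \<in> opn T J" if "i \<in> I" for i using that J m u by (simp add: ap_F_in)
  have tu: "op (F J) I t u = op (F J) I (hd I t) (\<lambda>i. ap (F J) (dm I t) (u i))"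
    using I J t u by (intro op_hd) (simp_all add: F_model)
  show "hd J (op (F J) I t u) = op (F J) I (hd I t) (\<lambda>i. pl J (dm I t) (hd J (u i)))"
    unfolding tu using J I k au by (subst hd_op_haff) (simp_all add: hd_ap m u)
  show "dm J (op (F J) I t u) = op (F (fin 1)) I (hd I t) (\<lambda>i. ap (F (fin 1)) (dm I t) (dm J (u i)))"
    unfolding tu using J I k au by (simp add: dm_op dm_ap m u)
qed

end

locale hau_down = hau T for T :: "'u::universe alg_theory"
begin

sublocale D: mp "down T" by unfold_locales (rule matched_pair_down)

definition to_matched :: "'u alg \<Rightarrow> 'u alg" where
  "to_matched = reduct (matched_syms (down T)) down_renaming"

text \<open>The action of \<open>t\<close> is forced by its decomposition: first act on each
  argument by the unary part, then apply the hyperaffine part.\<close>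

definition of_matched :: "'u alg \<Rightarrow> 'u alg" where
  "of_matched X = mk_alg T (car X) (\<lambda>I t x. op X I (hd I t) (\<lambda>i. act X (dm I t) (x i)))"

lemma car_to_matched [simp]: "car (to_matched X) = car X" and car_of_matched [simp]: "car (of_matched X) = car X"
  by (simp_all add: to_matched_def of_matched_def)

lemma op_to_matched: "\<lbrakk>small I; h \<in> opn T I; hyperaffine T I h\<rbrakk> \<Longrightarrow> op (to_matched X) I h x = op X I h x"
  unfolding to_matched_def by (rule op_reduct) simp_all

lemma act_to_matched: "m \<in> opn T (fin 1) \<Longrightarrow> act (to_matched X) m x = ap X m x"
  unfolding to_matched_def by (simp add: act_def reduct_def ap_def op_def)

lemma op_of_matched: "\<lbrakk>small I; t \<in> opn T I; \<And>i. i \<in> I \<Longrightarrow> x i \<in> car X\<rbrakk>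
    \<Longrightarrow> op (of_matched X) I t x = op X I (hd I t) (\<lambda>i. act X (dm I t) (x i))"
  unfolding of_matched_def by (simp add: op_mk_alg)

lemma to_matched_model: assumes X: "Md X" shows "matched_model (down T) (to_matched X)"
proof (rule D.matched_modelI; (simp only: down_simps car_to_matched)?)
  show "is_alg (matched_syms (down T)) sym_arity (to_matched X)"
    unfolding to_matched_def using X
    by (intro is_alg_reduct[of "theory_syms T" sym_arity]) (auto simp: theory_model_def elim!: matched_symsE)
  have "model_laws Hp X"
    using X unfolding theory_model_def model_laws_def by (auto simp: PiE_iff)
  then show "model_laws Hp (to_matched X)"
    by (rule model_laws_cong[OF algebraic_Hp, rotated 2]) (simp_all add: to_matched_def reduct_def)
  show "act (to_matched X) e1 x = x" if "x \<in> car X" for x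
    using that X by (simp add: act_to_matched ap_e1)
  show "act (to_matched X) (m \<otimes>\<^bsub>mon (down T)\<^esub> n) x = act (to_matched X) m (act (to_matched X) n x)"
    if "m \<in> opn T (fin 1)" "n \<in> opn T (fin 1)" "x \<in> car X" for m n x
    using that X by (simp add: mult_down act_to_matched ap_F_in ap_ap)
  show "act (to_matched X) (push (down T) I h m) x = op (to_matched X) I h (\<lambda>i. act (to_matched X) (m i) x)"
    if "small I" "h \<in> opn Hp I" "m \<in> I \<rightarrow>\<^sub>E opn T (fin 1)" "x \<in> car X" for I h m x
    using that X PiE_mem[OF that(3)] by (simp add: push_down act_to_matched op_to_matched op_F_in ap_op)
  show "act (to_matched X) n (op (to_matched X) I h x) = op (to_matched X) I (pull (down T) I n h) (\<lambda>i. act (to_matched X) n (x i))"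
    if "small I" "h \<in> opn Hp I" "n \<in> opn T (fin 1)" "\<And>i. i \<in> I \<Longrightarrow> x i \<in> car X" for I h n x
    using that X by (simp add: pull_down act_to_matched op_to_matched pl_in hyperaffine_pl ap_op_pl)
qed

lemma
  assumes X: "matched_model (down T) X"
  shows mx_op_in: "\<lbrakk>small I; h \<in> opn T I; hyperaffine T I h; \<And>i. i \<in> I \<Longrightarrow> x i \<in> car X\<rbrakk> \<Longrightarrow> op X I h x \<in> car X"
    and mx_act_in: "\<lbrakk>m \<in> opn T (fin 1); z \<in> car X\<rbrakk> \<Longrightarrow> act X m z \<in> car X"
    and mx_act_e1: "z \<in> car X \<Longrightarrow> act X e1 z = z"
    and mx_act_ap: "\<lbrakk>m \<in> opn T (fin 1); n \<in> opn T (fin 1); z \<in> car X\<rbrakk> \<Longrightarrow> act X (ap (F (fin 1)) m n) z = act X m (act X n z)"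
    and mx_op_pro: "\<lbrakk>small I; i \<in> I; \<And>i. i \<in> I \<Longrightarrow> x i \<in> car X\<rbrakk> \<Longrightarrow> op X I (pro T I i) x = x i"
    and mx_act_op: "\<lbrakk>small I; h \<in> opn T I; hyperaffine T I h; m \<in> opn T (fin 1); \<And>i. i \<in> I \<Longrightarrow> x i \<in> car X\<rbrakk>
      \<Longrightarrow> act X m (op X I h x) = op X I (pl I m h) (\<lambda>i. act X m (x i))"
    and mx_act_ps: "\<lbrakk>small I; h \<in> opn T I; hyperaffine T I h; \<And>i. i \<in> I \<Longrightarrow> p i \<in> opn T (fin 1); z \<in> car X\<rbrakk>
      \<Longrightarrow> act X (op (F (fin 1)) I h p) z = op X I h (\<lambda>i. act X (p i) z)"
    and mx_op_op: "\<lbrakk>small I; small J; h \<in> opn T I; hyperaffine T I h; \<And>i. i \<in> I \<Longrightarrow> k i \<in> opn T J;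
        \<And>i. i \<in> I \<Longrightarrow> hyperaffine T J (k i); \<And>j. j \<in> J \<Longrightarrow> x j \<in> car X\<rbrakk>
      \<Longrightarrow> op X J (op (F J) I h k) x = op X I h (\<lambda>i. op X J (k i) x)"
    and mx_absorb: "\<lbrakk>small I; small J; h \<in> opn T J; hyperaffine T J h; \<And>j. j \<in> J \<Longrightarrow> k j \<in> opn T I;
        \<And>j. j \<in> J \<Longrightarrow> hyperaffine T I (k j); \<And>i j. \<lbrakk>j \<in> J; i \<in> I\<rbrakk> \<Longrightarrow> y j i \<in> car X\<rbrakk>
      \<Longrightarrow> op X J h (\<lambda>j. op X I (k j) (\<lambda>i. op X J h (\<lambda>j'. y j' i))) = op X J h (\<lambda>j. op X I (k j) (y j))"
proof -
  show "op X I h x \<in> car X" if "small I" "h \<in> opn T I" "hyperaffine T I h" "\<And>i. i \<in> I \<Longrightarrow> x i \<in> car X" for I h x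
    using D.mm_op_in[OF X that(1), of h x] that by simp
  show "act X m z \<in> car X" if "m \<in> opn T (fin 1)" "z \<in> car X" for m z
    using D.mm_act_in[OF X] that by simp
  show "act X e1 z = z" if "z \<in> car X" for z using D.mm_act_one[OF X that] by simp
  show "act X (ap (F (fin 1)) m n) z = act X m (act X n z)" if "m \<in> opn T (fin 1)" "n \<in> opn T (fin 1)" "z \<in> car X" for m n z
    using D.mm_act_mult[OF X, of m n z] that by (simp add: mult_down)
  show "op X I (pro T I i) x = x i" if "small I" "i \<in> I" "\<And>i. i \<in> I \<Longrightarrow> x i \<in> car X" for I i x
    using D.mm_op_pro[OF X that] by simp
  show "act X m (op X I h x) = op X I (pl I m h) (\<lambda>i. act X m (x i))"
    if "small I" "h \<in> opn T I" "hyperaffine T I h" "m \<in> opn T (fin 1)" "\<And>i. i \<in> I \<Longrightarrow> x i \<in> car X" for I h m x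
    using D.mm_act_op[OF X that(1), of h m x] that by (simp add: pull_down)
  show "act X (op (F (fin 1)) I h p) z = op X I h (\<lambda>i. act X (p i) z)"
    if "small I" "h \<in> opn T I" "hyperaffine T I h" "\<And>i. i \<in> I \<Longrightarrow> p i \<in> opn T (fin 1)" "z \<in> car X" for I h p z
  proof -
    have "push (down T) I h (restrict p I) = op (F (fin 1)) I h p" using that by (simp add: push_down)
    then show ?thesis using D.mm_act_ps[OF X that(1), of h p z] that by (simp add: D.ps_def)
  qed
  show "op X J (op (F J) I h k) x = op X I h (\<lambda>i. op X J (k i) x)"
    if "small I" "small J" "h \<in> opn T I" "hyperaffine T I h" "\<And>i. i \<in> I \<Longrightarrow> k i \<in> opn T J"
        "\<And>i. i \<in> I \<Longrightarrow> hyperaffine T J (k i)" "\<And>j. j \<in> J \<Longrightarrow> x j \<in> car X" for I J h k x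
    using D.mm_op_op[OF X that(1,2), of h k x] that by (simp add: op_Hp)
  show "op X J h (\<lambda>j. op X I (k j) (\<lambda>i. op X J h (\<lambda>j'. y j' i))) = op X J h (\<lambda>j. op X I (k j) (y j))"
    if "small I" "small J" "h \<in> opn T J" "hyperaffine T J h" "\<And>j. j \<in> J \<Longrightarrow> k j \<in> opn T I"
        "\<And>j. j \<in> J \<Longrightarrow> hyperaffine T I (k j)" "\<And>i j. \<lbrakk>j \<in> J; i \<in> I\<rbrakk> \<Longrightarrow> y j i \<in> car X" for I J h k y
    using D.mm_absorb[OF X that(1,2), of h k y] that by simp
qed

text \<open>Substitution is the law with content: the unary part of a composite brings a second copy
  of the hyperaffine part of \<open>t\<close> inside, and absorption in \<open>X\<close> removes
  it.\<close>

lemma of_matched_model: assumes X: "matched_model (down T) X" shows "Md (of_matched X)"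
  unfolding of_matched_def
proof (rule theory_model_mk_alg)
  show "small (car X)" using X by (simp add: matched_model_def Let_def is_alg_def)
  fix I t x assume "small I" "t \<in> opn T I" and x: "x \<in> I \<rightarrow>\<^sub>E car X"
  then show "op X I (hd I t) (\<lambda>i. act X (dm I t) (x i)) \<in> car X"
    using PiE_mem[OF x] by (intro mx_op_in[OF X] hd_in hyperaffine_hd mx_act_in[OF X] dm_in)
next
  fix I :: "'u set" and i x assume "small I" "i \<in> I" and x: "x \<in> I \<rightarrow>\<^sub>E car X"
  then show "op X I (hd I (pro T I i)) (\<lambda>i'. act X (dm I (pro T I i)) (x i')) = x i"
    using PiE_mem[OF x] by (simp add: hd_haff pro_opn hyperaffine_pro mx_act_e1[OF X] mx_op_pro[OF X])
next
  fix I J t u x assume I: "small I" and J: "small J" and t: "t \<in> opn T I" and uE: "u \<in> I \<rightarrow>\<^sub>E opn T J"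
    and xE: "x \<in> J \<rightarrow>\<^sub>E car X"
  have u: "\<And>i. i \<in> I \<Longrightarrow> u i \<in> opn T J" and x: "\<And>j. j \<in> J \<Longrightarrow> x j \<in> car X" using uE xE by auto
  let ?k = "hd I t" and ?m = "dm I t" and ?l = "\<lambda>i. hd J (u i)" and ?n = "\<lambda>i. dm J (u i)"
  have k: "?k \<in> opn T I" "hyperaffine T I ?k" and m: "?m \<in> opn T (fin 1)"
    using I t by (simp_all add: hd_in hyperaffine_hd dm_in)
  have l: "?l i \<in> opn T J" "hyperaffine T J (?l i)" "?n i \<in> opn T (fin 1)" if "i \<in> I" for i
    using that J u by (simp_all add: hd_in hyperaffine_hd dm_in)
  have nx: "act X (?n i) (x j) \<in> car X" if "i \<in> I" "j \<in> J" for i j using that l x by (simp add: mx_act_in[OF X])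
  have "op X J (hd J (subst T I J t u)) (\<lambda>j. act X (dm J (subst T I J t u)) (x j))
    = op X J (op (F J) I ?k (\<lambda>i. pl J ?m (?l i))) (\<lambda>j. act X (op (F (fin 1)) I ?k (\<lambda>i. ap (F (fin 1)) ?m (?n i))) (x j))"
    using I J t u uE by (simp add: subst_eq_op hd_op)
  also have "\<dots> = op X J (op (F J) I ?k (\<lambda>i. pl J ?m (?l i))) (\<lambda>j. op X I ?k (\<lambda>i. act X ?m (act X (?n i) (x j))))"
    using I k m l x by (intro op_cong) (simp add: mx_act_ps[OF X] ap_F_in mx_act_ap[OF X])
  also have "\<dots> = op X I ?k (\<lambda>i. op X J (pl J ?m (?l i)) (\<lambda>j. op X I ?k (\<lambda>i'. act X ?m (act X (?n i') (x j)))))"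
    using I J k m l nx by (intro mx_op_op[OF X]) (simp_all add: pl_in hyperaffine_pl mx_op_in[OF X] mx_act_in[OF X])
  also have "\<dots> = op X I ?k (\<lambda>i. op X J (pl J ?m (?l i)) (\<lambda>j. act X ?m (act X (?n i) (x j))))"
    using I J k m l nx by (intro mx_absorb[OF X]) (simp_all add: pl_in hyperaffine_pl mx_act_in[OF X])
  also have "\<dots> = op X I ?k (\<lambda>i. act X ?m (op X J (?l i) (\<lambda>j. act X (?n i) (x j))))"
    using J m l nx by (intro op_cong) (simp add: mx_act_op[OF X])
  finally show "op X J (hd J (subst T I J t u)) (\<lambda>j. act X (dm J (subst T I J t u)) (x j)) =
    op X I ?k (\<lambda>i. act X ?m ((\<lambda>i\<in>I. op X J (hd J (u i)) (\<lambda>j. act X (dm J (u i)) (x j))) i))"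
    by simp
qed

text \<open>Both passages keep carriers and functions. Restoring \<open>t\<close> from its parts is
  its decomposition; conversely a hyperaffine operation has the identity as unary part, and a unary
  operation has the projection as hyperaffine part.\<close>

lemma conc_iso_matched: "conc_iso (theory_Mod T) (matched_Mod (down T)) to_matched of_matched"
  unfolding conc_iso_def conc_map_def
proof (intro conjI ballI subsetI)
  fix X Y f assume "X \<in> cob (theory_Mod T)" "Y \<in> cob (theory_Mod T)" "f \<in> chom (theory_Mod T) X Y"
  then have X: "Md X" and Y: "Md Y" and f: "thom T X Y f" by auto
  then have "alg_hom (matched_syms (down T)) sym_arity (to_matched X) (to_matched Y) f"
    unfolding matched_hom_alg_iff
    using thom_op[OF f, of "fin 1"] by (auto simp: thom_iff op_to_matched act_to_matched ap_def)
  then show "f \<in> chom (matched_Mod (down T)) (to_matched X) (to_matched Y)" by simp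
next
  fix X Y f assume "X \<in> cob (matched_Mod (down T))" "Y \<in> cob (matched_Mod (down T))" "f \<in> chom (matched_Mod (down T)) X Y"
  then have X: "matched_model (down T) X" and Y: "matched_model (down T) Y"
    and f: "alg_hom (matched_syms (down T)) sym_arity X Y f" by auto
  have f': "f \<in> car X \<rightarrow>\<^sub>E car Y" "\<And>x. x \<in> car X \<Longrightarrow> f x \<in> car Y" using f by (auto simp: alg_hom_def)
  have "thom T (of_matched X) (of_matched Y) f"
    unfolding thom_iff
  proof (intro conjI allI impI)
    show "f \<in> car (of_matched X) \<rightarrow>\<^sub>E car (of_matched Y)" using f' by simp
    fix I t x assume h: "small I" "t \<in> opn T I" "\<forall>i\<in>I. x i \<in> car (of_matched X)"
    then show "f (op (of_matched X) I t x) = op (of_matched Y) I t (\<lambda>i. f (x i))"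
      using f f'(2) unfolding matched_hom_alg_iff
      by (simp add: op_of_matched hd_in hyperaffine_hd mx_act_in[OF X] dm_in)
  qed
  then show "f \<in> chom (theory_Mod T) (of_matched X) (of_matched Y)" by simp
next
  fix X assume "X \<in> cob (theory_Mod T)"
  then have X: "Md X" by simp
  show "of_matched (to_matched X) = X"
    by (rule theory_model_eqI[OF of_matched_model[OF to_matched_model[OF X]] X])
      (use X in \<open>simp_all add: op_of_matched op_to_matched hd_in hyperaffine_hd act_to_matched dm_in op_hd\<close>)
next
  fix X assume "X \<in> cob (matched_Mod (down T))"
  then have X: "matched_model (down T) X" by simp
  show "to_matched (of_matched X) = X"
  proof (rule matched_model_eqI[OF to_matched_model[OF of_matched_model[OF X]] X])
    fix I h x assume "small I" "h \<in> opn (hth (down T)) I" "\<And>i. i \<in> I \<Longrightarrow> x i \<in> car (to_matched (of_matched X))"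
    then show "op (to_matched (of_matched X)) I h x = op X I h x"
      by (simp add: op_to_matched op_of_matched hd_haff mx_act_e1[OF X])
  next
    fix m x assume "m \<in> carrier (mon (down T))" "x \<in> car (to_matched (of_matched X))"
    then have m: "m \<in> opn T (fin 1)" and x: "x \<in> car X" by auto
    have "hd (fin 1) m = pro T (fin 1) (num 1)"
      using hd_ap_pro[of "fin 1" "num 1" m] m ap_F1_e1[OF m] by (simp add: e1_def)
    then show "act (to_matched (of_matched X)) m x = act X m x"
      using m x unfolding act_to_matched[OF m] ap_def
      by (simp add: op_of_matched dm_fin1 mx_op_pro[OF X] mx_act_in[OF X])
  qed simp
qed (use to_matched_model of_matched_model in \<open>simp_all\<close>)

end

section \<open>The triangle\<close>

lemma matched_reduct_id:
  fixes P :: "'u::universe matched"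
  assumes "X \<in> cob (matched_Mod P)"
  shows "reduct (matched_syms P) (matched_renaming (ident HAff_Un P)) X = X"
proof -
  have "reduct (matched_syms P) (matched_renaming (ident HAff_Un P)) X = reduct (matched_syms P) (\<lambda>s. s) X"
    by (rule reduct_cong) (auto elim!: matched_symsE simp: theory_id_def)
  then show ?thesis
    using assms reduct_id[of "matched_syms P" sym_arity X] by (simp add: matched_Mod_def matched_model_def Let_def)
qed

lemma matched_reduct_comp:
  fixes P Q :: "'u::universe matched"
  assumes F: "matched_hom P Q F"
  shows "reduct (matched_syms P) (matched_renaming (matched_comp P G F)) X =
    reduct (matched_syms P) (matched_renaming F) (reduct (matched_syms Q) (matched_renaming G) X)"
proof -
  have "reduct (matched_syms P) (matched_renaming F) (reduct (matched_syms Q) (matched_renaming G) X) =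
      reduct (matched_syms P) (\<lambda>s. matched_renaming G (matched_renaming F s)) X"
    by (rule reduct_reduct) (rule matched_renaming_syms[OF F])
  also have "\<dots> = reduct (matched_syms P) (matched_renaming (matched_comp P G F)) X"
    by (rule reduct_cong) (auto elim!: matched_symsE simp: matched_comp_def theory_comp_def)
  finally show ?thesis ..
qed

lemma conc_iso_matched_reduct:
  fixes P Q :: "'u::universe matched"
  assumes P: "matched_pair P" and Q: "matched_pair Q" and FG: "inverse_arrows HAff_Un P Q F G"
  shows "conc_iso (matched_Mod Q) (matched_Mod P) (reduct (matched_syms P) (matched_renaming F))
    (reduct (matched_syms Q) (matched_renaming G))"
proof -
  have F: "matched_hom P Q F" and G: "matched_hom Q P G"
    and c: "matched_comp P G F = ident HAff_Un P" "matched_comp Q F G = ident HAff_Un Q"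
    using FG by (simp_all add: inverse_arrows_def)
  show ?thesis
    unfolding conc_iso_def
  proof (intro conjI ballI)
    show "conc_map (matched_Mod Q) (matched_Mod P) (reduct (matched_syms P) (matched_renaming F))"
      by (rule conc_map_matched_reduct[OF P Q F])
    show "conc_map (matched_Mod P) (matched_Mod Q) (reduct (matched_syms Q) (matched_renaming G))"
      by (rule conc_map_matched_reduct[OF Q P G])
  qed (simp_all only: matched_reduct_comp[OF F, symmetric] matched_reduct_comp[OF G, symmetric] c matched_reduct_id)
qed

text \<open>\<open>variety\<close> demands a presentation of the category itself, not one up to
  isomorphism, so a presentation of \<open>D\<close> is assumed; the other conditions move along the
  isomorphism.\<close>

lemma ccVar_conc_iso:
  assumes "C \<in> Ob ccVar" "conc_iso C D fo go" "concrete_category D" "equational_theory E" "D = eqn_Mod E"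
  shows "D \<in> Ob ccVar"
  using assms conc_iso_has_free_objects[OF assms(2)] conc_iso_nondegenerate[OF assms(2)]
    conc_iso_cartesian_closed[OF assms(2,3)]
  by (auto simp: variety_def)

context mp
begin

lemma matched_Mod_in_ccVar: "D \<in> Ob ccVar \<Longrightarrow> conc_iso D (matched_Mod P) fo go \<Longrightarrow> matched_Mod P \<in> Ob ccVar"
  by (rule ccVar_conc_iso[OF _ _ concrete_category_matched_Mod equational_matched_eqns matched_Mod_eq_eqn_Mod])

end

lemma matched_Mod_down_in_ccVar:
  fixes T :: "'u::universe alg_theory"
  assumes ob: "T \<in> Ob HAffUn" shows "matched_Mod (down T) \<in> Ob ccVar"
proof -
  interpret hau_down T using ob by unfold_locales (auto simp: hau_algebraic)
  show ?thesis by (rule D.matched_Mod_in_ccVar[OF theory_Mod_in_ccVar[OF ob] conc_iso_matched])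
qed

text \<open>\<open>P\<close> is isomorphic to \<open>down T\<close> for some theory
  \<open>T\<close>, so its category of models is concretely isomorphic to that of
  \<open>down T\<close>, for which the claim is known.\<close>

lemma matched_Mod_in_ccVar:
  fixes P :: "'u::universe matched"
  assumes P: "P \<in> Ob HAff_Un" shows "matched_Mod P \<in> Ob ccVar"
proof -
  obtain T :: "'u alg_theory" and F G where T: "T \<in> Ob HAffUn" and FG: "inverse_arrows HAff_Un (down T) P F G"
    using ess_surjective_down P unfolding ess_surjective_def isomorphic_def is_iso_def by fastforce
  interpret mp P using P by unfold_locales simp
  have "matched_pair (down T)" "matched_pair P" using P down_in_HAff_Un[OF T] by simp_all
  then show ?thesis
    by (intro matched_Mod_in_ccVar[OF matched_Mod_down_in_ccVar[OF T] conc_iso_sym[OF conc_iso_matched_reduct[OF _ _ FG]]])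
qed

lemma is_functor_matched_Mod:
  "is_functor (HAff_Un :: ('u::universe matched, 'u matched_map) cat) (op_cat ccVar) matched_Mod_functor"
  unfolding is_functor_def
proof (intro conjI ballI)
  show "category (HAff_Un :: ('u matched, 'u matched_map) cat)" by (rule category_HAff_Un)
  show "category (op_cat ccVar)" by (intro category_op_cat category_ccVar)
  fix P :: "'u matched" assume P: "P \<in> Ob HAff_Un"
  show "fob matched_Mod_functor P \<in> Ob (op_cat ccVar)" using matched_Mod_in_ccVar[OF P] by simp
  show "far matched_Mod_functor P P (ident HAff_Un P) = ident (op_cat ccVar) (fob matched_Mod_functor P)"
    by (simp add: far_matched_Mod_functor ident_Conc conc_functor_eq_iff matched_reduct_id del: ident_HAff_Un)
next
  fix P Q :: "'u matched" and F assume h: "P \<in> Ob HAff_Un" "Q \<in> Ob HAff_Un" "F \<in> Hom HAff_Un P Q"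
  then have "concrete_category (matched_Mod P)" "concrete_category (matched_Mod Q)"
    using matched_Mod_in_ccVar by auto
  then show "far matched_Mod_functor P Q F \<in> Hom (op_cat ccVar) (fob matched_Mod_functor P) (fob matched_Mod_functor Q)"
    using concrete_functor_conc_functor conc_map_matched_reduct[of P Q F] h by (simp add: far_matched_Mod_functor)
next
  fix P Q R :: "'u matched" and F G
  assume "P \<in> Ob HAff_Un" "Q \<in> Ob HAff_Un" "R \<in> Ob HAff_Un" "F \<in> Hom HAff_Un P Q" "G \<in> Hom HAff_Un Q R"
  then have m: "matched_pair P" "matched_pair Q" "matched_pair R"
    and F: "matched_hom P Q F" and G: "matched_hom Q R G" by auto
  show "far matched_Mod_functor P R (cmp HAff_Un P Q R G F) =
    cmp (op_cat ccVar) (fob matched_Mod_functor P) (fob matched_Mod_functor Q) (fob matched_Mod_functor R)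
      (far matched_Mod_functor Q R G) (far matched_Mod_functor P Q F)"
    by (simp add: far_matched_Mod_functor cmp_Conc[OF conc_map_matched_reduct[OF m(2,3) G]] conc_functor_eq_iff
        matched_reduct_comp[OF F])
qed

text \<open>The component at \<open>T\<close> makes a model of \<open>T\<close> a model of
  \<open>down T\<close> by keeping the hyperaffine operations and reading the unary ones as an
  action; in the opposite category it points from \<open>matched_Mod\<close> to
  \<open>theory_Mod\<close>. Naturality holds already on symbols, since both routes rename a symbol
  in the same way.\<close>

lemma naturally_isomorphic_matched_Mod:
  "naturally_isomorphic (HAffUn :: ('u::universe alg_theory, 'u theory_map) cat) (op_cat ccVar)
    (comp_fctr matched_Mod_functor down_functor) theory_Mod_functor"
  unfolding naturally_isomorphic_def
proof (intro conjI exI ballI)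
  let ?r = "\<lambda>T :: 'u alg_theory. reduct (matched_syms (down T)) down_renaming"
  let ?\<alpha> = "\<lambda>T. conc_functor (theory_Mod T) (?r T)"
  show "is_functor (HAffUn :: ('u alg_theory, 'u theory_map) cat) (op_cat ccVar) (comp_fctr matched_Mod_functor down_functor)"
    by (rule is_functor_comp[OF is_functor_down is_functor_matched_Mod])
  show "is_functor (HAffUn :: ('u alg_theory, 'u theory_map) cat) (op_cat ccVar) theory_Mod_functor" by (rule is_functor_theory_Mod)
  have i: "\<exists>go. conc_iso (theory_Mod T) (matched_Mod (down T)) (?r T) go" if "T \<in> Ob HAffUn" for T :: "'u alg_theory"
  proof -
    interpret hau_down T using that by unfold_locales (auto simp: hau_algebraic)
    show ?thesis using conc_iso_matched unfolding to_matched_def by blast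
  qed
  show "is_iso (op_cat ccVar) (fob (comp_fctr matched_Mod_functor down_functor) T) (fob theory_Mod_functor T) (?\<alpha> T)"
    if T: "T \<in> Ob HAffUn" for T :: "'u alg_theory"
  proof -
    obtain go where "conc_iso (theory_Mod T) (matched_Mod (down T)) (?r T) go" using i[OF T] ..
    then have "inverse_arrows Conc (theory_Mod T) (matched_Mod (down T)) (?\<alpha> T) (conc_functor (matched_Mod (down T)) go)"
      using theory_Mod_in_ccVar[OF T] matched_Mod_down_in_ccVar[OF T] by (intro inverse_arrows_conc_functor) simp_all
    then have "inverse_arrows (op_cat ccVar) (matched_Mod (down T)) (theory_Mod T) (?\<alpha> T) (conc_functor (matched_Mod (down T)) go)"
      unfolding inverse_arrows_op_cat inverse_arrows_ccVar by (rule inverse_arrows_sym)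
    then show ?thesis unfolding is_iso_def comp_fctr_def by auto
  qed
  fix S T :: "'u alg_theory" and \<phi> assume S: "S \<in> Ob HAffUn" and T: "T \<in> Ob HAffUn" and "\<phi> \<in> Hom HAffUn S T"
  then have a: "algebraic_theory S" "algebraic_theory T" and \<phi>: "theory_hom S T \<phi>" by (auto simp: hau_algebraic)
  interpret hau_hom S T \<phi> using S T \<phi> by unfold_locales (auto simp: hau_algebraic)
  let ?\<psi> = "far down_functor S T \<phi>"
  have \<psi>: "matched_renaming ?\<psi> s \<in> matched_syms (down T)" if "s \<in> matched_syms (down S)" for s
    using matched_renaming_syms[OF matched_hom_down that] .
  have th: "down_renaming s \<in> theory_syms S" if "s \<in> matched_syms (down S)" for s
    using that by (auto elim!: matched_symsE)
  have eq: "reduct (matched_syms (down S)) (matched_renaming ?\<psi>) (?r T X) =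
      ?r S (reduct (theory_syms S) (theory_renaming \<phi>) X)" for X
  proof -
    have "reduct (matched_syms (down S)) (matched_renaming ?\<psi>) (?r T X) =
        reduct (matched_syms (down S)) (\<lambda>s. down_renaming (matched_renaming ?\<psi> s)) X"
      using \<psi> by (rule reduct_reduct)
    also have "\<dots> = reduct (matched_syms (down S)) (\<lambda>s. theory_renaming \<phi> (down_renaming s)) X"
      by (rule reduct_cong) (auto elim!: matched_symsE simp: far_down_functor)
    also have "\<dots> = ?r S (reduct (theory_syms S) (theory_renaming \<phi>) X)"
      using th by (rule reduct_reduct[symmetric])
    finally show ?thesis .
  qed
  have "conc_map (theory_Mod T) (matched_Mod (down T)) (?r T)" using i[OF T] by (auto simp: conc_iso_def)
  then show "cmp (op_cat ccVar) (fob (comp_fctr matched_Mod_functor down_functor) S)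
      (fob (comp_fctr matched_Mod_functor down_functor) T) (fob theory_Mod_functor T) (?\<alpha> T)
      (far (comp_fctr matched_Mod_functor down_functor) S T \<phi>) =
    cmp (op_cat ccVar) (fob (comp_fctr matched_Mod_functor down_functor) S) (fob theory_Mod_functor S)
      (fob theory_Mod_functor T) (far theory_Mod_functor S T \<phi>) (?\<alpha> S)"
    using conc_map_theory_reduct[OF a \<phi>]
    by (simp add: comp_fctr_def far_matched_Mod_functor far_theory_Mod_functor cmp_Conc conc_functor_eq_iff eq)
qed

lemmas matched_Mod_ff_eso =
  two_out_of_three[OF is_functor_down fully_faithful_down ess_surjective_down is_functor_matched_Mod
    fully_faithful_theory_Mod ess_surjective_theory_Mod naturally_isomorphic_matched_Mod]

section \<open>Invariance of being finitary\<close>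

lemma finitary_variety_isomorphic:
  assumes "C \<in> Ob ccVar" "D \<in> Ob ccVar" "isomorphic Conc C D" "finitary_variety D"
  shows "finitary_variety C"
proof -
  obtain E where E: "equational_theory E" "\<forall>s\<in>syms E. finite (arity E s)" "isomorphic Conc D (eqn_Mod E)"
    using assms(4) by (auto simp: finitary_variety_def)
  have "isomorphic Conc C (eqn_Mod E)"
    using isomorphic_trans[OF category_Conc _ _ _ assms(3) E(3)] assms concrete_category_eqn_Mod by auto
  then show ?thesis using assms(1) E by (auto simp: finitary_variety_def)
qed

text \<open>A support of \<open>s\<close> is carried by \<phi> to a support of the image of
  \<open>s\<close>.\<close>

lemma finitary_surjective_hom:
  fixes S T :: "'u::universe alg_theory"
  assumes S: "algebraic_theory S" and T: "algebraic_theory T" and \<phi>: "theory_hom S T \<phi>"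
    and surj: "\<And>I t. \<lbrakk>small I; t \<in> opn T I\<rbrakk> \<Longrightarrow> \<exists>s\<in>opn S I. \<phi> I s = t" and fin: "finitary S"
  shows "finitary T"
proof -
  interpret S: alg_th S by unfold_locales fact
  interpret T: alg_th T by unfold_locales fact
  show ?thesis
    unfolding T.finitary_iff
  proof (intro allI impI ballI)
    fix I t assume I: "small I" and "t \<in> opn T I"
    then obtain s where s: "s \<in> opn S I" "\<phi> I s = t" using surj by blast
    then obtain J w where "S.supported I J w s" using fin I unfolding S.finitary_iff by blast
    then have J: "finite J" "J \<subseteq> I" "small J" and w: "w \<in> opn S J" and "s = op (S.F I) J w (pro S I)"
      by (auto simp: S.supported_def small_finite)
    moreover have "pro S I j \<in> opn S I" if "j \<in> J" for j using I J(2) that by (auto intro: S.pro_opn)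
    ultimately have "t = op (T.F I) J (\<phi> J w) (\<lambda>j. \<phi> I (pro S I j))"
      using s theory_hom_op[OF S T \<phi> J(3) I w, of "pro S I"] by simp
    also have "\<dots> = op (T.F I) J (\<phi> J w) (pro T I)"
      using J(2) by (intro op_cong) (auto simp: theory_hom_pro[OF \<phi> I])
    finally have "T.supported I J (\<phi> J w) t"
      using J w theory_hom_opn[OF \<phi>] by (simp add: T.supported_def)
    then show "\<exists>J w. T.supported I J w t" by blast
  qed
qed

text \<open>One direction of the isomorphism has a surjective theory component from
  \<open>hth Q\<close> to \<open>hth P\<close>, along which finitariness passes.\<close>

lemma finitary_hth_isomorphic:
  fixes P Q :: "'u::universe matched"
  assumes P: "P \<in> Ob HAff_Un" and Q: "Q \<in> Ob HAff_Un" and iso: "isomorphic HAff_Un P Q" and fin: "finitary (hth Q)"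
  shows "finitary (hth P)"
proof -
  interpret P: mp P using P by unfold_locales simp
  interpret Q: mp Q using Q by unfold_locales simp
  obtain F G where F: "matched_hom P Q F" and G: "matched_hom Q P G" and c: "matched_comp P G F = ident HAff_Un P"
    using iso by (auto simp: isomorphic_def is_iso_def inverse_arrows_def)
  obtain \<phi> f \<psi> g where FG: "F = (\<phi>, f)" "G = (\<psi>, g)" by (cases F, cases G) auto
  note th = matched_hom_theory[OF F[unfolded FG]] matched_hom_theory[OF G[unfolded FG]]
  have "theory_comp (hth P) \<psi> \<phi> = theory_id (hth P)" using c by (simp add: FG matched_comp_def)
  then have "\<psi> I (\<phi> I h) = h" if "small I" "h \<in> opn (hth P) I" for I h
    using that by (auto simp: theory_comp_def theory_id_def dest!: fun_cong[where x = I] fun_cong[where x = h])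
  then show ?thesis
    using theory_hom_opn[OF th(1)] by (intro finitary_surjective_hom[OF Q.H.T P.H.T th(2) _ fin]) blast
qed

lemma finitary_down:
  fixes T :: "'u::universe alg_theory"
  assumes "T \<in> Ob HAffUn" shows "finitary T \<longleftrightarrow> finitary (hth (down T))"
proof -
  interpret hau T using assms by unfold_locales (auto simp: hau_algebraic)
  show ?thesis using finitary_hyperaffine_part by (simp add: down_def)
qed

lemma finitary_theory_Mod:
  fixes T :: "'u::universe alg_theory"
  assumes "T \<in> Ob HAffUn" shows "finitary T \<longleftrightarrow> finitary_variety (theory_Mod T)"
proof -
  interpret alg_th T using assms by unfold_locales (auto simp: hau_algebraic)
  show ?thesis using finitary_variety_iff by simp
qed

lemma finitary_matched_Mod_down:
  fixes T :: "'u::universe alg_theory"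
  assumes T: "T \<in> Ob HAffUn" shows "finitary T \<longleftrightarrow> finitary_variety (matched_Mod (down T))"
proof -
  have "isomorphic (op_cat ccVar) (fob (comp_fctr matched_Mod_functor down_functor) T) (fob theory_Mod_functor T)"
    using naturally_isomorphic_matched_Mod T unfolding naturally_isomorphic_def isomorphic_def by blast
  then have "isomorphic Conc (matched_Mod (down T)) (theory_Mod T)" by (simp add: comp_fctr_def)
  then show ?thesis
    using finitary_variety_isomorphic isomorphic_sym theory_Mod_in_ccVar[OF T] matched_Mod_down_in_ccVar[OF T]
      finitary_theory_Mod[OF T] by metis
qed

text \<open>Both sides are invariant under isomorphism, so \<open>P\<close> may be replaced by some
  \<open>down T\<close>, where both are equivalent to \<open>T\<close> being finitary.\<close>

lemma finitary_matched_Mod: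
  fixes P :: "'u::universe matched"
  assumes P: "P \<in> Ob HAff_Un" shows "finitary (hth P) \<longleftrightarrow> finitary_variety (matched_Mod P)"
proof -
  obtain T :: "'u alg_theory" where T: "T \<in> Ob HAffUn" and iso: "isomorphic HAff_Un (down T) P"
    using ess_surjective_down P unfolding ess_surjective_def by fastforce
  have D: "down T \<in> Ob HAff_Un" by (rule down_in_HAff_Un[OF T])
  have "isomorphic Conc (matched_Mod (down T)) (matched_Mod P)"
    using functor_isomorphic[OF is_functor_matched_Mod D P iso] by simp
  then have "finitary_variety (matched_Mod P) \<longleftrightarrow> finitary_variety (matched_Mod (down T))"
    using finitary_variety_isomorphic isomorphic_sym matched_Mod_in_ccVar[OF P] matched_Mod_in_ccVar[OF D] by metis
  moreover have "finitary (hth P) \<longleftrightarrow> finitary (hth (down T))"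
    using finitary_hth_isomorphic isomorphic_sym iso P D by metis
  ultimately show ?thesis using finitary_down[OF T] finitary_matched_Mod_down[OF T] by simp
qed

theorem theorem6p9:
  shows
    "equivalence_of_cats (HAffUn :: ('u::universe alg_theory, 'u theory_map) cat)
                 (HAff_Un :: ('u matched, 'u matched_map) cat) down_functor \<and>
     equivalence_of_cats (HAffUn :: ('u alg_theory, 'u theory_map) cat)
                 (op_cat (ccVar :: 'u var_cat)) theory_Mod_functor \<and>
     equivalence_of_cats (HAff_Un :: ('u matched, 'u matched_map) cat)
                 (op_cat (ccVar :: 'u var_cat)) matched_Mod_functor \<and>
     naturally_isomorphic (HAffUn :: ('u alg_theory, 'u theory_map) cat)
                 (op_cat (ccVar :: 'u var_cat))
                 (comp_fctr matched_Mod_functor down_functor) theory_Mod_functor \<and>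
     equivalence_of_cats (HAffUn_fin :: ('u alg_theory, 'u theory_map) cat)
                 (HAff_Un_fin :: ('u matched, 'u matched_map) cat) down_functor \<and>
     equivalence_of_cats (HAffUn_fin :: ('u alg_theory, 'u theory_map) cat)
                 (op_cat (ccVar_fin :: 'u var_cat)) theory_Mod_functor \<and>
     equivalence_of_cats (HAff_Un_fin :: ('u matched, 'u matched_map) cat)
                 (op_cat (ccVar_fin :: 'u var_cat)) matched_Mod_functor \<and>
     naturally_isomorphic (HAffUn_fin :: ('u alg_theory, 'u theory_map) cat)
                 (op_cat (ccVar_fin :: 'u var_cat))
                 (comp_fctr matched_Mod_functor down_functor) theory_Mod_functor"
proof (intro conjI)
  note d = is_functor_down fully_faithful_down ess_surjective_down
  note t = is_functor_theory_Mod fully_faithful_theory_Mod ess_surjective_theory_Mod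
  note m = is_functor_matched_Mod matched_Mod_ff_eso
  have v: "finitary_variety Z" if "Z \<in> Ob (op_cat ccVar)" "Z' \<in> Ob (op_cat ccVar)"
      "isomorphic (op_cat ccVar) Z Z'" "finitary_variety Z'" for Z Z' :: "('u alg, 'u) conc"
    using that finitary_variety_isomorphic[of Z Z'] by simp
  show "equivalence_of_cats (HAffUn :: ('u alg_theory, 'u theory_map) cat) HAff_Un down_functor"
    by (rule equivalence_if_fully_faithful_ess_surjective[OF d])
  show "equivalence_of_cats (HAffUn :: ('u alg_theory, 'u theory_map) cat) (op_cat ccVar) theory_Mod_functor"
    by (rule equivalence_if_fully_faithful_ess_surjective[OF t])
  show "equivalence_of_cats (HAff_Un :: ('u matched, 'u matched_map) cat) (op_cat ccVar) matched_Mod_functor"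
    by (rule equivalence_if_fully_faithful_ess_surjective[OF m])
  show "naturally_isomorphic (HAffUn :: ('u alg_theory, 'u theory_map) cat) (op_cat ccVar)
      (comp_fctr matched_Mod_functor down_functor) theory_Mod_functor"
    by (rule naturally_isomorphic_matched_Mod)
  show "equivalence_of_cats (HAffUn_fin :: ('u alg_theory, 'u theory_map) cat) HAff_Un_fin down_functor"
    unfolding HAffUn_fin_def HAff_Un_fin_def
  proof (rule equivalence_full_subcat[OF d])
    show "finitary T \<longleftrightarrow> finitary (hth (fob down_functor T))" if "T \<in> Ob HAffUn" for T :: "'u alg_theory"
      unfolding fob_down_functor by (rule finitary_down[OF that])
  qed (rule finitary_hth_isomorphic)
  show "equivalence_of_cats (HAffUn_fin :: ('u alg_theory, 'u theory_map) cat) (op_cat ccVar_fin) theory_Mod_functor"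
    unfolding HAffUn_fin_def ccVar_fin_def op_cat_full_subcat
  proof (rule equivalence_full_subcat[OF t _ v])
    show "finitary T \<longleftrightarrow> finitary_variety (fob theory_Mod_functor T)" if "T \<in> Ob HAffUn" for T :: "'u alg_theory"
      unfolding fob_theory_Mod_functor by (rule finitary_theory_Mod[OF that])
  qed
  show "equivalence_of_cats (HAff_Un_fin :: ('u matched, 'u matched_map) cat) (op_cat ccVar_fin) matched_Mod_functor"
    unfolding HAff_Un_fin_def ccVar_fin_def op_cat_full_subcat
  proof (rule equivalence_full_subcat[OF m _ v])
    show "finitary (hth P) \<longleftrightarrow> finitary_variety (fob matched_Mod_functor P)" if "P \<in> Ob HAff_Un" for P :: "'u matched"
      unfolding fob_matched_Mod_functor by (rule finitary_matched_Mod[OF that])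
  qed
  show "naturally_isomorphic (HAffUn_fin :: ('u alg_theory, 'u theory_map) cat) (op_cat ccVar_fin)
      (comp_fctr matched_Mod_functor down_functor) theory_Mod_functor"
    unfolding HAffUn_fin_def ccVar_fin_def op_cat_full_subcat
    by (rule naturally_isomorphic_full_subcat[OF naturally_isomorphic_matched_Mod])
      (simp_all only: comp_fctr_def fctr.simps fob_down_functor fob_matched_Mod_functor fob_theory_Mod_functor
        finitary_theory_Mod[symmetric] finitary_matched_Mod_down[symmetric])
qed

end
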